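(* Let $W$ be a vector space over $\mathbb C$ and let $U$ be an $\mathcal S$-local subset of $\mathcal E^o(W)=\operatorname{Hom}(W,W((x^{-1})))$. Then $U$ is compatible, and the nonlocal vertex algebra $\langle U\rangle$ generated by $U$ is a weak quantum vertex algebra with $W$ as a module-at-infinity (with $Y_W(a(x),x_0)=a(x_0)$ for $a(x)\in\langle U\rangle$).
   Context: All vector spaces are over $\mathbb C$; $\mathbb N=\{0,1,2,\dots\}$; powers $(y+z)^n$ of binomials are expanded in nonnegative powers of the second variable $z$. $W((x_1^{-1},\dots,x_r^{-1}))$ denotes $W[[x_1^{-1},\dots,x_r^{-1}]][x_1,\dots,x_r]$. $\mathcal E^o(W)=\operatorname{Hom}(W,W((x^{-1})))$, and $1_W$ is the identity operator. $\iota_{x,\infty}:\mathbb C(x)\to\mathbb C((x^{-1}))$ is the Laurent expansion at $x=\infty$; for $g(x)=\sum_{n\ge m}g_nx^{-n}\in \mathbb C((x^{-1}))$, $g(-x_1+x_2)=\sum_{n\ge m}g_n(-x_1+x_2)^{-n}\in\mathbb C[x_2]((x_1^{-1}))$. $\iota_{x,\infty;x_0,0}:\mathbb C(x,x_0)\to\mathbb C((x^{-1}))((x_0))$ is the unique field embedding extending the inclusion of $\mathbb C[x,x_0]$. For $A\in\operatorname{Hom}(W,W((x_1^{-1},x^{-1})))$, $A(x_1,x)|_{x_1=x+x_0}=\big(e^{x_0\partial/\partial x_1}A(x_1,x)\big)|_{x_1=x}$. **$\mathcal S$-local.** $U\subset\mathcal E^o(W)$ is $\mathcal S$-local if for any $a(x),b(x)\in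 U$ there are finitely many $u^{(i)}(x),v^{(i)}(x)\in U$, $f_i(x)\in\mathbb C(x)$ ($1\le i\le r$) and $k\in\mathbb N$ such that $$(x_1-x_2)^ka(x_1)b(x_2)=(x_1-x_2)^k\sum_{i=1}^r\iota_{x,\infty}(f_i)(-x_1+x_2)\,u^{(i)}(x_2)v^{(i)}(x_1).$$ **(Quasi-)compatible.** A finite sequence $a_1(x),\dots,a_r(x)$ in $\mathcal E^o(W)$ is quasi-compatible if there is a nonzero polynomial $p(x_1,x_2)$ with $\big(\prod_{1\le i<j\le r}p(x_i,x_j)\big)a_1(x_1)\cdots a_r(x_r)\in\operatorname{Hom}(W,W((x_1^{-1},\dots,x_r^{-1})))$, and compatible if this holds with $p(x_1,x_2)=(x_1-x_2)^k$ for some $k\in\mathbb N$. A subset is quasi-compatible (compatible) if every finite sequence in it is. **Operation $Y_{\mathcal E^o}$.** For a quasi-compatible pair $(a(x),b(x))$ choose a nonzero polynomial $p$ with $p(x_1,x_2)a(x_1)b(x_2)\in\operatorname{Hom}(W,W((x_1^{-1},x_2^{-1})))$ and set $$Y_{\mathcal E^o}(a(x),x_0)b(x)=\sum_{n\in\mathbb Z}a(x)_nb(x)\,x_0^{-n-1}=\iota_{x,\infty;x_0,0}\big(1/p(x_0+x,x)\big)\big(p(x_1,x)a(x_1)b(x)\big)|_{x_1=x+x_0}\in\mathcal E^o(W)((x_0)),$$ independent of the choice of $p$. A quasi-compatible subspace $K$ is closed if $a(x)_nb(x)\in K$ for all $a(x),b(x)\in K$, $n\in\mathbb Z$. For a quasi-compatible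 subset $S$, $\langle S\rangle$ is the smallest closed quasi-compatible subspace containing $S$ and $1_W$; $(\langle S\rangle,Y_{\mathcal E^o},1_W)$ is a nonlocal vertex algebra, called the one generated by $S$. **Nonlocal vertex algebra.** A vector space $V$ with a linear map $Y:V\to\operatorname{Hom}(V,V((x)))$ and $\mathbf 1\in V$ such that $Y(\mathbf 1,x)v=v$, $Y(v,x)\mathbf 1\in V[[x]]$, $\lim_{x\to0}Y(v,x)\mathbf 1=v$, and for all $u,v,w$ there is $l\in\mathbb N$ with $(x_0+x_2)^lY(u,x_0+x_2)Y(v,x_2)w=(x_0+x_2)^lY(Y(u,x_0)v,x_2)w$. **Weak quantum vertex algebra.** A nonlocal vertex algebra $V$ such that for any $u,v\in V$ there are finitely many $u^{(i)},v^{(i)}\in V$, $f_i(x)\in\mathbb C((x))$ and $k\in\mathbb N$ with $(x_1-x_2)^kY(u,x_1)Y(v,x_2)=(x_1-x_2)^k\sum_if_i(x_2-x_1)Y(v^{(i)},x_2)Y(u^{(i)},x_1)$. **Module-at-infinity.** For a nonlocal vertex algebra $V$: a vector space $W$ with a linear map $Y_W:V\to\operatorname{Hom}(W,W((x^{-1})))$ such that $Y_W(\mathbf 1,x)=1_W$ and for any $u,v\in V$ there is $k\in\mathbb N$ with $(x_1-x_2)^kY_W(u,x_1)Y_W(v,x_2)\in\operatorname{Hom}(W,W((x_1^{-1},x_2^{-1})))$ and $x_0^kY_W(Y(u,x_0)v,x_2)=\big((x_1-x_2)^kY_W(u,x_1)Y_W(v,x_2)\big)|_{x_1=x_2+x_0}$.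 *)

theory Defs
  imports
    Complex_Main
    "HOL-Computational_Algebra.Computational_Algebra"
    "HOL-Library.Groups_Big_Fun"
    "HOL-Library.Function_Algebras"
begin

text \<open>
  Conventions. The vector space \<open>W\<close> is a type \<open>'w\<close> with scalar multiplication \<open>scale\<close>.

  A Laurent series in \<open>W((x\<^sup>-\<^sup>1))\<close> is an element \<open>f\<close> of \<open>'w fls\<close> in the variable \<open>x\<^sup>-\<^sup>1\<close>:
  \<open>f $$ n\<close> is the coefficient of \<open>x\<^sup>-\<^sup>n\<close>, and \<open>x\<close> itself is \<^const>\<open>fls_X_inv\<close>. In contrast, series in
  \<open>V((x))\<close> and \<open>\<complex>((x))\<close> use the variable \<open>x\<close>. The iterated \<open>W((x\<^sup>-\<^sup>1))((x\<^sub>0))\<close> is \<open>'w fls fls\<close>, the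
  outer variable being \<open>x\<^sub>0\<close>.

  A polynomial in two variables is an element \<open>p\<close> of \<open>complex poly poly\<close>; the first variable is the
  inner one, i.e. \<open>coeff (coeff p l) k\<close> belongs to the monomial \<open>x\<^sub>1\<^sup>k x\<^sub>2\<^sup>l\<close>.

  A doubly infinite formal series in \<open>x\<^sub>1,\<dots>,x\<^sub>r\<close> is a function \<open>F\<close> on integer lists of length \<open>r\<close>:
  \<open>F [n\<^sub>1,\<dots>,n\<^sub>r]\<close> is the coefficient of \<open>x\<^sub>1\<^bsup>n\<^sub>1\<^esup>\<cdots>x\<^sub>r\<^bsup>n\<^sub>r\<^esup>\<close> (exponents of \<open>x\<^sub>i\<close>, not of \<open>x\<^sub>i\<^sup>-\<^sup>1\<close>). Values at lists
  of other lengths carry no meaning.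

  \<^const>\<open>Sum_any\<close> sums the nonzero terms of a family; wherever it is used below on meaningful input,
  only finitely many terms are nonzero.
\<close>

unbundle fps_syntax

type_synonym 'w fseries = "int list \<Rightarrow> 'w"


section \<open>Polynomials and expansions of rational functions\<close>

definition poly2 :: "('a::zero \<Rightarrow> 'b::comm_semiring_0) \<Rightarrow> 'a poly poly \<Rightarrow> 'b \<Rightarrow> 'b \<Rightarrow> 'b" where
  "poly2 h p y z = poly (map_poly (\<lambda>q. poly (map_poly h q) y) p) z"
  \<comment> \<open>\<open>p(y,z)\<close>, where \<open>h\<close> embeds the coefficients\<close>

definition X1 :: "complex poly poly" where "X1 = [:[:0, 1:]:]"
definition X2 :: "complex poly poly" where "X2 = [:0, 1:]"

definition extend_fract :: "('a::idom \<Rightarrow> 'b::field) \<Rightarrow> 'a fract \<Rightarrow> 'b" where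
  "extend_fract e r = (THE z. \<exists>a b. b \<noteq> 0 \<and> r = Fract a b \<and> z = e a / e b)"
  \<comment> \<open>the extension of an injective ring homomorphism to the field of fractions\<close>

lemma extend_fract_Fract:
  assumes "\<And>x y. e (x * y) = e x * e y" and "\<And>x. e x = 0 \<longleftrightarrow> x = 0" and "b \<noteq> 0"
  shows "extend_fract e (Fract a b) = e a / e b"
  unfolding extend_fract_def
proof (rule the_equality)
  fix z assume "\<exists>a' b'. b' \<noteq> 0 \<and> Fract a b = Fract a' b' \<and> z = e a' / e b'"
  then obtain a' b' where *: "b' \<noteq> 0" "Fract a b = Fract a' b'" "z = e a' / e b'" by blast
  then have "e (a * b') = e (a' * b)" using assms(3) by (simp add: eq_fract)
  then have "e a * e b' = e a' * e b" by (simp add: assms(1))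
  then show "z = e a / e b" using *(1,3) assms(2,3) by (simp add: frac_eq_eq)
qed (use assms(3) in blast)

definition iota_inf :: "complex poly fract \<Rightarrow> complex fls" where
  "iota_inf = extend_fract (\<lambda>q. poly (map_poly fls_const q) fls_X_inv)"

definition iota_inf_0 :: "complex poly poly fract \<Rightarrow> complex fls fls" where
  "iota_inf_0 = extend_fract
     (\<lambda>q. poly2 (\<lambda>c. fls_const (fls_const c)) q (fls_const fls_X_inv) fls_X)"
  \<comment> \<open>here the first variable is \<open>x\<close> and the second one is \<open>x\<^sub>0\<close>\<close>

definition binom_coeff :: "complex \<Rightarrow> complex \<Rightarrow> int \<Rightarrow> int \<Rightarrow> complex" where
  "binom_coeff s t i j =
     (if j < 0 then 0 else (of_int (i + j) gchoose nat j) * s powi i * t powi j)"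
  \<comment> \<open>the coefficient of \<open>y\<^sup>i z\<^sup>j\<close> in \<open>(s y + t z)\<^bsup>i+j\<^esup>\<close>, expanded in nonnegative powers of \<open>z\<close>\<close>


section \<open>Formal series\<close>

definition fls_scale :: "(complex \<Rightarrow> 'w \<Rightarrow> 'w::ab_group_add) \<Rightarrow> complex \<Rightarrow> 'w fls \<Rightarrow> 'w fls" where
  "fls_scale sc c f = Abs_fls (\<lambda>n. sc c (f $$ n))"

definition fls_smult :: "('a::zero \<Rightarrow> 'w \<Rightarrow> 'w::ab_group_add) \<Rightarrow> 'a fls \<Rightarrow> 'w fls \<Rightarrow> 'w fls" where
  "fls_smult act g f = Abs_fls (\<lambda>n. Sum_any (\<lambda>i. act (g $$ i) (f $$ (n - i))))"
  \<comment> \<open>the product \<open>g f\<close>, where coefficients are multiplied by \<open>act\<close>\<close>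

primrec op_prod :: "('w \<Rightarrow> int \<Rightarrow> 'w) list \<Rightarrow> 'w \<Rightarrow> 'w fseries" where
  "op_prod [] w ns = w"
| "op_prod (A # As) w ns = A (op_prod As w (tl ns)) (hd ns)"
  \<comment> \<open>\<open>A\<^sub>1(x\<^sub>1)\<cdots>A\<^sub>r(x\<^sub>r)w\<close>, where \<open>A w n\<close> is the coefficient of \<open>x\<^sup>n\<close> in \<open>A(x)w\<close>\<close>

text \<open>In the next definition the variable indices \<open>i\<close> and \<open>j\<close>, counted from 0, must be different.\<close>

definition poly_act :: "(complex \<Rightarrow> 'w \<Rightarrow> 'w::ab_group_add) \<Rightarrow> nat \<Rightarrow> nat \<Rightarrow> complex poly poly
    \<Rightarrow> 'w fseries \<Rightarrow> 'w fseries" where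
  "poly_act sc i j p F = (\<lambda>ns. \<Sum>l\<le>degree p. \<Sum>k\<le>degree (coeff p l).
     sc (coeff (coeff p l) k) (F (ns[i := ns ! i - int k, j := ns ! j - int l])))"

text \<open>
  Multiplication by \<open>\<Prod>\<^sub>i\<^sub><\<^sub>j p(x\<^sub>i,x\<^sub>j)\<close>; the factors commute, so their order does not matter.
\<close>

definition pairs_act :: "(complex \<Rightarrow> 'w \<Rightarrow> 'w::ab_group_add) \<Rightarrow> nat \<Rightarrow> complex poly poly
    \<Rightarrow> 'w fseries \<Rightarrow> 'w fseries" where
  "pairs_act sc r p F = foldr (\<lambda>(i, j). poly_act sc i j p) [(i, j). i \<leftarrow> [0..<r], j \<leftarrow> [Suc i..<r]] F"

definition series_act :: "(complex \<Rightarrow> 'w \<Rightarrow> 'w::ab_group_add) \<Rightarrow> (int \<Rightarrow> int \<Rightarrow> complex)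
    \<Rightarrow> 'w fseries \<Rightarrow> 'w fseries" where
  "series_act sc C F = (\<lambda>ns. Sum_any (\<lambda>(i, j). sc (C i j) (F [ns ! 0 - i, ns ! 1 - j])))"
  \<comment> \<open>multiplication by \<open>\<Sum>\<^sub>i\<^sub>,\<^sub>j C\<^sub>i\<^sub>j x\<^sub>1\<^sup>i x\<^sub>2\<^sup>j\<close>\<close>

definition hom_inf :: "(complex \<Rightarrow> 'w \<Rightarrow> 'w::ab_group_add) \<Rightarrow> nat \<Rightarrow> ('w \<Rightarrow> 'w fseries) \<Rightarrow> bool" where
  "hom_inf sc r A \<longleftrightarrow>
     (\<forall>ns. length ns = r \<longrightarrow> Vector_Spaces.linear sc sc (\<lambda>w. A w ns)) \<and>
     (\<forall>w. \<exists>N. \<forall>ns. length ns = r \<longrightarrow> A w ns \<noteq> 0 \<longrightarrow> (\<forall>n\<in>set ns. n \<le> N))"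
  \<comment> \<open>\<open>A \<in> Hom(W, W((x\<^sub>1\<^sup>-\<^sup>1,\<dots>,x\<^sub>r\<^sup>-\<^sup>1)))\<close>\<close>

definition deriv1 :: "(complex \<Rightarrow> 'w \<Rightarrow> 'w::ab_group_add) \<Rightarrow> 'w fseries \<Rightarrow> 'w fseries" where
  "deriv1 sc F = (\<lambda>ns. sc (of_int (ns ! 0 + 1)) (F (ns[0 := ns ! 0 + 1])))"
  \<comment> \<open>the partial derivative with respect to \<open>x\<^sub>1\<close>\<close>

text \<open>
  \<open>F(x\<^sub>1,x)|\<^bsub>x\<^sub>1 = x + x\<^sub>0\<^esub> = (e\<^bsup>x\<^sub>0 \<partial>/\<partial>x\<^sub>1\<^esup> F(x\<^sub>1,x))|\<^bsub>x\<^sub>1 = x\<^esub>\<close> for \<open>F \<in> W((x\<^sub>1\<^sup>-\<^sup>1,x\<^sup>-\<^sup>1))\<close>.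
\<close>

definition subst_add :: "(complex \<Rightarrow> 'w \<Rightarrow> 'w::ab_group_add) \<Rightarrow> 'w fseries \<Rightarrow> 'w fls fls" where
  "subst_add sc F = Abs_fls (\<lambda>l. if l < 0 then 0 else
     Abs_fls (\<lambda>n. Sum_any (\<lambda>i. sc (1 / fact (nat l)) ((deriv1 sc ^^ nat l) F [i, - n - i]))))"


section \<open>Laurent series of operators at infinity\<close>

definition Eo :: "(complex \<Rightarrow> 'w \<Rightarrow> 'w::ab_group_add) \<Rightarrow> ('w \<Rightarrow> 'w fls) set" where
  "Eo sc = {a. Vector_Spaces.linear sc (fls_scale sc) a}"

definition Eo_scale :: "(complex \<Rightarrow> 'w \<Rightarrow> 'w::ab_group_add) \<Rightarrow> complex \<Rightarrow> ('w \<Rightarrow> 'w fls) \<Rightarrow> 'w \<Rightarrow> 'w fls" where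
  "Eo_scale sc c a = (\<lambda>w. fls_scale sc c (a w))"

definition Eo_one :: "'w::ab_group_add \<Rightarrow> 'w fls" where
  "Eo_one w = fls_const w"

definition coeffs_inf :: "('w::ab_group_add \<Rightarrow> 'w fls) \<Rightarrow> 'w \<Rightarrow> int \<Rightarrow> 'w" where
  "coeffs_inf a w n = a w $$ (- n)"

definition clears :: "(complex \<Rightarrow> 'w \<Rightarrow> 'w::ab_group_add) \<Rightarrow> complex poly poly \<Rightarrow> ('w \<Rightarrow> 'w fls) list \<Rightarrow> bool" where
  "clears sc p as \<longleftrightarrow>
     hom_inf sc (length as) (\<lambda>w. pairs_act sc (length as) p (op_prod (map coeffs_inf as) w))"
  \<comment> \<open>\<open>(\<Prod>\<^sub>i\<^sub><\<^sub>j p(x\<^sub>i,x\<^sub>j)) a\<^sub>1(x\<^sub>1)\<cdots>a\<^sub>r(x\<^sub>r) \<in> Hom(W, W((x\<^sub>1\<^sup>-\<^sup>1,\<dots>,x\<^sub>r\<^sup>-\<^sup>1)))\<close>\<close>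

definition quasi_compatible :: "(complex \<Rightarrow> 'w \<Rightarrow> 'w::ab_group_add) \<Rightarrow> ('w \<Rightarrow> 'w fls) set \<Rightarrow> bool" where
  "quasi_compatible sc U \<longleftrightarrow> U \<subseteq> Eo sc \<and> (\<forall>as. set as \<subseteq> U \<longrightarrow> (\<exists>p. p \<noteq> 0 \<and> clears sc p as))"

definition compatible :: "(complex \<Rightarrow> 'w \<Rightarrow> 'w::ab_group_add) \<Rightarrow> ('w \<Rightarrow> 'w fls) set \<Rightarrow> bool" where
  "compatible sc U \<longleftrightarrow> U \<subseteq> Eo sc \<and> (\<forall>as. set as \<subseteq> U \<longrightarrow> (\<exists>k. clears sc ((X1 - X2) ^ k) as))"

text \<open>
  \<^term>\<open>op_prod [u, v] w (rev ns)\<close> is \<open>u(x\<^sub>2)v(x\<^sub>1)w\<close> as a series in \<open>x\<^sub>1,x\<^sub>2\<close>, and the scalar series acting on it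
  is \<open>g(-x\<^sub>1 + x\<^sub>2)\<close> for \<open>g = \<Sum> g\<^sub>n x\<^sup>-\<^sup>n\<close>, the expansion of \<open>f\<^sub>i\<close> at infinity.
\<close>

definition S_local :: "(complex \<Rightarrow> 'w \<Rightarrow> 'w::ab_group_add) \<Rightarrow> ('w \<Rightarrow> 'w fls) set \<Rightarrow> bool" where
  "S_local sc U \<longleftrightarrow> U \<subseteq> Eo sc \<and>
    (\<forall>a\<in>U. \<forall>b\<in>U. \<exists>(r::nat) u v (f :: nat \<Rightarrow> complex poly fract) k.
      (\<forall>i<r. u i \<in> U \<and> v i \<in> U) \<and>
      (\<forall>w m n.
        poly_act sc 0 1 ((X1 - X2) ^ k) (op_prod [coeffs_inf a, coeffs_inf b] w) [m, n] =
        poly_act sc 0 1 ((X1 - X2) ^ k)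
          (\<lambda>ns. \<Sum>i<r. series_act sc
             (\<lambda>s t. iota_inf (f i) $$ (- (s + t)) * binom_coeff (- 1) 1 s t)
             (\<lambda>ns. op_prod [coeffs_inf (u i), coeffs_inf (v i)] w (rev ns)) ns) [m, n]))"

definition clearing_poly :: "(complex \<Rightarrow> 'w \<Rightarrow> 'w::ab_group_add) \<Rightarrow> ('w \<Rightarrow> 'w fls) \<Rightarrow> ('w \<Rightarrow> 'w fls)
    \<Rightarrow> complex poly poly" where
  "clearing_poly sc a b = (SOME p. p \<noteq> 0 \<and> clears sc p [a, b])"

text \<open>
  The polynomial passed to \<open>Fract 1\<close> is \<open>p(x\<^sub>0 + x, x)\<close>, with first variable \<open>x\<close> and second variable \<open>x\<^sub>0\<close>.
  The coefficient of \<open>x\<^sub>0\<^bsup>-n-1\<^esup>\<close> in \<open>Y_Eo sc a b\<close> is \<open>a(x)\<^sub>n b(x)\<close>.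
\<close>

definition Y_Eo :: "(complex \<Rightarrow> 'w \<Rightarrow> 'w::ab_group_add) \<Rightarrow> ('w \<Rightarrow> 'w fls) \<Rightarrow> ('w \<Rightarrow> 'w fls)
    \<Rightarrow> ('w \<Rightarrow> 'w fls) fls" where
  "Y_Eo sc a b = (let p = clearing_poly sc a b in
     Abs_fls (\<lambda>m w.
       fls_smult (fls_smult sc)
         (iota_inf_0 (Fract 1 (poly2 (\<lambda>c. [:[:c:]:]) p (X2 + X1) X1)))
         (subst_add sc (poly_act sc 0 1 p (op_prod [coeffs_inf a, coeffs_inf b] w))) $$ m))"

definition closed_subspace :: "(complex \<Rightarrow> 'w \<Rightarrow> 'w::ab_group_add) \<Rightarrow> ('w \<Rightarrow> 'w fls) set \<Rightarrow> bool" where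
  "closed_subspace sc K \<longleftrightarrow> module.subspace (Eo_scale sc) K \<and> quasi_compatible sc K \<and>
     (\<forall>a\<in>K. \<forall>b\<in>K. \<forall>n::int. Y_Eo sc a b $$ (- n - 1) \<in> K)"

definition generated :: "(complex \<Rightarrow> 'w \<Rightarrow> 'w::ab_group_add) \<Rightarrow> ('w \<Rightarrow> 'w fls) set \<Rightarrow> ('w \<Rightarrow> 'w fls) set" where
  "generated sc S = (LEAST K. closed_subspace sc K \<and> S \<subseteq> K \<and> Eo_one \<in> K)"
  \<comment> \<open>least with respect to inclusion\<close>


section \<open>Nonlocal vertex algebras and modules-at-infinity\<close>

text \<open>
  The underlying space is a subspace \<open>V\<close> of an ambient vector space. The values of \<open>Y\<close>
  outside \<open>V\<close> are irrelevant. In \<open>weak_assoc\<close> the variables are \<open>x\<^sub>0,x\<^sub>2\<close>; the inner sum on its left-hand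
  side is the coefficient of \<open>x\<^sub>0\<^sup>m x\<^sub>2\<^sup>n\<close> in \<open>Y(u,x\<^sub>0 + x\<^sub>2)Y(v,x\<^sub>2)w\<close>.
\<close>

locale nonlocal_vertex_algebra = vector_space sc
  for sc :: "complex \<Rightarrow> 'v \<Rightarrow> 'v::ab_group_add" +
  fixes V :: "'v set" and Y :: "'v \<Rightarrow> 'v \<Rightarrow> 'v fls" and vac :: 'v
  assumes subspace_V: "subspace V"
    and vac_in: "vac \<in> V"
    and Y_in: "u \<in> V \<Longrightarrow> v \<in> V \<Longrightarrow> Y u v $$ n \<in> V"
    and Y_add_left: "u \<in> V \<Longrightarrow> u' \<in> V \<Longrightarrow> v \<in> V \<Longrightarrow> Y (u + u') v = Y u v + Y u' v"
    and Y_scale_left: "u \<in> V \<Longrightarrow> v \<in> V \<Longrightarrow> Y (sc c u) v = fls_scale sc c (Y u v)"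
    and Y_add_right: "u \<in> V \<Longrightarrow> v \<in> V \<Longrightarrow> v' \<in> V \<Longrightarrow> Y u (v + v') = Y u v + Y u v'"
    and Y_scale_right: "u \<in> V \<Longrightarrow> v \<in> V \<Longrightarrow> Y u (sc c v) = fls_scale sc c (Y u v)"
    and Y_vac: "v \<in> V \<Longrightarrow> Y vac v = fls_const v"
    and creation_regular: "v \<in> V \<Longrightarrow> n < 0 \<Longrightarrow> Y v vac $$ n = 0"
    and creation_limit: "v \<in> V \<Longrightarrow> Y v vac $$ 0 = v"
    and weak_assoc: "u \<in> V \<Longrightarrow> v \<in> V \<Longrightarrow> w \<in> V \<Longrightarrow> \<exists>l. \<forall>m n.
      poly_act sc 0 1 ((X1 + X2) ^ l)
        (\<lambda>ns. Sum_any (\<lambda>j. sc (binom_coeff 1 1 (ns ! 0) j)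
           (Y u (Y v w $$ (ns ! 1 - j)) $$ (ns ! 0 + j)))) [m, n] =
      poly_act sc 0 1 ((X1 + X2) ^ l) (\<lambda>ns. Y (Y u v $$ (ns ! 0)) w $$ (ns ! 1)) [m, n]"

text \<open>
  The scalar series below is \<open>f\<^sub>i(x\<^sub>2 - x\<^sub>1)\<close>, expanded in nonnegative powers of \<open>x\<^sub>1\<close>; its coefficient at
  \<open>x\<^sub>1\<^sup>s x\<^sub>2\<^sup>t\<close> is that of \<open>y\<^sup>t z\<^sup>s\<close> in \<open>f\<^sub>i(y - z)\<close>.
\<close>

locale weak_quantum_vertex_algebra = nonlocal_vertex_algebra +
  assumes S_locality: "a \<in> V \<Longrightarrow> b \<in> V \<Longrightarrow>
    \<exists>(r::nat) u v (f :: nat \<Rightarrow> complex fls) k.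
      (\<forall>i<r. u i \<in> V \<and> v i \<in> V) \<and>
      (\<forall>w\<in>V. \<forall>m n.
        poly_act sc 0 1 ((X1 - X2) ^ k) (op_prod [\<lambda>w n. Y a w $$ n, \<lambda>w n. Y b w $$ n] w) [m, n] =
        poly_act sc 0 1 ((X1 - X2) ^ k)
          (\<lambda>ns. \<Sum>i<r. series_act sc
             (\<lambda>s t. f i $$ (s + t) * binom_coeff 1 (- 1) t s)
             (\<lambda>ns. op_prod [\<lambda>w n. Y (v i) w $$ n, \<lambda>w n. Y (u i) w $$ n] w (rev ns)) ns) [m, n])"

locale module_at_infinity = nonlocal_vertex_algebra sc V Y vac + W: vector_space scW
  for sc :: "complex \<Rightarrow> 'v \<Rightarrow> 'v::ab_group_add" and V Y vac
    and scW :: "complex \<Rightarrow> 'w \<Rightarrow> 'w::ab_group_add" +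
  fixes YW :: "'v \<Rightarrow> 'w \<Rightarrow> 'w fls"
  assumes YW_in: "u \<in> V \<Longrightarrow> YW u \<in> Eo scW"
    and YW_add: "u \<in> V \<Longrightarrow> v \<in> V \<Longrightarrow> YW (u + v) = YW u + YW v"
    and YW_scale: "u \<in> V \<Longrightarrow> YW (sc c u) = Eo_scale scW c (YW u)"
    and YW_vac: "YW vac = Eo_one"
    and YW_assoc: "u \<in> V \<Longrightarrow> v \<in> V \<Longrightarrow> \<exists>k.
      hom_inf scW 2 (\<lambda>w. poly_act scW 0 1 ((X1 - X2) ^ k)
        (op_prod [coeffs_inf (YW u), coeffs_inf (YW v)] w)) \<and>
      (\<forall>w m. YW (Y u v $$ (m - int k)) w =
        subst_add scW (poly_act scW 0 1 ((X1 - X2) ^ k)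
          (op_prod [coeffs_inf (YW u), coeffs_inf (YW v)] w)) $$ m)"

end

theory Submission
  imports Defs
begin

text \<open>
  Call a set of operators good when any two of its elements \<open>a\<close>, \<open>b\<close> are compatible and satisfy a
  \<^emph>\<open>rational\<close> \<open>\<S>\<close>-locality
  \<open>q(x\<^sub>1 - x\<^sub>2) a(x\<^sub>1)b(x\<^sub>2) = \<Sum>\<^sub>i g\<^sub>i(x\<^sub>1 - x\<^sub>2) u\<^sub>i(x\<^sub>2)v\<^sub>i(x\<^sub>1)\<close>
  with polynomials \<open>q \<noteq> 0\<close> and \<open>g\<^sub>i\<close>, and \<open>u\<^sub>i\<close>, \<open>v\<^sub>i\<close> in the set. Clearing denominators shows that an
  \<open>\<S>\<close>-local set is good. In a good set every finite sequence is compatible: moving the first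
  operator to the right of the others bounds the powers of its variable, after multiplication by a
  polynomial in the differences, and the factors other than powers of \<open>x\<^sub>1 - x\<^sub>j\<close> can be cancelled by
  looking at top coefficients.

  Goodness passes from a set to its products \<open>a\<^sub>mb\<close>: a relation for \<open>a(x\<^sub>1)b(x\<^sub>2)c(x\<^sub>3)\<close> with factor
  \<open>p(x\<^sub>1 - x\<^sub>3)q(x\<^sub>2 - x\<^sub>3)\<close> becomes, after \<open>x\<^sub>1 = x\<^sub>2 + x\<^sub>0\<close> and Taylor expansion of \<open>p\<close> in \<open>x\<^sub>0\<close>, a relation
  with factor \<open>(pq)(x\<^sub>2 - x\<^sub>3)\<^sup>k\<close> for each coefficient in \<open>x\<^sub>0\<close>, because only finitely many negative powers of
  \<open>x\<^sub>0\<close> occur. Hence \<open>\<langle>U\<rangle>\<close> is the span of the iterated products of \<open>U\<close> and \<open>1\<^sub>W\<close>, and it is good.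

  Finally \<open>Y(a,x\<^sub>1)Y(b,x\<^sub>2)c\<close> and \<open>Y(Y(a,x\<^sub>0)b,x\<^sub>2)c\<close> are, up to powers of the differences, obtained by
  substituting \<open>z\<^sub>1 = x + x\<^sub>1\<close>, \<open>z\<^sub>2 = x + x\<^sub>2\<close>, \<open>z\<^sub>3 = x\<close> and \<open>x\<^sub>1 = x\<^sub>0 + x\<^sub>2\<close> in one triple product
  \<open>a(z\<^sub>1)b(z\<^sub>2)c(z\<^sub>3)\<close>. This gives weak associativity, and transports the rational \<open>\<S>\<close>-locality to \<open>Y\<close>;
  dividing by \<open>q\<close> turns it into the relation with coefficients \<open>g\<^sub>i/q \<in> \<complex>((x))\<close>.
\<close>

section \<open>Polynomials acting on vector spaces\<close>

text \<open>Multiplication by a fixed polynomial is not injective on doubly infinite series, since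
  delta-type series are killed by powers of x1 - x2, and an expansion such as 1/q(-x1 + x2) may be
  multiplied only with series bounded in the appropriate direction. Relations are therefore kept
  with polynomial coefficients on both sides: polynomials in x1 - x2 act on every series, commute
  with the maps used, and do not record where 1/q is expanded, so that a relation found at infinity
  can be carried over to Y, where 1/q is expanded at 0. Each division is postponed to a place where
  the support is bounded, from above for operators at infinity and from below for Y. The second
  obstacle is uniformity. The power of x1 - x2 in the locality of Y must not depend on the vector c
  acted on, although the triple product a(z1)b(z2)c(z3) does. Powers of z1 - z3 and z2 - z3 may
  depend on c, because they turn into powers of the monomials x1 and x2 and can be cancelled.
  Finally, products are introduced in one factor of a pair at a time, so goodness is stated as a
  relation between two sets.\<close>

definition fscale :: "(complex \<Rightarrow> 'b \<Rightarrow> 'b) \<Rightarrow> complex \<Rightarrow> ('a \<Rightarrow> 'b) \<Rightarrow> 'a \<Rightarrow> 'b" where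
  "fscale s c F = (\<lambda>x. s c (F x))"

lemma fscale_apply [simp]: "fscale s c F x = s c (F x)"
  by (simp add: fscale_def)

lemma vector_space_fscale:
  fixes s :: "complex \<Rightarrow> 'b \<Rightarrow> 'b::ab_group_add"
  assumes "vector_space s"
  shows "vector_space (fscale s :: complex \<Rightarrow> ('a \<Rightarrow> 'b) \<Rightarrow> 'a \<Rightarrow> 'b)"
proof -
  interpret vector_space s by fact
  show ?thesis
    by unfold_locales (auto simp: fun_eq_iff scale_right_distrib scale_left_distrib)
qed

text \<open>All later multiplications by polynomials in a variable or in a difference of variables
  have this form for some linear operator \<open>T\<close> on a space of series. The abstract
  treatment gives multiplicativity and commutation once for all these spaces.\<close>

definition pact :: "(complex \<Rightarrow> 'x \<Rightarrow> 'x::ab_group_add) \<Rightarrow> ('x \<Rightarrow> 'x) \<Rightarrow> complex poly \<Rightarrow> 'x \<Rightarrow> 'x" where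
  "pact s T p F = (\<Sum>i\<le>degree p. s (coeff p i) ((T ^^ i) F))"

definition pact2 :: "(complex \<Rightarrow> 'x \<Rightarrow> 'x::ab_group_add) \<Rightarrow> ('x \<Rightarrow> 'x) \<Rightarrow> ('x \<Rightarrow> 'x)
    \<Rightarrow> complex poly poly \<Rightarrow> 'x \<Rightarrow> 'x" where
  "pact2 s T1 T2 p F = (\<Sum>l\<le>degree p. pact s T1 (coeff p l) ((T2 ^^ l) F))"

section \<open>Polynomials in one linear operator\<close>

locale linear_endo = vector_space s for s :: "complex \<Rightarrow> 'x \<Rightarrow> 'x::ab_group_add" +
  fixes T :: "'x \<Rightarrow> 'x"
  assumes T_add: "T (x + y) = T x + T y"
    and T_scale: "T (s c x) = s c (T x)"
begin

lemma T_zero [simp]: "T 0 = 0"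
  using T_add[of 0 0] by simp

lemma T_uminus: "T (- x) = - T x"
  using T_add[of x "- x"] by (simp add: eq_neg_iff_add_eq_0 add.commute)

lemma T_diff: "T (x - y) = T x - T y"
  using T_add[of x "- y"] by (simp add: T_uminus)

lemma T_sum: "T (sum f A) = (\<Sum>i\<in>A. T (f i))"
  by (induction A rule: infinite_finite_induct) (auto simp: T_add)

lemma pow_endo: "linear_endo s (T ^^ n)"
proof -
  have "(T ^^ n) (x + y) = (T ^^ n) x + (T ^^ n) y \<and> (T ^^ n) (s c x) = s c ((T ^^ n) x)" for x y c
    by (induction n) (auto simp: T_add T_scale)
  then show ?thesis by unfold_locales auto
qed

lemma pact_ge:
  assumes "degree p \<le> N"
  shows "pact s T p F = (\<Sum>i\<le>N. s (coeff p i) ((T ^^ i) F))"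
  unfolding pact_def using assms
  by (intro sum.mono_neutral_left) (auto simp: coeff_eq_0)

lemma pact_0 [simp]: "pact s T 0 F = 0"
  by (simp add: pact_def)

lemma pact_pCons: "pact s T (pCons a p) F = s a F + T (pact s T p F)"
proof -
  have "pact s T (pCons a p) F = (\<Sum>i\<le>Suc (degree p). s (coeff (pCons a p) i) ((T ^^ i) F))"
    by (rule pact_ge) (simp add: degree_pCons_eq_if)
  also have "\<dots> = s a F + T (pact s T p F)"
    by (simp add: pact_def sum.atMost_Suc_shift T_sum T_scale del: sum.atMost_Suc)
  finally show ?thesis .
qed

lemma pact_add: "pact s T (p + q) F = pact s T p F + pact s T q F"
proof -
  let ?N = "max (degree p) (degree q)"
  have "degree (p + q) \<le> ?N" by (rule degree_add_le_max)
  then show ?thesis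
    by (simp add: pact_ge[of _ ?N] scale_left_distrib sum.distrib)
qed

lemma pact_smult: "pact s T (smult c p) F = s c (pact s T p F)"
  by (simp add: pact_ge[of _ "degree p"] scale_sum_right degree_smult_le)

lemma pact_endo: "linear_endo s (pact s T p)"
proof -
  have "pact s T p (x + y) = pact s T p x + pact s T p y \<and> pact s T p (s c x) = s c (pact s T p x)" for x y c
    by (induction p) (auto simp: pact_pCons T_add T_scale scale_right_distrib scale_left_commute algebra_simps)
  then show ?thesis by unfold_locales auto
qed

lemmas pact_add_right = linear_endo.T_add[OF pact_endo]
  and pact_scale_right = linear_endo.T_scale[OF pact_endo]
  and pact_zero_right = linear_endo.T_zero[OF pact_endo]
  and pact_diff_right = linear_endo.T_diff[OF pact_endo]
  and pact_sum_right = linear_endo.T_sum[OF pact_endo]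

text \<open>A linear map intertwining \<open>T\<close> and \<open>T'\<close> is a homomorphism of
  modules over the polynomial ring. Slicing, evaluation and the exchange of variables are carried
  past polynomials in this way.\<close>

lemma pact_commute:
  assumes "\<And>x y. L (x + y) = L x + L y" "\<And>c x. L (s c x) = s' c (L x)" "\<And>x. L (T x) = T' (L x)"
    and "linear_endo s' T'"
  shows "L (pact s T p x) = pact s' T' p (L x)"
proof (induction p)
  case 0
  have "L 0 = 0" using assms(1)[of 0 0] by simp
  then show ?case by (simp add: linear_endo.pact_0[OF assms(4)])
next
  case (pCons a p)
  then show ?case by (simp add: pact_pCons linear_endo.pact_pCons[OF assms(4)] assms(1-3))
qed

lemma pact_T: "pact s T p (T x) = T (pact s T p x)"
  by (rule pact_commute[symmetric]) (auto simp: T_add T_scale linear_endo_axioms)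

lemma pact_mult: "pact s T (p * q) F = pact s T p (pact s T q F)"
  by (induction p) (auto simp: pact_pCons pact_add pact_smult)

lemma pact_1 [simp]: "pact s T 1 F = F"
  using pact_pCons[of 1 0 F] by (simp flip: one_pCons)

lemma pact_X: "pact s T [:0, 1:] F = T F"
  by (simp add: pact_pCons)

lemma pact_X_power: "pact s T ([:0, 1:] ^ k) F = (T ^^ k) F"
  by (induction k) (auto simp: pact_mult pact_X simp del: mult_pCons_left)

lemma uminus_endo: "linear_endo s (\<lambda>x. - T x)"
  by unfold_locales (auto simp: T_add T_scale)

text \<open>Exchanging two variables, or passing from x1 - x2 to -x1 + x2, changes the sign of the
  operator; here the sign is moved into the polynomial.\<close>

lemma pact_uminus: "pact s (\<lambda>x. - T x) p F = pact s T (pcompose p [:0, -1:]) F"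
proof (induction p)
  case 0
  then show ?case by (simp add: linear_endo.pact_0[OF uminus_endo])
next
  case (pCons a p)
  have "pact s T (pcompose (pCons a p) [:0, -1:]) F =
      s a F + pact s T ([:0, -1:] * pcompose p [:0, -1:]) F"
    by (simp only: pcompose_pCons pact_add) (simp add: pact_pCons)
  also have "\<dots> = s a F - T (pact s T (pcompose p [:0, -1:]) F)"
    by (simp only: pact_mult) (simp add: pact_pCons T_uminus)
  finally show ?case using pCons
    by (simp add: linear_endo.pact_pCons[OF uminus_endo] T_uminus)
qed

lemma pact_in:
  assumes "0 \<in> P" "\<And>x y. x \<in> P \<Longrightarrow> y \<in> P \<Longrightarrow> x + y \<in> P" "\<And>c x. x \<in> P \<Longrightarrow> s c x \<in> P"
    "\<And>x. x \<in> P \<Longrightarrow> T x \<in> P" "x \<in> P"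
  shows "pact s T p x \<in> P"
  by (induction p) (auto simp: pact_pCons assms)

lemma pact2_ge:
  assumes "degree p \<le> N"
  shows "pact2 s T T2 p F = (\<Sum>l\<le>N. pact s T (coeff p l) ((T2 ^^ l) F))"
  unfolding pact2_def using assms
  by (intro sum.mono_neutral_left) (auto simp: coeff_eq_0)

end

section \<open>Polynomials in two commuting linear operators\<close>

locale linear_endo2 = E1: linear_endo s T1 + E2: linear_endo s T2
  for s :: "complex \<Rightarrow> 'x \<Rightarrow> 'x::ab_group_add" and T1 T2 +
  assumes T12: "T1 (T2 x) = T2 (T1 x)"
begin

lemma T12_pact: "T2 (pact s T1 p x) = pact s T1 p (T2 x)"
  by (rule E1.pact_commute) (auto simp: E2.T_add E2.T_scale T12 E1.linear_endo_axioms)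

lemma pact2_0 [simp]: "pact2 s T1 T2 0 F = 0"
  by (simp add: pact2_def)

lemma pact2_pCons: "pact2 s T1 T2 (pCons q p) F = pact s T1 q F + T2 (pact2 s T1 T2 p F)"
proof -
  have "pact2 s T1 T2 (pCons q p) F = (\<Sum>l\<le>Suc (degree p). pact s T1 (coeff (pCons q p) l) ((T2 ^^ l) F))"
    by (rule E1.pact2_ge) (simp add: degree_pCons_eq_if)
  also have "\<dots> = pact s T1 q F + T2 (pact2 s T1 T2 p F)"
    by (simp add: pact2_def sum.atMost_Suc_shift E2.T_sum T12_pact del: sum.atMost_Suc)
  finally show ?thesis .
qed

lemma pact2_add: "pact2 s T1 T2 (p + q) F = pact2 s T1 T2 p F + pact2 s T1 T2 q F"
proof -
  let ?N = "max (degree p) (degree q)"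
  have "degree (p + q) \<le> ?N" by (rule degree_add_le_max)
  then show ?thesis
    by (simp add: E1.pact2_ge[of _ ?N] E1.pact_add sum.distrib)
qed

lemma pact2_smult: "pact2 s T1 T2 (smult c p) F = pact s T1 c (pact2 s T1 T2 p F)"
  by (simp add: E1.pact2_ge[of _ "degree p"] E1.pact_sum_right E1.pact_mult degree_smult_le)

lemma pact2_endo: "linear_endo s (pact2 s T1 T2 p)"
proof -
  have "pact2 s T1 T2 p (x + y) = pact2 s T1 T2 p x + pact2 s T1 T2 p y \<and>
      pact2 s T1 T2 p (s c x) = s c (pact2 s T1 T2 p x)" for x y c
    by (induction p)
      (auto simp: pact2_pCons E1.pact_add_right E2.T_add E1.pact_scale_right E2.T_scale E1.scale_right_distrib algebra_simps)
  then show ?thesis by unfold_locales auto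
qed

lemma pact2_mult: "pact2 s T1 T2 (p * q) F = pact2 s T1 T2 p (pact2 s T1 T2 q F)"
  by (induction p) (auto simp: pact2_pCons pact2_add pact2_smult)

lemma pact2_1 [simp]: "pact2 s T1 T2 1 F = F"
  using pact2_pCons[of 1 0 F] by (simp flip: one_pCons)

lemma pact2_X1: "pact2 s T1 T2 X1 F = T1 F"
  by (simp add: X1_def pact2_pCons E1.pact_X)

lemma pact2_X2: "pact2 s T1 T2 X2 F = T2 F"
  by (simp add: X2_def pact2_pCons)

lemma pact2_diff: "pact2 s T1 T2 (p - q) F = pact2 s T1 T2 p F - pact2 s T1 T2 q F"
  using pact2_add[of "p - q" q F] by (simp add: algebra_simps)

lemma pact2_diff_power: "pact2 s T1 T2 ((X1 - X2) ^ k) F = ((\<lambda>x. T1 x - T2 x) ^^ k) F"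
  by (induction k) (auto simp: pact2_mult pact2_diff pact2_X1 pact2_X2)

lemma pact2_sum_power: "pact2 s T1 T2 ((X1 + X2) ^ k) F = ((\<lambda>x. T1 x + T2 x) ^^ k) F"
  by (induction k) (auto simp: pact2_mult pact2_add pact2_X1 pact2_X2)

lemma diff_endo: "linear_endo s (\<lambda>x. T1 x - T2 x)"
  by unfold_locales (auto simp: E1.T_add E2.T_add E1.T_scale E2.T_scale E1.scale_right_diff_distrib)

lemma pact2_commute:
  assumes "\<And>x y. L (x + y) = L x + L y" "\<And>c x. L (s c x) = s' c (L x)" "\<And>x. L (T1 x) = T1' (L x)"
    "\<And>x. L (T2 x) = T2' (L x)" and "linear_endo2 s' T1' T2'"
  shows "L (pact2 s T1 T2 p x) = pact2 s' T1' T2' p (L x)"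
proof -
  interpret P: linear_endo2 s' T1' T2' by fact
  have *: "L (pact s T1 q x) = pact s' T1' q (L x)" for q x
    by (rule E1.pact_commute) (auto simp: assms P.E1.linear_endo_axioms)
  have "L 0 = 0" using assms(1)[of 0 0] by simp
  then show ?thesis
    by (induction p) (auto simp: pact2_pCons P.pact2_pCons assms *)
qed

end

text \<open>One notion for three uses: with one difference of variables in \<open>Ts\<close>, with
  two of them, and with \<open>Ts\<close> empty, when it is the linear span.\<close>

inductive_set nmod :: "(complex \<Rightarrow> 'x \<Rightarrow> 'x::ab_group_add) \<Rightarrow> ('x \<Rightarrow> 'x) set \<Rightarrow> 'x set \<Rightarrow> 'x set"
  for s Ts B where
  nmod_base: "x \<in> B \<Longrightarrow> x \<in> nmod s Ts B"
| nmod_0: "0 \<in> nmod s Ts B"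
| nmod_add: "x \<in> nmod s Ts B \<Longrightarrow> y \<in> nmod s Ts B \<Longrightarrow> x + y \<in> nmod s Ts B"
| nmod_scale: "x \<in> nmod s Ts B \<Longrightarrow> s c x \<in> nmod s Ts B"
| nmod_op: "x \<in> nmod s Ts B \<Longrightarrow> T \<in> Ts \<Longrightarrow> T x \<in> nmod s Ts B"

lemma nmod_mono: "x \<in> nmod s Ts B \<Longrightarrow> B \<subseteq> B' \<Longrightarrow> x \<in> nmod s Ts B'"
  by (induction rule: nmod.induct) (auto intro: nmod.intros)

context linear_endo
begin

lemma nmod_pact: "x \<in> nmod s Ts B \<Longrightarrow> T \<in> Ts \<Longrightarrow> pact s T p x \<in> nmod s Ts B"
  by (rule pact_in) (auto intro: nmod.intros)

text \<open>Closure arguments work with induction over \<open>nmod\<close>. The explicit list is for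
  the final relation, which has to exhibit its finitely many coefficients.\<close>

lemma nmod_sum_list:
  assumes "x \<in> nmod s {T} B"
  shows "\<exists>gs. snd ` set gs \<subseteq> B \<and> x = (\<Sum>(g, y)\<leftarrow>gs. pact s T g y)"
  using assms
proof (induction rule: nmod.induct)
  case (nmod_base x)
  then show ?case by (intro exI[of _ "[(1, x)]"]) auto
next
  case nmod_0
  then show ?case by (intro exI[of _ "[]"]) auto
next
  case (nmod_add x y)
  then obtain gs hs where "snd ` set gs \<subseteq> B" "x = (\<Sum>(g, y)\<leftarrow>gs. pact s T g y)"
    "snd ` set hs \<subseteq> B" "y = (\<Sum>(g, y)\<leftarrow>hs. pact s T g y)" by blast
  then show ?case by (intro exI[of _ "gs @ hs"]) auto
next
  case (nmod_scale x c)
  then obtain gs where gs: "snd ` set gs \<subseteq> B" "x = (\<Sum>(g, y)\<leftarrow>gs. pact s T g y)" by blast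
  have "s c (\<Sum>(g, y)\<leftarrow>gs. pact s T g y) = (\<Sum>(g, y)\<leftarrow>map (\<lambda>(g, y). (smult c g, y)) gs. pact s T g y)" for gs
    by (induction gs) (auto simp: scale_right_distrib pact_smult)
  with gs show ?case by (intro exI[of _ "map (\<lambda>(g, y). (smult c g, y)) gs"]) auto
next
  case (nmod_op x T')
  then obtain gs where gs: "snd ` set gs \<subseteq> B" "x = (\<Sum>(g, y)\<leftarrow>gs. pact s T g y)" by blast
  have "T (\<Sum>(g, y)\<leftarrow>gs. pact s T g y) = (\<Sum>(g, y)\<leftarrow>map (\<lambda>(g, y). (pCons 0 g, y)) gs. pact s T g y)" for gs
    by (induction gs) (auto simp: T_add pact_pCons)
  with gs nmod_op show ?case by (intro exI[of _ "map (\<lambda>(g, y). (pCons 0 g, y)) gs"]) auto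
qed

end

section \<open>Series in two variables\<close>

text \<open>A function \<open>F\<close> on pairs of integers stands for the formal series
  \<open>\<Sum>\<^sub>m\<^sub>,\<^sub>n F m n x\<^sub>1\<^sup>m x\<^sub>2\<^sup>n\<close>; then \<open>sh1\<close>, \<open>sh2\<close> and \<open>dl\<close> are the multiplications by \<open>x\<^sub>1\<close>, \<open>x\<^sub>2\<close> and
  \<open>x\<^sub>1 - x\<^sub>2\<close>. The pointwise simplification rules are switched off because they also rewrite partially
  applied operators, by eta-expanding them.\<close>

declare plus_fun_apply [simp del] minus_apply [simp del] zero_fun_apply [simp del]
lemmas fun_app = plus_fun_apply minus_apply zero_fun_apply uminus_apply

definition sh1 :: "(int \<Rightarrow> int \<Rightarrow> 'v) \<Rightarrow> int \<Rightarrow> int \<Rightarrow> 'v" where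
  "sh1 F m n = F (m - 1) n"

definition sh2 :: "(int \<Rightarrow> int \<Rightarrow> 'v) \<Rightarrow> int \<Rightarrow> int \<Rightarrow> 'v" where
  "sh2 F m n = F m (n - 1)"

definition dl :: "(int \<Rightarrow> int \<Rightarrow> 'v::ab_group_add) \<Rightarrow> int \<Rightarrow> int \<Rightarrow> 'v" where
  "dl F = (\<lambda>m n. F (m - 1) n - F m (n - 1))"

lemma dl_alt: "dl F = sh1 F - sh2 F"
  by (simp add: dl_def sh1_def sh2_def fun_eq_iff fun_app)

definition flip2 :: "(int \<Rightarrow> int \<Rightarrow> 'v) \<Rightarrow> int \<Rightarrow> int \<Rightarrow> 'v" where
  "flip2 F = (\<lambda>m n. F n m)"

lemma flip2_flip2 [simp]: "flip2 (flip2 F) = F"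
  by (simp add: flip2_def)

definition bnd2 :: "(int \<Rightarrow> int \<Rightarrow> 'v::zero) \<Rightarrow> bool" where
  "bnd2 F \<longleftrightarrow> (\<exists>N. \<forall>m n. F m n \<noteq> 0 \<longrightarrow> m \<le> N \<and> n \<le> N)"

definition sing :: "(int \<Rightarrow> int \<Rightarrow> 'v::ab_group_add) \<Rightarrow> bool" where
  "sing F \<longleftrightarrow> (\<exists>k. bnd2 ((dl ^^ k) F))"

lemma bnd2I: "(\<And>m n. F m n \<noteq> 0 \<Longrightarrow> m \<le> N \<and> n \<le> N) \<Longrightarrow> bnd2 F"
  by (auto simp: bnd2_def)

lemma bnd2_0: "bnd2 (\<lambda>m n. 0)"
  by (rule bnd2I) auto

lemma bnd2_add:
  fixes F G :: "int \<Rightarrow> int \<Rightarrow> 'v::ab_group_add"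
  assumes "bnd2 F" "bnd2 G"
  shows "bnd2 (F + G)"
proof -
  obtain N M where N: "\<And>m n. F m n \<noteq> 0 \<Longrightarrow> m \<le> N \<and> n \<le> N" and M: "\<And>m n. G m n \<noteq> 0 \<Longrightarrow> m \<le> M \<and> n \<le> M"
    using assms unfolding bnd2_def by blast
  have "m \<le> max N M \<and> n \<le> max N M" if "(F + G) m n \<noteq> 0" for m n
    using N[of m n] M[of m n] that by (cases "F m n = 0") (auto simp: fun_app)
  then show ?thesis by (rule bnd2I)
qed

lemma bnd2_dl: "bnd2 F \<Longrightarrow> bnd2 (dl F)"
proof -
  assume "bnd2 F"
  then obtain N where N: "\<And>m n. F m n \<noteq> 0 \<Longrightarrow> m \<le> N \<and> n \<le> N"
    unfolding bnd2_def by blast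
  have "m \<le> N + 1 \<and> n \<le> N + 1" if "dl F m n \<noteq> 0" for m n
    using N[of "m - 1" n] N[of m "n - 1"] that
    by (cases "F (m - 1) n = 0") (auto simp: dl_def)
  then show ?thesis by (rule bnd2I)
qed

lemma bnd2_dl_pow: "bnd2 F \<Longrightarrow> bnd2 ((dl ^^ k) F)"
  by (induction k) (auto simp: bnd2_dl)

lemma funpow_split: "k \<le> l \<Longrightarrow> (f ^^ l) x = (f ^^ (l - k)) ((f ^^ k) x)"
  by (metis funpow_add comp_apply le_add_diff_inverse2)

lemma bnd2_dl_mono: "bnd2 ((dl ^^ k) F) \<Longrightarrow> k \<le> l \<Longrightarrow> bnd2 ((dl ^^ l) F)"
  using bnd2_dl_pow[of "(dl ^^ k) F" "l - k"] by (simp add: funpow_split[of k l])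

lemma dl_add: "dl (F + G) = dl F + dl G"
  by (simp add: dl_def fun_eq_iff fun_app)

lemma dl_pow_add: "(dl ^^ k) (F + G) = (dl ^^ k) F + (dl ^^ k) G"
  by (induction k) (auto simp: dl_add)

lemma dl_sh2: "dl (sh2 F) = sh2 (dl F)"
  by (simp add: dl_def sh2_def fun_eq_iff)

lemma dl_pow_sh2: "(dl ^^ k) (sh2 F) = sh2 ((dl ^^ k) F)"
  by (induction k) (auto simp: dl_sh2)

lemma dl_pow_map:
  assumes "\<And>x y. \<phi> (x - y) = \<phi> x - \<phi> y"
  shows "(dl ^^ k) (\<lambda>m n. \<phi> (F m n)) = (\<lambda>m n. \<phi> ((dl ^^ k) F m n))"
  by (induction k arbitrary: F) (simp_all add: dl_def assms)

lemma bnd2_sh2: "bnd2 F \<Longrightarrow> bnd2 (sh2 F)"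
proof -
  assume "bnd2 F"
  then obtain N where "\<And>m n. F m n \<noteq> 0 \<Longrightarrow> m \<le> N \<and> n \<le> N"
    unfolding bnd2_def by blast
  then show ?thesis
    by (intro bnd2I[of _ "N + 1"]) (fastforce simp: sh2_def)
qed

lemma bnd2_map: "bnd2 F \<Longrightarrow> \<phi> 0 = 0 \<Longrightarrow> bnd2 (\<lambda>m n. \<phi> (F m n))"
  unfolding bnd2_def by (metis (no_types, lifting))

lemma sing_bnd2: "bnd2 F \<Longrightarrow> sing F"
  unfolding sing_def by (rule exI[of _ 0]) simp

lemma sing_add: "sing F \<Longrightarrow> sing G \<Longrightarrow> sing (F + G)"
proof -
  assume "sing F" "sing G"
  then obtain k l where "bnd2 ((dl ^^ k) F)" "bnd2 ((dl ^^ l) G)" unfolding sing_def by blast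
  then have "bnd2 ((dl ^^ max k l) (F + G))"
    unfolding dl_pow_add by (intro bnd2_add bnd2_dl_mono[where l = "max k l"]) auto
  then show ?thesis unfolding sing_def by blast
qed

lemma sing_dl: "sing F \<Longrightarrow> sing (dl F)"
  unfolding sing_def by (auto simp flip: funpow_swap1 intro: bnd2_dl)

lemma sing_sh2: "sing F \<Longrightarrow> sing (sh2 F)"
  unfolding sing_def by (auto simp: dl_pow_sh2 intro: bnd2_sh2)

lemma sh1_eq: "sh1 F = dl F + sh2 F"
  by (simp add: dl_def sh1_def sh2_def fun_eq_iff fun_app)

lemma sing_sh1: "sing F \<Longrightarrow> sing (sh1 F)"
  unfolding sh1_eq by (intro sing_add sing_dl sing_sh2)

lemma sing_map:
  assumes "sing F" "\<And>x y. \<phi> (x - y) = \<phi> x - \<phi> y"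
  shows "sing (\<lambda>m n. \<phi> (F m n))"
proof -
  have "\<phi> 0 = 0" using assms(2)[of 0 0] by simp
  then show ?thesis using assms(1) bnd2_map
    unfolding sing_def dl_pow_map[OF assms(2)] by blast
qed

text \<open>The coefficient of x^(i-j) x0^j in (x + x0)^i. The value 0 for negative \<open>j\<close>
  makes Pascal's rule hold for all integers without side conditions.\<close>

definition cb :: "int \<Rightarrow> int \<Rightarrow> complex" where
  "cb i j = (if j < 0 then 0 else of_int i gchoose nat j)"

lemma cb_Suc: "cb (i + 1) j = cb i j + cb i (j - 1)"
proof (cases "j \<le> 0")
  case True
  then show ?thesis by (cases "j = 0") (auto simp: cb_def)
next
  case False
  then have "nat j = Suc (nat (j - 1))" by linarith
  with False show ?thesis by (simp add: cb_def gbinomial_Suc_Suc)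
qed

lemma cb_neg [simp]: "j < 0 \<Longrightarrow> cb i j = 0"
  by (simp add: cb_def)

lemma cb_0 [simp]: "cb i 0 = 1"
  by (simp add: cb_def)

lemma cb_zero_left: "cb 0 j = (if j = 0 then 1 else 0)"
proof (cases "j > 0")
  case True
  then have "nat j = Suc (nat (j - 1))" by linarith
  with True show ?thesis by (simp add: cb_def)
qed (auto simp: cb_def)

section \<open>The substitution x1 = x + x0\<close>

locale complex_space = vector_space sc for sc :: "complex \<Rightarrow> 'w \<Rightarrow> 'w::ab_group_add"
begin

sublocale dl: linear_endo2 "fscale (fscale sc)" sh1 sh2
proof -
  interpret V: vector_space "fscale (fscale sc) :: _ \<Rightarrow> (int \<Rightarrow> int \<Rightarrow> 'w) \<Rightarrow> _"
    by (intro vector_space_fscale) unfold_locales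
  show "linear_endo2 (fscale (fscale sc)) sh1 sh2"
    by unfold_locales (auto simp: sh1_def sh2_def fun_eq_iff fun_app)
qed

sublocale dlE: linear_endo "fscale (fscale sc)" dl
proof -
  have "dl = (\<lambda>x. sh1 x - sh2 x :: int \<Rightarrow> int \<Rightarrow> 'w)" by (rule ext) (rule dl_alt)
  then show "linear_endo (fscale (fscale sc)) (dl :: (int \<Rightarrow> int \<Rightarrow> 'w) \<Rightarrow> _)" using dl.diff_endo by simp
qed

definition S :: "int \<Rightarrow> (int \<Rightarrow> int \<Rightarrow> 'w) \<Rightarrow> int \<Rightarrow> 'w" where
  "S j F n = Sum_any (\<lambda>i. sc (cb i j) (F i (n + j - i)))"
  \<comment> \<open>the coefficient of \<open>x\<^sub>0\<^sup>j x\<^sup>n\<close> in \<open>F(x + x\<^sub>0, x)\<close>\<close>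

lemma S_eq_sum:
  assumes "\<And>m n. F m n \<noteq> 0 \<Longrightarrow> m \<le> N \<and> n \<le> N" "finite I" "{n + j - N..N} \<subseteq> I"
  shows "S j F n = (\<Sum>i\<in>I. sc (cb i j) (F i (n + j - i)))"
  unfolding S_def
proof (rule Sum_any.expand_superset)
  show "{i. sc (cb i j) (F i (n + j - i)) \<noteq> 0} \<subseteq> I"
  proof
    fix i assume "i \<in> {i. sc (cb i j) (F i (n + j - i)) \<noteq> 0}"
    then have "F i (n + j - i) \<noteq> 0" by auto
    then have "i \<le> N \<and> n + j - i \<le> N" by (rule assms(1))
    then show "i \<in> I" using assms(3) by auto
  qed
qed fact

lemma S_neg: "j < 0 \<Longrightarrow> S j F = (\<lambda>_. 0)"
  by (simp add: S_def fun_eq_iff)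

lemma S_add:
  assumes "bnd2 F" "bnd2 G"
  shows "S j (F + G) = S j F + S j G"
proof (rule ext)
  fix n
  obtain N M where N: "\<And>m n. F m n \<noteq> 0 \<Longrightarrow> m \<le> N \<and> n \<le> N" and M: "\<And>m n. G m n \<noteq> 0 \<Longrightarrow> m \<le> M \<and> n \<le> M"
    using assms unfolding bnd2_def by blast
  define K where "K = max N M"
  have 1: "F m n \<noteq> 0 \<Longrightarrow> m \<le> K \<and> n \<le> K" "G m n \<noteq> 0 \<Longrightarrow> m \<le> K \<and> n \<le> K" for m n
    using N[of m n] M[of m n] by (auto simp: K_def)
  have 2: "(F + G) m n \<noteq> 0 \<Longrightarrow> m \<le> K \<and> n \<le> K" for m n
    using 1[of m n] by (cases "F m n = 0") (auto simp: fun_app)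
  show "S j (F + G) n = (S j F + S j G) n"
    using S_eq_sum[of "F + G", OF 2 finite_atLeastAtMost_int order.refl]
      S_eq_sum[of F, OF 1(1) finite_atLeastAtMost_int order.refl]
      S_eq_sum[of G, OF 1(2) finite_atLeastAtMost_int order.refl]
    by (simp add: fun_app scale_right_distrib sum.distrib)
qed

lemma S_map:
  assumes "bnd2 F" "\<And>x y. \<phi> (x + y) = \<phi> x + \<phi> y" "\<And>c x. \<phi> (sc c x) = sc c (\<phi> x)"
  shows "S j (\<lambda>m n. \<phi> (F m n)) n = \<phi> (S j F n)"
proof -
  obtain N where N: "\<And>m n. F m n \<noteq> 0 \<Longrightarrow> m \<le> N \<and> n \<le> N"
    using assms unfolding bnd2_def by blast
  have 0: "\<phi> 0 = 0" using assms(2)[of 0 0] by simp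
  have sum: "\<phi> (sum f A) = (\<Sum>i\<in>A. \<phi> (f i))" for f :: "int \<Rightarrow> _" and A
    by (induction A rule: infinite_finite_induct) (auto simp: assms 0)
  have M: "\<phi> (F m n) \<noteq> 0 \<Longrightarrow> m \<le> N \<and> n \<le> N" for m n
    using N[of m n] 0 by metis
  show ?thesis
    using S_eq_sum[of F, OF N finite_atLeastAtMost_int order.refl]
      S_eq_sum[of "\<lambda>m n. \<phi> (F m n)", OF M finite_atLeastAtMost_int order.refl]
    by (simp add: sum assms(2,3))
qed

lemma S_scale: "bnd2 F \<Longrightarrow> S j (fscale (fscale sc) c F) n = sc c (S j F n)"
  using S_map[of F "sc c" j n] by (simp add: fscale_def scale_right_distrib scale_left_commute)

lemma S_sh2: "S j (sh2 F) n = S j F (n - 1)"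
  by (simp add: S_def sh2_def algebra_simps)

text \<open>After x1 = x + x0, x2 = x the difference x1 - x2 is x0; on coefficients this is Pascal's
  rule.\<close>

lemma S_dl:
  assumes "bnd2 F"
  shows "S j (dl F) = S (j - 1) F"
proof (rule ext)
  fix n
  obtain N where N: "\<And>m n. F m n \<noteq> 0 \<Longrightarrow> m \<le> N \<and> n \<le> N"
    using assms unfolding bnd2_def by blast
  have M: "m \<le> N + 1 \<and> n \<le> N + 1"
    if "dl F m n \<noteq> 0" for m n
    using N[of "m - 1" n] N[of m "n - 1"] that
    by (cases "F (m - 1) n = 0") (auto simp: dl_def)
  \<comment> \<open>The margin makes the summands vanish at both ends, so that the window shifted by
    one may be exchanged for the original one.\<close>
  define A B where "A = n + j - (N + 1) - 5" and "B = N + 5"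
  have z: "F i (n + j - 1 - i) = 0" if "i < A + 1 \<or> i > B - 1" for i
    using N[of i "n + j - 1 - i"] that by (cases "F i (n + j - 1 - i) = 0") (auto simp: A_def B_def)
  have "S j (dl F) n = (\<Sum>i\<in>{A..B}. sc (cb i j) (dl F i (n + j - i)))"
    by (rule S_eq_sum[OF M]) (auto simp: A_def B_def)
  also have "\<dots> = (\<Sum>i\<in>{A..B}. sc (cb i j) (F (i - 1) (n + j - i))) - (\<Sum>i\<in>{A..B}. sc (cb i j) (F i (n + j - 1 - i)))"
    by (simp add: dl_def scale_right_diff_distrib sum_subtractf algebra_simps)
  also have "(\<Sum>i\<in>{A..B}. sc (cb i j) (F (i - 1) (n + j - i))) =
      (\<Sum>i\<in>{A-1..B-1}. sc (cb (i + 1) j) (F i (n + j - 1 - i)))"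
    by (rule sum.reindex_bij_witness[of _ "\<lambda>i. i + 1" "\<lambda>i. i - 1"]) (auto simp: algebra_simps)
  also have "\<dots> = (\<Sum>i\<in>{A..B}. sc (cb (i + 1) j) (F i (n + j - 1 - i)))"
    by (rule sum.mono_neutral_cong) (auto simp: z)
  also have "\<dots> - (\<Sum>i\<in>{A..B}. sc (cb i j) (F i (n + j - 1 - i))) =
      (\<Sum>i\<in>{A..B}. sc (cb i (j - 1)) (F i (n + (j - 1) - i)))"
    by (simp add: cb_Suc scale_left_distrib flip: sum_subtractf) (simp add: algebra_simps)
  also have "\<dots> = S (j - 1) F n"
    by (rule S_eq_sum[symmetric, OF N]) (auto simp: A_def B_def)
  finally show "S j (dl F) n = S (j - 1) F n" .
qed

lemma S_dl_pow: "bnd2 F \<Longrightarrow> S j ((dl ^^ k) F) = S (j - int k) F"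
  by (induction k arbitrary: j) (auto simp: S_dl bnd2_dl_pow algebra_simps)

text \<open>\<open>sg m F\<close> is the coefficient of \<open>x\<^sub>0\<^sup>m\<close> in \<open>x\<^sub>0\<^sup>-\<^sup>k (((x\<^sub>1 - x)\<^sup>k F(x\<^sub>1,x))|\<^bsub>x\<^sub>1 = x + x\<^sub>0\<^esub>)\<close>, for any
  \<open>k\<close> for which the substitution makes sense.\<close>

definition sg :: "int \<Rightarrow> (int \<Rightarrow> int \<Rightarrow> 'w) \<Rightarrow> int \<Rightarrow> 'w" where
  "sg m F = (let k = (LEAST k. bnd2 ((dl ^^ k) F)) in S (m + int k) ((dl ^^ k) F))"

text \<open>By \<open>S_dl_pow\<close> each surplus factor x1 - x2 raises the power of x0 by one,
  which the index \<open>m + int k\<close> compensates. Hence every admissible \<open>k\<close>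
  gives the same result, in particular a common one for two series.\<close>

lemma sg_eq:
  assumes "bnd2 ((dl ^^ k) F)"
  shows "sg m F = S (m + int k) ((dl ^^ k) F)"
proof -
  define l where "l = (LEAST k. bnd2 ((dl ^^ k) F))"
  have l: "bnd2 ((dl ^^ l) F)" "l \<le> k"
    unfolding l_def using assms by (rule LeastI, rule Least_le)
  have "(dl ^^ k) F = (dl ^^ (k - l)) ((dl ^^ l) F)"
    using l(2) by (rule funpow_split)
  then have "S (m + int k) ((dl ^^ k) F) = S (m + int l) ((dl ^^ l) F)"
    using l by (simp add: S_dl_pow of_nat_diff algebra_simps)
  then show ?thesis by (simp add: sg_def l_def Let_def)
qed

lemma sg_bnd2: "bnd2 F \<Longrightarrow> sg m F = S m F"
  using sg_eq[of 0 F m] by simp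

lemma sg_neg: "bnd2 ((dl ^^ k) F) \<Longrightarrow> m < - int k \<Longrightarrow> sg m F = (\<lambda>_. 0)"
  by (simp add: sg_eq S_neg)

lemma sg_add:
  assumes "sing F" "sing G"
  shows "sg m (F + G) = sg m F + sg m G"
proof -
  obtain k l where "bnd2 ((dl ^^ k) F)" "bnd2 ((dl ^^ l) G)" using assms unfolding sing_def by blast
  then have *: "bnd2 ((dl ^^ max k l) F)" "bnd2 ((dl ^^ max k l) G)"
    by (auto elim!: bnd2_dl_mono)
  then have "bnd2 ((dl ^^ max k l) (F + G))" by (simp add: dl_pow_add bnd2_add)
  from sg_eq[OF this] sg_eq[OF *(1)] sg_eq[OF *(2)] show ?thesis
    by (simp add: dl_pow_add S_add * del: of_nat_max)
qed

lemma sg_map: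
  assumes "sing F" "\<And>x y. \<phi> (x + y) = \<phi> x + \<phi> y" "\<And>c x. \<phi> (sc c x) = sc c (\<phi> x)"
  shows "sg m (\<lambda>m n. \<phi> (F m n)) n = \<phi> (sg m F n)"
proof -
  obtain k where k: "bnd2 ((dl ^^ k) F)" using assms unfolding sing_def by blast
  have "\<phi> (- x) = - \<phi> x" for x using assms(3)[of "-1" x] by simp
  then have d: "\<phi> (x - y) = \<phi> x - \<phi> y" for x y using assms(2)[of x "- y"] by simp
  have 0: "\<phi> 0 = 0" using assms(2)[of 0 0] by simp
  have "bnd2 ((dl ^^ k) (\<lambda>m n. \<phi> (F m n)))"
    unfolding dl_pow_map[where \<phi> = \<phi>, OF d] by (rule bnd2_map) (use k 0 in auto)
  then show ?thesis
    by (simp add: sg_eq[OF k] sg_eq dl_pow_map[where \<phi> = \<phi>, OF d] S_map[OF k assms(2,3)])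
qed

lemma sing_scale: "sing F \<Longrightarrow> sing (fscale (fscale sc) c F)"
  using sing_map[of F "sc c"] by (simp add: fscale_def scale_right_diff_distrib)

lemma sg_scale: "sing F \<Longrightarrow> sg m (fscale (fscale sc) c F) = fscale sc c (sg m F)"
  using sg_map[of F "sc c" m] by (simp add: fscale_def scale_right_distrib scale_left_commute fun_eq_iff)

lemma sing_zero: "sing (0 :: int \<Rightarrow> int \<Rightarrow> 'w)"
  using sing_bnd2[OF bnd2_0] by (simp add: zero_fun_def)

lemma sg_zero: "sg m 0 = 0"
  using sg_bnd2[OF bnd2_0, of m] by (simp add: zero_fun_def S_def fun_eq_iff)

lemma sg_uminus: "sing F \<Longrightarrow> sg m (- F) = - sg m F"
  using sg_scale[of F m "-1"] by (simp add: fscale_def fun_Compl_def)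

lemma sing_uminus: "sing F \<Longrightarrow> sing (- F)"
  using sing_map[of F uminus] by (simp add: fun_Compl_def)

lemma sg_diff: "sing F \<Longrightarrow> sing G \<Longrightarrow> sg m (F - G) = sg m F - sg m G"
  using sg_add[of F "- G" m] by (simp add: sg_uminus sing_uminus)

lemma sg_dl:
  assumes "sing F"
  shows "sg m (dl F) = sg (m - 1) F"
proof -
  obtain k where k: "bnd2 ((dl ^^ k) F)" using assms unfolding sing_def by blast
  then have *: "bnd2 ((dl ^^ Suc k) F)" by (simp add: bnd2_dl)
  then have "bnd2 ((dl ^^ k) (dl F))" by (simp add: funpow_swap1)
  from sg_eq[OF this, of m] sg_eq[OF *, of "m - 1"] show ?thesis
    by (simp add: funpow_swap1)
qed

lemma sg_sh2:
  assumes "sing F"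
  shows "sg m (sh2 F) n = sg m F (n - 1)"
proof -
  obtain k where k: "bnd2 ((dl ^^ k) F)" using assms unfolding sing_def by blast
  then have "bnd2 ((dl ^^ k) (sh2 F))" by (simp add: dl_pow_sh2 bnd2_sh2)
  with k show ?thesis by (simp add: sg_eq dl_pow_sh2 S_sh2)
qed

lemma sg_sh1: "sing F \<Longrightarrow> sg m (sh1 F) n = sg m F (n - 1) + sg (m - 1) F n"
  by (simp add: fun_app sh1_eq sg_add sing_dl sing_sh2 sg_dl sg_sh2)

lemma S_bounded:
  assumes "\<And>m n. F m n \<noteq> 0 \<Longrightarrow> m \<le> N \<and> n \<le> N" "S j F n \<noteq> 0"
  shows "n \<le> 2 * N - j"
proof (rule ccontr)
  assume "\<not> n \<le> 2 * N - j"
  then have "S j F n = (\<Sum>i\<in>{}. sc (cb i j) (F i (n + j - i)))"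
    by (intro S_eq_sum[of _ N] assms(1)) auto
  then show False using assms(2) by simp
qed

end

section \<open>Laurent series acting on Laurent series\<close>

text \<open>\<open>Abs_fls\<close> returns the intended coefficients only if these vanish below some
  index, here \<open>A + B\<close>. The free index set \<open>I\<close> allows sums with different
  bounds to be aligned.\<close>

lemma fls_smult_nth:
  assumes "\<And>a. act a 0 = 0" "\<And>x. act 0 x = 0"
    and "\<And>i. i < A \<Longrightarrow> g $$ i = 0" "\<And>i. i < B \<Longrightarrow> f $$ i = 0" "finite I" "{A..n - B} \<subseteq> I"
  shows "fls_smult act g f $$ n = (\<Sum>i\<in>I. act (g $$ i) (f $$ (n - i)))"
proof -
  have z: "act (g $$ i) (f $$ (n - i)) = 0" if "i \<notin> {A..n - B}" for i n
  proof (cases "i < A")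
    case False
    with that have "n - i < B" by auto
    with assms show ?thesis by simp
  qed (use assms in simp)
  have supp: "{i. act (g $$ i) (f $$ (n - i)) \<noteq> 0} \<subseteq> {A..n - B}" for n
    using z by blast
  have "Sum_any (\<lambda>i. act (g $$ i) (f $$ (n - i))) = 0" if "n < A + B" for n
    using supp[of n] that by (subst Sum_any.expand_superset[of "{}"]) auto
  then have "fls_smult act g f $$ n = Sum_any (\<lambda>i. act (g $$ i) (f $$ (n - i)))"
    unfolding fls_smult_def by (intro nth_Abs_fls_lower_bound[of "A + B"]) auto
  also have "\<dots> = (\<Sum>i\<in>I. act (g $$ i) (f $$ (n - i)))"
    using supp[of n] assms(5,6) by (intro Sum_any.expand_superset) auto
  finally show ?thesis .
qed

text \<open>Applied twice: over the complex numbers it gives an action of Laurent series in one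
  variable, and over these an action of iterated series. Associativity is what permits division by
  an invertible iterated series when \<open>Y_Eo\<close> is computed.\<close>

lemma fls_smult_module:
  fixes act :: "'a::comm_ring_1 \<Rightarrow> 'w::ab_group_add \<Rightarrow> 'w"
  assumes "module act"
  shows "module (fls_smult act)"
proof -
  interpret module act by fact
  have low: "\<exists>N. \<forall>n<N. f $$ n = 0" for f :: "'z::zero fls"
    using fls_nth_vanishes_belowE[of f] by metis
  have nth: "fls_smult act g f $$ n = (\<Sum>i\<in>I. act (g $$ i) (f $$ (n - i)))"
    if "\<And>i. i < A \<Longrightarrow> g $$ i = 0" "\<And>i. i < B \<Longrightarrow> f $$ i = 0" "finite I" "{A..n - B} \<subseteq> I" for g f A B I n
    by (rule fls_smult_nth[of act A g B f]) (use that in auto)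
  show ?thesis
  proof
    fix g :: "'a fls" and f f' :: "'w fls"
    obtain A B B' where A: "\<And>i. i < A \<Longrightarrow> g $$ i = 0" and B: "\<And>i. i < B \<Longrightarrow> f $$ i = 0" and B': "\<And>i. i < B' \<Longrightarrow> f' $$ i = 0"
      using low[of f] low[of f'] low[of g] by blast
    show "fls_smult act g (f + f') = fls_smult act g f + fls_smult act g f'"
    proof (rule fls_eqI)
      fix n
      define C where "C = min B B'"
      have C: "i < C \<Longrightarrow> f $$ i = 0" "i < C \<Longrightarrow> f' $$ i = 0" "i < C \<Longrightarrow> (f + f') $$ i = 0" for i
        using B B' by (auto simp: C_def)
      have *: "fls_smult act g e $$ n = (\<Sum>i\<in>{A..n - C}. act (g $$ i) (e $$ (n - i)))"
        if "\<And>i. i < C \<Longrightarrow> e $$ i = 0" for e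
        by (rule nth[OF A that]) auto
      show "fls_smult act g (f + f') $$ n = (fls_smult act g f + fls_smult act g f') $$ n"
        by (simp add: *[OF C(1)] *[OF C(2)] *[OF C(3)] scale_right_distrib sum.distrib)
    qed
  next
    fix g g' :: "'a fls" and f :: "'w fls"
    obtain A B B' where A: "\<And>i. i < A \<Longrightarrow> f $$ i = 0" and B: "\<And>i. i < B \<Longrightarrow> g $$ i = 0" and B': "\<And>i. i < B' \<Longrightarrow> g' $$ i = 0"
      using low[of g] low[of g'] low[of f] by blast
    show "fls_smult act (g + g') f = fls_smult act g f + fls_smult act g' f"
    proof (rule fls_eqI)
      fix n
      define C where "C = min B B'"
      have C: "i < C \<Longrightarrow> g $$ i = 0" "i < C \<Longrightarrow> g' $$ i = 0" "i < C \<Longrightarrow> (g + g') $$ i = 0" for i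
        using B B' by (auto simp: C_def)
      have *: "fls_smult act e f $$ n = (\<Sum>i\<in>{C..n - A}. act (e $$ i) (f $$ (n - i)))"
        if "\<And>i. i < C \<Longrightarrow> e $$ i = 0" for e
        by (rule nth[OF that A]) auto
      show "fls_smult act (g + g') f $$ n = (fls_smult act g f + fls_smult act g' f) $$ n"
        by (simp add: *[OF C(1)] *[OF C(2)] *[OF C(3)] scale_left_distrib sum.distrib)
    qed
  next
    fix g h :: "'a fls" and f :: "'w fls"
    obtain A C where A: "\<And>i. i < A \<Longrightarrow> g $$ i = 0" and C: "\<And>i. i < C \<Longrightarrow> f $$ i = 0"
      using low[of g] low[of f] by blast
    define B where "B = fls_subdegree h"
    have B: "i < B \<Longrightarrow> h $$ i = 0" for i by (simp add: B_def)
    define G where "G = fls_subdegree g"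
    have G: "i < G \<Longrightarrow> g $$ i = 0" for i by (simp add: G_def)
    show "fls_smult act g (fls_smult act h f) = fls_smult act (g * h) f"
    proof (rule fls_eqI)
      fix n
      have HF: "fls_smult act h f $$ i = 0" if "i < B + C" for i
      proof -
        have "fls_smult act h f $$ i = (\<Sum>j\<in>{}. act (h $$ j) (f $$ (i - j)))"
          by (rule nth[OF B C]) (use that in auto)
        then show ?thesis by simp
      qed
      have GH: "i < G + B \<Longrightarrow> (g * h) $$ i = 0" for i
        by (simp add: G_def B_def fls_times_nth_eq0)
      \<comment> \<open>\<open>J\<close> contains the relevant exponents of \<open>g\<close> and
        \<open>K\<close> those of the product of \<open>g\<close> and \<open>h\<close>, so the
        double sum runs over a fixed rectangle and can be interchanged.\<close>
      define J where "J = {G..n - B - C}"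
      define K where "K = {G + B..n - C}"
      have "fls_smult act g (fls_smult act h f) $$ n = (\<Sum>j\<in>J. act (g $$ j) (fls_smult act h f $$ (n - j)))"
        by (rule nth[OF G HF]) (auto simp: J_def)
      also have "\<dots> = (\<Sum>j\<in>J. \<Sum>i\<in>K. act (g $$ j * h $$ (i - j)) (f $$ (n - i)))"
      proof (rule sum.cong[OF refl])
        fix j assume j: "j \<in> J"
        have "fls_smult act h f $$ (n - j) = (\<Sum>l\<in>(\<lambda>i. i - j) ` K. act (h $$ l) (f $$ (n - j - l)))"
        proof (rule nth[OF B C])
          show "{B..n - j - C} \<subseteq> (\<lambda>i. i - j) ` K"
          proof
            fix x assume "x \<in> {B..n - j - C}"
            then have "x + j \<in> K" using j by (auto simp: K_def J_def)
            then show "x \<in> (\<lambda>i. i - j) ` K" by (auto intro!: image_eqI[of _ _ "x + j"])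
          qed
        qed (auto simp: K_def)
        also have "\<dots> = (\<Sum>i\<in>K. act (h $$ (i - j)) (f $$ (n - i)))"
          by (subst sum.reindex) (auto simp: inj_on_def algebra_simps)
        finally show "act (g $$ j) (fls_smult act h f $$ (n - j)) = (\<Sum>i\<in>K. act (g $$ j * h $$ (i - j)) (f $$ (n - i)))"
          by (simp add: scale_sum_right)
      qed
      also have "\<dots> = (\<Sum>i\<in>K. \<Sum>j\<in>J. act (g $$ j * h $$ (i - j)) (f $$ (n - i)))"
        by (rule sum.swap)
      also have "\<dots> = (\<Sum>i\<in>K. act ((g * h) $$ i) (f $$ (n - i)))"
      proof (rule sum.cong[OF refl])
        fix i assume i: "i \<in> K"
        have "(g * h) $$ i = (\<Sum>j\<in>J. g $$ j * h $$ (i - j))"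
          unfolding fls_times_nth(2) G_def[symmetric] B_def[symmetric]
        proof (rule sum.mono_neutral_left)
          show "\<forall>j\<in>J - {G..i - B}. g $$ j * h $$ (i - j) = 0"
            using B by (auto simp: J_def)
        qed (use i in \<open>auto simp: J_def K_def\<close>)
        then show "(\<Sum>j\<in>J. act (g $$ j * h $$ (i - j)) (f $$ (n - i))) = act ((g * h) $$ i) (f $$ (n - i))"
          by (simp add: scale_sum_left)
      qed
      also have "\<dots> = fls_smult act (g * h) f $$ n"
        by (rule nth[OF GH C, symmetric]) (auto simp: K_def)
      finally show "fls_smult act g (fls_smult act h f) $$ n = fls_smult act (g * h) f $$ n" .
    qed
  next
    fix f :: "'w fls"
    obtain C where C: "\<And>i. i < C \<Longrightarrow> f $$ i = 0"
      using low[of f] by blast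
    show "fls_smult act 1 f = f"
    proof (rule fls_eqI)
      fix n
      have "fls_smult act 1 f $$ n = (\<Sum>i\<in>{0..n - C} \<union> {0}. act (1 $$ i) (f $$ (n - i)))"
        by (rule fls_smult_nth[of act 0 1 C f]) (auto simp: C)
      also have "\<dots> = (\<Sum>i\<in>{0}. act (1 $$ i) (f $$ (n - i)))"
        by (rule sum.mono_neutral_right) auto
      finally show "fls_smult act 1 f $$ n = f $$ n" by simp
    qed
  qed
qed

lemma fls_smult_const:
  assumes "module act"
  shows "fls_smult act (fls_const c) f $$ n = act c (f $$ n)"
proof -
  interpret module act by fact
  obtain C where C: "\<And>i. i < C \<Longrightarrow> f $$ i = 0"
    using fls_nth_vanishes_belowE[of f] by metis
  have "fls_smult act (fls_const c) f $$ n = (\<Sum>i\<in>{0..n - C} \<union> {0}. act (fls_const c $$ i) (f $$ (n - i)))"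
    by (rule fls_smult_nth[of act 0 _ C]) (auto simp: C)
  also have "\<dots> = (\<Sum>i\<in>{0}. act (fls_const c $$ i) (f $$ (n - i)))"
    by (rule sum.mono_neutral_right) auto
  finally show ?thesis by simp
qed

lemma fls_smult_X:
  assumes "module act"
  shows "fls_smult act fls_X f $$ n = f $$ (n - 1)"
proof -
  interpret module act by fact
  obtain C where C: "\<And>i. i < C \<Longrightarrow> f $$ i = 0"
    using fls_nth_vanishes_belowE[of f] by metis
  have "fls_smult act fls_X f $$ n = (\<Sum>i\<in>{0..n - C} \<union> {1}. act (fls_X $$ i) (f $$ (n - i)))"
    by (rule fls_smult_nth[of act 0 _ C]) (auto simp: C)
  also have "\<dots> = (\<Sum>i\<in>{1}. act (fls_X $$ i) (f $$ (n - i)))"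
    by (rule sum.mono_neutral_right) auto
  finally show ?thesis by simp
qed

lemma fls_smult_X_inv:
  assumes "module act"
  shows "fls_smult act fls_X_inv f $$ n = f $$ (n + 1)"
proof -
  interpret M: module "fls_smult act" by (rule fls_smult_module) fact
  have "f $$ (n + 1) = fls_smult act (fls_X * fls_X_inv) f $$ (n + 1)"
    by (simp add: fls_X_times_conv_shift)
  also have "\<dots> = fls_smult act fls_X (fls_smult act fls_X_inv f) $$ (n + 1)"
    by (simp only: M.scale_scale)
  also have "\<dots> = fls_smult act fls_X_inv f $$ n"
    by (simp add: fls_smult_X[OF assms] del: M.scale_scale)
  finally show ?thesis by simp
qed

section \<open>Expansions of rational functions\<close>

locale coeff_hom =
  fixes h :: "'a::comm_ring_1 \<Rightarrow> 'b::comm_ring_1"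
  assumes h_0 [simp]: "h 0 = 0" and h_1 [simp]: "h 1 = 1"
    and h_add: "h (x + y) = h x + h y" and h_mult: "h (x * y) = h x * h y"
begin

lemma ev_add: "poly (map_poly h (p + q)) y = poly (map_poly h p) y + poly (map_poly h q) y"
proof (induction p arbitrary: q)
  case (pCons a p)
  obtain b q' where "q = pCons b q'" by (rule pCons_cases)
  with pCons.IH[of q'] show ?case by (simp add: map_poly_pCons h_add algebra_simps)
qed simp

lemma ev_smult: "poly (map_poly h (smult c q)) y = h c * poly (map_poly h q) y"
  by (induction q) (simp_all add: map_poly_pCons h_mult algebra_simps)

lemma ev_mult: "poly (map_poly h (p * q)) y = poly (map_poly h p) y * poly (map_poly h q) y"
  by (induction p) (simp_all add: map_poly_pCons ev_add ev_smult algebra_simps)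

lemma poly2_0 [simp]: "poly2 h 0 y z = 0"
  by (simp add: poly2_def)

lemma poly2_pCons: "poly2 h (pCons q p) y z = poly (map_poly h q) y + z * poly2 h p y z"
  by (simp add: poly2_def map_poly_pCons)

lemma poly2_add: "poly2 h (p + q) y z = poly2 h p y z + poly2 h q y z"
proof (induction p arbitrary: q)
  case (pCons a p)
  obtain b q' where "q = pCons b q'" by (rule pCons_cases)
  with pCons.IH[of q'] show ?case by (simp add: poly2_pCons ev_add algebra_simps)
qed simp

lemma poly2_smult: "poly2 h (smult c q) y z = poly (map_poly h c) y * poly2 h q y z"
  by (induction q) (simp_all add: poly2_pCons ev_mult algebra_simps)

lemma poly2_mult: "poly2 h (p * q) y z = poly2 h p y z * poly2 h q y z"
  by (induction p) (simp_all add: poly2_pCons poly2_add poly2_smult algebra_simps)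

lemma poly2_1 [simp]: "poly2 h 1 y z = 1"
  by (simp add: one_pCons poly2_pCons map_poly_pCons)

lemma poly2_diff: "poly2 h (p - q) y z = poly2 h p y z - poly2 h q y z"
  using poly2_add[of "p - q" q y z] by (simp add: algebra_simps)

lemma poly2_power: "poly2 h (p ^ k) y z = poly2 h p y z ^ k"
  by (induction k) (simp_all add: poly2_mult)

end

lemma (in coeff_hom) poly2_compose:
  fixes h' :: "'a \<Rightarrow> 'c::comm_ring_1"
  assumes "coeff_hom h'" and "\<And>x y. g (x + y) = g x + g y" "\<And>x y. g (x * y) = g x * g y" "\<And>a. g (h a) = h' a"
  shows "g (poly2 h p u v) = poly2 h' p (g u) (g v)"
proof -
  interpret H: coeff_hom h' by fact
  have g0: "g 0 = 0" using assms(2)[of 0 0] by simp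
  have "g (poly (map_poly h q) u) = poly (map_poly h' q) (g u)" for q
    by (induction q) (simp_all add: map_poly_pCons g0 assms)
  then show ?thesis
    by (induction p) (simp_all add: g0 poly2_pCons H.poly2_pCons assms)
qed

lemma coeff_hom_poly: "coeff_hom (\<lambda>c::complex. [:[:c:]:])"
  by unfold_locales (simp_all add: one_pCons)

lemma coeff_hom_fls: "coeff_hom (\<lambda>c::complex. fls_const (fls_const c))"
  by unfold_locales (simp_all add: fls_plus_const)

lemma coeff_hom_fls1: "coeff_hom (\<lambda>c::complex. fls_const c)"
  by unfold_locales (simp_all add: fls_plus_const)

interpretation HP: coeff_hom "\<lambda>c::complex. [:[:c:]:]" by (rule coeff_hom_poly)
interpretation HF: coeff_hom "\<lambda>c::complex. fls_const (fls_const c)" by (rule coeff_hom_fls)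
interpretation HF1: coeff_hom "\<lambda>c::complex. fls_const c" by (rule coeff_hom_fls1)

lemma poly2_X1_X2: "poly2 (\<lambda>c. [:[:c:]:]) p X1 X2 = p"
proof -
  have "poly (map_poly (\<lambda>c. [:[:c:]:]) q) X1 = [:q:]" for q :: "complex poly"
    by (induction q) (simp_all add: map_poly_pCons X1_def)
  then show ?thesis
    by (induction p) (simp_all add: HP.poly2_pCons X2_def)
qed

lemma ev_X1: "poly2 (\<lambda>c. [:[:c:]:]) X1 y z = y"
  by (simp add: X1_def HP.poly2_pCons map_poly_pCons)

lemma ev_X2: "poly2 (\<lambda>c. [:[:c:]:]) X2 y z = z"
  by (simp add: X2_def HP.poly2_pCons map_poly_pCons)

lemma ev_F_X1: "poly2 (\<lambda>c. fls_const (fls_const c)) X1 y z = y"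
  by (simp add: X1_def HF.poly2_pCons map_poly_pCons)

lemma ev_F_X2: "poly2 (\<lambda>c. fls_const (fls_const c)) X2 y z = z"
  by (simp add: X2_def HF.poly2_pCons map_poly_pCons)

text \<open>The substitution is invertible: sending x to x2 and x0 to x1 - x2, as \<open>?g\<close>
  does, gives \<open>p\<close> back.\<close>

lemma shifted_poly_nonzero:
  assumes "p \<noteq> 0"
  shows "poly2 (\<lambda>c. [:[:c:]:]) p (X2 + X1) X1 \<noteq> 0"
proof
  assume *: "poly2 (\<lambda>c. [:[:c:]:]) p (X2 + X1) X1 = 0"
  let ?g = "\<lambda>q. poly2 (\<lambda>c. [:[:c:]:]) q X2 (X1 - X2)"
  have "?g (poly2 (\<lambda>c. [:[:c:]:]) p (X2 + X1) X1) =
      poly2 (\<lambda>c. [:[:c:]:]) p (?g (X2 + X1)) (?g X1)"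
    by (rule HP.poly2_compose[OF coeff_hom_poly])
      (simp_all add: HP.poly2_add HP.poly2_mult HP.poly2_pCons map_poly_pCons)
  also have "\<dots> = p" by (simp add: HP.poly2_add ev_X1 ev_X2 poly2_X1_X2)
  finally show False using * assms by simp
qed

abbreviation xx :: "complex fls fls" where "xx \<equiv> fls_const fls_X_inv"

definition emb2 :: "complex poly poly \<Rightarrow> complex fls fls" where
  "emb2 q = poly2 (\<lambda>c. fls_const (fls_const c)) q xx fls_X"

text \<open>As x is \<open>fls_X_inv\<close>, the power x^k sits at index -k. In particular the
  expansion at infinity is injective on polynomials, which \<open>extend_fract\<close>
  presupposes.\<close>

lemma poly_fls_X_inv_nth:
  fixes q :: "complex poly"
  shows "poly (map_poly fls_const q) fls_X_inv $$ (- int k) = coeff q k"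
proof (induction q arbitrary: k)
  case (pCons a q)
  show ?case
  proof (cases k)
    case 0
    have "poly (map_poly fls_const q) fls_X_inv $$ 1 = 0"
    proof (induction q)
      case (pCons b q)
      have "poly (map_poly fls_const q) fls_X_inv $$ n = 0" if "n > 0" for n
        using that by (induction q arbitrary: n) (simp_all add: map_poly_pCons fls_X_inv_times_conv_shift)
      then show ?case by (simp add: map_poly_pCons fls_X_inv_times_conv_shift)
    qed simp
    with 0 show ?thesis by (simp add: map_poly_pCons fls_X_inv_times_conv_shift)
  next
    case (Suc l)
    with pCons.IH[of l] show ?thesis
      by (simp add: map_poly_pCons fls_X_inv_times_conv_shift)
  qed
qed simp

lemma poly_fls_X_inv_eq_0:
  fixes q :: "complex poly"
  shows "poly (map_poly fls_const q) fls_X_inv = 0 \<longleftrightarrow> q = 0"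
proof
  assume "poly (map_poly fls_const q) fls_X_inv = 0"
  then have "coeff q k = 0" for k using poly_fls_X_inv_nth[of q k] by simp
  then show "q = 0" by (simp add: poly_eq_iff)
qed simp

lemma emb2_nth: "emb2 q $$ int l = poly (map_poly fls_const (coeff q l)) fls_X_inv"
proof -
  have c: "poly (map_poly (\<lambda>c. fls_const (fls_const c)) a) xx = fls_const (poly (map_poly fls_const a) fls_X_inv)"
    for a :: "complex poly"
    by (induction a) (simp_all add: map_poly_pCons fls_plus_const)
  have neg: "emb2 q $$ n = 0" if "n < 0" for n q
    using that unfolding emb2_def
    by (induction q arbitrary: n) (simp_all add: HF.poly2_pCons c fls_X_times_conv_shift)
  show ?thesis
  proof (induction q arbitrary: l)
    case (pCons a q)
    show ?case
    proof (cases l)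
      case 0
      with neg[of "-1" q] show ?thesis by (simp add: emb2_def HF.poly2_pCons c fls_X_times_conv_shift)
    next
      case (Suc k)
      with pCons.IH[of k] show ?thesis
        by (simp add: emb2_def HF.poly2_pCons c fls_X_times_conv_shift)
    qed
  qed (simp add: emb2_def)
qed

lemma emb2_eq_0: "emb2 q = 0 \<longleftrightarrow> q = 0"
proof
  assume "emb2 q = 0"
  then have "coeff q l = 0" for l
    using emb2_nth[of q l] by (simp add: poly_fls_X_inv_eq_0)
  then show "q = 0" by (simp add: poly_eq_iff)
qed (simp add: emb2_def)

lemma emb2_mult: "emb2 (p * q) = emb2 p * emb2 q"
  by (simp add: emb2_def HF.poly2_mult)

lemma emb2_shift:
  "emb2 (poly2 (\<lambda>c. [:[:c:]:]) p (X2 + X1) X1) =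
     poly2 (\<lambda>c. fls_const (fls_const c)) p (fls_X + xx) xx"
  unfolding emb2_def
  by (subst HP.poly2_compose[OF coeff_hom_fls, where g = "\<lambda>q. poly2 (\<lambda>c. fls_const (fls_const c)) q xx fls_X"])
    (simp_all add: HF.poly2_add HF.poly2_mult HF.poly2_pCons map_poly_pCons ev_F_X1 ev_F_X2)

lemma iota_inf_0_shift:
  assumes "p \<noteq> 0"
  shows "iota_inf_0 (Fract 1 (poly2 (\<lambda>c. [:[:c:]:]) p (X2 + X1) X1)) =
     inverse (poly2 (\<lambda>c. fls_const (fls_const c)) p (fls_X + xx) xx)"
    and "poly2 (\<lambda>c. fls_const (fls_const c)) p (fls_X + xx) xx \<noteq> 0"
proof -
  let ?P = "poly2 (\<lambda>c. [:[:c:]:]) p (X2 + X1) X1"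
  have P: "?P \<noteq> 0" by (rule shifted_poly_nonzero) fact
  have i: "iota_inf_0 = extend_fract emb2" by (simp add: iota_inf_0_def emb2_def[abs_def])
  have "emb2 1 = 1" by (simp add: emb2_def)
  then show "iota_inf_0 (Fract 1 ?P) =
     inverse (poly2 (\<lambda>c. fls_const (fls_const c)) p (fls_X + xx) xx)"
    unfolding i by (subst extend_fract_Fract[OF emb2_mult emb2_eq_0 P]) (simp add: emb2_shift divide_inverse)
  show "poly2 (\<lambda>c. fls_const (fls_const c)) p (fls_X + xx) xx \<noteq> 0"
    using P emb2_eq_0[of ?P] by (simp add: emb2_shift)
qed

lemma iota_inf_Fract:
  "q \<noteq> 0 \<Longrightarrow> iota_inf (Fract g q) = poly (map_poly fls_const g) fls_X_inv / poly (map_poly fls_const q) fls_X_inv"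
  unfolding iota_inf_def
  by (rule extend_fract_Fract) (auto simp: HF1.ev_mult poly_fls_X_inv_eq_0)

section \<open>Operators at infinity and their coefficients\<close>

lemma sum_fun_apply: "(sum f A) x = (\<Sum>i\<in>A. f i x)"
  by (induction A rule: infinite_finite_induct) (auto simp: fun_app)

definition pr2 :: "('w::ab_group_add \<Rightarrow> 'w fls) \<Rightarrow> ('w \<Rightarrow> 'w fls) \<Rightarrow> 'w \<Rightarrow> int \<Rightarrow> int \<Rightarrow> 'w" where
  "pr2 a b = (\<lambda>w m n. coeffs_inf a (coeffs_inf b w n) m)"

definition pr3 :: "('w::ab_group_add \<Rightarrow> 'w fls) \<Rightarrow> ('w \<Rightarrow> 'w fls) \<Rightarrow> ('w \<Rightarrow> 'w fls) \<Rightarrow> 'w \<Rightarrow> int \<Rightarrow> int \<Rightarrow> int \<Rightarrow> 'w" where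
  "pr3 a b c = (\<lambda>w m n r. coeffs_inf a (coeffs_inf b (coeffs_inf c w r) n) m)"

definition compat2 :: "nat \<Rightarrow> ('w::ab_group_add \<Rightarrow> 'w fls) \<Rightarrow> ('w \<Rightarrow> 'w fls) \<Rightarrow> bool" where
  "compat2 k a b \<longleftrightarrow> (\<forall>w. bnd2 ((dl ^^ k) (pr2 a b w)))"

definition shl :: "nat \<Rightarrow> 'w fseries \<Rightarrow> 'w fseries" where
  "shl i F = (\<lambda>ns. F (ns[i := ns ! i - 1]))"

lemma shl_commute: "shl i (shl j F) = shl j (shl i F)"
  by (cases "i = j") (simp_all add: shl_def fun_eq_iff list_update_swap)

lemma shl_pow: "(shl i ^^ k) F ns = F (ns[i := ns ! i - int k])"
proof (induction k arbitrary: ns)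
  case (Suc k)
  show ?case
    by (cases "i < length ns") (simp_all add: shl_def[of i "(shl i ^^ k) F"] Suc list_update_beyond algebra_simps)
qed simp

lemma coeffs_inf_ext: "(\<And>w n. coeffs_inf a w n = coeffs_inf b w n) \<Longrightarrow> a = b"
proof (intro ext fls_eqI)
  fix w n assume "\<And>w n. coeffs_inf a w n = coeffs_inf b w n"
  from this[of w "- n"] show "a w $$ n = b w $$ n" by (simp add: coeffs_inf_def)
qed

lemma coeffs_inf_bounded: "\<exists>N. \<forall>n. coeffs_inf a w n \<noteq> 0 \<longrightarrow> n \<le> N"
proof -
  obtain N where N: "\<forall>n<N. a w $$ n = 0" using fls_nth_vanishes_belowE by blast
  have "n \<le> - N" if "coeffs_inf a w n \<noteq> 0" for n
  proof -
    have "\<not> - n < N" using N that by (auto simp: coeffs_inf_def)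
    then show ?thesis by simp
  qed
  then show ?thesis by blast
qed

definition lin_fam :: "(complex \<Rightarrow> 'w \<Rightarrow> 'w::ab_group_add) \<Rightarrow> (complex \<Rightarrow> 'x \<Rightarrow> 'x::ab_group_add) \<Rightarrow> ('w \<Rightarrow> 'x) \<Rightarrow> bool" where
  "lin_fam s s' A \<longleftrightarrow> (\<forall>w w'. A (w + w') = A w + A w') \<and> (\<forall>c w. A (s c w) = s' c (A w))"

lemma lin_fam_comp: "lin_fam s s' A \<Longrightarrow> linear_endo s' T \<Longrightarrow> lin_fam s s' (\<lambda>w. T (A w))"
  by (simp add: lin_fam_def linear_endo.T_add linear_endo.T_scale)

lemma linear_iff_lin_fam:
  assumes "vector_space s" "vector_space s'"
  shows "Vector_Spaces.linear s s' A \<longleftrightarrow> lin_fam s s' A"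
  using assms
  by (auto simp: Vector_Spaces.linear_def module_hom_def module_hom_axioms_def lin_fam_def
      vector_space_def module_def)

context complex_space
begin

lemma shl_endo2: "linear_endo2 (fscale sc) (shl i) (shl j)"
proof -
  interpret V: vector_space "fscale sc :: _ \<Rightarrow> (int list \<Rightarrow> 'w) \<Rightarrow> _"
    by (intro vector_space_fscale) unfold_locales
  show ?thesis
    by unfold_locales (rule shl_commute | simp add: shl_def fun_eq_iff fun_app)+
qed

lemma poly_act_eq_pact2:
  assumes "i \<noteq> j"
  shows "poly_act sc i j p F = pact2 (fscale sc) (shl i) (shl j) p F"
  using assms by (auto simp: poly_act_def pact2_def pact_def fun_eq_iff sum_fun_apply shl_pow)

lemma poly_act_2:
  "poly_act sc 0 1 p F [m, n] = pact2 (fscale (fscale sc)) sh1 sh2 p (\<lambda>m n. F [m, n]) m n"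
proof -
  have "(\<lambda>m n. pact2 (fscale sc) (shl 0) (shl 1) p F [m, n]) =
      pact2 (fscale (fscale sc)) sh1 sh2 p (\<lambda>m n. F [m, n])"
    by (rule linear_endo2.pact2_commute[OF shl_endo2, where L = "\<lambda>F m n. F [m, n]"])
      (auto simp: fun_eq_iff fun_app shl_def sh1_def sh2_def dl.linear_endo2_axioms)
  then show ?thesis by (simp add: poly_act_eq_pact2 fun_eq_iff)
qed

lemma pact2_dl: "pact2 (fscale (fscale sc)) sh1 sh2 ((X1 - X2) ^ k) F = (dl ^^ k) F"
proof -
  have "dl = (\<lambda>x. sh1 x - sh2 x :: int \<Rightarrow> int \<Rightarrow> 'w)" by (rule ext) (rule dl_alt)
  then show ?thesis by (simp add: dl.pact2_diff_power)
qed

lemma fls_scale_nth: "fls_scale sc c f $$ n = sc c (f $$ n)"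
proof -
  obtain N where "\<forall>n<N. f $$ n = 0" using fls_nth_vanishes_belowE by blast
  then show ?thesis
    unfolding fls_scale_def by (intro nth_Abs_fls_lower_bound[of N]) auto
qed

lemma vector_space_fls_scale: "vector_space (fls_scale sc)"
  by unfold_locales (auto simp: fls_eq_iff fls_scale_nth scale_right_distrib scale_left_distrib)

lemma Eo_scale_eq: "Eo_scale sc = fscale (fls_scale sc)"
  by (simp add: Eo_scale_def fscale_def fun_eq_iff)

lemma vector_space_Eo_scale: "vector_space (Eo_scale sc)"
  unfolding Eo_scale_eq by (intro vector_space_fscale vector_space_fls_scale)

lemma Eo_iff: "a \<in> Eo sc \<longleftrightarrow> (\<forall>n. lin_fam sc sc (\<lambda>w. coeffs_inf a w n))"
proof -
  have "a \<in> Eo sc \<longleftrightarrow> lin_fam sc (fls_scale sc) a"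
    unfolding Eo_def by (simp add: linear_iff_lin_fam vector_space_fls_scale vector_space_axioms)
  also have "\<dots> \<longleftrightarrow> (\<forall>n. lin_fam sc sc (\<lambda>w. a w $$ n))"
    by (auto simp: lin_fam_def fls_eq_iff fls_scale_nth)
  also have "\<dots> \<longleftrightarrow> (\<forall>n. lin_fam sc sc (\<lambda>w. coeffs_inf a w n))"
    unfolding coeffs_inf_def by (metis minus_minus)
  finally show ?thesis .
qed

lemma coeffs_inf_add: "a \<in> Eo sc \<Longrightarrow> coeffs_inf a (w + w') n = coeffs_inf a w n + coeffs_inf a w' n"
  by (simp add: Eo_iff lin_fam_def)

lemma coeffs_inf_scale: "a \<in> Eo sc \<Longrightarrow> coeffs_inf a (sc c w) n = sc c (coeffs_inf a w n)"
  by (simp add: Eo_iff lin_fam_def)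

lemma coeffs_inf_0 [simp]: "a \<in> Eo sc \<Longrightarrow> coeffs_inf a 0 n = 0"
  using coeffs_inf_add[of a 0 0 n] by simp

lemma coeffs_inf_diff: "a \<in> Eo sc \<Longrightarrow> coeffs_inf a (w - w') n = coeffs_inf a w n - coeffs_inf a w' n"
  using coeffs_inf_add[of a "w - w'" w' n] by simp

lemma coeffs_inf_one: "coeffs_inf Eo_one w n = (if n = 0 then w else 0)"
  by (simp add: coeffs_inf_def Eo_one_def)

lemma Eo_one_in: "Eo_one \<in> Eo sc"
  by (auto simp: Eo_iff lin_fam_def coeffs_inf_one)

lemma coeffs_inf_plus: "coeffs_inf (a + b) w n = coeffs_inf a w n + coeffs_inf b w n"
  by (simp add: coeffs_inf_def fun_app)

lemma coeffs_inf_Eo_scale: "coeffs_inf (Eo_scale sc c a) w n = sc c (coeffs_inf a w n)"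
  by (simp add: coeffs_inf_def Eo_scale_def fls_scale_nth)

lemma coeffs_inf_zero: "coeffs_inf 0 w n = 0"
  by (simp add: coeffs_inf_def fun_app)

lemma lin_fam_op_prod: "set as \<subseteq> Eo sc \<Longrightarrow> lin_fam sc (fscale sc) (op_prod (map coeffs_inf as))"
proof (induction as)
  case Nil
  then show ?case by (auto simp: lin_fam_def fun_eq_iff fun_app)
next
  case (Cons a as)
  then show ?case
    by (auto simp: lin_fam_def fun_eq_iff fun_app coeffs_inf_add coeffs_inf_scale)
qed

lemma hom_inf_iff:
  assumes "lin_fam sc (fscale sc) A"
  shows "hom_inf sc r A \<longleftrightarrow> (\<forall>w. \<exists>N. \<forall>ns. length ns = r \<longrightarrow> A w ns \<noteq> 0 \<longrightarrow> (\<forall>n\<in>set ns. n \<le> N))"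
proof -
  have "Vector_Spaces.linear sc sc (\<lambda>w. A w ns)" for ns
    using assms by (auto simp: linear_iff_lin_fam vector_space_axioms lin_fam_def fun_app)
  then show ?thesis by (simp add: hom_inf_def)
qed

lemma poly_act_endo:
  assumes "i \<noteq> j"
  shows "linear_endo (fscale sc) (poly_act sc i j p)"
proof -
  have "poly_act sc i j p = pact2 (fscale sc) (shl i) (shl j) p"
    by (rule ext) (rule poly_act_eq_pact2[OF assms])
  then show ?thesis using linear_endo2.pact2_endo[OF shl_endo2, of i j p] by simp
qed

lemma hom_inf_2:
  assumes "a \<in> Eo sc" "b \<in> Eo sc"
  shows "hom_inf sc 2 (\<lambda>w. poly_act sc 0 1 p (op_prod [coeffs_inf a, coeffs_inf b] w)) \<longleftrightarrow>
    (\<forall>w. bnd2 (pact2 (fscale (fscale sc)) sh1 sh2 p (pr2 a b w)))"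
proof -
  have "lin_fam sc (fscale sc) (op_prod [coeffs_inf a, coeffs_inf b])"
    using lin_fam_op_prod[of "[a, b]"] assms by simp
  then have "lin_fam sc (fscale sc) (\<lambda>w. poly_act sc 0 1 p (op_prod [coeffs_inf a, coeffs_inf b] w))"
    by (rule lin_fam_comp) (simp add: poly_act_endo)
  then have "hom_inf sc 2 (\<lambda>w. poly_act sc 0 1 p (op_prod [coeffs_inf a, coeffs_inf b] w)) \<longleftrightarrow>
      (\<forall>w. \<exists>N. \<forall>ns. length ns = 2 \<longrightarrow> poly_act sc 0 1 p (op_prod [coeffs_inf a, coeffs_inf b] w) ns \<noteq> 0
        \<longrightarrow> (\<forall>n\<in>set ns. n \<le> N))"
    by (rule hom_inf_iff)
  also have "\<dots> \<longleftrightarrow> (\<forall>w. \<exists>N. \<forall>m n. poly_act sc 0 1 p (op_prod [coeffs_inf a, coeffs_inf b] w) [m, n] \<noteq> 0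
        \<longrightarrow> m \<le> N \<and> n \<le> N)"
    by (simp add: numeral_2_eq_2 length_Suc_conv imp_ex del: One_nat_def)
  finally show ?thesis by (simp add: poly_act_2 bnd2_def pr2_def del: One_nat_def)
qed

lemma clears_2:
  assumes "a \<in> Eo sc" "b \<in> Eo sc"
  shows "clears sc p [a, b] \<longleftrightarrow> (\<forall>w. bnd2 (pact2 (fscale (fscale sc)) sh1 sh2 p (pr2 a b w)))"
proof -
  have "[(i, j). i \<leftarrow> [0..<2], j \<leftarrow> [Suc i..<2]] = [(0, Suc 0)]"
    by (simp add: numeral_2_eq_2)
  then have "clears sc p [a, b] \<longleftrightarrow>
      hom_inf sc 2 (\<lambda>w. poly_act sc 0 1 p (op_prod [coeffs_inf a, coeffs_inf b] w))"
    by (simp add: clears_def pairs_act_def numeral_2_eq_2)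
  with hom_inf_2[OF assms] show ?thesis by simp
qed

lemma clears_power_2: "a \<in> Eo sc \<Longrightarrow> b \<in> Eo sc \<Longrightarrow> clears sc ((X1 - X2) ^ k) [a, b] \<longleftrightarrow> compat2 k a b"
  by (simp add: clears_2 compat2_def pact2_dl)

lemma deriv1_pow: "(deriv1 sc ^^ l) F [i, j] = sc (pochhammer (of_int i + 1) l) (F [i + int l, j])"
proof (induction l arbitrary: i)
  case (Suc l)
  have "(deriv1 sc ^^ Suc l) F [i, j] = sc (of_int (i + 1)) ((deriv1 sc ^^ l) F [i + 1, j])"
    by (simp add: deriv1_def)
  also have "\<dots> = sc (pochhammer (of_int i + 1) (Suc l)) (F [i + int (Suc l), j])"
    by (simp add: Suc pochhammer_rec algebra_simps)
  finally show ?case .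
qed simp

text \<open>The l-th derivative divided by l! contributes the rising factorial of i + 1 over l!,
  which is the binomial coefficient of i + l over l. So Taylor's formula is the binomial expansion
  of F(x + x0, x). The sign in \<open>- n\<close> comes from counting powers of x^-1.\<close>

lemma subst_add_nth:
  assumes "bnd2 (\<lambda>m n. F [m, n])"
  shows "subst_add sc F $$ l $$ n = S l (\<lambda>m n. F [m, n]) (- n)"
proof (cases "l < 0")
  case True
  then show ?thesis unfolding subst_add_def
    by (subst nth_Abs_fls_lower_bound[of 0]) (auto simp: S_neg)
next
  case False
  obtain N where N: "\<And>m n. F [m, n] \<noteq> 0 \<Longrightarrow> m \<le> N \<and> n \<le> N"
    using assms unfolding bnd2_def by blast
  have eq: "Sum_any (\<lambda>i. sc (1 / fact (nat l)) ((deriv1 sc ^^ nat l) F [i, - n - i])) = S l (\<lambda>m n. F [m, n]) (- n)" for n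
  proof -
    have c: "sc (1 / fact (nat l)) ((deriv1 sc ^^ nat l) F [i, - n - i]) = sc (cb (i + l) l) (F [i + l, - n + l - (i + l)])" for i
    proof -
      have "1 / fact (nat l) * pochhammer (of_int i + 1) (nat l) = cb (i + l) l"
        using False by (simp add: cb_def gbinomial_pochhammer' algebra_simps)
      then show ?thesis using False by (simp add: deriv1_pow)
    qed
    show ?thesis unfolding S_def c
      by (rule Sum_any.reindex_cong[of "\<lambda>i. i + l", symmetric])
        (auto simp: bij_def inj_on_def surj_def o_def fun_eq_iff algebra_simps intro: exI[of _ "_ - l"])
  qed
  have "subst_add sc F $$ l = Abs_fls (\<lambda>n. S l (\<lambda>m n. F [m, n]) (- n))"
    unfolding subst_add_def using False
    by (subst nth_Abs_fls_lower_bound[of 0]) (auto simp: eq)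
  also have "\<dots> $$ n = S l (\<lambda>m n. F [m, n]) (- n)"
  proof (rule nth_Abs_fls_lower_bound[of "l - 2 * N"], clarify)
    fix n assume "n < l - 2 * N"
    have "- n \<le> 2 * N - l" if "S l (\<lambda>m n. F [m, n]) (- n) \<noteq> 0"
      using N that by (rule S_bounded)
    with \<open>n < l - 2 * N\<close> show "S l (\<lambda>m n. F [m, n]) (- n) = 0"
      by (cases "S l (\<lambda>m n. F [m, n]) (- n) = 0") auto
  qed
  finally show ?thesis .
qed

section \<open>Computation of the products of two compatible operators\<close>

definition sbs :: "(int \<Rightarrow> int \<Rightarrow> 'w) \<Rightarrow> 'w fls fls" where
  "sbs F = subst_add sc (\<lambda>ns. F (ns ! 0) (ns ! 1))"

lemma sbs_nth: "bnd2 F \<Longrightarrow> sbs F $$ l $$ n = S l F (- n)"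
  unfolding sbs_def using subst_add_nth[of "\<lambda>ns. F (ns ! 0) (ns ! 1)"] by simp

lemma sbs_nth': "bnd2 (\<lambda>m n. F [m, n]) \<Longrightarrow> subst_add sc F = sbs (\<lambda>m n. F [m, n])"
  by (intro fls_eqI) (simp add: sbs_nth subst_add_nth)

abbreviation smul :: "complex fls fls \<Rightarrow> 'w fls fls \<Rightarrow> 'w fls fls" where
  "smul \<equiv> fls_smult (fls_smult sc)"

lemma module_smult1: "module (fls_smult sc)"
  by (rule fls_smult_module) unfold_locales

lemma module_smul: "module smul"
  by (intro fls_smult_module module_smult1)

lemma bnd2_pact2: "bnd2 F \<Longrightarrow> bnd2 (pact2 (fscale (fscale sc)) sh1 sh2 p F)"
proof -
  have 1: "bnd2 F \<Longrightarrow> bnd2 (sh1 F)" for F :: "int \<Rightarrow> int \<Rightarrow> 'w"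
    unfolding sh1_eq by (intro bnd2_add bnd2_dl bnd2_sh2)
  have 2: "bnd2 F \<Longrightarrow> bnd2 (fscale (fscale sc) c F)" for F c
    using bnd2_map[of F "sc c"] by (simp add: fscale_def)
  have "bnd2 (pact (fscale (fscale sc)) sh1 q F)" if "bnd2 F" for q F
    using dl.E1.pact_in[of "{F. bnd2 F}" F q] that by (auto simp: bnd2_add 1 2 bnd2_0 zero_fun_def)
  then show "bnd2 F \<Longrightarrow> bnd2 (pact2 (fscale (fscale sc)) sh1 sh2 p F)"
    by (induction p) (auto simp: dl.pact2_pCons bnd2_add bnd2_sh2 bnd2_0 zero_fun_def)
qed

text \<open>The variables x1 and x2 turn into x0 + x and x. It is enough to know this for x2 and x1
  - x2, because x1 is their sum.\<close>

lemma sbs_pact2: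
  assumes "bnd2 F"
  shows "sbs (pact2 (fscale (fscale sc)) sh1 sh2 p F) =
    smul (poly2 (\<lambda>c. fls_const (fls_const c)) p (fls_X + xx) xx) (sbs F)"
proof -
  interpret M: module smul by (rule module_smul)
  have "module sc" by unfold_locales
  have add: "sbs (F + G) = sbs F + sbs G" if "bnd2 F" "bnd2 G" for F G
    by (intro fls_eqI) (simp add: sbs_nth that bnd2_add S_add fun_app)
  have sclB: "bnd2 (fscale (fscale sc) c F)" if "bnd2 F" for F c
    using bnd2_map[of F "sc c"] that by (simp add: fscale_def)
  have scl: "sbs (fscale (fscale sc) c F) = smul (fls_const (fls_const c)) (sbs F)" if "bnd2 F" for F c
    by (intro fls_eqI) (simp add: sbs_nth that sclB S_scale fls_smult_const[OF module_smult1] fls_smult_const[OF \<open>module sc\<close>])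
  have x2: "sbs (sh2 F) = smul xx (sbs F)" if "bnd2 F" for F
    by (intro fls_eqI) (simp add: sbs_nth that bnd2_sh2 S_sh2 fls_smult_const[OF module_smult1] fls_smult_X_inv[OF \<open>module sc\<close>] algebra_simps)
  have d: "sbs (dl F) = smul fls_X (sbs F)" if "bnd2 F" for F
    by (intro fls_eqI) (simp add: sbs_nth that bnd2_dl S_dl fls_smult_X[OF module_smult1])
  have x1: "sbs (sh1 F) = smul (fls_X + xx) (sbs F)" if "bnd2 F" for F
    using that by (simp add: sh1_eq add bnd2_dl bnd2_sh2 x2 d M.scale_left_distrib)
  have b0: "bnd2 (0 :: int \<Rightarrow> int \<Rightarrow> 'w)"
    using bnd2_0 by (simp add: zero_fun_def)
  have zero: "sbs 0 = 0"
    by (intro fls_eqI) (simp add: sbs_nth[OF b0] S_def fun_app)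
  have b1: "bnd2 F \<Longrightarrow> bnd2 (sh1 F)" for F :: "int \<Rightarrow> int \<Rightarrow> 'w"
    unfolding sh1_eq by (intro bnd2_add bnd2_dl bnd2_sh2)
  have q: "bnd2 (pact (fscale (fscale sc)) sh1 q F) \<and> sbs (pact (fscale (fscale sc)) sh1 q F) =
      smul (poly (map_poly (\<lambda>c. fls_const (fls_const c)) q) (fls_X + xx)) (sbs F)" if "bnd2 F" for q F
    using that by (induction q)
      (auto simp: zero b0 dl.E1.pact_pCons bnd2_add sclB b1 add scl x1 map_poly_pCons M.scale_left_distrib algebra_simps)
  show ?thesis using assms
    by (induction p)
      (auto simp: zero dl.pact2_pCons HF.poly2_pCons add q bnd2_pact2 bnd2_sh2 x2 M.scale_left_distrib)
qed

lemma smul_X_power: "smul (fls_X ^ k) f $$ n = f $$ (n - int k)"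
proof (induction k arbitrary: n)
  case 0
  interpret M: module smul by (rule module_smul)
  show ?case by simp
next
  case (Suc k)
  interpret M: module smul by (rule module_smul)
  have "smul (fls_X ^ Suc k) f $$ n = smul fls_X (smul (fls_X ^ k) f) $$ n" by simp
  also have "\<dots> = f $$ (n - int (Suc k))"
    by (simp add: fls_smult_X[OF module_smult1] Suc algebra_simps del: M.scale_scale)
  finally show ?case .
qed

text \<open>The clearing polynomial in \<open>Y_Eo\<close> is an arbitrary choice. Multiplying by
  both \<open>p\<close> and (x1 - x2)^k before the substitution, and cancelling p(x0 + x, x) in the
  field of iterated series, shows that (x1 - x2)^k gives the same result. From here on products are
  handled through \<open>sg\<close>.\<close>

lemma coeffs_Y_Eo:
  assumes ab: "a \<in> Eo sc" "b \<in> Eo sc" and k: "compat2 k a b"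
  shows "coeffs_inf (Y_Eo sc a b $$ m) w n = sg m (pr2 a b w) n"
    and "Y_Eo sc a b $$ m = (\<lambda>w. sbs ((dl ^^ k) (pr2 a b w)) $$ (m + int k))"
proof -
  interpret M: module smul by (rule module_smul)
  define p where "p = clearing_poly sc a b"
  have "(X1 - X2) ^ k \<noteq> (0 :: complex poly poly)" by (simp add: X1_def X2_def)
  moreover have "clears sc ((X1 - X2) ^ k) [a, b]"
    using k ab by (simp add: clears_power_2)
  ultimately have "p \<noteq> 0 \<and> clears sc p [a, b]"
    unfolding p_def clearing_poly_def by (intro someI[of "\<lambda>p. p \<noteq> 0 \<and> clears sc p [a, b]"]) auto
  then have p0: "p \<noteq> 0" and pb: "\<And>w. bnd2 (pact2 (fscale (fscale sc)) sh1 sh2 p (pr2 a b w))"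
    using ab by (auto simp: clears_2)
  define P where "P = poly2 (\<lambda>c. fls_const (fls_const c)) p (fls_X + xx) xx"
  have P0: "P \<noteq> 0" and iota: "iota_inf_0 (Fract 1 (poly2 (\<lambda>c. [:[:c:]:]) p (X2 + X1) X1)) = inverse P"
    using iota_inf_0_shift[OF p0] by (auto simp: P_def)
  have kb: "bnd2 ((dl ^^ k) (pr2 a b w))" for w
    using k by (simp add: compat2_def)
  define H where "H w = smul (inverse P) (sbs (pact2 (fscale (fscale sc)) sh1 sh2 p (pr2 a b w)))" for w
  have H: "smul (fls_X ^ k) (H w) = sbs ((dl ^^ k) (pr2 a b w))" for w
  proof -
    have "smul (fls_X ^ k) (sbs (pact2 (fscale (fscale sc)) sh1 sh2 p (pr2 a b w))) =
        sbs (pact2 (fscale (fscale sc)) sh1 sh2 ((X1 - X2) ^ k) (pact2 (fscale (fscale sc)) sh1 sh2 p (pr2 a b w)))"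
      by (simp add: sbs_pact2 pb HF.poly2_power HF.poly2_diff ev_F_X1 ev_F_X2)
    also have "\<dots> = sbs (pact2 (fscale (fscale sc)) sh1 sh2 p ((dl ^^ k) (pr2 a b w)))"
      by (simp only: pact2_dl[symmetric] dl.pact2_mult[symmetric] mult.commute)
    also have "\<dots> = smul P (sbs ((dl ^^ k) (pr2 a b w)))"
      by (simp add: sbs_pact2 kb P_def)
    finally have "smul (inverse P * fls_X ^ k) (sbs (pact2 (fscale (fscale sc)) sh1 sh2 p (pr2 a b w))) =
        smul (inverse P * P) (sbs ((dl ^^ k) (pr2 a b w)))"
      by (simp only: M.scale_scale[symmetric])
    then show ?thesis using P0 by (simp add: H_def mult.commute)
  qed
  have Hn: "H w $$ m = sbs ((dl ^^ k) (pr2 a b w)) $$ (m + int k)" for w m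
    using smul_X_power[of k "H w" "m + int k"] by (simp add: H)
  have Y: "Y_Eo sc a b = Abs_fls (\<lambda>m w. H w $$ m)"
  proof -
    have "subst_add sc (poly_act sc 0 1 p (op_prod [coeffs_inf a, coeffs_inf b] w)) =
        sbs (pact2 (fscale (fscale sc)) sh1 sh2 p (pr2 a b w))" for w
      using pb[of w] by (subst sbs_nth') (simp_all add: poly_act_2 pr2_def del: One_nat_def)
    then show ?thesis
      by (simp add: Y_Eo_def p_def[symmetric] iota H_def Let_def del: One_nat_def op_prod.simps)
  qed
  have "Abs_fls (\<lambda>m w. H w $$ m) $$ m = (\<lambda>w. H w $$ m)" for m
  proof (rule nth_Abs_fls_lower_bound[of "- int k"], clarify)
    fix m assume "m < - int k"
    then show "(\<lambda>w. H w $$ m) = 0"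
      by (auto simp: fun_eq_iff fun_app Hn fls_eq_iff sbs_nth kb S_neg)
  qed
  then show 1: "Y_Eo sc a b $$ m = (\<lambda>w. sbs ((dl ^^ k) (pr2 a b w)) $$ (m + int k))"
    by (simp add: Y Hn)
  show "coeffs_inf (Y_Eo sc a b $$ m) w n = sg m (pr2 a b w) n"
    by (simp add: coeffs_inf_def 1 sbs_nth kb sg_eq[OF kb])
qed

end

declare fscale_apply [simp del]

section \<open>From pairs to finite sequences\<close>

definition dij :: "nat \<Rightarrow> nat \<Rightarrow> 'w::ab_group_add fseries \<Rightarrow> 'w fseries" where
  "dij i j F = shl i F - shl j F"

definition dprod :: "(nat \<times> nat) list \<Rightarrow> nat \<Rightarrow> 'w::ab_group_add fseries \<Rightarrow> 'w fseries" where
  "dprod ps k F = foldr (\<lambda>(i, j). dij i j ^^ k) ps F"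

text \<open>Compatibility is proved one variable at a time: the bound on the exponent of x_i uses
  only the factors x_i - x_j with j > i.\<close>

definition bvar :: "nat \<Rightarrow> nat \<Rightarrow> 'w::ab_group_add fseries \<Rightarrow> bool" where
  "bvar r i F \<longleftrightarrow> (\<exists>N. \<forall>ns. length ns = r \<longrightarrow> F ns \<noteq> 0 \<longrightarrow> ns ! i \<le> N)"

lemma shl_add: "shl i (F + G) = shl i F + shl i G"
  by (simp add: shl_def fun_eq_iff fscale_apply fun_app)

lemma shl_diff: "shl i (F - G) = shl i F - shl i (G :: 'w::ab_group_add fseries)"
  by (simp add: shl_def fun_eq_iff fscale_apply fun_app)

lemma dij_shl: "dij i j (shl l F) = shl l (dij i j F)"
  by (simp add: dij_def shl_diff shl_commute)

lemma dij_diff: "dij i j (F - G) = dij i j F - dij i j G"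
  by (simp add: dij_def shl_diff)

lemma dij_add: "dij i j (F + G) = dij i j F + dij i j G"
  by (simp add: dij_def shl_add)

lemma dij_commute: "dij i j (dij i' j' F) = dij i' j' (dij i j F)"
  unfolding dij_def[of i' j'] by (simp add: dij_shl dij_diff)

lemma dprod_Nil [simp]: "dprod [] k F = F"
  by (simp add: dprod_def)

lemma dprod_Cons [simp]: "dprod ((i, j) # ps) k F = (dij i j ^^ k) (dprod ps k F)"
  by (simp add: dprod_def)

lemma funpow_intertwine: "(\<And>x. L (T x) = T' (L x)) \<Longrightarrow> L ((T ^^ k) x) = (T' ^^ k) (L x)"
  by (induction k) simp_all

lemma dprod_intertwine:
  assumes "\<And>i j F. (i, j) \<in> set ps \<Longrightarrow> L (dij i j F) = dij i j (L F)"
  shows "L (dprod ps k F) = dprod ps k (L F)"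
  using assms
proof (induction ps)
  case (Cons p ps)
  obtain i j where p: "p = (i, j)" by force
  have "L ((dij i j ^^ k) (dprod ps k F)) = (dij i j ^^ k) (L (dprod ps k F))"
    by (rule funpow_intertwine[where L = L]) (simp add: Cons.prems p)
  with Cons show ?case by (simp add: p)
qed simp

lemma dij_pow_commute: "(dij i j ^^ l) (dij i' j' F) = dij i' j' ((dij i j ^^ l) F)"
  by (induction l) (simp_all add: dij_commute)

lemma dij_pow_dprod: "(dij i j ^^ l) (dprod ps k F) = dprod ps k ((dij i j ^^ l) F)"
  by (rule dprod_intertwine) (rule dij_pow_commute)

lemma dprod_add: "dprod ps (k + l) F = dprod ps k (dprod ps l F)"
proof (induction ps)
  case (Cons p ps)
  obtain i j where p: "p = (i, j)" by force
  with Cons show ?case by (simp add: p funpow_add dij_pow_dprod)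
qed simp

text \<open>The factors commute, so any selection of them may be applied first.\<close>

lemma dprod_filter: "dprod ps k F = dprod (filter (\<lambda>x. \<not> P x) ps) k (dprod (filter P ps) k F)"
proof (induction ps)
  case (Cons p ps)
  obtain i j where p: "p = (i, j)" by force
  with Cons show ?case by (simp add: p dij_pow_dprod)
qed simp

lemma bvar_shl:
  assumes "bvar r i F"
  shows "bvar r i (shl j F)"
proof -
  obtain N where N: "\<And>ns. length ns = r \<Longrightarrow> F ns \<noteq> 0 \<Longrightarrow> ns ! i \<le> N"
    using assms unfolding bvar_def by blast
  have "ns ! i \<le> N + 1" if "length ns = r" "shl j F ns \<noteq> 0" for ns
  proof -
    have "ns[j := ns ! j - 1] ! i \<le> N" using N[of "ns[j := ns ! j - 1]"] that by (simp add: shl_def)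
    then show ?thesis by (cases "i = j"; cases "i < length ns") (auto simp: list_update_beyond)
  qed
  then show ?thesis unfolding bvar_def by blast
qed

lemma bvar_diff:
  assumes "bvar r i F" "bvar r i G"
  shows "bvar r i (F - G)"
proof -
  obtain N M where N: "\<And>ns. length ns = r \<Longrightarrow> F ns \<noteq> 0 \<Longrightarrow> ns ! i \<le> N"
    and M: "\<And>ns. length ns = r \<Longrightarrow> G ns \<noteq> 0 \<Longrightarrow> ns ! i \<le> M"
    using assms unfolding bvar_def by blast
  have "ns ! i \<le> max N M" if "length ns = r" "(F - G) ns \<noteq> 0" for ns
    using N[of ns] M[of ns] that by (cases "F ns = 0") (auto simp: fun_app)
  then show ?thesis unfolding bvar_def by blast
qed

lemma bvar_0: "bvar r i 0"
  by (simp add: bvar_def fun_app)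

lemma bvar_add: "bvar r i F \<Longrightarrow> bvar r i G \<Longrightarrow> bvar r i (F + G)"
  using bvar_diff[OF _ bvar_diff[OF bvar_0, of r i G], of F] by simp

lemma bvar_map: "bvar r i F \<Longrightarrow> \<phi> 0 = 0 \<Longrightarrow> bvar r i (\<lambda>ns. \<phi> (F ns))"
  unfolding bvar_def by (metis (no_types, lifting))

lemma bvar_dij: "bvar r i F \<Longrightarrow> bvar r i (dij j l F)"
  by (simp add: dij_def bvar_diff bvar_shl)

lemma bvar_dij_pow: "bvar r i F \<Longrightarrow> bvar r i ((dij j l ^^ k) F)"
  by (induction k) (simp_all add: bvar_dij)

lemma bvar_dprod: "bvar r i F \<Longrightarrow> bvar r i (dprod ps k F)"
  by (induction ps) (auto simp: bvar_dij_pow)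

lemma bvar_dprod_mono: "bvar r i (dprod ps k F) \<Longrightarrow> k \<le> l \<Longrightarrow> bvar r i (dprod ps l F)"
  using bvar_dprod[of r i "dprod ps k F" ps "l - k"] by (simp flip: dprod_add)

text \<open>Values at lists of the wrong length are arbitrary. Setting them to 0 turns equalities
  that hold for lists of length \<open>r\<close> into equalities of functions, to which the
  intertwining lemmas apply.\<close>

definition restr :: "nat \<Rightarrow> 'w::zero fseries \<Rightarrow> 'w fseries" where
  "restr r F = (\<lambda>ns. if length ns = r then F ns else 0)"

lemma restr_dij: "restr r (dij i j F) = dij i j (restr r F)"
  by (simp add: restr_def dij_def shl_def fun_eq_iff fscale_apply fun_app)

lemma bvar_restr: "bvar r i (restr r F) \<longleftrightarrow> bvar r i F"
  by (auto simp: bvar_def restr_def)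

text \<open>\<open>ap a F\<close> is \<open>a(x\<^sub>1) F(x\<^sub>2,\<dots>,x\<^sub>r)\<close>.\<close>

definition ap :: "('w::ab_group_add \<Rightarrow> 'w fls) \<Rightarrow> 'w fseries \<Rightarrow> 'w fseries" where
  "ap a F = (\<lambda>ns. coeffs_inf a (F (tl ns)) (hd ns))"

lemma op_prod_Cons: "op_prod (map coeffs_inf (a # as)) w = ap a (op_prod (map coeffs_inf as) w)"
  by (simp add: ap_def fun_eq_iff fscale_apply)

lemma shl_ap: "shl (Suc i) (ap a F) = ap a (shl i F)"
proof
  fix ns show "shl (Suc i) (ap a F) ns = ap a (shl i F) ns"
    by (cases ns) (simp_all add: shl_def ap_def)
qed

definition good_rel :: "(complex \<Rightarrow> 'w \<Rightarrow> 'w::ab_group_add) \<Rightarrow> ('w \<Rightarrow> 'w fls) set \<Rightarrow> ('w \<Rightarrow> 'w fls) set \<Rightarrow> bool" where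
  "good_rel sc A B \<longleftrightarrow> A \<subseteq> Eo sc \<and> B \<subseteq> Eo sc \<and> (\<forall>a\<in>A. \<forall>b\<in>B. (\<exists>k. compat2 k a b) \<and>
     (\<exists>q. q \<noteq> 0 \<and> pact (fscale (fscale (fscale sc))) ((\<circ>) dl) q (pr2 a b) \<in>
        nmod (fscale (fscale (fscale sc))) {(\<circ>) dl} {\<lambda>w. flip2 (pr2 u v w) |u v. u \<in> B \<and> v \<in> A}))"
  \<comment> \<open>a rational \<open>\<S>\<close>-locality \<open>q(x\<^sub>1 - x\<^sub>2) a(x\<^sub>1)b(x\<^sub>2) = \<Sum>\<^sub>i g\<^sub>i(x\<^sub>1 - x\<^sub>2) u\<^sub>i(x\<^sub>2)v\<^sub>i(x\<^sub>1)\<close> with polynomials \<open>q \<noteq> 0\<close> and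
     \<open>g\<^sub>i\<close>, where \<open>u\<^sub>i \<in> B\<close> and \<open>v\<^sub>i \<in> A\<close>\<close>

lemma nmod_induct1 [consumes 1, case_names base zero add scale endo]:
  assumes "x \<in> nmod s {T} B" and "\<And>x. x \<in> B \<Longrightarrow> P x" and "P 0"
    and "\<And>x y. x \<in> nmod s {T} B \<Longrightarrow> P x \<Longrightarrow> y \<in> nmod s {T} B \<Longrightarrow> P y \<Longrightarrow> P (x + y)"
    and "\<And>x c. x \<in> nmod s {T} B \<Longrightarrow> P x \<Longrightarrow> P (s c x)"
    and "\<And>x. x \<in> nmod s {T} B \<Longrightarrow> P x \<Longrightarrow> P (T x)"
  shows "P x"
  using assms(1) by (induction rule: nmod.induct) (use assms in auto)

context complex_space
begin

abbreviation s2 :: "complex \<Rightarrow> (int \<Rightarrow> int \<Rightarrow> 'w) \<Rightarrow> int \<Rightarrow> int \<Rightarrow> 'w" where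
  "s2 \<equiv> fscale (fscale sc)"

abbreviation s3 :: "complex \<Rightarrow> ('w \<Rightarrow> int \<Rightarrow> int \<Rightarrow> 'w) \<Rightarrow> 'w \<Rightarrow> int \<Rightarrow> int \<Rightarrow> 'w" where
  "s3 \<equiv> fscale (fscale (fscale sc))"

abbreviation D :: "('w \<Rightarrow> int \<Rightarrow> int \<Rightarrow> 'w) \<Rightarrow> 'w \<Rightarrow> int \<Rightarrow> int \<Rightarrow> 'w" where
  "D \<equiv> (\<circ>) dl"

abbreviation gens :: "('w \<Rightarrow> 'w fls) set \<Rightarrow> ('w \<Rightarrow> 'w fls) set \<Rightarrow> ('w \<Rightarrow> int \<Rightarrow> int \<Rightarrow> 'w) set" where
  "gens B A \<equiv> {\<lambda>w. flip2 (pr2 u v w) |u v. u \<in> B \<and> v \<in> A}"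

sublocale D: linear_endo s3 D
proof -
  interpret V: vector_space "s3"
    by (intro vector_space_fscale) unfold_locales
  show "linear_endo s3 D"
    by unfold_locales (simp_all add: fun_eq_iff fscale_apply dlE.T_scale, simp_all add: dl_def fun_app algebra_simps)
qed

lemma D_apply: "pact s3 D q F w = pact s2 dl q (F w)"
  by (rule D.pact_commute[where L = "\<lambda>F. F w"]) (auto simp: fun_app fscale_apply dlE.linear_endo_axioms)

lemma dij_endo: "linear_endo (fscale sc) (dij i j)"
proof -
  have "dij i j = (\<lambda>x. shl i x - shl j x :: int list \<Rightarrow> 'w)" by (rule ext) (rule dij_def)
  then show ?thesis using linear_endo2.diff_endo[OF shl_endo2, of i j] by simp
qed

lemma pairs_act_eq_dprod:
  "pairs_act sc r ((X1 - X2) ^ k) F = dprod [(i, j). i \<leftarrow> [0..<r], j \<leftarrow> [Suc i..<r]] k F"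
proof -
  have "foldr (\<lambda>(i, j). poly_act sc i j ((X1 - X2) ^ k)) ps F = dprod ps k F"
    if "\<And>i j. (i, j) \<in> set ps \<Longrightarrow> i < j" for ps
    using that
  proof (induction ps)
    case (Cons p ps)
    obtain i j where p: "p = (i, j)" by force
    then have "i \<noteq> j" using Cons.prems[of i j] by auto
    moreover have "dij i j = (\<lambda>x. shl i x - shl j x :: int list \<Rightarrow> 'w)" by (rule ext) (rule dij_def)
    ultimately show ?case using Cons
      by (simp add: p poly_act_eq_pact2 linear_endo2.pact2_diff_power[OF shl_endo2])
  qed simp
  then show ?thesis unfolding pairs_act_def by (rule meta_mp) auto
qed

text \<open>On the highest power of x1 only the summand x1 of x1 - x2 contributes, so each factor
  moves the top row up by one and leaves its entries unchanged.\<close>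

lemma dl_top:
  assumes "\<And>m n. m > M \<Longrightarrow> H m n = 0"
  shows "(m > M + int i \<longrightarrow> (dl ^^ i) H m n = 0) \<and> (dl ^^ i) H (M + int i) n = (H M n :: 'w)"
proof (induction i arbitrary: m n)
  case (Suc i)
  show ?case
    using Suc[of "m - 1" n] Suc[of m "n - 1"] Suc[of "M + int i" n] Suc[of "M + 1 + int i" "n - 1"]
    by (simp add: dl_def algebra_simps)
qed (simp add: assms)

text \<open>Compares the coefficients of the highest power of \<open>x\<^sub>1\<close>, on which \<open>q(x\<^sub>1 - x\<^sub>2)\<close> acts by its
  leading term.\<close>

lemma cancel_top:
  assumes "q \<noteq> 0" and N: "\<And>m n. m > N \<Longrightarrow> pact s2 dl q H m n = 0"
    and M: "\<And>m n. m > M \<Longrightarrow> H m n = 0" and "m > N"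
  shows "H m n = 0"
proof -
  \<comment> \<open>The rows above \<open>N\<close> are cleared from \<open>M\<close> downwards, one
    for each step of the induction.\<close>
  have "\<forall>m n. m > max N (M - int k) \<longrightarrow> H m n = 0" for k
  proof (induction k)
    case (Suc k)
    define L where "L = M - int k"
    show ?case
    proof (cases "L > N")
      case True
      have *: "\<And>m n. m > L \<Longrightarrow> H m n = 0" using Suc True by (simp add: L_def)
      have "H L n = 0" for n
      proof -
        have "0 = pact s2 dl q H (L + int (degree q)) n"
          using True by (simp add: N)
        also have "\<dots> = (\<Sum>i\<le>degree q. sc (coeff q i) ((dl ^^ i) H (L + int (degree q)) n))"
          by (simp add: pact_def sum_fun_apply fscale_apply)
        also have "\<dots> = (\<Sum>i\<in>{degree q}. sc (coeff q i) ((dl ^^ i) H (L + int (degree q)) n))"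
          using dl_top[of L H, OF *] by (intro sum.mono_neutral_right) auto
        also have "\<dots> = sc (lead_coeff q) (H L n)"
          using dl_top[of L H, OF *] by simp
        finally show ?thesis using \<open>q \<noteq> 0\<close> by simp
      qed
      moreover have "m > max N (M - int (Suc k)) \<Longrightarrow> m = L \<or> m > L" for m by (auto simp: L_def)
      ultimately show ?thesis using * by blast
    next
      case False
      then show ?thesis using Suc by (auto simp: L_def)
    qed
  qed (use M in auto)
  from this[of "nat (M - N)"] \<open>m > N\<close> show ?thesis by auto
qed

text \<open>Induction on the tail. Locality replaces x(x1)b(x2) by terms u(x2)v(x1), in which
  \<open>v\<close> is the head of the shorter sequence and \<open>u\<close> leaves the exponent of
  x1 alone. This holds only after multiplication by q(x1 - x2), which \<open>cancel_top\<close>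
  removes again; the boundedness it asks for comes from \<open>compat2\<close>. The head is
  generalized because \<open>v\<close> takes the place of \<open>x\<close>.\<close>

lemma head_bounded:
  assumes "good_rel sc B A" "x \<in> B" "set as \<subseteq> A"
  shows "\<exists>k. \<forall>w. bvar (Suc (length as)) 0
    (dprod [(0, j). j \<leftarrow> [1..<Suc (length as)]] k (op_prod (map coeffs_inf (x # as)) w))"
  using assms(2,3)
proof (induction as arbitrary: x)
  case Nil
  have "bvar 1 0 (op_prod (map coeffs_inf [x]) w)" for w
    using coeffs_inf_bounded[of x w] by (fastforce simp: bvar_def length_Suc_conv)
  then show ?case by (simp del: op_prod.simps)
next
  case (Cons b as)
  define R where "R = Suc (Suc (length as))"
  define P where "P w = op_prod (map coeffs_inf as) w" for w
  \<comment> \<open>\<open>F\<close> is a series in the first two variables depending on a vector;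
    for this vector the coefficients of the product of the remaining operators are inserted.\<close>
  define \<Phi> where "\<Phi> F w = restr R (\<lambda>ns. F (P w (tl (tl ns))) (hd ns) (hd (tl ns)))"
    for F :: "'w \<Rightarrow> int \<Rightarrow> int \<Rightarrow> 'w" and w
  define js where "js = [(0 :: nat, j). j \<leftarrow> [2..<R]]"
  have js_eq: "js = [(0, j). j \<leftarrow> map (Suc \<circ> Suc) [0..<length as]]"
    by (simp only: js_def R_def map_map[of Suc Suc, symmetric] map_Suc_upt numeral_2_eq_2)
  have R2: "length ns = R \<longleftrightarrow> (\<exists>m n ns'. ns = m # n # ns' \<and> length ns' = length as)" for ns :: "int list"
    by (auto simp: R_def length_Suc_conv)
  have x: "x \<in> Eo sc" and b: "b \<in> A" and as: "set as \<subseteq> A" and A: "A \<subseteq> Eo sc"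
    using assms(1) Cons.prems by (auto simp: good_rel_def)
  obtain k0 q where k0: "compat2 k0 x b" and q: "q \<noteq> 0" "pact s3 D q (pr2 x b) \<in> nmod s3 {D} (gens A B)"
    using assms(1) b Cons.prems unfolding good_rel_def by blast
  have \<Phi>_add: "\<Phi> (F + G) w = \<Phi> F w + \<Phi> G w" for F G w
    by (simp add: \<Phi>_def restr_def fun_eq_iff fscale_apply fun_app)
  have \<Phi>_scale: "\<Phi> (s3 c F) w = fscale sc c (\<Phi> F w)" for F c w
    by (simp add: \<Phi>_def restr_def fun_eq_iff fscale_apply)
  have \<Phi>_D: "\<Phi> (D F) w = dij 0 1 (\<Phi> F w)" for F w
  proof
    fix ns show "\<Phi> (D F) w ns = dij 0 1 (\<Phi> F w) ns"
    proof (cases "length ns = R")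
      case True
      then obtain m n ns' where "ns = m # n # ns'" using R2 by blast
      with True show ?thesis by (simp add: \<Phi>_def restr_def dij_def shl_def dl_def fun_app)
    qed (simp add: \<Phi>_def restr_def dij_def shl_def fun_app)
  qed
  \<comment> \<open>The exponent must not depend on \<open>w\<close>. It comes from the induction
    hypothesis for a generator, and sums take the maximum.\<close>
  have gen: "\<exists>k. \<forall>w. bvar R 0 (dprod js k (\<Phi> X w))" if "X \<in> nmod s3 {D} (gens A B)" for X
    using that
  proof (induction rule: nmod_induct1)
    case (base X)
    then obtain u v where X: "X = (\<lambda>w. flip2 (pr2 u v w))" and uv: "u \<in> A" "v \<in> B" by blast
    then have u: "u \<in> Eo sc" using A by blast
    obtain k where k: "\<And>w. bvar (Suc (length as)) 0
        (dprod [(0, j). j \<leftarrow> [1..<Suc (length as)]] k (op_prod (map coeffs_inf (v # as)) w))"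
      using Cons.IH[OF uv(2) as] by blast
    \<comment> \<open>\<open>\<Psi>\<close> inserts \<open>u\<close> with the second variable, so
      that the product with head \<open>v\<close> becomes the exchanged term u(x2)v(x1) followed by
      \<open>as\<close>.\<close>
    define \<Psi> where "\<Psi> G = restr R (\<lambda>ns. coeffs_inf u (G (hd ns # tl (tl ns))) (hd (tl ns)))"
      for G :: "'w fseries"
    have \<Psi>: "\<Psi> (dij 0 (Suc j) G) = dij 0 (Suc (Suc j)) (\<Psi> G)" for j G
    proof
      fix ns show "\<Psi> (dij 0 (Suc j) G) ns = dij 0 (Suc (Suc j)) (\<Psi> G) ns"
      proof (cases "length ns = R")
        case True
        then obtain m n ns' where "ns = m # n # ns'" using R2 by blast
        with True u show ?thesis by (simp add: \<Psi>_def restr_def dij_def shl_def fun_app coeffs_inf_diff)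
      qed (simp add: \<Psi>_def restr_def dij_def shl_def fun_app)
    qed
    have "\<Psi> (dprod [(0, j). j \<leftarrow> map Suc l] k G) = dprod [(0, j). j \<leftarrow> map (Suc \<circ> Suc) l] k (\<Psi> G)" for l G
    proof (induction l)
      case (Cons j l)
      have "\<Psi> ((dij 0 (Suc j) ^^ k) H) = (dij 0 (Suc (Suc j)) ^^ k) (\<Psi> H)" for H
        by (rule funpow_intertwine[where L = \<Psi>]) (rule \<Psi>)
      with Cons show ?case by simp
    qed simp
    from this[of "[0..<length as]"]
    have "\<Psi> (dprod [(0, j). j \<leftarrow> [1..<Suc (length as)]] k G) = dprod js k (\<Psi> G)" for G
      by (simp only: js_eq map_Suc_upt One_nat_def)
    moreover have "\<Psi> (op_prod (map coeffs_inf (v # as)) w) = \<Phi> X w" for w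
    proof
      fix ns show "\<Psi> (op_prod (map coeffs_inf (v # as)) w) ns = \<Phi> X w ns"
        by (simp add: \<Psi>_def \<Phi>_def X restr_def pr2_def flip2_def P_def)
    qed
    moreover have "bvar R 0 (\<Psi> G)" if G: "bvar (Suc (length as)) 0 G" for G
    proof -
      obtain N where N: "\<And>ns. length ns = Suc (length as) \<Longrightarrow> G ns \<noteq> 0 \<Longrightarrow> ns ! 0 \<le> N"
        using G unfolding bvar_def by blast
      have "ns ! 0 \<le> N" if "length ns = R" "\<Psi> G ns \<noteq> 0" for ns
      proof -
        obtain m n ns' where ns: "ns = m # n # ns'" "length ns' = length as" using R2 \<open>length ns = R\<close> by blast
        with that u have "G (m # ns') \<noteq> 0" by (auto simp: \<Psi>_def restr_def)
        with N[of "m # ns'"] ns show ?thesis by simp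
      qed
      then show ?thesis unfolding bvar_def by blast
    qed
    ultimately show ?case using k by metis
  next
    case zero
    have "\<Phi> 0 w = 0" for w by (simp add: \<Phi>_def restr_def fun_eq_iff fscale_apply fun_app)
    then show ?case by (auto intro!: exI[of _ 0] bvar_dprod simp: bvar_0)
  next
    case (add X Y)
    then obtain k l where k: "\<And>w. bvar R 0 (dprod js k (\<Phi> X w))" and l: "\<And>w. bvar R 0 (dprod js l (\<Phi> Y w))"
      by blast
    have add: "dprod js m (F + G) = dprod js m F + dprod js m G" for m and F G :: "'w fseries"
    proof -
      have "(dij i j ^^ m) (F + G) = (dij i j ^^ m) F + (dij i j ^^ m) G" for i j and F G :: "'w fseries"
        by (induction m) (simp_all add: dij_add)
      then have "dprod ps m (F + G) = dprod ps m F + dprod ps m G" for ps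
        by (induction ps) auto
      then show ?thesis .
    qed
    have "bvar R 0 (dprod js (max k l) (\<Phi> (X + Y) w))" for w
      unfolding \<Phi>_add add
      by (intro bvar_add bvar_dprod_mono[OF k] bvar_dprod_mono[OF l]) auto
    then show ?case by blast
  next
    case (scale X c)
    then obtain k where k: "\<And>w. bvar R 0 (dprod js k (\<Phi> X w))" by blast
    have "dprod js k (fscale sc c F) = fscale sc c (dprod js k F)" for F
      by (rule dprod_intertwine[symmetric]) (rule linear_endo.T_scale[OF dij_endo, symmetric])
    moreover have "bvar R 0 (fscale sc c F)" if "bvar R 0 F" for F
      using bvar_map[OF that, of "sc c"] by (simp add: fscale_def)
    ultimately have "bvar R 0 (dprod js k (\<Phi> (s3 c X) w))" for w
      using k[of w] by (simp add: \<Phi>_scale)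
    then show ?case by blast
  next
    case (endo X)
    then obtain k where k: "\<And>w. bvar R 0 (dprod js k (\<Phi> X w))" by blast
    have "dprod js k (dij 0 1 F) = dij 0 1 (dprod js k F)" for F :: "'w fseries"
      by (rule dprod_intertwine[symmetric]) (rule dij_commute)
    then have *: "bvar R 0 (dprod js k (\<Phi> (D X) w))" for w
      using k[of w] by (simp add: \<Phi>_D bvar_dij del: o_apply One_nat_def)
    show ?case by (rule exI[of _ k], rule allI, rule *)
  qed
  from gen[OF q(2)] obtain k where k': "\<forall>w. bvar R 0 (dprod js k (\<Phi> (pact s3 D q (pr2 x b)) w))" ..
  have k: "bvar R 0 (dprod js k (\<Phi> (pact s3 D q (pr2 x b)) w))" for w
    using k' by (rule spec)
  have main: "bvar R 0 (dprod js k ((dij 0 1 ^^ k0) (\<Phi> (pr2 x b) w)))" for w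
  proof -
    define Z where "Z = dprod js k ((dij 0 1 ^^ k0) (\<Phi> (pr2 x b) w))"
    have "\<Phi> (pact s3 D q (pr2 x b)) w = pact (fscale sc) (dij 0 1) q (\<Phi> (pr2 x b) w)"
      by (rule D.pact_commute[where L = "\<lambda>F. \<Phi> F w"]) (auto simp: \<Phi>_add \<Phi>_scale \<Phi>_D dij_endo simp del: o_apply One_nat_def)
    moreover have c1: "pact (fscale sc) (dij 0 1) q (dprod js k F) = dprod js k (pact (fscale sc) (dij 0 1) q F)"
      for F :: "'w fseries"
      by (rule dprod_intertwine, rule linear_endo.pact_commute[OF dij_endo, symmetric])
        (auto simp: dij_add linear_endo.T_scale[OF dij_endo] dij_commute dij_endo)
    moreover have c2: "pact (fscale sc) (dij 0 1) q ((dij 0 1 ^^ k0) F) = (dij 0 1 ^^ k0) (pact (fscale sc) (dij 0 1) q F)"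
      for F :: "'w fseries"
      by (rule funpow_intertwine[where L = "pact (fscale sc) (dij 0 1) q"]) (rule linear_endo.pact_T[OF dij_endo])
    ultimately have "pact (fscale sc) (dij 0 1) q Z = (dij 0 1 ^^ k0) (dprod js k (\<Phi> (pact s3 D q (pr2 x b)) w))"
      by (simp add: Z_def dij_pow_dprod)
    then have "bvar R 0 (pact (fscale sc) (dij 0 1) q Z)" using k[of w] by (simp add: bvar_dij_pow)
    then obtain N where N: "\<And>ns. length ns = R \<Longrightarrow> pact (fscale sc) (dij 0 1) q Z ns \<noteq> 0 \<Longrightarrow> ns ! 0 \<le> N"
      unfolding bvar_def by blast
    \<comment> \<open>With the exponents of x3, x4, ... fixed, \<open>Z\<close> is bounded in x1
      uniformly in the exponent of x2: the power \<open>k0\<close> makes \<open>x\<close> and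
      \<open>b\<close> compatible, and each further factor combines only two such slices.\<close>
    have slice: "\<exists>M. \<forall>m n. m > M \<longrightarrow> Z (m # n # ns) = 0" for ns
    proof -
      define Q where "Q G \<longleftrightarrow> (\<forall>ns. \<exists>M. \<forall>m n. m > M \<longrightarrow> G (m # n # ns) = 0)" for G :: "'w fseries"
      have "Q (dij 0 (Suc (Suc j)) G)" if G: "Q G" for j G
        unfolding Q_def
      proof
        fix ns
        obtain M M' where M: "\<forall>m n. m > M \<longrightarrow> G (m # n # ns) = 0"
          "\<forall>m n. m > M' \<longrightarrow> G (m # n # ns[j := ns ! j - 1]) = 0"
          using G unfolding Q_def by blast
        show "\<exists>M. \<forall>m n. m > M \<longrightarrow> dij 0 (Suc (Suc j)) G (m # n # ns) = 0"
          by (rule exI[of _ "max (M + 1) M'"]) (simp add: dij_def shl_def fun_app M)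
      qed
      then have "Q ((dij 0 (Suc (Suc j)) ^^ k) G)" if "Q G" for j G
        using that by (induction k) simp_all
      then have "Q (dprod [(0, j). j \<leftarrow> map (Suc \<circ> Suc) l] k G)" if "Q G" for l G
        using that by (induction l) simp_all
      from this[of _ "[0..<length as]"] have "Q (dprod js k G)" if "Q G" for G
        using that by (simp only: js_eq)
      moreover have "Q ((dij 0 1 ^^ k0) (\<Phi> (pr2 x b) w))"
        unfolding Q_def
      proof
        fix ns
        have 1: "\<Phi> ((D ^^ k0) F) w = (dij 0 1 ^^ k0) (\<Phi> F w)" for F
          by (rule funpow_intertwine[where L = "\<lambda>F. \<Phi> F w"]) (rule \<Phi>_D)
        have 2: "(D ^^ k0) F w' = (dl ^^ k0) (F w')" for F w'
          by (rule funpow_intertwine[where L = "\<lambda>F. F w'"]) simp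
        obtain M where M: "\<And>m n. (dl ^^ k0) (pr2 x b (P w ns)) m n \<noteq> 0 \<Longrightarrow> m \<le> M \<and> n \<le> M"
          using k0 unfolding compat2_def bnd2_def by blast
        have "(dij 0 1 ^^ k0) (\<Phi> (pr2 x b) w) (m # n # ns) = 0" if "m > M" for m n
        proof -
          have "(dl ^^ k0) (pr2 x b (P w ns)) m n = 0" using M[of m n] that by fastforce
          then show ?thesis unfolding 1[symmetric] by (simp add: \<Phi>_def restr_def 2)
        qed
        then show "\<exists>M. \<forall>m n. m > M \<longrightarrow> (dij 0 1 ^^ k0) (\<Phi> (pr2 x b) w) (m # n # ns) = 0" by blast
      qed
      ultimately show ?thesis unfolding Z_def Q_def by blast
    qed
    have "ns ! 0 \<le> N" if ns: "length ns = R" "Z ns \<noteq> 0" for ns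
    proof (rule ccontr)
      assume "\<not> ns ! 0 \<le> N"
      obtain m n ns' where ns': "ns = m # n # ns'" "length ns' = length as" using R2 ns by blast
      obtain M where M: "\<And>m n. m > M \<Longrightarrow> Z (m # n # ns') = 0" using slice by blast
      define H where "H = (\<lambda>m n. Z (m # n # ns'))"
      have "(\<lambda>m n. pact (fscale sc) (dij 0 1) q Z (m # n # ns')) = pact s2 dl q H"
        unfolding H_def
        by (rule linear_endo.pact_commute[OF dij_endo, where L = "\<lambda>Z m n. Z (m # n # ns')"])
          (auto simp: fun_eq_iff fscale_apply fun_app dij_def shl_def dl_def dlE.linear_endo_axioms)
      then have "pact s2 dl q H m n = 0" if "m > N" for m n
        using N[of "m # n # ns'"] that ns'(2) by (auto simp: fun_eq_iff fscale_apply R_def)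
      then have "H m n = 0"
        using \<open>\<not> ns ! 0 \<le> N\<close> ns'(1) M by (intro cancel_top[OF q(1), of N H M m n]) (auto simp: H_def)
      then show False using ns ns' by (simp add: H_def)
    qed
    then show ?thesis unfolding bvar_def Z_def by blast
  qed
  have P: "\<Phi> (pr2 x b) w = restr R (op_prod (map coeffs_inf (x # b # as)) w)" for w
    by (simp add: \<Phi>_def restr_def fun_eq_iff fscale_apply pr2_def P_def)
  \<comment> \<open>A single exponent has to serve all factors, hence the sum of the two.\<close>
  have "bvar R 0 (dprod ((0, 1) # js) (k0 + k) (op_prod (map coeffs_inf (x # b # as)) w))" for w
  proof -
    have "bvar R 0 ((dij 0 1 ^^ k) (dprod js k0 (dprod js k ((dij 0 1 ^^ k0) (\<Phi> (pr2 x b) w)))))"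
      by (intro bvar_dij_pow bvar_dprod main)
    then have "bvar R 0 (dprod ((0, 1) # js) (k0 + k) (\<Phi> (pr2 x b) w))"
      by (simp add: dprod_add[of js k0 k, unfolded add.commute[of k0 k]] funpow_add add.commute[of k0 k] dij_pow_dprod del: One_nat_def)
    moreover have "restr R (dprod ((0, 1) # js) (k0 + k) F) = dprod ((0, 1) # js) (k0 + k) (restr R F)" for F :: "'w fseries"
      by (rule dprod_intertwine) (rule restr_dij)
    ultimately show ?thesis unfolding P by (metis bvar_restr)
  qed
  moreover have "[(0, j). j \<leftarrow> [1..<Suc (length (b # as))]] = (0 :: nat, 1 :: nat) # js"
    by (simp add: js_def R_def upt_conv_Cons numeral_2_eq_2 del: upt_Suc)
  ultimately show ?case
    by (intro exI[of _ "k0 + k"]) (simp add: R_def del: upt_Suc op_prod.simps list.map One_nat_def)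
qed

text \<open>The operators to the left of position \<open>i\<close> act coefficientwise and leave
  that exponent alone; peeling them off reduces the claim to \<open>head_bounded\<close>.\<close>

lemma var_bounded:
  assumes "good_rel sc A A" "set as \<subseteq> A" "i < length as"
  shows "\<exists>k. \<forall>w. bvar (length as) i
    (dprod [(i, j). j \<leftarrow> [Suc i..<length as]] k (op_prod (map coeffs_inf as) w))"
  using assms(2,3)
proof (induction as arbitrary: i)
  case (Cons a as)
  show ?case
  proof (cases i)
    case 0
    with head_bounded[OF assms(1), of a as] Cons.prems show ?thesis
      by (simp del: upt_Suc list.map op_prod.simps)
  next
    case (Suc i')
    then obtain k where k: "\<And>w. bvar (length as) i'
        (dprod [(i', j). j \<leftarrow> [Suc i'..<length as]] k (op_prod (map coeffs_inf as) w))"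
      using Cons.IH[of i'] Cons.prems by auto
    have a: "a \<in> Eo sc" using assms(1) Cons.prems by (auto simp: good_rel_def)
    have ap_dij: "ap a (dij i j F) = dij (Suc i) (Suc j) (ap a F)" for i j F
      unfolding dij_def shl_ap using a by (simp add: ap_def fun_eq_iff fscale_apply fun_app coeffs_inf_diff)
    have "dprod [(Suc i', j). j \<leftarrow> map Suc l] k (ap a F) = ap a (dprod [(i', j). j \<leftarrow> l] k F)" for l F
    proof (induction l)
      case (Cons j l)
      have "ap a ((dij i' j ^^ k) F) = (dij (Suc i') (Suc j) ^^ k) (ap a F)" for F
        by (rule funpow_intertwine[where L = "ap a"]) (rule ap_dij)
      with Cons show ?case by simp
    qed simp
    from this[of "[Suc i'..<length as]"]
    have eq: "dprod [(i, j). j \<leftarrow> [Suc i..<length (a # as)]] k (op_prod (map coeffs_inf (a # as)) w) =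
        ap a (dprod [(i', j). j \<leftarrow> [Suc i'..<length as]] k (op_prod (map coeffs_inf as) w))" for w
      by (simp only: op_prod_Cons Suc map_Suc_upt list.size add_Suc_right add_0_right)
    have "bvar (Suc r) (Suc i') (ap a F)" if F: "bvar r i' F" for r F
    proof -
      obtain N where N: "\<And>ns. length ns = r \<Longrightarrow> F ns \<noteq> 0 \<Longrightarrow> ns ! i' \<le> N"
        using F unfolding bvar_def by blast
      have "ns ! Suc i' \<le> N" if "length ns = Suc r" "ap a F ns \<noteq> 0" for ns
        using that N[of "tl ns"] a by (cases ns; cases "F (tl ns) = 0") (auto simp: ap_def)
      then show ?thesis unfolding bvar_def by blast
    qed
    then have "bvar (length (a # as)) i (dprod [(i, j). j \<leftarrow> [Suc i..<length (a # as)]] k (op_prod (map coeffs_inf (a # as)) w))" for w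
      unfolding eq using k Suc by simp
    then show ?thesis by blast
  qed
qed simp

text \<open>For each \<open>i\<close> the factors with first index \<open>i\<close> already bound
  the exponent of x_i, and the other factors preserve this bound. So the largest of the exponents
  \<open>k i\<close> works for all variables.\<close>

lemma good_compatible:
  assumes "good_rel sc A A"
  shows "compatible sc A"
  unfolding compatible_def
proof (intro conjI allI impI)
  show AE: "A \<subseteq> Eo sc" using assms by (simp add: good_rel_def)
  fix as assume as: "set as \<subseteq> A"
  define r where "r = length as"
  obtain k where k: "\<And>i w. i < r \<Longrightarrow> bvar r i (dprod [(i, j). j \<leftarrow> [Suc i..<r]] (k i) (op_prod (map coeffs_inf as) w))"
    using var_bounded[OF assms as] unfolding r_def by metis
  \<comment> \<open>The inserted 0 covers the empty sequence.\<close>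
  define K where "K = Max (insert 0 (k ` {..<r}))"
  define ps where "ps = [(i, j). i \<leftarrow> [0..<r], j \<leftarrow> [Suc i..<r]]"
  have lin: "lin_fam sc (fscale sc) (\<lambda>w. dprod ps K (op_prod (map coeffs_inf as) w))"
  proof -
    have "linear_endo (fscale sc) (dprod ps K :: 'w fseries \<Rightarrow> _)"
    proof (induction ps)
      case Nil
      interpret E: linear_endo "fscale sc" "dij 0 0 :: 'w fseries \<Rightarrow> _" by (rule dij_endo)
      show ?case by unfold_locales simp_all
    next
      case (Cons p ps)
      obtain i j where p: "p = (i, j)" by force
      interpret A: linear_endo "fscale sc" "dij i j ^^ K :: 'w fseries \<Rightarrow> _"
        by (rule linear_endo.pow_endo) (rule dij_endo)
      interpret B: linear_endo "fscale sc" "dprod ps K :: 'w fseries \<Rightarrow> _" by fact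
      show ?case by unfold_locales (simp_all add: p A.T_add B.T_add A.T_scale B.T_scale)
    qed
    moreover have "set as \<subseteq> Eo sc" using as AE by blast
    ultimately show ?thesis by (rule lin_fam_comp[OF lin_fam_op_prod, rotated])
  qed
  have bv: "bvar r i (dprod ps K (op_prod (map coeffs_inf as) w))" if "i < r" for i w
  proof -
    have "k i \<le> K" unfolding K_def using that by (intro Max_ge) auto
    have "filter (\<lambda>p. fst p = i) (map (Pair i') l) = (if i' = i then map (Pair i') l else [])" for i' and l :: "nat list"
      by (induction l) auto
    then have "filter (\<lambda>p. fst p = i) (concat (map (\<lambda>i. map (Pair i) (f i)) l)) = (if i \<in> set l then map (Pair i) (f i) else [])"
      if "distinct l" for f :: "nat \<Rightarrow> nat list" and l
      using that by (induction l) auto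
    from this[of "[0..<r]" "\<lambda>i. [Suc i..<r]"] that
    have "filter (\<lambda>p. fst p = i) ps = [(i, j). j \<leftarrow> [Suc i..<r]]"
      by (simp add: ps_def)
    then show ?thesis
      using bvar_dprod[OF bvar_dprod_mono[OF k[OF that] \<open>k i \<le> K\<close>]]
      by (subst dprod_filter[of _ _ _ "\<lambda>p. fst p = i"]) simp
  qed
  have "clears sc ((X1 - X2) ^ K) as"
    unfolding clears_def pairs_act_eq_dprod r_def[symmetric] ps_def[symmetric] hom_inf_iff[OF lin]
  proof
    fix w
    have "\<forall>i. \<exists>N. i < r \<longrightarrow> (\<forall>ns. length ns = r \<longrightarrow> dprod ps K (op_prod (map coeffs_inf as) w) ns \<noteq> 0 \<longrightarrow> ns ! i \<le> N)"
      using bv[of _ w] unfolding bvar_def by blast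
    from choice[OF this] obtain N where
      N: "\<And>i ns. i < r \<Longrightarrow> length ns = r \<Longrightarrow> dprod ps K (op_prod (map coeffs_inf as) w) ns \<noteq> 0 \<Longrightarrow> ns ! i \<le> N i"
      by blast
    have "n \<le> Max (N ` {..<r})" if "length ns = r" "dprod ps K (op_prod (map coeffs_inf as) w) ns \<noteq> 0" and n: "n \<in> set ns" for ns n
    proof -
      obtain i where "i < r" "n = ns ! i" using n \<open>length ns = r\<close> by (auto simp: in_set_conv_nth)
      then have "n \<le> N i" "N i \<le> Max (N ` {..<r})" using N that by auto
      then show ?thesis by simp
    qed
    then show "\<exists>N. \<forall>ns. length ns = r \<longrightarrow> dprod ps K (op_prod (map coeffs_inf as) w) ns \<noteq> 0 \<longrightarrow> (\<forall>n\<in>set ns. n \<le> N)"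
      by blast
  qed
  then show "\<exists>k. clears sc ((X1 - X2) ^ k) as" by blast
qed

end

section \<open>Closure under products\<close>

definition e12 :: "(int \<Rightarrow> int \<Rightarrow> int \<Rightarrow> 'v::ab_group_add) \<Rightarrow> int \<Rightarrow> int \<Rightarrow> int \<Rightarrow> 'v" where
  "e12 F = (\<lambda>m n r. F (m - 1) n r - F m (n - 1) r)"

definition e13 :: "(int \<Rightarrow> int \<Rightarrow> int \<Rightarrow> 'v::ab_group_add) \<Rightarrow> int \<Rightarrow> int \<Rightarrow> int \<Rightarrow> 'v" where
  "e13 F = (\<lambda>m n r. F (m - 1) n r - F m n (r - 1))"

definition e23 :: "(int \<Rightarrow> int \<Rightarrow> int \<Rightarrow> 'v::ab_group_add) \<Rightarrow> int \<Rightarrow> int \<Rightarrow> int \<Rightarrow> 'v" where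
  "e23 F = (\<lambda>m n r. F m (n - 1) r - F m n (r - 1))"

lemmas e_defs = e12_def e13_def e23_def

lemma e_commute: "e13 (e12 F) = e12 (e13 F)" "e23 (e12 F) = e12 (e23 F)" "e23 (e13 F) = e13 (e23 F)"
  by (simp_all add: e_defs fun_eq_iff algebra_simps)

lemma e_pow_commute: "e13 ((e12 ^^ k) F) = (e12 ^^ k) (e13 F)" "e23 ((e12 ^^ k) F) = (e12 ^^ k) (e23 F)"
   "e23 ((e13 ^^ k) F) = (e13 ^^ k) (e23 F)"
  by (induction k) (simp_all add: e_commute)

lemma e_pow_pow_commute: "(e13 ^^ l) ((e12 ^^ k) F) = (e12 ^^ k) ((e13 ^^ l) F)"
  "(e23 ^^ l) ((e12 ^^ k) F) = (e12 ^^ k) ((e23 ^^ l) F)" "(e23 ^^ l) ((e13 ^^ k) F) = (e13 ^^ k) ((e23 ^^ l) F)"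
  by (induction l) (simp_all add: e_pow_commute)

definition bnd3 :: "(int \<Rightarrow> int \<Rightarrow> int \<Rightarrow> 'v::ab_group_add) \<Rightarrow> bool" where
  "bnd3 F \<longleftrightarrow> (\<exists>N. \<forall>m n r. F m n r \<noteq> 0 \<longrightarrow> m \<le> N \<and> n \<le> N \<and> r \<le> N)"

text \<open>\<open>pr\<close> selects one of the three exponents, so that an argument about bounds
  is made once for all of them.\<close>

definition ebd :: "(int \<Rightarrow> int \<Rightarrow> int \<Rightarrow> int) \<Rightarrow> (int \<Rightarrow> int \<Rightarrow> int \<Rightarrow> 'v::ab_group_add) \<Rightarrow> bool" where
  "ebd pr F \<longleftrightarrow> (\<exists>N. \<forall>m n r. F m n r \<noteq> 0 \<longrightarrow> pr m n r \<le> N)"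

lemma ebd_shift:
  assumes "ebd pr F" and pr: "\<And>m n r. pr m n r \<le> pr (m - 1) n r + 1" "\<And>m n r. pr m n r \<le> pr m (n - 1) r + 1"
    "\<And>m n r. pr m n r \<le> pr m n (r - 1) + 1"
  shows "ebd pr (e12 F)" "ebd pr (e13 F)" "ebd pr (e23 F)"
proof -
  obtain N where N: "\<And>m n r. F m n r \<noteq> 0 \<Longrightarrow> pr m n r \<le> N" using assms(1) unfolding ebd_def by blast
  have *: "pr m n r \<le> N + 1" if "F (m - 1) n r \<noteq> 0 \<or> F m (n - 1) r \<noteq> 0 \<or> F m n (r - 1) \<noteq> 0" for m n r
    using N[of "m - 1" n r] N[of m "n - 1" r] N[of m n "r - 1"] pr[of m n r] that by linarith
  have "e12 F m n r \<noteq> 0 \<Longrightarrow> pr m n r \<le> N + 1" for m n r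
    by (rule *) (auto simp: e_defs)
  then show "ebd pr (e12 F)" unfolding ebd_def by blast
  have "e13 F m n r \<noteq> 0 \<Longrightarrow> pr m n r \<le> N + 1" for m n r
    by (rule *) (auto simp: e_defs)
  then show "ebd pr (e13 F)" unfolding ebd_def by blast
  have "e23 F m n r \<noteq> 0 \<Longrightarrow> pr m n r \<le> N + 1" for m n r
    by (rule *) (auto simp: e_defs)
  then show "ebd pr (e23 F)" unfolding ebd_def by blast
qed

lemma ebd_pow:
  assumes "ebd pr F" and "\<And>m n r. pr m n r \<le> pr (m - 1) n r + 1" "\<And>m n r. pr m n r \<le> pr m (n - 1) r + 1"
    "\<And>m n r. pr m n r \<le> pr m n (r - 1) + 1"
  shows "ebd pr ((e12 ^^ i) ((e13 ^^ j) ((e23 ^^ l) F)))"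
proof -
  have 0: "ebd pr F \<Longrightarrow> ebd pr (e12 F)" "ebd pr F \<Longrightarrow> ebd pr (e13 F)" "ebd pr F \<Longrightarrow> ebd pr (e23 F)"
    for F :: "int \<Rightarrow> int \<Rightarrow> int \<Rightarrow> 'a"
    using ebd_shift[of pr F] assms(2-4) by simp_all
  have 1: "ebd pr F \<Longrightarrow> ebd pr ((e12 ^^ k) F)" "ebd pr F \<Longrightarrow> ebd pr ((e13 ^^ k) F)" "ebd pr F \<Longrightarrow> ebd pr ((e23 ^^ k) F)"
    for F :: "int \<Rightarrow> int \<Rightarrow> int \<Rightarrow> 'a" and k
    by (induction k) (simp_all add: 0)
  show ?thesis by (intro 1 assms(1))
qed

lemma bnd3_iff: "bnd3 F \<longleftrightarrow> ebd (\<lambda>m n r. m) F \<and> ebd (\<lambda>m n r. n) F \<and> ebd (\<lambda>m n r. r) F"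
proof
  assume "ebd (\<lambda>m n r. m) F \<and> ebd (\<lambda>m n r. n) F \<and> ebd (\<lambda>m n r. r) F"
  then obtain K L M where *: "\<And>m n r. F m n r \<noteq> 0 \<Longrightarrow> m \<le> K" "\<And>m n r. F m n r \<noteq> 0 \<Longrightarrow> n \<le> L"
    "\<And>m n r. F m n r \<noteq> 0 \<Longrightarrow> r \<le> M" unfolding ebd_def by metis
  have "m \<le> max K (max L M) \<and> n \<le> max K (max L M) \<and> r \<le> max K (max L M)" if "F m n r \<noteq> 0" for m n r
    using *[OF that] by linarith
  then show "bnd3 F" unfolding bnd3_def by blast
qed (auto simp: bnd3_def ebd_def)

lemma bnd3_pow: "bnd3 F \<Longrightarrow> bnd3 ((e12 ^^ i) ((e13 ^^ j) ((e23 ^^ l) F)))"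
  unfolding bnd3_iff by (auto intro!: ebd_pow)

lemma nmod_map:
  assumes "x \<in> nmod s {T} B" and "\<And>x y. L (x + y) = L x + L y" "\<And>c x. L (s c x) = s' c (L x)"
    "\<And>x. L (T x) = T' (L x)" "T' \<in> Ts" "\<And>x. x \<in> B \<Longrightarrow> L x \<in> nmod s' Ts B'"
  shows "L x \<in> nmod s' Ts B'"
proof -
  have "L 0 = 0" using assms(2)[of 0 0] by simp
  with assms(1) show ?thesis
    by (induction rule: nmod_induct1)
      (auto simp: assms(2-4) intro: assms(6) nmod_0 nmod_add nmod_scale nmod_op[OF _ assms(5)])
qed

lemma nmod_induct2 [consumes 1, case_names base zero add scale endo1 endo2]:
  assumes "x \<in> nmod s {T, T'} B" and "\<And>x. x \<in> B \<Longrightarrow> P x" and "P 0"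
    and "\<And>x y. x \<in> nmod s {T, T'} B \<Longrightarrow> P x \<Longrightarrow> y \<in> nmod s {T, T'} B \<Longrightarrow> P y \<Longrightarrow> P (x + y)"
    and "\<And>x c. x \<in> nmod s {T, T'} B \<Longrightarrow> P x \<Longrightarrow> P (s c x)"
    and "\<And>x. x \<in> nmod s {T, T'} B \<Longrightarrow> P x \<Longrightarrow> P (T x)"
    and "\<And>x. x \<in> nmod s {T, T'} B \<Longrightarrow> P x \<Longrightarrow> P (T' x)"
  shows "P x"
  using assms(1) by (induction rule: nmod.induct) (use assms in auto)

declare o_apply [simp del]

definition flipw :: "('w \<Rightarrow> int \<Rightarrow> int \<Rightarrow> 'v) \<Rightarrow> 'w \<Rightarrow> int \<Rightarrow> int \<Rightarrow> 'v" where
  "flipw F = (\<lambda>w. flip2 (F w))"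

lemma flipw_flipw [simp]: "flipw (flipw F) = F"
  by (simp add: flipw_def)

context complex_space
begin

abbreviation s4 :: "complex \<Rightarrow> ('w \<Rightarrow> int \<Rightarrow> int \<Rightarrow> int \<Rightarrow> 'w) \<Rightarrow> 'w \<Rightarrow> int \<Rightarrow> int \<Rightarrow> int \<Rightarrow> 'w" where
  "s4 \<equiv> fscale (fscale (fscale (fscale sc)))"

abbreviation E12 :: "('w \<Rightarrow> int \<Rightarrow> int \<Rightarrow> int \<Rightarrow> 'w) \<Rightarrow> 'w \<Rightarrow> int \<Rightarrow> int \<Rightarrow> int \<Rightarrow> 'w" where
  "E12 \<equiv> (\<circ>) e12"

abbreviation E13 :: "('w \<Rightarrow> int \<Rightarrow> int \<Rightarrow> int \<Rightarrow> 'w) \<Rightarrow> 'w \<Rightarrow> int \<Rightarrow> int \<Rightarrow> int \<Rightarrow> 'w" where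
  "E13 \<equiv> (\<circ>) e13"

abbreviation E23 :: "('w \<Rightarrow> int \<Rightarrow> int \<Rightarrow> int \<Rightarrow> 'w) \<Rightarrow> 'w \<Rightarrow> int \<Rightarrow> int \<Rightarrow> int \<Rightarrow> 'w" where
  "E23 \<equiv> (\<circ>) e23"

sublocale E: linear_endo2 s4 E13 E23
proof -
  interpret V: vector_space s4
    by (intro vector_space_fscale) unfold_locales
  show "linear_endo2 s4 E13 E23"
    by unfold_locales
      (simp_all add: fun_eq_iff fscale_apply o_apply fun_app e_defs scale_right_diff_distrib algebra_simps)
qed

section \<open>The substitution x1 = x2 + x0 in the first two of three variables\<close>

definition sgA :: "int \<Rightarrow> ('w \<Rightarrow> int \<Rightarrow> int \<Rightarrow> int \<Rightarrow> 'w) \<Rightarrow> 'w \<Rightarrow> int \<Rightarrow> int \<Rightarrow> 'w" where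
  "sgA m F = (\<lambda>w n r. sg m (\<lambda>m n. F w m n r) n)"

definition singA :: "('w \<Rightarrow> int \<Rightarrow> int \<Rightarrow> int \<Rightarrow> 'w) \<Rightarrow> bool" where
  "singA F \<longleftrightarrow> (\<forall>w r. sing (\<lambda>m n. F w m n r))"

lemma slice_add: "(\<lambda>m n. (F + G) w m n r) = (\<lambda>m n. F w m n r) + (\<lambda>m n. G w m n r)"
  by (simp add: fun_eq_iff fun_app)

lemma slice_scale: "(\<lambda>m n. s4 c F w m n r) = s2 c (\<lambda>m n. F w m n r)"
  by (simp add: fun_eq_iff fscale_apply)

lemma slice_E12: "(\<lambda>m n. E12 F w m n r) = dl (\<lambda>m n. F w m n r)"
  by (simp add: o_apply fun_eq_iff e12_def dl_def)

lemma slice_E13: "(\<lambda>m n. E13 F w m n r) = sh1 (\<lambda>m n. F w m n r) - (\<lambda>m n. F w m n (r - 1))"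
  by (simp add: o_apply fun_eq_iff e13_def sh1_def fun_app)

lemma slice_E23: "(\<lambda>m n. E23 F w m n r) = sh2 (\<lambda>m n. F w m n r) - (\<lambda>m n. F w m n (r - 1))"
  by (simp add: o_apply fun_eq_iff e23_def sh2_def fun_app)

lemma sing_diff: "sing F \<Longrightarrow> sing G \<Longrightarrow> sing (F - G :: int \<Rightarrow> int \<Rightarrow> 'w)"
  using sing_add[of F "- G"] by (simp add: sing_uminus)

lemma singA_zero: "singA 0"
  using sing_zero by (simp add: singA_def zero_fun_def)

lemma singA_add: "singA F \<Longrightarrow> singA G \<Longrightarrow> singA (F + G)"
  by (simp only: singA_def slice_add sing_add simp_thms)

lemma singA_scale: "singA F \<Longrightarrow> singA (s4 c F)"
  by (simp only: singA_def slice_scale sing_scale simp_thms)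

lemma singA_E13: "singA F \<Longrightarrow> singA (E13 F)"
  by (simp only: singA_def slice_E13 sing_sh1 sing_diff simp_thms)

lemma singA_E23: "singA F \<Longrightarrow> singA (E23 F)"
  by (simp only: singA_def slice_E23 sing_sh2 sing_diff simp_thms)

lemma singA_E12: "singA F \<Longrightarrow> singA (E12 F)"
  by (simp only: singA_def slice_E12 sing_dl simp_thms)

lemma sgA_zero: "sgA m 0 = 0"
  using sg_zero[of m] by (simp add: sgA_def zero_fun_def)

lemma sgA_add: "singA F \<Longrightarrow> singA G \<Longrightarrow> sgA m (F + G) = sgA m F + sgA m G"
  unfolding sgA_def slice_add by (simp add: singA_def sg_add fun_eq_iff fun_app)

lemma sgA_scale: "singA F \<Longrightarrow> sgA m (s4 c F) = s3 c (sgA m F)"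
  unfolding sgA_def slice_scale by (simp add: singA_def sg_scale fun_eq_iff fscale_apply)

lemma sgA_E12: "singA F \<Longrightarrow> sgA m (E12 F) = sgA (m - 1) F"
  unfolding sgA_def slice_E12 by (simp add: singA_def sg_dl)

lemma sgA_E23: "singA F \<Longrightarrow> sgA m (E23 F) = D (sgA m F)"
  unfolding sgA_def slice_E23
  by (simp add: singA_def sg_diff sing_sh2 sg_sh2 dl_def o_apply fun_eq_iff fun_app)

lemma sgA_E13: "singA F \<Longrightarrow> sgA m (E13 F) = D (sgA m F) + sgA (m - 1) F"
  unfolding sgA_def slice_E13
  by (simp add: singA_def sg_diff sing_sh1 sg_sh1 dl_def o_apply fun_eq_iff fun_app)

lemma singA_pact_E23: "singA F \<Longrightarrow> singA (pact s4 E23 q F)"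
  using E.E2.pact_in[of "{F. singA F}" F q] by (simp add: singA_zero singA_add singA_scale singA_E23)

lemma singA_pact_E13: "singA F \<Longrightarrow> singA (pact s4 E13 q F)"
  using E.E1.pact_in[of "{F. singA F}" F q] by (simp add: singA_zero singA_add singA_scale singA_E13)

lemma sgA_pact_E23: "singA F \<Longrightarrow> sgA m (pact s4 E23 q F) = pact s3 D q (sgA m F)"
  by (induction q)
    (simp_all add: sgA_zero E.E2.pact_pCons D.pact_pCons sgA_add singA_scale singA_pact_E23 singA_E23 sgA_scale sgA_E23)

text \<open>The Taylor expansion of \<open>p(x\<^sub>1 - x\<^sub>3)\<close> at \<open>x\<^sub>1 = x\<^sub>2 + x\<^sub>0\<close>.\<close>

lemma sgA_pact_E13:
  "\<exists>h N. h 0 = p \<and> (\<forall>l>N. h l = 0) \<and> (\<forall>F m. singA F \<longrightarrow>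
     sgA m (pact s4 E13 p F) = (\<Sum>l\<le>N. pact s3 D (h l) (sgA (m - int l) F)))"
proof (induction p)
  case 0
  show ?case by (rule exI[of _ "\<lambda>_. 0"], rule exI[of _ 0]) (simp add: sgA_zero)
next
  case (pCons a p)
  then obtain h N where h: "h 0 = p" "\<And>l. l > N \<Longrightarrow> h l = 0"
    "\<And>F m. singA F \<Longrightarrow> sgA m (pact s4 E13 p F) = (\<Sum>l\<le>N. pact s3 D (h l) (sgA (m - int l) F))"
    by blast
  \<comment> \<open>As x1 - x3 = (x2 - x3) + x0, the coefficient of x0^l in (x1 - x3) p(x1 - x3) is
    (x2 - x3) h_l + h_(l-1); the constant \<open>a\<close> enters for l = 0 alone.\<close>
  define g where "g l = (if l = 0 then pCons a p else pCons 0 (h l) + h (l - 1))" for l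
  have "sgA m (pact s4 E13 (pCons a p) F) = (\<Sum>l\<le>Suc N. pact s3 D (g l) (sgA (m - int l) F))"
    if F: "singA F" for F m
  proof -
    define Z where "Z l = sgA (m - int l) F" for l
    have "sgA m (pact s4 E13 (pCons a p) F) =
        s3 a (sgA m F) + (D (sgA m (pact s4 E13 p F)) + sgA (m - 1) (pact s4 E13 p F))"
      using F by (simp add: E.E1.pact_pCons sgA_add singA_scale singA_E13 singA_pact_E13 sgA_scale sgA_E13)
    also have "D (sgA m (pact s4 E13 p F)) = (\<Sum>l\<le>N. D (pact s3 D (h l) (Z l)))"
      using F by (simp add: h(3) D.T_sum Z_def)
    also have "\<dots> = (\<Sum>l\<le>Suc N. D (pact s3 D (h l) (Z l)))"
      using h(2)[of "Suc N"] by (simp add: D.T_zero)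
    also have "\<dots> = D (pact s3 D p (Z 0)) + (\<Sum>l\<le>N. D (pact s3 D (h (Suc l)) (Z (Suc l))))"
      unfolding sum.atMost_Suc_shift h(1) ..
    also have "sgA (m - 1) (pact s4 E13 p F) = (\<Sum>l\<le>N. pact s3 D (h l) (Z (Suc l)))"
      using F by (simp add: h(3) Z_def algebra_simps)
    finally have "sgA m (pact s4 E13 (pCons a p) F) = s3 a (Z 0) + D (pact s3 D p (Z 0)) +
        (\<Sum>l\<le>N. D (pact s3 D (h (Suc l)) (Z (Suc l))) + pact s3 D (h l) (Z (Suc l)))"
      by (simp add: sum.distrib Z_def add.assoc)
    also have "\<dots> = (\<Sum>l\<le>Suc N. pact s3 D (g l) (Z l))"
      unfolding sum.atMost_Suc_shift
      by (simp add: g_def D.pact_pCons D.pact_add D.scale_zero_left)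
    finally show ?thesis by (simp add: Z_def)
  qed
  moreover have "g 0 = pCons a p" "\<And>l. l > Suc N \<Longrightarrow> g l = 0"
    by (auto simp: g_def h(2))
  ultimately show ?case by blast
qed

text \<open>Taylor expansion expresses \<open>(pq)\<cdot>F\<^sub>m\<close> through \<open>F\<^sub>m\<^sub>-\<^sub>1, F\<^sub>m\<^sub>-\<^sub>2, \<dots>\<close> modulo \<open>P\<close>, so that induction on \<open>m\<close>
  applies, starting where \<open>F\<^sub>m = 0\<close>.\<close>

lemma merge:
  assumes P: "0 \<in> P" "\<And>x y. x \<in> P \<Longrightarrow> y \<in> P \<Longrightarrow> x + y \<in> P" "\<And>c x. x \<in> P \<Longrightarrow> s3 c x \<in> P"
      "\<And>x. x \<in> P \<Longrightarrow> D x \<in> P"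
    and F: "singA F" and e: "\<And>m. m < - int e \<Longrightarrow> sgA m F = 0"
    and PF: "\<And>m. sgA m (pact s4 E13 p (pact s4 E23 q F)) \<in> P"
  shows "\<exists>k. pact s3 D ((q * p) ^ k) (sgA m F) \<in> P"
proof -
  obtain h N where h: "h 0 = p"
    "\<And>F m. singA F \<Longrightarrow> sgA m (pact s4 E13 p F) = (\<Sum>l\<le>N. pact s3 D (h l) (sgA (m - int l) F))"
    using sgA_pact_E13[of p] by blast
  have act: "x \<in> P \<Longrightarrow> pact s3 D g x \<in> P" for g x
    by (rule D.pact_in) (use P in auto)
  have minus: "x \<in> P \<Longrightarrow> y \<in> P \<Longrightarrow> x - y \<in> P" for x y
    using P(2)[of x "s3 (-1) y"] P(3)[of y "-1"] by simp
  have sumP: "(\<And>i. i \<in> I \<Longrightarrow> f i \<in> P) \<Longrightarrow> sum f I \<in> P" for f and I :: "nat set"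
    by (induction I rule: infinite_finite_induct) (use P in auto)
  \<comment> \<open>The coefficients vanish below \<open>- int e\<close>, and each step up in
    \<open>m\<close> costs one more factor \<open>q * p\<close>.\<close>
  have "\<forall>m < int j - int e. pact s3 D ((q * p) ^ j) (sgA m F) \<in> P" for j
  proof (induction j)
    case 0
    then show ?case using e P(1) by simp
  next
    case (Suc j)
    show ?case
    proof (intro allI impI)
      fix m assume m: "m < int (Suc j) - int e"
      define R where "R = (\<Sum>l<N. pact s3 D (h (Suc l) * q) (sgA (m - int (Suc l)) F))"
      have "sgA m (pact s4 E13 p (pact s4 E23 q F)) = (\<Sum>l\<le>N. pact s3 D (h l * q) (sgA (m - int l) F))"
        using F by (simp add: h(2) singA_pact_E23 sgA_pact_E23 D.pact_mult)
      also have "\<dots> = pact s3 D (p * q) (sgA m F) + R"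
        unfolding R_def sum.atMost_shift h(1) by simp
      finally have "pact s3 D (p * q) (sgA m F) = sgA m (pact s4 E13 p (pact s4 E23 q F)) - R"
        by simp
      moreover have "(q * p) ^ Suc j = (q * p) ^ j * (p * q)" by (simp add: mult_ac)
      ultimately have "pact s3 D ((q * p) ^ Suc j) (sgA m F) =
          pact s3 D ((q * p) ^ j) (sgA m (pact s4 E13 p (pact s4 E23 q F))) - pact s3 D ((q * p) ^ j) R"
        by (simp only: D.pact_mult[of "(q * p) ^ j"] D.pact_diff_right)
      moreover have "pact s3 D ((q * p) ^ j) R \<in> P"
      proof -
        have "pact s3 D ((q * p) ^ j) R = (\<Sum>l<N. pact s3 D (h (Suc l) * q) (pact s3 D ((q * p) ^ j) (sgA (m - int (Suc l)) F)))"
          unfolding R_def D.pact_sum_right D.pact_mult[symmetric] by (simp only: mult_ac)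
        also have "\<dots> \<in> P" by (rule sumP, rule act) (use Suc m in auto)
        finally show ?thesis .
      qed
      ultimately show "pact s3 D ((q * p) ^ Suc j) (sgA m F) \<in> P"
        using minus act PF by simp
    qed
  qed
  from this[of "nat (m + int e + 1)"] show ?thesis
    by (intro exI[of _ "nat (m + int e + 1)"]) (auto split: if_splits)
qed

lemma nmod_submodule:
  "0 \<in> nmod s3 {D} B" "x \<in> nmod s3 {D} B \<Longrightarrow> y \<in> nmod s3 {D} B \<Longrightarrow> x + y \<in> nmod s3 {D} B"
  "x \<in> nmod s3 {D} B \<Longrightarrow> s3 c x \<in> nmod s3 {D} B" "x \<in> nmod s3 {D} B \<Longrightarrow> D x \<in> nmod s3 {D} B"
  by (auto intro: nmod_0 nmod_add nmod_scale nmod_op[where T = D])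

text \<open>The exchange of variables sends x1 - x2 to its negative, which the scalar -1
  absorbs.\<close>

lemma nmod_flipw:
  assumes "x \<in> nmod s3 {D} B"
  shows "flipw x \<in> nmod s3 {D} (flipw ` B)"
  using assms
proof (induction rule: nmod_induct1)
  case (base x)
  then show ?case by (auto intro: nmod_base)
next
  case zero
  have "flipw (0 :: 'w \<Rightarrow> int \<Rightarrow> int \<Rightarrow> 'w) = 0" by (simp add: flipw_def flip2_def fun_eq_iff fun_app)
  then show ?case by (simp add: nmod_0)
next
  case (add x y)
  have "flipw (x + y) = flipw x + flipw y" by (simp add: flipw_def flip2_def fun_eq_iff fun_app)
  with add show ?case by (simp add: nmod_add)
next
  case (scale x c)
  have "flipw (s3 c x) = s3 c (flipw x)" by (simp add: flipw_def flip2_def fun_eq_iff fscale_apply)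
  with scale show ?case by (simp add: nmod_scale)
next
  case (endo x)
  have *: "flipw (D x) = s3 (-1) (D (flipw x))"
    by (simp add: flipw_def flip2_def dl_def fun_eq_iff fscale_apply o_apply)
  show ?case unfolding * by (intro nmod_submodule(3,4) endo)
qed

lemma pact_flipw: "flipw (pact s3 D q F) = pact s3 D (pcompose q [:0, -1:]) (flipw F)"
  unfolding D.pact_uminus[symmetric]
  by (rule D.pact_commute[where L = flipw])
    (auto simp: flipw_def flip2_def dl_def fun_eq_iff fscale_apply o_apply fun_app D.uminus_endo)

lemma pcompose_uminus_nonzero: "q \<noteq> 0 \<Longrightarrow> pcompose q [:0, - 1 :: complex:] \<noteq> 0"
  by (simp add: pcompose_eq_0_iff)

text \<open>The last item is the relation with its variables renamed, for the case that the left
  operator carries the second variable.\<close>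

lemma good_relD:
  assumes "good_rel sc A B" "a \<in> A" "b \<in> B"
  shows "a \<in> Eo sc" "b \<in> Eo sc" "\<exists>k. compat2 k a b"
    "\<exists>q. q \<noteq> 0 \<and> pact s3 D q (pr2 a b) \<in> nmod s3 {D} {flipw (pr2 u v) |u v. u \<in> B \<and> v \<in> A}"
    "\<exists>q. q \<noteq> 0 \<and> pact s3 D q (flipw (pr2 a b)) \<in> nmod s3 {D} {pr2 u v |u v. u \<in> B \<and> v \<in> A}"
proof -
  show "a \<in> Eo sc" "b \<in> Eo sc" "\<exists>k. compat2 k a b"
    using assms unfolding good_rel_def by blast+
  show *: "\<exists>q. q \<noteq> 0 \<and> pact s3 D q (pr2 a b) \<in> nmod s3 {D} {flipw (pr2 u v) |u v. u \<in> B \<and> v \<in> A}"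
    using assms unfolding good_rel_def flipw_def by blast
  then obtain q where q: "q \<noteq> 0" "pact s3 D q (pr2 a b) \<in> nmod s3 {D} {flipw (pr2 u v) |u v. u \<in> B \<and> v \<in> A}"
    by blast
  have "flipw ` {flipw (pr2 u v) |u v. u \<in> B \<and> v \<in> A} = {pr2 u v |u v. u \<in> B \<and> v \<in> A}"
    by (force simp: image_iff)
  with nmod_flipw[OF q(2)] have "pact s3 D (pcompose q [:0, -1:]) (flipw (pr2 a b)) \<in> nmod s3 {D} {pr2 u v |u v. u \<in> B \<and> v \<in> A}"
    by (simp add: pact_flipw)
  with pcompose_uminus_nonzero[OF q(1)]
  show "\<exists>q. q \<noteq> 0 \<and> pact s3 D q (flipw (pr2 a b)) \<in> nmod s3 {D} {pr2 u v |u v. u \<in> B \<and> v \<in> A}" by blast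
qed

lemma coeffs_pow_map:
  assumes a: "a \<in> Eo sc"
  shows "(e23 ^^ k) (\<lambda>m n r. coeffs_inf a (G n r) m) = (\<lambda>m n r. coeffs_inf a ((dl ^^ k) G n r) m)"
proof (induction k)
  case (Suc k)
  then show ?case using a by (simp add: e23_def dl_def coeffs_inf_diff o_apply)
qed simp

text \<open>The first exponent is bounded by \<open>head_bounded\<close> with the factors x1 - x2
  and x1 - x3, the other two by the compatibility of \<open>a\<close> and \<open>b\<close>, on whose
  product \<open>x\<close> acts coefficientwise.\<close>

lemma triple_compat:
  assumes CA: "good_rel sc C A" and A: "good_rel sc A A" and x: "x \<in> C" and a: "a \<in> A" and b: "b \<in> A"
  shows "\<exists>k. \<forall>w. bnd3 ((e12 ^^ k) ((e13 ^^ k) ((e23 ^^ k) (pr3 x a b w))))"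
proof -
  obtain k0 where k0: "compat2 k0 a b" using good_relD(3)[OF A a b] by blast
  have xE: "x \<in> Eo sc" using good_relD(1)[OF CA x a] .
  obtain k where k: "\<And>w. bvar 3 0 (dprod [(0, 1), (0, 2)] k (op_prod (map coeffs_inf [x, a, b]) w))"
    using head_bounded[OF CA x, of "[a, b]"] a b by (auto simp: numeral_3_eq_3 numeral_2_eq_2)
  have L: "(\<lambda>m n r. (dij 0 1 ^^ k) F [m, n, r]) = (e12 ^^ k) (\<lambda>m n r. F [m, n, r])"
    "(\<lambda>m n r. (dij 0 2 ^^ k) F [m, n, r]) = (e13 ^^ k) (\<lambda>m n r. F [m, n, r])" for k and F :: "'w fseries"
    by (rule funpow_intertwine[where L = "\<lambda>F m n r. F [m, n, r]"],
        simp add: fun_eq_iff fun_app dij_def shl_def e12_def e13_def numeral_2_eq_2)+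
  have 1: "ebd (\<lambda>m n r. m) ((e12 ^^ k) ((e13 ^^ k) (pr3 x a b w)))" for w
  proof -
    have "(\<lambda>m n r. dprod [(0, 1), (0, 2)] k (op_prod (map coeffs_inf [x, a, b]) w) [m, n, r]) =
        (e12 ^^ k) ((e13 ^^ k) (pr3 x a b w))"
      unfolding dprod_Cons dprod_Nil L by (simp add: pr3_def)
    moreover obtain N where "\<And>ns. length ns = 3 \<Longrightarrow> dprod [(0, 1), (0, 2)] k (op_prod (map coeffs_inf [x, a, b]) w) ns \<noteq> 0 \<Longrightarrow> ns ! 0 \<le> N"
      using k[of w] unfolding bvar_def by blast
    ultimately have "\<And>m n r. (e12 ^^ k) ((e13 ^^ k) (pr3 x a b w)) m n r \<noteq> 0 \<Longrightarrow> m \<le> N"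
      by (metis length_Cons list.size(3) nth_Cons_0 numeral_3_eq_3)
    then show ?thesis unfolding ebd_def by blast
  qed
  have 2: "ebd (\<lambda>m n r. n) ((e23 ^^ k0) (pr3 x a b w)) \<and> ebd (\<lambda>m n r. r) ((e23 ^^ k0) (pr3 x a b w))" for w
  proof -
    obtain N where N: "\<And>n r. (dl ^^ k0) (pr2 a b w) n r \<noteq> 0 \<Longrightarrow> n \<le> N \<and> r \<le> N"
      using k0 unfolding compat2_def bnd2_def by blast
    have "(e23 ^^ k0) (pr3 x a b w) = (\<lambda>m n r. coeffs_inf x ((dl ^^ k0) (pr2 a b w) n r) m)"
      using coeffs_pow_map[OF xE, of k0 "pr2 a b w"] by (simp add: pr3_def pr2_def)
    then have "n \<le> N \<and> r \<le> N" if "(e23 ^^ k0) (pr3 x a b w) m n r \<noteq> 0" for m n r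
      using N[of n r] that xE by (cases "(dl ^^ k0) (pr2 a b w) n r = 0") auto
    then show ?thesis unfolding ebd_def by blast
  qed
  define K where "K = k + k0"
  have "bnd3 ((e12 ^^ K) ((e13 ^^ K) ((e23 ^^ K) (pr3 x a b w))))" for w
  proof -
    have "(e12 ^^ K) ((e13 ^^ K) ((e23 ^^ K) (pr3 x a b w))) =
        (e12 ^^ k0) ((e13 ^^ k0) ((e23 ^^ K) ((e12 ^^ k) ((e13 ^^ k) (pr3 x a b w)))))"
      by (simp add: K_def add.commute[of k] funpow_add o_apply e_pow_pow_commute)
    then have "ebd (\<lambda>m n r. m) ((e12 ^^ K) ((e13 ^^ K) ((e23 ^^ K) (pr3 x a b w))))"
      using ebd_pow[OF 1[of w], of k0 k0 K] by simp
    moreover have "(e12 ^^ K) ((e13 ^^ K) ((e23 ^^ K) (pr3 x a b w))) =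
        (e12 ^^ K) ((e13 ^^ K) ((e23 ^^ k) ((e23 ^^ k0) (pr3 x a b w))))"
      by (simp add: K_def funpow_add o_apply)
    ultimately show ?thesis
      using ebd_pow[of "\<lambda>m n r. n" "(e23 ^^ k0) (pr3 x a b w)" K K k] ebd_pow[of "\<lambda>m n r. r" "(e23 ^^ k0) (pr3 x a b w)" K K k] 2[of w]
      unfolding bnd3_iff by simp
  qed
  then show ?thesis by blast
qed

lemma Y_coeff_Eo:
  assumes "a \<in> Eo sc" "b \<in> Eo sc" "compat2 k a b"
  shows "Y_Eo sc a b $$ m \<in> Eo sc"
proof -
  have s: "sing (pr2 a b w)" for w using assms(3) unfolding compat2_def sing_def by blast
  have "pr2 a b (w + w') = pr2 a b w + pr2 a b w'" "pr2 a b (sc c w) = s2 c (pr2 a b w)" for w w' c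
    using assms(1,2) by (simp_all add: pr2_def fun_eq_iff fun_app fscale_apply coeffs_inf_add coeffs_inf_scale)
  then show ?thesis
    by (simp add: Eo_iff lin_fam_def coeffs_Y_Eo(1)[OF assms] sg_add sg_scale s fun_app fscale_apply)
qed

section \<open>Goodness passes to products\<close>

definition prods :: "('w \<Rightarrow> 'w fls) set \<Rightarrow> ('w \<Rightarrow> 'w fls) set" where
  "prods A = {Y_Eo sc a b $$ m |a b m. a \<in> A \<and> b \<in> A}"

text \<open>The truncation at \<open>- int k\<close> is uniform in \<open>w\<close> and in the third
  exponent. It gives the induction in \<open>merge\<close> its starting point.\<close>

lemma sgA_pr3_left:
  assumes "a \<in> Eo sc" "b \<in> Eo sc" "compat2 k a b"
  shows "singA (pr3 a b c)" "sgA m (pr3 a b c) = pr2 (Y_Eo sc a b $$ m) c"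
    "m < - int k \<Longrightarrow> sgA m (pr3 a b c) = 0"
proof -
  have *: "(\<lambda>m n. pr3 a b c w m n r) = pr2 a b (coeffs_inf c w r)" for w r
    by (simp add: pr3_def pr2_def)
  have k: "bnd2 ((dl ^^ k) (pr2 a b w))" for w using assms(3) by (simp add: compat2_def)
  show "singA (pr3 a b c)" unfolding singA_def * sing_def using k by blast
  show "sgA m (pr3 a b c) = pr2 (Y_Eo sc a b $$ m) c"
    unfolding sgA_def * by (simp add: pr2_def[of "Y_Eo sc a b $$ m"] coeffs_Y_Eo(1)[OF assms])
  show "m < - int k \<Longrightarrow> sgA m (pr3 a b c) = 0"
    unfolding sgA_def * by (simp add: sg_neg[OF k] fun_eq_iff fun_app)
qed

text \<open>The exponents are permuted because the substitution concerns the first two variables: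
  these belong to \<open>a\<close> and \<open>b\<close>, while \<open>c\<close> stands at the left
  with the third. As \<open>c\<close> acts coefficientwise, it can be pulled out of the
  substitution.\<close>

lemma sgA_pr3_right:
  assumes "a \<in> Eo sc" "b \<in> Eo sc" "compat2 k a b" and c: "c \<in> Eo sc"
  defines "F \<equiv> \<lambda>w m n r. pr3 c a b w r m n"
  shows "singA F" "sgA m F = flipw (pr2 c (Y_Eo sc a b $$ m))" "m < - int k \<Longrightarrow> sgA m F = 0"
proof -
  have *: "(\<lambda>m n. F w m n r) = (\<lambda>m n. coeffs_inf c (pr2 a b w m n) r)" for w r
    by (simp add: pr3_def pr2_def F_def)
  have k: "bnd2 ((dl ^^ k) (pr2 a b w))" for w using assms(3) by (simp add: compat2_def)
  then have s: "sing (pr2 a b w)" for w unfolding sing_def by blast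
  have "sing (\<lambda>m n. coeffs_inf c (pr2 a b w m n) r)" for w r
    by (rule sing_map[where \<phi> = "\<lambda>x. coeffs_inf c x r", OF s]) (simp add: coeffs_inf_diff c)
  then show "singA F" unfolding singA_def * by blast
  have 1: "sgA m F w n r = coeffs_inf c (sg m (pr2 a b w) n) r" for m w n r
    unfolding sgA_def *
    by (rule sg_map[where \<phi> = "\<lambda>x. coeffs_inf c x r", OF s]) (simp_all add: coeffs_inf_add coeffs_inf_scale c)
  show "sgA m F = flipw (pr2 c (Y_Eo sc a b $$ m))"
    by (simp add: fun_eq_iff 1 flipw_def flip2_def pr2_def[of c] coeffs_Y_Eo(1)[OF assms(1-3)])
  show "m < - int k \<Longrightarrow> sgA m F = 0"
    using c by (simp add: 1 fun_eq_iff fun_app sg_neg[OF k])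
qed

text \<open>Moving a factor past the two others gives polynomial multiples of both \<open>x\<^sub>1 - x\<^sub>3\<close> and \<open>x\<^sub>2 - x\<^sub>3\<close>.\<close>

lemma move_left:
  assumes AB: "good_rel sc A B" and a: "a \<in> A" and b: "b \<in> A" and c: "c \<in> B"
  shows "\<exists>p q. p \<noteq> 0 \<and> q \<noteq> 0 \<and> pact s4 E13 p (pact s4 E23 q (pr3 a b c)) \<in>
    nmod s4 {E13, E23} {\<lambda>w m n r. pr3 c a b w r m n |a b c. a \<in> A \<and> b \<in> A \<and> c \<in> B}" (is "\<exists>p q. _ \<and> _ \<and> _ \<in> ?M")
proof -
  have aE: "a \<in> Eo sc" using good_relD[OF AB a c] by blast
  define \<Phi> where "\<Phi> X = (\<lambda>w m n r. coeffs_inf a (X w n r) m)" for X :: "'w \<Rightarrow> int \<Rightarrow> int \<Rightarrow> 'w"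
  have \<Phi>: "\<Phi> (X + Y) = \<Phi> X + \<Phi> Y" "\<Phi> (s3 e X) = s4 e (\<Phi> X)" "\<Phi> (D X) = E23 (\<Phi> X)" for X Y e
    using aE by (simp_all add: \<Phi>_def fun_eq_iff fun_app fscale_apply o_apply coeffs_inf_add coeffs_inf_scale coeffs_inf_diff e23_def dl_def)
  have \<Phi>0: "\<Phi> 0 = 0" using \<Phi>(1)[of 0 0] by simp
  \<comment> \<open>After \<open>b\<close> and \<open>c\<close> are exchanged, each term has some
    \<open>u\<close> with the variable x3 next to \<open>a\<close>. The second exchange costs a
    polynomial in x1 - x3 that depends on the term, hence the products of polynomials for
    sums.\<close>
  have main: "\<exists>p. p \<noteq> 0 \<and> pact s4 E13 p (\<Phi> X) \<in> ?M"
    if "X \<in> nmod s3 {D} {flipw (pr2 u v) |u v. u \<in> B \<and> v \<in> A}" for X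
    using that
  proof (induction rule: nmod_induct1)
    case (base X)
    then obtain u v where X: "X = flipw (pr2 u v)" and u: "u \<in> B" and v: "v \<in> A" by blast
    obtain p where p: "p \<noteq> 0" "pact s3 D p (pr2 a u) \<in> nmod s3 {D} {flipw (pr2 u v) |u v. u \<in> B \<and> v \<in> A}"
      using good_relD(4)[OF AB a u] by blast
    \<comment> \<open>\<open>v\<close> stays at the right with the second variable, while the
      exchange takes place in the variables 1 and 3.\<close>
    define \<Psi> where "\<Psi> X = (\<lambda>w m n r. X (coeffs_inf v w n) m r)" for X :: "'w \<Rightarrow> int \<Rightarrow> int \<Rightarrow> 'w"
    have \<Psi>: "\<Psi> (X + Y) = \<Psi> X + \<Psi> Y" "\<Psi> (s3 e X) = s4 e (\<Psi> X)" "\<Psi> (D X) = E13 (\<Psi> X)" for X Y e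
      by (simp_all add: \<Psi>_def fun_eq_iff fun_app fscale_apply o_apply e13_def dl_def)
    have "\<Phi> X = \<Psi> (pr2 a u)"
      by (simp add: \<Phi>_def \<Psi>_def X flipw_def flip2_def pr2_def)
    then have "pact s4 E13 p (\<Phi> X) = \<Psi> (pact s3 D p (pr2 a u))"
      using D.pact_commute[of \<Psi> s4 E13 p, OF \<Psi>] E.E1.linear_endo_axioms by simp
    also have "\<dots> \<in> ?M"
    proof (rule nmod_map[where L = \<Psi> and T = D and s = s3 and s' = s4 and T' = E13
          and B = "{flipw (pr2 u v) |u v. u \<in> B \<and> v \<in> A}"])
      fix x assume "x \<in> {flipw (pr2 u v) |u v. u \<in> B \<and> v \<in> A}"
      then obtain u' v' where x: "x = flipw (pr2 u' v')" "u' \<in> B" "v' \<in> A" by blast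
      have "\<Psi> x = (\<lambda>w m n r. pr3 u' v' v w r m n)"
        by (simp add: \<Psi>_def x flipw_def flip2_def pr2_def pr3_def)
      then show "\<Psi> x \<in> ?M" using x v by (intro nmod_base) blast
    qed (use p(2) in \<open>simp_all add: \<Psi>\<close>)
    finally show ?case using p(1) by blast
  next
    case zero
    show ?case by (rule exI[of _ 1]) (simp add: \<Phi>0 nmod_0)
  next
    case (add X Y)
    then obtain p q where p: "p \<noteq> 0" "pact s4 E13 p (\<Phi> X) \<in> ?M" and q: "q \<noteq> 0" "pact s4 E13 q (\<Phi> Y) \<in> ?M" by blast
    have "pact s4 E13 (p * q) (\<Phi> (X + Y)) = pact s4 E13 q (pact s4 E13 p (\<Phi> X)) + pact s4 E13 p (pact s4 E13 q (\<Phi> Y))"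
      by (simp only: \<Phi> E.E1.pact_add_right E.E1.pact_mult[symmetric] mult.commute)
    also have "\<dots> \<in> ?M" by (rule nmod_add; rule E.E1.nmod_pact) (use p q in auto)
    finally show ?case using p q by (intro exI[of _ "p * q"]) auto
  next
    case (scale X e)
    then obtain p where p: "p \<noteq> 0" "pact s4 E13 p (\<Phi> X) \<in> ?M" by blast
    then show ?case by (intro exI[of _ p]) (simp add: \<Phi> E.E1.pact_scale_right nmod_scale)
  next
    case (endo X)
    then obtain p where p: "p \<noteq> 0" "pact s4 E13 p (\<Phi> X) \<in> ?M" by blast
    then show ?case
      by (intro exI[of _ p]) (simp only: \<Phi> E.T12_pact[symmetric], auto intro: nmod_op[where T = E23])
  qed
  obtain q where q: "q \<noteq> 0" "pact s3 D q (pr2 b c) \<in> nmod s3 {D} {flipw (pr2 u v) |u v. u \<in> B \<and> v \<in> A}"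
    using good_relD(4)[OF AB b c] by blast
  have "\<Phi> (pact s3 D q (pr2 b c)) = pact s4 E23 q (\<Phi> (pr2 b c))"
    by (rule D.pact_commute[where L = \<Phi>]) (simp_all add: \<Phi> E.E2.linear_endo_axioms)
  moreover have "\<Phi> (pr2 b c) = pr3 a b c" by (simp add: \<Phi>_def pr2_def pr3_def)
  ultimately show ?thesis using main[OF q(2)] q(1) by auto
qed

text \<open>Mirror image of \<open>move_left\<close>: \<open>c\<close> starts at the left with the
  third variable and passes first \<open>a\<close>, then \<open>b\<close>.\<close>

lemma move_right:
  assumes CA: "good_rel sc C A" and A: "A \<subseteq> Eo sc" and c: "c \<in> C" and a: "a \<in> A" and b: "b \<in> A"
  shows "\<exists>p q. p \<noteq> 0 \<and> q \<noteq> 0 \<and> pact s4 E13 p (pact s4 E23 q (\<lambda>w m n r. pr3 c a b w r m n)) \<in>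
    nmod s4 {E13, E23} {pr3 a b c |a b c. a \<in> A \<and> b \<in> A \<and> c \<in> C}" (is "\<exists>p q. _ \<and> _ \<and> _ \<in> ?M")
proof -
  define \<Psi> where "\<Psi> X = (\<lambda>w m n r. X (coeffs_inf b w n) m r)" for X :: "'w \<Rightarrow> int \<Rightarrow> int \<Rightarrow> 'w"
  have \<Psi>: "\<Psi> (X + Y) = \<Psi> X + \<Psi> Y" "\<Psi> (s3 e X) = s4 e (\<Psi> X)" "\<Psi> (D X) = E13 (\<Psi> X)" for X Y e
    by (simp_all add: \<Psi>_def fun_eq_iff fun_app fscale_apply o_apply e13_def dl_def)
  have \<Psi>0: "\<Psi> 0 = 0" using \<Psi>(1)[of 0 0] by simp
  have main: "\<exists>q. q \<noteq> 0 \<and> pact s4 E23 q (\<Psi> X) \<in> ?M"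
    if "X \<in> nmod s3 {D} {pr2 u v |u v. u \<in> A \<and> v \<in> C}" for X
    using that
  proof (induction rule: nmod_induct1)
    case (base X)
    then obtain u v where X: "X = pr2 u v" and u: "u \<in> A" and v: "v \<in> C" by blast
    have uE: "u \<in> Eo sc" using A u by blast
    define \<Phi> where "\<Phi> X = (\<lambda>w m n r. coeffs_inf u (X w n r) m)" for X :: "'w \<Rightarrow> int \<Rightarrow> int \<Rightarrow> 'w"
    have \<Phi>: "\<Phi> (X + Y) = \<Phi> X + \<Phi> Y" "\<Phi> (s3 e X) = s4 e (\<Phi> X)" "\<Phi> (D X) = E23 (\<Phi> X)" for X Y e
      using uE by (simp_all add: \<Phi>_def fun_eq_iff fun_app fscale_apply o_apply coeffs_inf_add coeffs_inf_scale coeffs_inf_diff e23_def dl_def)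
    obtain q where q: "q \<noteq> 0" "pact s3 D q (flipw (pr2 v b)) \<in> nmod s3 {D} {pr2 u v |u v. u \<in> A \<and> v \<in> C}"
      using good_relD(5)[OF CA v b] by blast
    have "\<Psi> X = \<Phi> (flipw (pr2 v b))"
      by (simp add: \<Phi>_def \<Psi>_def X flipw_def flip2_def pr2_def)
    then have "pact s4 E23 q (\<Psi> X) = \<Phi> (pact s3 D q (flipw (pr2 v b)))"
      using D.pact_commute[of \<Phi> s4 E23 q, OF \<Phi>] E.E2.linear_endo_axioms by simp
    also have "\<dots> \<in> ?M"
    proof (rule nmod_map[where L = \<Phi> and T = D and s = s3 and s' = s4 and T' = E23
          and B = "{pr2 u v |u v. u \<in> A \<and> v \<in> C}"])
      fix x assume "x \<in> {pr2 u v |u v. u \<in> A \<and> v \<in> C}"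
      then obtain u' v' where x: "x = pr2 u' v'" "u' \<in> A" "v' \<in> C" by blast
      have "\<Phi> x = pr3 u u' v'"
        by (simp add: \<Phi>_def x pr2_def pr3_def)
      then show "\<Phi> x \<in> ?M" using x u by (intro nmod_base) blast
    qed (use q(2) in \<open>simp_all add: \<Phi>\<close>)
    finally show ?case using q(1) by blast
  next
    case zero
    show ?case by (rule exI[of _ 1]) (simp add: \<Psi>0 nmod_0)
  next
    case (add X Y)
    then obtain p q where p: "p \<noteq> 0" "pact s4 E23 p (\<Psi> X) \<in> ?M" and q: "q \<noteq> 0" "pact s4 E23 q (\<Psi> Y) \<in> ?M" by blast
    have "pact s4 E23 (p * q) (\<Psi> (X + Y)) = pact s4 E23 q (pact s4 E23 p (\<Psi> X)) + pact s4 E23 p (pact s4 E23 q (\<Psi> Y))"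
      by (simp only: \<Psi> E.E2.pact_add_right E.E2.pact_mult[symmetric] mult.commute)
    also have "\<dots> \<in> ?M" by (rule nmod_add; rule E.E2.nmod_pact) (use p q in auto)
    finally show ?case using p q by (intro exI[of _ "p * q"]) auto
  next
    case (scale X e)
    then obtain p where p: "p \<noteq> 0" "pact s4 E23 p (\<Psi> X) \<in> ?M" by blast
    then show ?case by (intro exI[of _ p]) (simp add: \<Psi> E.E2.pact_scale_right nmod_scale)
  next
    case (endo X)
    then obtain p where p: "p \<noteq> 0" "pact s4 E23 p (\<Psi> X) \<in> ?M" by blast
    have "pact s4 E23 p (E13 (\<Psi> X)) = E13 (pact s4 E23 p (\<Psi> X))"
      by (rule E.E2.pact_commute[symmetric]) (auto simp: E.E1.T_add E.E1.T_scale E.T12 E.E2.linear_endo_axioms)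
    with p show ?case
      by (intro exI[of _ p]) (simp only: \<Psi>, auto intro: nmod_op[where T = E13])
  qed
  obtain p where p: "p \<noteq> 0" "pact s3 D p (flipw (pr2 c a)) \<in> nmod s3 {D} {pr2 u v |u v. u \<in> A \<and> v \<in> C}"
    using good_relD(5)[OF CA c a] by blast
  have 1: "\<Psi> (pact s3 D p (flipw (pr2 c a))) = pact s4 E13 p (\<Psi> (flipw (pr2 c a)))"
    by (rule D.pact_commute[where L = \<Psi>]) (simp_all add: \<Psi> E.E1.linear_endo_axioms)
  have 2: "\<Psi> (flipw (pr2 c a)) = (\<lambda>w m n r. pr3 c a b w r m n)"
    by (simp add: \<Psi>_def flipw_def flip2_def pr2_def pr3_def)
  obtain q where q: "q \<noteq> 0" "pact s4 E23 q (\<Psi> (pact s3 D p (flipw (pr2 c a)))) \<in> ?M" using main[OF p(2)] by blast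
  have "pact s4 E23 q (pact s4 E13 p F) = pact s4 E13 p (pact s4 E23 q F)" for F
    by (rule E.E1.pact_commute[where L = "pact s4 E23 q"])
      (auto simp: E.E2.pact_add_right E.E2.pact_scale_right E.E1.linear_endo_axioms
        intro!: E.E2.pact_commute[symmetric] simp: E.E1.T_add E.E1.T_scale E.T12 E.E2.linear_endo_axioms)
  with p q show ?thesis unfolding 1 2 by auto
qed

text \<open>With the further factor (x1 - x2)^k the series is bounded, and the substitution keeps it
  bounded. That factor becomes x0^k and merely shifts \<open>m\<close> by \<open>k\<close>.\<close>

lemma sgA_bounded:
  assumes "\<And>w. bnd3 ((e12 ^^ k) ((e13 ^^ k) ((e23 ^^ k) (F w))))" and F: "singA F"
  shows "sgA m (pact s4 E13 ([:0, 1:] ^ k) (pact s4 E23 ([:0, 1:] ^ k) F)) \<in> {X. \<forall>w. bnd2 (X w)}"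
proof -
  define G where "G = (E12 ^^ k) ((E13 ^^ k) ((E23 ^^ k) F))"
  have ptw: "(E12 ^^ k) H w = (e12 ^^ k) (H w)" "(E13 ^^ k) H w = (e13 ^^ k) (H w)" "(E23 ^^ k) H w = (e23 ^^ k) (H w)" for H w
    by (rule funpow_intertwine[where L = "\<lambda>F. F w"], simp add: o_apply)+
  have G: "bnd3 (G w)" for w using assms(1)[of w] by (simp add: G_def ptw)
  have s: "singA ((E13 ^^ k) H)" "singA ((E23 ^^ k) H)" if "singA H" for H
    using that by (induction k) (simp_all add: singA_E13 singA_E23 o_def[of "E13"] o_def[of E23])
  have E: "singA H \<Longrightarrow> singA ((E12 ^^ l) H) \<and> sgA m ((E12 ^^ l) H) = sgA (m - int l) H" for l H m
    by (induction l arbitrary: m) (simp_all add: singA_E12 sgA_E12 o_apply[of "E12"] algebra_simps)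
  have "sgA m (pact s4 E13 ([:0, 1:] ^ k) (pact s4 E23 ([:0, 1:] ^ k) F)) = sgA (m + int k) G"
    using E[OF s(1)[OF s(2)[OF F]], where m = "m + int k" and l = k] by (simp add: G_def E.E1.pact_X_power E.E2.pact_X_power)
  also have "\<dots> \<in> {X. \<forall>w. bnd2 (X w)}"
  proof (intro CollectI allI)
    fix w
    obtain N where N: "\<And>m n r. G w m n r \<noteq> 0 \<Longrightarrow> m \<le> N \<and> n \<le> N \<and> r \<le> N"
      using G[of w] unfolding bnd3_def by blast
    have b: "bnd2 (\<lambda>m n. G w m n r)" for r
      by (rule bnd2I[of _ N]) (use N in blast)
    define j where "j = m + int k"
    have "n \<le> max N (2 * N - j) \<and> r \<le> max N (2 * N - j)" if nz: "sgA j G w n r \<noteq> 0" for n r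
    proof -
      have nz': "S j (\<lambda>m n. G w m n r) n \<noteq> 0" using nz by (simp add: sgA_def sg_bnd2[OF b])
      have "n \<le> 2 * N - j" by (rule S_bounded[OF _ nz']) (use N in blast)
      moreover have "r \<le> N"
      proof (rule ccontr)
        assume "\<not> r \<le> N"
        then have "G w m n r = 0" for m n using N[of m n r] by blast
        then show False using nz' by (simp add: S_def)
      qed
      ultimately show ?thesis by auto
    qed
    then show "bnd2 (sgA (m + int k) G w)" unfolding j_def by (rule bnd2I)
  qed
  finally show ?thesis .
qed

lemma bnd_submodule:
  fixes x y :: "'w \<Rightarrow> int \<Rightarrow> int \<Rightarrow> 'w"
  shows "0 \<in> {X :: 'w \<Rightarrow> int \<Rightarrow> int \<Rightarrow> 'w. \<forall>w. bnd2 (X w)}"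
  "x \<in> {X. \<forall>w. bnd2 (X w)} \<Longrightarrow> y \<in> {X. \<forall>w. bnd2 (X w)} \<Longrightarrow> x + y \<in> {X. \<forall>w. bnd2 (X w)}"
  "x \<in> {X. \<forall>w. bnd2 (X w)} \<Longrightarrow> s3 c x \<in> {X. \<forall>w. bnd2 (X w)}"
  "x \<in> {X. \<forall>w. bnd2 (X w)} \<Longrightarrow> D x \<in> {X. \<forall>w. bnd2 (X w)}"
  using bnd2_0 bnd2_map[where \<phi> = "sc c"] by (auto simp: zero_fun_def plus_fun_def[of x y] bnd2_add fscale_def o_apply bnd2_dl)

text \<open>\<open>merge\<close> for the submodule of bounded series. Both polynomials are powers of
  the variable, so the result is a power of the difference, as compatibility requires.\<close>

lemma bnd_merge:
  assumes F: "singA F" "\<And>m. m < - int e \<Longrightarrow> sgA m F = 0"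
    and "\<exists>k. \<forall>w. bnd3 ((e12 ^^ k) ((e13 ^^ k) ((e23 ^^ k) (F w))))"
  shows "\<exists>k. \<forall>w. bnd2 ((dl ^^ k) (sgA m F w))"
proof -
  obtain k where k: "\<And>w. bnd3 ((e12 ^^ k) ((e13 ^^ k) ((e23 ^^ k) (F w))))" using assms(3) by blast
  from merge[OF bnd_submodule F sgA_bounded[OF k F(1)]]
  obtain l where "pact s3 D (([:0, 1:] ^ k * [:0, 1:] ^ k) ^ l) (sgA m F) \<in> {X. \<forall>w. bnd2 (X w)}" by blast
  moreover have "([:0, 1:] ^ k * [:0, 1:] ^ k) ^ l = ([:0, 1:] :: complex poly) ^ ((k + k) * l)"
    by (simp add: power_mult power_add)
  moreover have "(D ^^ l) H w = (dl ^^ l) (H w)" for l H w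
    by (rule funpow_intertwine[where L = "\<lambda>F. F w"]) (simp add: o_apply)
  ultimately show ?thesis by (auto simp: D.pact_X_power)
qed

lemma nmod_merge:
  assumes F: "singA F" "\<And>m. m < - int e \<Longrightarrow> sgA m F = 0"
    and pq: "\<exists>p q. p \<noteq> 0 \<and> q \<noteq> 0 \<and> pact s4 E13 p (pact s4 E23 q F) \<in> nmod s4 {E13, E23} B"
    and B: "\<And>x. x \<in> B \<Longrightarrow> singA x \<and> (\<forall>m. sgA m x \<in> B')"
  shows "\<exists>q. q \<noteq> 0 \<and> pact s3 D q (sgA m F) \<in> nmod s3 {D} B'"
proof -
  obtain p q where p: "p \<noteq> 0" "q \<noteq> 0" "pact s4 E13 p (pact s4 E23 q F) \<in> nmod s4 {E13, E23} B"
    using pq by blast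
  \<comment> \<open>All \<open>m\<close> are treated together, since multiplication by x1 - x3 mixes
    the coefficients at \<open>m\<close> and \<open>m - 1\<close>.\<close>
  have *: "singA x \<and> (\<forall>m. sgA m x \<in> nmod s3 {D} B')" if "x \<in> nmod s4 {E13, E23} B" for x
    using that
  proof (induction rule: nmod_induct2)
    case (base x)
    then show ?case using B by (auto intro: nmod_base)
  next
    case zero
    show ?case by (simp add: singA_zero sgA_zero nmod_0)
  next
    case (add x y)
    then show ?case by (simp add: singA_add sgA_add nmod_add)
  next
    case (scale x c)
    then show ?case by (simp add: singA_scale sgA_scale nmod_scale)
  next
    case (endo1 x)
    then show ?case by (simp add: singA_E13 sgA_E13 nmod_submodule)
  next
    case (endo2 x)
    then show ?case by (simp add: singA_E23 sgA_E23 nmod_submodule)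
  qed
  from merge[OF nmod_submodule F, where p = p and q = q] *[OF p(3)]
  obtain k where "pact s3 D ((q * p) ^ k) (sgA m F) \<in> nmod s3 {D} B'" by blast
  moreover have "(q * p) ^ k \<noteq> 0" using p by simp
  ultimately show ?thesis by blast
qed

lemma good_relI:
  assumes "A \<subseteq> Eo sc" "B \<subseteq> Eo sc"
    and "\<And>a b. a \<in> A \<Longrightarrow> b \<in> B \<Longrightarrow> \<exists>k. compat2 k a b"
    and "\<And>a b. a \<in> A \<Longrightarrow> b \<in> B \<Longrightarrow> \<exists>q. q \<noteq> 0 \<and> pact s3 D q (pr2 a b) \<in> nmod s3 {D} {flipw (pr2 u v) |u v. u \<in> B \<and> v \<in> A}"
  shows "good_rel sc A B"
  unfolding good_rel_def using assms by (simp add: flipw_def)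

text \<open>Both properties come from a(x1)b(x2)c(x3). Moving \<open>c\<close> to the left leaves a
  pair from \<open>A\<close> with the variables x1, x2 on the other side as well, so that x1 = x2 +
  x0 produces products on both sides.\<close>

lemma good_rel_prods_left:
  assumes A: "good_rel sc A A"
  shows "good_rel sc (prods A) A"
proof (rule good_relI)
  have AE: "A \<subseteq> Eo sc" using A by (simp add: good_rel_def)
  then show "A \<subseteq> Eo sc" .
  show "prods A \<subseteq> Eo sc"
    using good_relD(1-3)[OF A] Y_coeff_Eo unfolding prods_def by blast
  fix x c assume "x \<in> prods A" and c: "c \<in> A"
  then obtain a b m where x: "x = Y_Eo sc a b $$ m" and a: "a \<in> A" and b: "b \<in> A" unfolding prods_def by blast
  have E: "a \<in> Eo sc" "b \<in> Eo sc" "c \<in> Eo sc" using a b c AE by auto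
  obtain k where k: "compat2 k a b" using good_relD(3)[OF A a b] by blast
  note F = sgA_pr3_left[OF E(1,2) k]
  show "\<exists>k. compat2 k x c"
    using bnd_merge[OF F(1) F(3) triple_compat[OF A A a b c], where m = m] by (simp add: F(2) x compat2_def)
  have "\<exists>q. q \<noteq> 0 \<and> pact s3 D q (sgA m (pr3 a b c)) \<in> nmod s3 {D} {flipw (pr2 u v) |u v. u \<in> A \<and> v \<in> prods A}"
  proof (rule nmod_merge[OF F(1) F(3) move_left[OF A a b c]])
    fix X assume "X \<in> {\<lambda>w m n r. pr3 c a b w r m n |a b c. a \<in> A \<and> b \<in> A \<and> c \<in> A}"
    then obtain a' b' c' where X: "X = (\<lambda>w m n r. pr3 c' a' b' w r m n)" and abc: "a' \<in> A" "b' \<in> A" "c' \<in> A" by blast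
    obtain k' where "compat2 k' a' b'" using good_relD(3)[OF A] abc by blast
    moreover have "a' \<in> Eo sc" "b' \<in> Eo sc" "c' \<in> Eo sc" using abc AE by auto
    ultimately have F': "singA X" "\<And>m. sgA m X = flipw (pr2 c' (Y_Eo sc a' b' $$ m))"
      unfolding X using sgA_pr3_right by blast+
    have "Y_Eo sc a' b' $$ m \<in> prods A" for m unfolding prods_def using abc by blast
    then show "singA X \<and> (\<forall>m. sgA m X \<in> {flipw (pr2 u v) |u v. u \<in> A \<and> v \<in> prods A})"
      using F' abc by blast
  qed
  then show "\<exists>q. q \<noteq> 0 \<and> pact s3 D q (pr2 x c) \<in> nmod s3 {D} {flipw (pr2 u v) |u v. u \<in> A \<and> v \<in> prods A}"
    by (simp add: F(2) x)
qed

lemma good_rel_prods_right: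
  assumes CA: "good_rel sc C A" and A: "good_rel sc A A"
  shows "good_rel sc C (prods A)"
proof (rule good_relI)
  have AE: "A \<subseteq> Eo sc" using A by (simp add: good_rel_def)
  show CE: "C \<subseteq> Eo sc" using CA by (simp add: good_rel_def)
  show "prods A \<subseteq> Eo sc"
    using good_relD(1-3)[OF A] Y_coeff_Eo unfolding prods_def by blast
  fix c x assume "x \<in> prods A" and c: "c \<in> C"
  then obtain a b m where x: "x = Y_Eo sc a b $$ m" and a: "a \<in> A" and b: "b \<in> A" unfolding prods_def by blast
  have E: "a \<in> Eo sc" "b \<in> Eo sc" "c \<in> Eo sc" using a b c AE CE by auto
  obtain k where k: "compat2 k a b" using good_relD(3)[OF A a b] by blast
  define F where "F = (\<lambda>w m n r. pr3 c a b w r m n)"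
  note F = sgA_pr3_right[OF E(1,2) k E(3), folded F_def]
  \<comment> \<open>\<open>triple_compat\<close> has the variables in the order \<open>c\<close>,
    \<open>a\<close>, \<open>b\<close>. The cyclic renaming permutes the three differences up to
    sign.\<close>
  have rot: "(e12 ^^ k) ((e13 ^^ k) ((e23 ^^ k) (\<lambda>m n r. G r m n))) =
      (\<lambda>m n r. ((\<lambda>H. - e12 H) ^^ k) (((\<lambda>H. - e13 H) ^^ k) ((e23 ^^ k) G)) r m n)" for k and G :: "int \<Rightarrow> int \<Rightarrow> int \<Rightarrow> 'w"
  proof -
    define L :: "(int \<Rightarrow> int \<Rightarrow> int \<Rightarrow> 'w) \<Rightarrow> int \<Rightarrow> int \<Rightarrow> int \<Rightarrow> 'w" where "L G = (\<lambda>m n r. G r m n)" for G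
    have "L ((e23 ^^ k) G) = (e12 ^^ k) (L G)" for G
      by (rule funpow_intertwine[where L = L]) (simp add: L_def e_defs)
    moreover have "L (((\<lambda>H. - e12 H) ^^ k) G) = (e13 ^^ k) (L G)" for G
      by (rule funpow_intertwine[where L = L]) (simp add: L_def e_defs fun_eq_iff)
    moreover have "L (((\<lambda>H. - e13 H) ^^ k) G) = (e23 ^^ k) (L G)" for G
      by (rule funpow_intertwine[where L = L]) (simp add: L_def e_defs fun_eq_iff)
    ultimately have "L (((\<lambda>H. - e12 H) ^^ k) (((\<lambda>H. - e13 H) ^^ k) ((e23 ^^ k) G))) =
        (e13 ^^ k) ((e23 ^^ k) ((e12 ^^ k) (L G)))"
      by simp
    also have "\<dots> = (e12 ^^ k) ((e13 ^^ k) ((e23 ^^ k) (L G)))"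
      by (simp add: e_pow_pow_commute)
    finally show ?thesis by (simp add: L_def)
  qed
  have triple: "\<exists>k. \<forall>w. bnd3 ((e12 ^^ k) ((e13 ^^ k) ((e23 ^^ k) (F w))))"
  proof -
    obtain k where k: "\<And>w. bnd3 ((e12 ^^ k) ((e13 ^^ k) ((e23 ^^ k) (pr3 c a b w))))"
      using triple_compat[OF CA A c a b] by blast
    have "bnd3 ((e12 ^^ k) ((e13 ^^ k) ((e23 ^^ k) (F w))))" for w
    proof -
      \<comment> \<open>Signs do not change the support, and boundedness depends on nothing
        else.\<close>
      have neg: "((\<lambda>H. - e12 H) ^^ k) (((\<lambda>H. - e13 H) ^^ k) H) = (e12 ^^ k) ((e13 ^^ k) H) \<or>
          ((\<lambda>H. - e12 H) ^^ k) (((\<lambda>H. - e13 H) ^^ k) H) = - (e12 ^^ k) ((e13 ^^ k) H)"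
        for H :: "int \<Rightarrow> int \<Rightarrow> int \<Rightarrow> 'w"
      proof -
        have m: "e12 (- H) = - e12 H" "e13 (- H) = - e13 H" for H :: "int \<Rightarrow> int \<Rightarrow> int \<Rightarrow> 'w"
          by (simp_all add: e_defs fun_eq_iff)
        have mp: "(e12 ^^ k) (- H) = - (e12 ^^ k) H" for H :: "int \<Rightarrow> int \<Rightarrow> int \<Rightarrow> 'w"
          by (induction k) (simp_all add: m o_apply del: uminus_apply)
        have pm: "((\<lambda>H. - e12 H) ^^ k) H = (e12 ^^ k) H \<or> ((\<lambda>H. - e12 H) ^^ k) H = - (e12 ^^ k) H"
          "((\<lambda>H. - e13 H) ^^ k) H = (e13 ^^ k) H \<or> ((\<lambda>H. - e13 H) ^^ k) H = - (e13 ^^ k) H"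
          for H :: "int \<Rightarrow> int \<Rightarrow> int \<Rightarrow> 'w"
          by (induction k) (auto simp: m o_apply simp del: uminus_apply)
        show ?thesis
          using pm(2)[of H] pm(1)[of "((\<lambda>H. - e13 H) ^^ k) H"]
          by (elim disjE) (simp_all add: mp del: uminus_apply)
      qed
      obtain N where N: "\<And>m n r. (e12 ^^ k) ((e13 ^^ k) ((e23 ^^ k) (pr3 c a b w))) m n r \<noteq> 0 \<Longrightarrow> m \<le> N \<and> n \<le> N \<and> r \<le> N"
        using k[of w] unfolding bnd3_def by blast
      have "(e12 ^^ k) ((e13 ^^ k) ((e23 ^^ k) (pr3 c a b w))) r m n \<noteq> 0"
        if "(e12 ^^ k) ((e13 ^^ k) ((e23 ^^ k) (F w))) m n r \<noteq> 0" for m n r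
        using that neg[of "(e23 ^^ k) (pr3 c a b w)"] unfolding F_def rot by auto
      with N show ?thesis unfolding bnd3_def by blast
    qed
    then show ?thesis by blast
  qed
  have flip: "(dl ^^ k) (flip2 G) = flip2 (((\<lambda>H. - dl H) ^^ k) G)" for k and G :: "int \<Rightarrow> int \<Rightarrow> 'w"
    by (rule funpow_intertwine[where L = flip2, symmetric]) (simp add: flip2_def dl_def fun_eq_iff)
  show "\<exists>k. compat2 k c x"
  proof -
    obtain k where k: "\<And>w. bnd2 ((dl ^^ k) (flip2 (pr2 c x w)))"
      using bnd_merge[OF F(1) F(3) triple, where m = m] by (auto simp: F(2) x flipw_def)
    have neg: "((\<lambda>H. - dl H) ^^ k) G = (dl ^^ k) G \<or> ((\<lambda>H. - dl H) ^^ k) G = - (dl ^^ k) G"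
      for G :: "int \<Rightarrow> int \<Rightarrow> 'w"
    proof -
      have m: "dl (- H) = - dl H" for H :: "int \<Rightarrow> int \<Rightarrow> 'w" by (simp add: dl_def fun_eq_iff)
      show ?thesis by (induction k) (auto simp: m o_apply simp del: uminus_apply)
    qed
    have "bnd2 ((dl ^^ k) (pr2 c x w))" for w
    proof -
      obtain N where N: "\<And>m n. (dl ^^ k) (flip2 (pr2 c x w)) m n \<noteq> 0 \<Longrightarrow> m \<le> N \<and> n \<le> N"
        using k[of w] unfolding bnd2_def by blast
      have "(dl ^^ k) (flip2 (pr2 c x w)) n m \<noteq> 0" if "(dl ^^ k) (pr2 c x w) m n \<noteq> 0" for m n
        using that neg[of "pr2 c x w"] unfolding flip by (auto simp: flip2_def)
      with N show ?thesis unfolding bnd2_def by blast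
    qed
    then show ?thesis unfolding compat2_def by blast
  qed
  have "\<exists>q. q \<noteq> 0 \<and> pact s3 D q (sgA m F) \<in> nmod s3 {D} {pr2 u v |u v. u \<in> prods A \<and> v \<in> C}"
  proof (rule nmod_merge[OF F(1) F(3)])
    show "\<exists>p q. p \<noteq> 0 \<and> q \<noteq> 0 \<and> pact s4 E13 p (pact s4 E23 q F) \<in> nmod s4 {E13, E23} {pr3 a b c |a b c. a \<in> A \<and> b \<in> A \<and> c \<in> C}"
      unfolding F_def by (rule move_right[OF CA AE c a b])
    fix X assume "X \<in> {pr3 a b c |a b c. a \<in> A \<and> b \<in> A \<and> c \<in> C}"
    then obtain a' b' c' where X: "X = pr3 a' b' c'" and abc: "a' \<in> A" "b' \<in> A" "c' \<in> C" by blast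
    obtain k' where "compat2 k' a' b'" using good_relD(3)[OF A] abc by blast
    moreover have "a' \<in> Eo sc" "b' \<in> Eo sc" using abc AE by auto
    ultimately have F': "singA X" "\<And>m. sgA m X = pr2 (Y_Eo sc a' b' $$ m) c'"
      unfolding X using sgA_pr3_left by blast+
    have "Y_Eo sc a' b' $$ m \<in> prods A" for m unfolding prods_def using abc by blast
    then show "singA X \<and> (\<forall>m. sgA m X \<in> {pr2 u v |u v. u \<in> prods A \<and> v \<in> C})"
      using F' abc by blast
  qed
  then obtain q where q: "q \<noteq> 0" "pact s3 D q (flipw (pr2 c x)) \<in> nmod s3 {D} {pr2 u v |u v. u \<in> prods A \<and> v \<in> C}"
    by (auto simp: F(2) x)
  have "flipw ` {pr2 u v |u v. u \<in> prods A \<and> v \<in> C} = {flipw (pr2 u v) |u v. u \<in> prods A \<and> v \<in> C}"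
    by blast
  with nmod_flipw[OF q(2)] have "pact s3 D (pcompose q [:0, -1:]) (pr2 c x) \<in> nmod s3 {D} {flipw (pr2 u v) |u v. u \<in> prods A \<and> v \<in> C}"
    by (simp add: pact_flipw)
  with pcompose_uminus_nonzero[OF q(1)]
  show "\<exists>q. q \<noteq> 0 \<and> pact s3 D q (pr2 c x) \<in> nmod s3 {D} {flipw (pr2 u v) |u v. u \<in> prods A \<and> v \<in> C}" by blast
qed

text \<open>The relation between \<open>prods A\<close> and \<open>A\<close> is the input for
  enlarging the second set.\<close>

lemma good_rel_prods: "good_rel sc A A \<Longrightarrow> good_rel sc (prods A) (prods A)"
  by (intro good_rel_prods_right good_rel_prods_left)

end

section \<open>Multiplication by series in a difference of variables\<close>

declare uminus_apply [simp del]

context complex_space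
begin

definition sact :: "(int \<Rightarrow> int \<Rightarrow> complex) \<Rightarrow> (int \<Rightarrow> int \<Rightarrow> 'w) \<Rightarrow> int \<Rightarrow> int \<Rightarrow> 'w" where
  "sact C F = (\<lambda>m n. Sum_any (\<lambda>(i, j). sc (C i j) (F (m - i) (n - j))))"

text \<open>\<open>Sum_any\<close> is 0 on an infinite support. Additivity in the scalar series is
  therefore restricted to products in which every coefficient is a finite sum.\<close>

definition sact_fin :: "(int \<Rightarrow> int \<Rightarrow> complex) \<Rightarrow> (int \<Rightarrow> int \<Rightarrow> 'w) \<Rightarrow> bool" where
  "sact_fin C F \<longleftrightarrow> (\<forall>m n. finite {(i, j). C i j \<noteq> 0 \<and> F (m - i) (n - j) \<noteq> 0})"

lemma sact_fin_supp:
  assumes "sact_fin C F"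
  shows "finite {p. (case p of (i, j) \<Rightarrow> sc (C i j) (F (m - i) (n - j))) \<noteq> 0}"
proof -
  have "finite {(i, j). C i j \<noteq> 0 \<and> F (m - i) (n - j) \<noteq> 0}"
    using assms unfolding sact_fin_def by blast
  then show ?thesis by (rule rev_finite_subset) auto
qed

lemma sact_cong_fin:
  assumes "sact_fin C F" "\<And>i j. C' i j = 0 \<or> C i j \<noteq> 0"
  shows "sact_fin C' F"
  unfolding sact_fin_def
proof (intro allI)
  fix m n
  have "{(i, j). C' i j \<noteq> 0 \<and> F (m - i) (n - j) \<noteq> 0} \<subseteq> {(i, j). C i j \<noteq> 0 \<and> F (m - i) (n - j) \<noteq> 0}"
    using assms(2) by blast
  then show "finite {(i, j). C' i j \<noteq> 0 \<and> F (m - i) (n - j) \<noteq> 0}"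
    by (rule finite_subset) (use assms(1) in \<open>simp add: sact_fin_def\<close>)
qed

lemma sact_add:
  assumes "sact_fin C F" "sact_fin C' F"
  shows "sact (\<lambda>i j. C i j + C' i j) F = sact C F + sact C' F"
proof (intro ext)
  fix m n
  have "Sum_any (\<lambda>(i, j). sc (C i j + C' i j) (F (m - i) (n - j))) =
     Sum_any (\<lambda>p. (case p of (i, j) \<Rightarrow> sc (C i j) (F (m - i) (n - j))) + (case p of (i, j) \<Rightarrow> sc (C' i j) (F (m - i) (n - j))))"
    by (rule Sum_any.cong) (auto simp: scale_left_distrib)
  also have "\<dots> = sact C F m n + sact C' F m n"
    unfolding sact_def using sact_fin_supp[OF assms(1)] sact_fin_supp[OF assms(2)] by (rule Sum_any.distrib)
  finally show "sact (\<lambda>i j. C i j + C' i j) F m n = (sact C F + sact C' F) m n"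
    by (simp add: sact_def fun_app)
qed

lemma sact_scale:
  assumes "sact_fin C F"
  shows "sact (\<lambda>i j. c * C i j) F = s2 c (sact C F)"
proof (cases "c = 0")
  case True
  have "sact (\<lambda>i j. 0) F = (\<lambda>m n. 0)" unfolding sact_def
    by (simp add: case_prod_unfold)
  with True show ?thesis by (simp add: fun_eq_iff fscale_apply fun_app)
next
  case False
  show ?thesis
  proof (intro ext)
    fix m n
    let ?f = "\<lambda>(i, j). sc (C i j) (F (m - i) (n - j))"
    let ?A = "{p. ?f p \<noteq> 0}"
    have fin: "finite ?A" by (rule sact_fin_supp) fact
    have "sact (\<lambda>i j. c * C i j) F m n = (\<Sum>p\<in>?A. (case p of (i, j) \<Rightarrow> sc (c * C i j) (F (m - i) (n - j))))"
      unfolding sact_def using False fin by (intro Sum_any.expand_superset) auto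
    also have "\<dots> = (\<Sum>p\<in>?A. sc c (?f p))" by (rule sum.cong) (auto)
    also have "\<dots> = sc c (sact C F m n)"
      by (simp add: sact_def Sum_any.expand_set scale_sum_right)
    finally show "sact (\<lambda>i j. c * C i j) F m n = s2 c (sact C F) m n" by (simp add: fscale_apply)
  qed
qed

lemma sact_sh1: "sh1 (sact C F) = sact (\<lambda>i j. C (i - 1) j) F"
proof (intro ext)
  fix m n
  show "sh1 (sact C F) m n = sact (\<lambda>i j. C (i - 1) j) F m n"
    unfolding sact_def sh1_def
    by (rule Sum_any.reindex_cong[of "\<lambda>(i, j). (i + 1, j)", symmetric])
      (auto simp: bij_def inj_on_def surj_def o_def fun_eq_iff algebra_simps intro: exI[of _ "_ - 1"])
qed

lemma sact_sh2: "sh2 (sact C F) = sact (\<lambda>i j. C i (j - 1)) F"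
proof (intro ext)
  fix m n
  show "sh2 (sact C F) m n = sact (\<lambda>i j. C i (j - 1)) F m n"
    unfolding sact_def sh2_def
    by (rule Sum_any.reindex_cong[of "\<lambda>(i, j). (i, j + 1)", symmetric])
      (auto simp: bij_def inj_on_def surj_def o_def fun_eq_iff algebra_simps intro: exI[of _ "_ - 1"])
qed

lemma sact_fin_shift:
  assumes "sact_fin C F"
  shows "sact_fin (\<lambda>i j. C (i - 1) j) F" "sact_fin (\<lambda>i j. C i (j - 1)) F"
proof -
  have f: "finite {(i, j). C i j \<noteq> 0 \<and> F (m - i) (n - j) \<noteq> 0}" for m n
    using assms unfolding sact_fin_def by blast
  have "{(i, j). C (i - 1) j \<noteq> 0 \<and> F (m - i) (n - j) \<noteq> 0} \<subseteq>
      (\<lambda>(i, j). (i + 1, j)) ` {(i, j). C i j \<noteq> 0 \<and> F (m - 1 - i) (n - j) \<noteq> 0}" for m n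
    by (force simp: image_iff algebra_simps intro!: exI[of _ "_ - 1"])
  then show "sact_fin (\<lambda>i j. C (i - 1) j) F"
    unfolding sact_fin_def using f by (meson finite_imageI finite_subset)
  have "{(i, j). C i (j - 1) \<noteq> 0 \<and> F (m - i) (n - j) \<noteq> 0} \<subseteq>
      (\<lambda>(i, j). (i, j + 1)) ` {(i, j). C i j \<noteq> 0 \<and> F (m - i) (n - 1 - j) \<noteq> 0}" for m n
    by (force simp: image_iff algebra_simps intro!: exI[of _ "_ - 1"])
  then show "sact_fin (\<lambda>i j. C i (j - 1)) F"
    unfolding sact_fin_def using f by (meson finite_imageI finite_subset)
qed

lemma sact_diff:
  assumes "sact_fin C F" "sact_fin C' F"
  shows "sact (\<lambda>i j. C i j - C' i j) F = sact C F - sact C' F"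
proof -
  have "sact_fin (\<lambda>i j. - 1 * C' i j) F" by (rule sact_cong_fin[OF assms(2)]) simp
  from sact_add[OF assms(1) this] sact_scale[OF assms(2), of "-1"]
  show ?thesis by (simp add: fun_eq_iff fscale_apply fun_app)
qed

lemma minus_dl_endo: "linear_endo s2 (\<lambda>F. - dl F)"
  by (rule dlE.uminus_endo)

text \<open>Common to both directions of expansion: the variable \<open>t\<close> of the series
  stands for x2 - x1, that is for \<open>- dl\<close>, so multiplying by q(x2 - x1) may be done
  inside the expanded series.\<close>

lemma sact_poly:
  fixes Cf :: "complex fls \<Rightarrow> int \<Rightarrow> int \<Rightarrow> complex"
  assumes fin: "\<And>h. sact_fin (Cf h) F"
    and add: "\<And>g h i j. Cf (g + h) i j = Cf g i j + Cf h i j"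
    and scl: "\<And>c h i j. Cf (fls_const c * h) i j = c * Cf h i j"
    and t: "\<And>h i j. Cf (t * h) i j = Cf h i (j - 1) - Cf h (i - 1) j"
  shows "pact s2 (\<lambda>F. - dl F) q (sact (Cf h) F) = sact (Cf (poly (map_poly fls_const q) t * h)) F"
proof (induction q)
  case 0
  have "Cf 0 i j = 0" for i j using scl[of 0 0 i j] by simp
  then have "sact (Cf 0) F = 0" by (simp add: sact_def fun_eq_iff case_prod_unfold fun_app)
  then show ?case by (simp add: linear_endo.pact_0[OF minus_dl_endo])
next
  case (pCons a q)
  define g where "g = poly (map_poly fls_const q) t * h"
  have 1: "Cf (t * g) = (\<lambda>i j. Cf g i (j - 1) - Cf g (i - 1) j)"
    by (intro ext) (rule t)
  have 2: "sact (Cf (t * g)) F = - dl (sact (Cf g) F)"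
    unfolding 1 sact_diff[OF sact_fin_shift(2)[OF fin] sact_fin_shift(1)[OF fin]]
    by (simp add: dl_alt sact_sh1 sact_sh2)
  have 3: "Cf (fls_const a * h + t * g) = (\<lambda>i j. a * Cf h i j + Cf (t * g) i j)"
    by (intro ext) (simp add: add scl)
  have fin': "sact_fin (\<lambda>i j. a * Cf h i j) F" by (rule sact_cong_fin[OF fin[of h]]) auto
  have "sact (Cf (fls_const a * h + t * g)) F = s2 a (sact (Cf h) F) - dl (sact (Cf g) F)"
    unfolding 3 sact_add[OF fin' fin] sact_scale[OF fin] 2 by simp
  moreover have "poly (map_poly fls_const (pCons a q)) t * h = fls_const a * h + t * g"
    by (simp add: map_poly_pCons g_def algebra_simps)
  ultimately show ?case
    by (simp add: linear_endo.pact_pCons[OF minus_dl_endo] pCons.IH g_def)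
qed

end

section \<open>Expansions at infinity and at 0\<close>

lemma binom_coeff_cb: "binom_coeff s t i j = cb (i + j) j * s powi i * t powi j"
  by (simp add: binom_coeff_def cb_def)

lemma binom_coeff_rec:
  assumes "s \<noteq> 0" "t \<noteq> 0"
  shows "binom_coeff s t i j = s * binom_coeff s t (i - 1) j + t * binom_coeff s t i (j - 1)"
proof -
  have "s powi i = s * s powi (i - 1)" "t powi j = t * t powi (j - 1)"
    using power_int_add_1'[of s "i - 1"] power_int_add_1'[of t "j - 1"] assms by simp_all
  moreover have "cb (i + j) j = cb (i + j - 1) j + cb (i + j - 1) (j - 1)"
    using cb_Suc[of "i + j - 1" j] by simp
  ultimately show ?thesis
    by (simp add: binom_coeff_cb algebra_simps)
qed

text \<open>\<open>Cinf h\<close> and \<open>Czero f\<close> are the coefficients of \<open>h(-x\<^sub>1 + x\<^sub>2)\<close>, expanded in nonnegative powers of \<open>x\<^sub>2\<close>,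
  and of \<open>f(x\<^sub>2 - x\<^sub>1)\<close>, expanded in nonnegative powers of \<open>x\<^sub>1\<close>; the argument \<open>h\<close> is a series in \<open>x\<^sup>-\<^sup>1\<close>.\<close>

definition Cinf :: "complex fls \<Rightarrow> int \<Rightarrow> int \<Rightarrow> complex" where
  "Cinf h = (\<lambda>s t. h $$ (- (s + t)) * binom_coeff (- 1) 1 s t)"

definition Czero :: "complex fls \<Rightarrow> int \<Rightarrow> int \<Rightarrow> complex" where
  "Czero f = (\<lambda>s t. f $$ (s + t) * binom_coeff 1 (- 1) t s)"

context complex_space
begin

text \<open>The powers of x in \<open>h\<close> are bounded above, hence so is i + j. Moreover j is
  nonnegative, and the bound on the first exponent of \<open>F\<close> bounds i from below.\<close>

lemma Cinf_fin:
  assumes "\<And>m n. F m n \<noteq> 0 \<Longrightarrow> m \<le> N"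
  shows "sact_fin (Cinf h) F"
  unfolding sact_fin_def
proof (intro allI)
  fix m n
  obtain A where A: "\<And>l. l < A \<Longrightarrow> h $$ l = 0" using fls_nth_vanishes_belowE[of h] by metis
  have "{(i, j). Cinf h i j \<noteq> 0 \<and> F (m - i) (n - j) \<noteq> 0} \<subseteq> {m - N.. - A} \<times> {0..- A - (m - N)}"
  proof clarify
    fix i j assume *: "Cinf h i j \<noteq> 0" "F (m - i) (n - j) \<noteq> 0"
    then have "\<not> j < 0" "h $$ (- (i + j)) \<noteq> 0" by (auto simp: Cinf_def binom_coeff_def)
    then have "j \<ge> 0" "- (i + j) \<ge> A" using A[of "- (i + j)"] by force+
    moreover have "m - i \<le> N" using assms * by blast
    ultimately show "i \<in> {m - N.. - A} \<and> j \<in> {0..- A - (m - N)}" by auto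
  qed
  then show "finite {(i, j). Cinf h i j \<noteq> 0 \<and> F (m - i) (n - j) \<noteq> 0}"
    by (rule finite_subset) auto
qed

lemma Cinf_poly:
  assumes "\<And>m n. F m n \<noteq> 0 \<Longrightarrow> m \<le> N"
  shows "pact s2 (\<lambda>F. - dl F) q (sact (Cinf h) F) = sact (Cinf (poly (map_poly fls_const q) fls_X_inv * h)) F"
proof (rule sact_poly)
  show "sact_fin (Cinf h) F" for h by (rule Cinf_fin) (use assms in blast)
  show "Cinf (fls_X_inv * h) i j = Cinf h i (j - 1) - Cinf h (i - 1) j" for h i j
  proof -
    have bc: "binom_coeff (- 1) 1 i j = binom_coeff (- 1) 1 i (j - 1) - binom_coeff (- 1) 1 (i - 1) j"
      by (simp add: binom_coeff_rec[of "-1" 1 i j])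
    have idx: "- (i + (j - 1)) = - (i + j) + 1" "- (i - 1 + j) = - (i + j) + 1" by simp_all
    show ?thesis unfolding Cinf_def idx
      by (simp add: bc right_diff_distrib fls_X_inv_times_conv_shift)
  qed
qed (simp_all add: Cinf_def algebra_simps)

lemma sact_one:
  assumes "\<And>i j. C i j = (if i = 0 \<and> j = 0 then 1 else 0)"
  shows "sact C F = F"
proof (intro ext)
  fix m n
  have "sact C F m n = (\<Sum>p\<in>{(0, 0)}. case p of (i, j) \<Rightarrow> sc (C i j) (F (m - i) (n - j)))"
    unfolding sact_def by (rule Sum_any.expand_superset) (auto simp: assms split: if_splits)
  then show "sact C F m n = F m n" by (simp add: assms)
qed

lemma Cinf_1: "sact (Cinf 1) F = F"
  by (rule sact_one) (auto simp: Cinf_def binom_coeff_cb cb_zero_left)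

lemma sact_Cinf_bounded:
  assumes "\<And>m n. F m n \<noteq> 0 \<Longrightarrow> m \<le> N"
  shows "\<exists>M. \<forall>m n. sact (Cinf h) F m n \<noteq> 0 \<longrightarrow> m \<le> M"
proof -
  obtain A where A: "\<And>l. l < A \<Longrightarrow> h $$ l = 0" using fls_nth_vanishes_belowE[of h] by metis
  have "m \<le> N - A" if nz: "sact (Cinf h) F m n \<noteq> 0" for m n
  proof -
    obtain p where "(case p of (i, j) \<Rightarrow> sc (Cinf h i j) (F (m - i) (n - j))) \<noteq> 0"
      using nz unfolding sact_def by (elim Sum_any.not_neutral_obtains_not_neutral)
    then obtain i j where *: "Cinf h i j \<noteq> 0" "F (m - i) (n - j) \<noteq> 0" by (cases p) auto
    then have "\<not> j < 0" "h $$ (- (i + j)) \<noteq> 0" by (auto simp: Cinf_def binom_coeff_def)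
    then have "j \<ge> 0" "- (i + j) \<ge> A" using A[of "- (i + j)"] by force+
    moreover have "m - i \<le> N" using assms * by blast
    ultimately show ?thesis by simp
  qed
  then show ?thesis by blast
qed

lemma series_act_eq_sact: "series_act sc C F [m, n] = sact C (\<lambda>m n. F [m, n]) m n"
  by (simp add: series_act_def sact_def)

lemma pr2_first_bounded: "a \<in> Eo sc \<Longrightarrow> \<exists>N. \<forall>m n. pr2 a b w m n \<noteq> 0 \<longrightarrow> n \<le> N"
proof -
  assume a: "a \<in> Eo sc"
  obtain N where "\<forall>n. coeffs_inf b w n \<noteq> 0 \<longrightarrow> n \<le> N" using coeffs_inf_bounded by blast
  then have "n \<le> N" if "pr2 a b w m n \<noteq> 0" for m n
    using that a by (cases "coeffs_inf b w n = 0") (auto simp: pr2_def)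
  then show ?thesis by blast
qed

lemma dl_pow_bounded:
  fixes F :: "int \<Rightarrow> int \<Rightarrow> 'w"
  shows "(\<exists>N. \<forall>m n. F m n \<noteq> 0 \<longrightarrow> m \<le> N) \<Longrightarrow> \<exists>N. \<forall>m n. (dl ^^ k) F m n \<noteq> 0 \<longrightarrow> m \<le> N"
    and "(\<exists>N. \<forall>m n. F m n \<noteq> 0 \<longrightarrow> n \<le> N) \<Longrightarrow> \<exists>N. \<forall>m n. (dl ^^ k) F m n \<noteq> 0 \<longrightarrow> n \<le> N"
proof -
  have "\<exists>N. \<forall>m n. dl F m n \<noteq> 0 \<longrightarrow> m \<le> N" if F: "\<exists>N. \<forall>m n. F m n \<noteq> 0 \<longrightarrow> m \<le> N" for F :: "int \<Rightarrow> int \<Rightarrow> 'w"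
  proof -
    obtain N where N: "\<And>m n. F m n \<noteq> 0 \<Longrightarrow> m \<le> N" using F by blast
    have "m \<le> N + 1" if "dl F m n \<noteq> 0" for m n
      using N[of "m - 1" n] N[of m "n - 1"] that by (cases "F (m - 1) n = 0") (auto simp: dl_def)
    then show ?thesis by blast
  qed
  then show "(\<exists>N. \<forall>m n. F m n \<noteq> 0 \<longrightarrow> m \<le> N) \<Longrightarrow> \<exists>N. \<forall>m n. (dl ^^ k) F m n \<noteq> 0 \<longrightarrow> m \<le> N"
    by (induction k) (simp_all add: o_apply)
  have "\<exists>N. \<forall>m n. dl F m n \<noteq> 0 \<longrightarrow> n \<le> N" if F: "\<exists>N. \<forall>m n. F m n \<noteq> 0 \<longrightarrow> n \<le> N" for F :: "int \<Rightarrow> int \<Rightarrow> 'w"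
  proof -
    obtain N where N: "\<And>m n. F m n \<noteq> 0 \<Longrightarrow> n \<le> N" using F by blast
    have "n \<le> N + 1" if "dl F m n \<noteq> 0" for m n
      using N[of "m - 1" n] N[of m "n - 1"] that by (cases "F (m - 1) n = 0") (auto simp: dl_def)
    then show ?thesis by blast
  qed
  then show "(\<exists>N. \<forall>m n. F m n \<noteq> 0 \<longrightarrow> n \<le> N) \<Longrightarrow> \<exists>N. \<forall>m n. (dl ^^ k) F m n \<noteq> 0 \<longrightarrow> n \<le> N"
    by (induction k) (simp_all add: o_apply)
qed

lemma dl_pow_sum: "(dl ^^ k) (sum f A) = (\<Sum>i\<in>A. (dl ^^ k) (f i :: int \<Rightarrow> int \<Rightarrow> 'w))"
  by (rule linear_endo.T_sum[OF dlE.pow_endo])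

text \<open>A common denominator \<open>Q\<close> turns the expansions into polynomials.
  Compatibility can be read off the given relation: its left side is bounded in x2, the variable of
  \<open>b\<close>, and its right side in x1, the variable of the \<open>v i\<close>, these
  operators being applied first.\<close>

lemma S_local_good_rel:
  assumes "S_local sc U"
  shows "good_rel sc U U"
proof (rule good_relI)
  show UE: "U \<subseteq> Eo sc" and "U \<subseteq> Eo sc" using assms by (auto simp: S_local_def)
  have main: "(\<exists>k. compat2 k a b) \<and> (\<exists>q. q \<noteq> 0 \<and> pact s3 D q (pr2 a b) \<in> nmod s3 {D} {flipw (pr2 u v) |u v. u \<in> U \<and> v \<in> U})"
    if a: "a \<in> U" and b: "b \<in> U" for a b
  proof -
    obtain r :: nat and u v and f :: "nat \<Rightarrow> complex poly fract" and k where uv: "\<And>i. i < r \<Longrightarrow> u i \<in> U \<and> v i \<in> U"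
      and eq: "\<And>w m n. poly_act sc 0 1 ((X1 - X2) ^ k) (op_prod [coeffs_inf a, coeffs_inf b] w) [m, n] =
        poly_act sc 0 1 ((X1 - X2) ^ k)
          (\<lambda>ns. \<Sum>i<r. series_act sc (Cinf (iota_inf (f i)))
             (\<lambda>ns. op_prod [coeffs_inf (u i), coeffs_inf (v i)] w (rev ns)) ns) [m, n]"
      using assms a b unfolding S_local_def Cinf_def by blast
    define F where "F i w = flip2 (pr2 (u i) (v i) w)" for i w
    define h where "h i = iota_inf (f i)" for i
    have aE: "a \<in> Eo sc" and bE: "b \<in> Eo sc" and uE: "\<And>i. i < r \<Longrightarrow> u i \<in> Eo sc" using UE a b uv by auto
    have bF: "\<exists>N. \<forall>m n. F i w m n \<noteq> 0 \<longrightarrow> m \<le> N" if "i < r" for i w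
      using pr2_first_bounded[OF uE[OF that], of "v i" w] by (auto simp: F_def flip2_def)
    have eq': "(dl ^^ k) (pr2 a b w) = (dl ^^ k) (\<Sum>i<r. sact (Cinf (h i)) (F i w))" for w
    proof (intro ext)
      fix m n
      have "(\<lambda>m n. \<Sum>i<r. series_act sc (Cinf (h i)) (\<lambda>ns. op_prod [coeffs_inf (u i), coeffs_inf (v i)] w (rev ns)) [m, n])
          = (\<Sum>i<r. sact (Cinf (h i)) (F i w))"
        by (simp add: series_act_eq_sact fun_eq_iff sum_fun_apply F_def flip2_def pr2_def)
      moreover have "(\<lambda>m n. op_prod [coeffs_inf a, coeffs_inf b] w [m, n]) = pr2 a b w"
        by (simp add: pr2_def)
      ultimately show "(dl ^^ k) (pr2 a b w) m n = (dl ^^ k) (\<Sum>i<r. sact (Cinf (h i)) (F i w)) m n"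
        using eq[of w m n] unfolding poly_act_2 pact2_dl h_def by simp
    qed
    have "compat2 k a b"
      unfolding compat2_def
    proof
      fix w
      have "\<exists>N. \<forall>m n. (\<Sum>i\<in>I. sact (Cinf (h i)) (F i w)) m n \<noteq> 0 \<longrightarrow> m \<le> N" if "I \<subseteq> {..<r}" for I
        using finite_subset[OF that finite_lessThan] that
      proof (induction I)
        case empty
        show ?case by (simp add: fun_app)
      next
        case (insert i I)
        obtain N where N: "\<And>m n. (\<Sum>i\<in>I. sact (Cinf (h i)) (F i w)) m n \<noteq> 0 \<Longrightarrow> m \<le> N"
          using insert by auto
        obtain M where M: "\<And>m n. sact (Cinf (h i)) (F i w) m n \<noteq> 0 \<Longrightarrow> m \<le> M"
          using sact_Cinf_bounded bF[of i w] insert by (metis insert_subset lessThan_iff)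
        have "m \<le> max N M" if "(\<Sum>i\<in>insert i I. sact (Cinf (h i)) (F i w)) m n \<noteq> 0" for m n
          using N[of m n] M[of m n] that insert
          by (cases "sact (Cinf (h i)) (F i w) m n = 0") (auto simp: fun_app)
        then show ?case by blast
      qed
      then have "\<exists>N. \<forall>m n. (dl ^^ k) (pr2 a b w) m n \<noteq> 0 \<longrightarrow> m \<le> N"
        unfolding eq' by (intro dl_pow_bounded(1)) auto
      moreover have "\<exists>N. \<forall>m n. (dl ^^ k) (pr2 a b w) m n \<noteq> 0 \<longrightarrow> n \<le> N"
        by (intro dl_pow_bounded(2) pr2_first_bounded aE)
      ultimately obtain N M where "\<And>m n. (dl ^^ k) (pr2 a b w) m n \<noteq> 0 \<Longrightarrow> m \<le> N" "\<And>m n. (dl ^^ k) (pr2 a b w) m n \<noteq> 0 \<Longrightarrow> n \<le> M"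
        by blast
      then show "bnd2 ((dl ^^ k) (pr2 a b w))" by (intro bnd2I[of _ "max N M"]) (meson max.coboundedI1 max.coboundedI2)
    qed
    have "\<forall>i. \<exists>g q. q \<noteq> 0 \<and> f i = Fract g q" using Fract_cases by metis
    then obtain g q where gq: "\<And>i. q i \<noteq> 0" "\<And>i. f i = Fract (g i) (q i)" by metis
    define Q where "Q = (\<Prod>i<r. q i)"
    define Qi where "Qi i = (\<Prod>j\<in>{..<r} - {i}. q j) * g i" for i
    have Q0: "Q \<noteq> 0" using gq by (simp add: Q_def)
    let ?e = "\<lambda>p. poly (map_poly fls_const p) (fls_X_inv :: complex fls)"
    have Qh: "?e Q * h i = ?e (Qi i)" if "i < r" for i
    proof -
      have "Q = q i * (\<Prod>j\<in>{..<r} - {i}. q j)"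
        unfolding Q_def using that by (subst prod.remove[of _ i]) auto
      then have "?e Q * h i = ?e (\<Prod>j\<in>{..<r} - {i}. q j) * (?e (q i) * h i)"
        by (simp only: HF1.ev_mult mult_ac)
      also have "?e (q i) * h i = ?e (g i)"
        using gq(1)[of i] by (simp add: h_def gq(2)[of i] iota_inf_Fract poly_fls_X_inv_eq_0)
      finally show ?thesis by (simp add: Qi_def HF1.ev_mult)
    qed
    \<comment> \<open>The quotient is cancelled inside the expansion: \<open>Q\<close> times the
      expansion of f_i and \<open>Qi i\<close> times 1 are the same Laurent series.\<close>
    have act: "pact s2 (\<lambda>F. - dl F) Q (sact (Cinf (h i)) (F i w)) = pact s2 (\<lambda>F. - dl F) (Qi i) (F i w)" if "i < r" for i w
    proof -
      obtain N where N: "\<And>m n. F i w m n \<noteq> 0 \<Longrightarrow> m \<le> N" using bF[OF \<open>i < r\<close>] by blast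
      have "pact s2 (\<lambda>F. - dl F) Q (sact (Cinf (h i)) (F i w)) = sact (Cinf (?e (Qi i) * 1)) (F i w)"
        using Cinf_poly[OF N] Qh[OF that] by simp
      also have "\<dots> = pact s2 (\<lambda>F. - dl F) (Qi i) (sact (Cinf 1) (F i w))"
        using Cinf_poly[OF N] by simp
      finally show ?thesis by (simp add: Cinf_1)
    qed
    \<comment> \<open>The expansions are in -x1 + x2, whereas goodness is stated in x1 - x2.\<close>
    let ?c = "\<lambda>q. pcompose q [:0, - 1 :: complex:]"
    have "pact s3 D ([:0, 1:] ^ k * ?c Q) (pr2 a b) = (\<Sum>i<r. pact s3 D ([:0, 1:] ^ k * ?c (Qi i)) (flipw (pr2 (u i) (v i))))"
    proof
      fix w
      have "pact s3 D ([:0, 1:] ^ k * ?c Q) (pr2 a b) w = pact s2 dl (?c Q) ((dl ^^ k) (pr2 a b w))"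
        by (simp only: D_apply dlE.pact_mult dlE.pact_X_power mult.commute[of "[:0, 1:] ^ k"])
      also have "\<dots> = (dl ^^ k) (pact s2 dl (?c Q) (\<Sum>i<r. sact (Cinf (h i)) (F i w)))"
        unfolding eq'
        by (rule funpow_intertwine[where L = "pact s2 dl (?c Q)"]) (rule dlE.pact_T)
      also have "pact s2 dl (?c Q) (\<Sum>i<r. sact (Cinf (h i)) (F i w)) = (\<Sum>i<r. pact s2 dl (?c (Qi i)) (F i w))"
        unfolding dlE.pact_sum_right
        by (rule sum.cong) (auto simp: act simp flip: dlE.pact_uminus)
      finally show "pact s3 D ([:0, 1:] ^ k * ?c Q) (pr2 a b) w =
          (\<Sum>i<r. pact s3 D ([:0, 1:] ^ k * ?c (Qi i)) (flipw (pr2 (u i) (v i)))) w"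
        by (simp only: sum_fun_apply[where x = w] D_apply dlE.pact_mult dlE.pact_X_power dl_pow_sum F_def flipw_def)
    qed
    also have "\<dots> \<in> nmod s3 {D} {flipw (pr2 u v) |u v. u \<in> U \<and> v \<in> U}"
    proof -
      have sumI: "(\<And>i. i \<in> I \<Longrightarrow> x i \<in> nmod s3 {D} B) \<Longrightarrow> sum x I \<in> nmod s3 {D} B" for x and I :: "nat set" and B
        by (induction I rule: infinite_finite_induct) (auto intro: nmod_submodule)
      have "flipw (pr2 (u i) (v i)) \<in> nmod s3 {D} {flipw (pr2 u v) |u v. u \<in> U \<and> v \<in> U}" if "i < r" for i
        using uv[OF that] by (intro nmod_base) blast
      then show ?thesis by (intro sumI D.nmod_pact) auto
    qed
    finally have "pact s3 D ([:0, 1:] ^ k * ?c Q) (pr2 a b) \<in> nmod s3 {D} {flipw (pr2 u v) |u v. u \<in> U \<and> v \<in> U}" .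
    moreover have "[:0, 1:] ^ k * ?c Q \<noteq> 0" using pcompose_uminus_nonzero[OF Q0] by simp
    ultimately show ?thesis using \<open>compat2 k a b\<close> by blast
  qed
  show "\<And>a b. a \<in> U \<Longrightarrow> b \<in> U \<Longrightarrow> \<exists>k. compat2 k a b" using main by blast
  show "\<And>a b. a \<in> U \<Longrightarrow> b \<in> U \<Longrightarrow> \<exists>q. q \<noteq> 0 \<and> pact s3 D q (pr2 a b) \<in> nmod s3 {D} {flipw (pr2 u v) |u v. u \<in> U \<and> v \<in> U}"
    using main by blast
qed

end

section \<open>The generated subspace\<close>

context complex_space
begin

lemma good_rel_mono_witness:
  assumes "\<exists>q. q \<noteq> 0 \<and> pact s3 D q X \<in> nmod s3 {D} {flipw (pr2 u v) |u v. u \<in> B \<and> v \<in> A}" "B \<subseteq> B'" "A \<subseteq> A'"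
  shows "\<exists>q. q \<noteq> 0 \<and> pact s3 D q X \<in> nmod s3 {D} {flipw (pr2 u v) |u v. u \<in> B' \<and> v \<in> A'}"
proof -
  have "{flipw (pr2 u v) |u v. u \<in> B \<and> v \<in> A} \<subseteq> {flipw (pr2 u v) |u v. u \<in> B' \<and> v \<in> A'}"
    using assms(2,3) by blast
  with assms(1) show ?thesis using nmod_mono by blast
qed

section \<open>The identity operator\<close>

lemma pr2_one_left: "pr2 Eo_one b w m n = (if m = 0 then coeffs_inf b w n else 0)"
  by (simp add: pr2_def coeffs_inf_one)

lemma pr2_one_right: "b \<in> Eo sc \<Longrightarrow> pr2 b Eo_one w m n = (if n = 0 then coeffs_inf b w m else 0)"
  by (simp add: pr2_def coeffs_inf_one)

lemma compat2_one_left: "compat2 0 Eo_one b"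
  unfolding compat2_def
proof
  fix w
  obtain N where N: "\<forall>n. coeffs_inf b w n \<noteq> 0 \<longrightarrow> n \<le> N" using coeffs_inf_bounded by blast
  show "bnd2 ((dl ^^ 0) (pr2 Eo_one b w))"
    by (rule bnd2I[of _ "max 0 N"]) (use N in \<open>auto simp: pr2_one_left split: if_splits\<close>)
qed

lemma compat2_one_right:
  assumes "b \<in> Eo sc"
  shows "compat2 0 b Eo_one"
  unfolding compat2_def
proof
  fix w
  obtain N where N: "\<forall>n. coeffs_inf b w n \<noteq> 0 \<longrightarrow> n \<le> N" using coeffs_inf_bounded by blast
  show "bnd2 ((dl ^^ 0) (pr2 b Eo_one w))"
    by (rule bnd2I[of _ "max 0 N"]) (use N assms in \<open>auto simp: pr2_one_right split: if_splits\<close>)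
qed

text \<open>The identity commutes with every operator, so \<open>q = 1\<close> and a single
  exchanged term suffice.\<close>

lemma good_rel_insert_one:
  assumes "good_rel sc U U"
  shows "good_rel sc (insert Eo_one U) (insert Eo_one U)"
proof (rule good_relI)
  let ?U = "insert Eo_one U"
  show UE: "?U \<subseteq> Eo sc" "?U \<subseteq> Eo sc" using assms Eo_one_in by (auto simp: good_rel_def)
  fix a b assume ab: "a \<in> ?U" "b \<in> ?U"
  then have E: "a \<in> Eo sc" "b \<in> Eo sc" using UE by auto
  show "\<exists>k. compat2 k a b"
    using ab good_relD(3)[OF assms, of a b] compat2_one_left compat2_one_right E by blast
  show "\<exists>q. q \<noteq> 0 \<and> pact s3 D q (pr2 a b) \<in> nmod s3 {D} {flipw (pr2 u v) |u v. u \<in> ?U \<and> v \<in> ?U}"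
  proof (cases "a = Eo_one \<or> b = Eo_one")
    case True
    then have "pr2 a b = flipw (pr2 b a)"
    proof
      assume a: "a = Eo_one"
      show ?thesis unfolding a using E by (simp add: fun_eq_iff flipw_def flip2_def pr2_one_left pr2_one_right)
    next
      assume b: "b = Eo_one"
      show ?thesis unfolding b using E by (simp add: fun_eq_iff flipw_def flip2_def pr2_one_left pr2_one_right)
    qed
    with ab show ?thesis by (intro exI[of _ 1]) (auto intro!: nmod_base)
  next
    case False
    with ab good_rel_mono_witness[OF good_relD(4)[OF assms, of a b], of ?U ?U] show ?thesis by auto
  qed
qed

lemma sg_one_left: "sg m (pr2 Eo_one b w) n = (if m = 0 then coeffs_inf b w n else 0)"
proof -
  have "bnd2 (pr2 Eo_one b w)" using compat2_one_left[of b] by (simp add: compat2_def)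
  then have "sg m (pr2 Eo_one b w) n = S m (pr2 Eo_one b w) n" by (simp add: sg_bnd2)
  also have "\<dots> = (\<Sum>i\<in>{0}. sc (cb i m) (pr2 Eo_one b w i (n + m - i)))"
    unfolding S_def by (rule Sum_any.expand_superset) (auto simp: pr2_one_left split: if_splits)
  finally show ?thesis by (simp add: pr2_one_left cb_zero_left)
qed

text \<open>These are the Taylor coefficients of b(x + x0), from which both creation properties
  follow.\<close>

lemma sg_one_right:
  assumes "b \<in> Eo sc"
  shows "sg m (pr2 b Eo_one w) n = sc (cb (n + m) m) (coeffs_inf b w (n + m))"
proof -
  have "bnd2 (pr2 b Eo_one w)" using compat2_one_right[OF assms] by (simp add: compat2_def)
  then have "sg m (pr2 b Eo_one w) n = S m (pr2 b Eo_one w) n" by (simp add: sg_bnd2)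
  also have "\<dots> = (\<Sum>i\<in>{n + m}. sc (cb i m) (pr2 b Eo_one w i (n + m - i)))"
    unfolding S_def by (rule Sum_any.expand_superset) (auto simp: pr2_one_right assms split: if_splits)
  finally show ?thesis by (simp add: pr2_one_right assms)
qed

lemma Y_Eo_one_left:
  assumes "b \<in> Eo sc"
  shows "Y_Eo sc Eo_one b = fls_const b"
proof (rule fls_eqI)
  fix m show "Y_Eo sc Eo_one b $$ m = fls_const b $$ m"
    by (rule coeffs_inf_ext)
      (simp add: coeffs_Y_Eo(1)[OF Eo_one_in assms compat2_one_left] sg_one_left coeffs_inf_zero)
qed

lemma Y_Eo_one_right:
  assumes "b \<in> Eo sc"
  shows "m < 0 \<Longrightarrow> Y_Eo sc b Eo_one $$ m = 0" "Y_Eo sc b Eo_one $$ 0 = b"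
  by (rule coeffs_inf_ext,
      simp add: coeffs_Y_Eo(1)[OF assms Eo_one_in compat2_one_right] assms sg_one_right coeffs_inf_zero)+

text \<open>Every \<open>b\<close> is a product of the identity with \<open>b\<close>, which makes
  the iterated products an increasing chain.\<close>

lemma prods_mono: "good_rel sc A A \<Longrightarrow> Eo_one \<in> A \<Longrightarrow> A \<subseteq> prods A"
proof
  fix b assume *: "good_rel sc A A" "Eo_one \<in> A" "b \<in> A"
  then have "b = Y_Eo sc Eo_one b $$ 0" using Y_Eo_one_left[of b] by (auto simp: good_rel_def)
  then show "b \<in> prods A" unfolding prods_def using * by blast
qed

section \<open>Iterated products and their span\<close>

primrec iter :: "('w \<Rightarrow> 'w fls) set \<Rightarrow> nat \<Rightarrow> ('w \<Rightarrow> 'w fls) set" where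
  "iter U 0 = insert Eo_one U"
| "iter U (Suc n) = prods (iter U n)"

lemma iter_good:
  assumes "good_rel sc U U"
  shows "good_rel sc (iter U n) (iter U n) \<and> Eo_one \<in> iter U n"
proof (induction n)
  case (Suc n)
  then show ?case using good_rel_prods[of "iter U n"] prods_mono[of "iter U n"] by auto
qed (use good_rel_insert_one[OF assms] in simp)

lemma iter_mono: "good_rel sc U U \<Longrightarrow> m \<le> n \<Longrightarrow> iter U m \<subseteq> iter U n"
  by (rule lift_Suc_mono_le[of "iter U"]) (use iter_good prods_mono in auto)

lemma good_rel_chain:
  assumes "good_rel sc U U"
  shows "good_rel sc (\<Union>n. iter U n) (\<Union>n. iter U n)"
proof (rule good_relI)
  let ?A = "\<Union>n. iter U n"
  show "?A \<subseteq> Eo sc" "?A \<subseteq> Eo sc" using iter_good[OF assms] by (auto simp: good_rel_def)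
  have *: "\<exists>n. a \<in> iter U n \<and> b \<in> iter U n" if ab: "a \<in> ?A" "b \<in> ?A" for a b
  proof -
    obtain m n where "a \<in> iter U m" "b \<in> iter U n" using ab by blast
    then show ?thesis using iter_mono[OF assms, of m "max m n"] iter_mono[OF assms, of n "max m n"] by fastforce
  qed
  fix a b assume "a \<in> ?A" "b \<in> ?A"
  then obtain n where n: "a \<in> iter U n" "b \<in> iter U n" using * by blast
  have g: "good_rel sc (iter U n) (iter U n)" using iter_good[OF assms] by blast
  show "\<exists>k. compat2 k a b" using good_relD(3)[OF g n] .
  show "\<exists>q. q \<noteq> 0 \<and> pact s3 D q (pr2 a b) \<in> nmod s3 {D} {flipw (pr2 u v) |u v. u \<in> ?A \<and> v \<in> ?A}"
    by (rule good_rel_mono_witness[OF good_relD(4)[OF g n]]) auto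
qed

abbreviation spn :: "('w \<Rightarrow> 'w fls) set \<Rightarrow> ('w \<Rightarrow> 'w fls) set" where
  "spn A \<equiv> nmod (Eo_scale sc) {} A"

lemma spn_induct [consumes 1, case_names base zero add scale]:
  assumes "x \<in> spn A" and "\<And>x. x \<in> A \<Longrightarrow> P x" and "P 0"
    and "\<And>x y. x \<in> spn A \<Longrightarrow> P x \<Longrightarrow> y \<in> spn A \<Longrightarrow> P y \<Longrightarrow> P (x + y)"
    and "\<And>x c. x \<in> spn A \<Longrightarrow> P x \<Longrightarrow> P (Eo_scale sc c x)"
  shows "P x"
  using assms(1) by (induction rule: nmod.induct) (use assms in auto)

lemma Eo_zero_in: "0 \<in> Eo sc"
  by (simp add: Eo_iff lin_fam_def coeffs_inf_zero)

lemma Eo_add_in: "a \<in> Eo sc \<Longrightarrow> b \<in> Eo sc \<Longrightarrow> a + b \<in> Eo sc"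
  by (simp add: Eo_iff lin_fam_def coeffs_inf_plus scale_right_distrib algebra_simps)

lemma Eo_scale_in: "a \<in> Eo sc \<Longrightarrow> Eo_scale sc c a \<in> Eo sc"
  by (simp add: Eo_iff lin_fam_def coeffs_inf_Eo_scale scale_right_distrib scale_left_commute)

lemma pr2_linear:
  "pr2 (a + a') b = pr2 a b + pr2 a' b" "pr2 (Eo_scale sc c a) b = s3 c (pr2 a b)" "pr2 0 b = 0"
  "a \<in> Eo sc \<Longrightarrow> pr2 a (b + b') = pr2 a b + pr2 a b'" "a \<in> Eo sc \<Longrightarrow> pr2 a (Eo_scale sc c b) = s3 c (pr2 a b)"
  "a \<in> Eo sc \<Longrightarrow> pr2 a 0 = 0"
  by (simp_all add: pr2_def fun_eq_iff fun_app fscale_apply coeffs_inf_plus coeffs_inf_Eo_scale coeffs_inf_zero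
      coeffs_inf_add coeffs_inf_scale)

text \<open>Goodness of a pair as a property of the series \<open>pr2 a b\<close>. This series is
  bilinear in the pair and the property is stable under sums, so the passage to the span is an
  induction in each argument.\<close>

definition locally_good :: "('w \<Rightarrow> 'w fls) set \<Rightarrow> ('w \<Rightarrow> int \<Rightarrow> int \<Rightarrow> 'w) \<Rightarrow> bool" where
  "locally_good K X \<longleftrightarrow> (\<exists>k. \<forall>w. bnd2 ((dl ^^ k) (X w))) \<and>
     (\<exists>q. q \<noteq> 0 \<and> pact s3 D q X \<in> nmod s3 {D} {flipw (pr2 u v) |u v. u \<in> K \<and> v \<in> K})"

lemma locally_good_zero: "locally_good K 0"
proof -
  have "bnd2 ((dl ^^ 0) ((0 :: 'w \<Rightarrow> int \<Rightarrow> int \<Rightarrow> 'w) w))" for w using bnd2_0 by (simp add: zero_fun_def)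
  moreover have "pact s3 D 1 0 \<in> nmod s3 {D} B" for B by (simp add: nmod_0)
  ultimately show ?thesis unfolding locally_good_def using one_neq_zero by blast
qed

lemma locally_good_add:
  assumes "locally_good K X" "locally_good K Y"
  shows "locally_good K (X + Y)"
proof -
  obtain k l where k: "\<And>w. bnd2 ((dl ^^ k) (X w))" and l: "\<And>w. bnd2 ((dl ^^ l) (Y w))"
    using assms unfolding locally_good_def by blast
  have b: "bnd2 ((dl ^^ max k l) ((X + Y) w))" for w
    unfolding plus_fun_apply[of X Y w] dl_pow_add
    by (intro bnd2_add bnd2_dl_mono[OF k] bnd2_dl_mono[OF l]) auto
  obtain p q where p: "p \<noteq> 0" "pact s3 D p X \<in> nmod s3 {D} {flipw (pr2 u v) |u v. u \<in> K \<and> v \<in> K}"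
    and q: "q \<noteq> 0" "pact s3 D q Y \<in> nmod s3 {D} {flipw (pr2 u v) |u v. u \<in> K \<and> v \<in> K}"
    using assms unfolding locally_good_def by blast
  have "pact s3 D (p * q) (X + Y) = pact s3 D q (pact s3 D p X) + pact s3 D p (pact s3 D q Y)"
    by (simp only: D.pact_add_right D.pact_mult[symmetric] mult.commute)
  also have "\<dots> \<in> nmod s3 {D} {flipw (pr2 u v) |u v. u \<in> K \<and> v \<in> K}"
    by (rule nmod_add; rule D.nmod_pact) (use p q in auto)
  finally have "\<exists>q. q \<noteq> 0 \<and> pact s3 D q (X + Y) \<in> nmod s3 {D} {flipw (pr2 u v) |u v. u \<in> K \<and> v \<in> K}"
    using p q by (intro exI[of _ "p * q"]) auto
  with b show ?thesis unfolding locally_good_def by blast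
qed

lemma locally_good_scale:
  assumes "locally_good K X"
  shows "locally_good K (s3 c X)"
proof -
  obtain k where k: "\<And>w. bnd2 ((dl ^^ k) (X w))"
    using assms unfolding locally_good_def by blast
  have "bnd2 ((dl ^^ k) (s3 c X w))" for w
  proof -
    have "(dl ^^ k) (s3 c X w) = s2 c ((dl ^^ k) (X w))"
      unfolding fscale_apply[of _ _ X w] by (rule linear_endo.T_scale[OF dlE.pow_endo])
    with bnd2_map[OF k, of "sc c"] show ?thesis by (simp add: fscale_def)
  qed
  moreover obtain p where p: "p \<noteq> 0" "pact s3 D p X \<in> nmod s3 {D} {flipw (pr2 u v) |u v. u \<in> K \<and> v \<in> K}"
    using assms unfolding locally_good_def by blast
  then have "pact s3 D p (s3 c X) \<in> nmod s3 {D} {flipw (pr2 u v) |u v. u \<in> K \<and> v \<in> K}"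
    by (simp add: D.pact_scale_right nmod_scale)
  ultimately show ?thesis using p(1) unfolding locally_good_def by blast
qed

lemma good_rel_iff: "good_rel sc K K \<longleftrightarrow> K \<subseteq> Eo sc \<and> (\<forall>a\<in>K. \<forall>b\<in>K. locally_good K (pr2 a b))"
  unfolding good_rel_def locally_good_def compat2_def flipw_def by blast

lemma good_rel_spn:
  assumes "good_rel sc A A"
  shows "good_rel sc (spn A) (spn A)"
proof -
  let ?K = "spn A"
  have AE: "A \<subseteq> Eo sc" using assms by (simp add: good_rel_def)
  have KE: "x \<in> Eo sc" if "x \<in> ?K" for x
    using that by (induction rule: spn_induct) (use AE Eo_zero_in Eo_add_in Eo_scale_in in auto)
  have AK: "A \<subseteq> ?K" by (auto intro: nmod_base)
  have 0: "locally_good ?K (pr2 a b)" if "a \<in> A" "b \<in> A" for a b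
    unfolding locally_good_def
    using good_relD(3)[OF assms that] good_rel_mono_witness[OF good_relD(4)[OF assms that] AK AK]
    unfolding compat2_def by blast
  have 1: "locally_good ?K (pr2 a b)" if "a \<in> ?K" "b \<in> A" for a b
    using that
    by (induction rule: spn_induct)
      (simp_all add: 0 pr2_linear locally_good_zero locally_good_add locally_good_scale)
  have "locally_good ?K (pr2 a b)" if "b \<in> ?K" "a \<in> ?K" for a b
    using that
    by (induction rule: spn_induct)
      (simp_all add: 1 pr2_linear KE locally_good_zero locally_good_add locally_good_scale)
  then show ?thesis unfolding good_rel_iff using KE by blast
qed

lemma compat2_linear:
  "compat2 k a b \<Longrightarrow> compat2 k' a' b \<Longrightarrow> compat2 (max k k') (a + a') b"
  "compat2 k a b \<Longrightarrow> compat2 k (Eo_scale sc c a) b"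
  "a \<in> Eo sc \<Longrightarrow> compat2 k a b \<Longrightarrow> compat2 k' a b' \<Longrightarrow> compat2 (max k k') a (b + b')"
  "a \<in> Eo sc \<Longrightarrow> compat2 k a b \<Longrightarrow> compat2 k a (Eo_scale sc c b)"
proof -
  have add: "bnd2 ((dl ^^ max k k') ((X + Y) w))" if "\<forall>w. bnd2 ((dl ^^ k) (X w))" "\<forall>w. bnd2 ((dl ^^ k') (Y w))" for X Y k k' and w :: 'w
    unfolding plus_fun_apply[of X Y w] dl_pow_add
    by (intro bnd2_add bnd2_dl_mono[OF that(1)[rule_format]] bnd2_dl_mono[OF that(2)[rule_format]]) auto
  have scl: "bnd2 ((dl ^^ k) (s3 c X w))" if "\<forall>w. bnd2 ((dl ^^ k) (X w))" for X k w c
  proof -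
    have "(dl ^^ k) (s3 c X w) = s2 c ((dl ^^ k) (X w))"
      unfolding fscale_apply[of _ _ X w] by (rule linear_endo.T_scale[OF dlE.pow_endo])
    with bnd2_map[OF that[rule_format, of w], of "sc c"] show ?thesis by (simp add: fscale_def)
  qed
  show "compat2 k a b \<Longrightarrow> compat2 k' a' b \<Longrightarrow> compat2 (max k k') (a + a') b"
    "compat2 k a b \<Longrightarrow> compat2 k (Eo_scale sc c a) b"
    "a \<in> Eo sc \<Longrightarrow> compat2 k a b \<Longrightarrow> compat2 k' a b' \<Longrightarrow> compat2 (max k k') a (b + b')"
    "a \<in> Eo sc \<Longrightarrow> compat2 k a b \<Longrightarrow> compat2 k a (Eo_scale sc c b)"
    unfolding compat2_def by (simp_all only: pr2_linear add scl simp_thms)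
qed

lemma sing_compat2: "compat2 k a b \<Longrightarrow> sing (pr2 a b w)"
  unfolding compat2_def sing_def by blast

lemma vs_Eo: "complex_space (Eo_scale sc)"
  using vector_space_Eo_scale by (simp add: complex_space_def)

lemma fls_scale_Eo_nth: "fls_scale (Eo_scale sc) c f $$ n = Eo_scale sc c (f $$ n)"
  by (rule complex_space.fls_scale_nth[OF vs_Eo])

lemma Y_Eo_add_left:
  assumes "a \<in> Eo sc" "a' \<in> Eo sc" "b \<in> Eo sc" "compat2 k a b" "compat2 k' a' b"
  shows "Y_Eo sc (a + a') b = Y_Eo sc a b + Y_Eo sc a' b"
proof (rule fls_eqI, rule coeffs_inf_ext)
  fix m w n
  show "coeffs_inf (Y_Eo sc (a + a') b $$ m) w n = coeffs_inf ((Y_Eo sc a b + Y_Eo sc a' b) $$ m) w n"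
    unfolding fls_plus_nth coeffs_inf_plus
    using coeffs_Y_Eo(1)[OF Eo_add_in[OF assms(1,2)] assms(3) compat2_linear(1)[OF assms(4,5)]]
      coeffs_Y_Eo(1)[OF assms(1,3,4)] coeffs_Y_Eo(1)[OF assms(2,3,5)]
    by (simp add: pr2_linear fun_app sg_add sing_compat2[OF assms(4)] sing_compat2[OF assms(5)])
qed

lemma Y_Eo_scale_left:
  assumes "a \<in> Eo sc" "b \<in> Eo sc" "compat2 k a b"
  shows "Y_Eo sc (Eo_scale sc c a) b = fls_scale (Eo_scale sc) c (Y_Eo sc a b)"
proof (rule fls_eqI, rule coeffs_inf_ext)
  fix m w n
  show "coeffs_inf (Y_Eo sc (Eo_scale sc c a) b $$ m) w n = coeffs_inf (fls_scale (Eo_scale sc) c (Y_Eo sc a b) $$ m) w n"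
    unfolding fls_scale_Eo_nth coeffs_inf_Eo_scale
    using coeffs_Y_Eo(1)[OF Eo_scale_in[OF assms(1)] assms(2) compat2_linear(2)[OF assms(3)]]
      coeffs_Y_Eo(1)[OF assms]
    by (simp add: pr2_linear fscale_apply sg_scale sing_compat2[OF assms(3)])
qed

lemma Y_Eo_add_right:
  assumes "a \<in> Eo sc" "b \<in> Eo sc" "b' \<in> Eo sc" "compat2 k a b" "compat2 k' a b'"
  shows "Y_Eo sc a (b + b') = Y_Eo sc a b + Y_Eo sc a b'"
proof (rule fls_eqI, rule coeffs_inf_ext)
  fix m w n
  show "coeffs_inf (Y_Eo sc a (b + b') $$ m) w n = coeffs_inf ((Y_Eo sc a b + Y_Eo sc a b') $$ m) w n"
    unfolding fls_plus_nth coeffs_inf_plus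
    using coeffs_Y_Eo(1)[OF assms(1) Eo_add_in[OF assms(2,3)] compat2_linear(3)[OF assms(1,4,5)]]
      coeffs_Y_Eo(1)[OF assms(1,2,4)] coeffs_Y_Eo(1)[OF assms(1,3,5)]
    by (simp add: pr2_linear assms fun_app sg_add sing_compat2[OF assms(4)] sing_compat2[OF assms(5)])
qed

lemma Y_Eo_scale_right:
  assumes "a \<in> Eo sc" "b \<in> Eo sc" "compat2 k a b"
  shows "Y_Eo sc a (Eo_scale sc c b) = fls_scale (Eo_scale sc) c (Y_Eo sc a b)"
proof (rule fls_eqI, rule coeffs_inf_ext)
  fix m w n
  show "coeffs_inf (Y_Eo sc a (Eo_scale sc c b) $$ m) w n = coeffs_inf (fls_scale (Eo_scale sc) c (Y_Eo sc a b) $$ m) w n"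
    unfolding fls_scale_Eo_nth coeffs_inf_Eo_scale
    using coeffs_Y_Eo(1)[OF assms(1) Eo_scale_in[OF assms(2)] compat2_linear(4)[OF assms(1,3)]]
      coeffs_Y_Eo(1)[OF assms]
    by (simp add: pr2_linear assms fscale_apply sg_scale sing_compat2[OF assms(3)])
qed

lemma subspace_Eo_iff:
  "module.subspace (Eo_scale sc) K \<longleftrightarrow> 0 \<in> K \<and> (\<forall>x\<in>K. \<forall>y\<in>K. x + y \<in> K) \<and> (\<forall>c. \<forall>x\<in>K. Eo_scale sc c x \<in> K)"
proof -
  interpret V: vector_space "Eo_scale sc" by (rule vector_space_Eo_scale)
  show ?thesis by (auto simp: V.subspace_def)
qed

definition vhull :: "('w \<Rightarrow> 'w fls) set \<Rightarrow> ('w \<Rightarrow> 'w fls) set" where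
  "vhull U = spn (\<Union>n. iter U n)"

lemma hull_good: "good_rel sc U U \<Longrightarrow> good_rel sc (vhull U) (vhull U)"
  unfolding vhull_def by (intro good_rel_spn good_rel_chain)

text \<open>Two elements of the chain lie in a common stage and their products in the next one.
  Bilinearity extends this to the span, one argument at a time.\<close>

lemma hull_Y:
  assumes U: "good_rel sc U U" and ab: "a \<in> vhull U" "b \<in> vhull U"
  shows "Y_Eo sc a b $$ m \<in> vhull U"
proof -
  note H = hull_good[OF U]
  let ?A = "\<Union>n. iter U n"
  have AH: "?A \<subseteq> vhull U" by (auto simp: vhull_def intro: nmod_base)
  have HE: "vhull U \<subseteq> Eo sc" using H by (simp add: good_rel_def)
  have sub: "0 \<in> vhull U" "x \<in> vhull U \<Longrightarrow> y \<in> vhull U \<Longrightarrow> x + y \<in> vhull U" "x \<in> vhull U \<Longrightarrow> Eo_scale sc c x \<in> vhull U" for x y c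
    by (auto simp: vhull_def intro: nmod_0 nmod_add nmod_scale)
  have c: "\<exists>k. compat2 k a b" if "a \<in> vhull U" "b \<in> vhull U" for a b
    using good_relD(3)[OF H that] .
  have 0: "Y_Eo sc 0 b $$ m = 0" "Y_Eo sc b 0 $$ m = 0" if b: "b \<in> vhull U" for b
  proof -
    have bE: "b \<in> Eo sc" using HE b by blast
    obtain k k' where k: "compat2 k 0 b" "compat2 k' b 0" using c sub(1) b by blast
    show "Y_Eo sc 0 b $$ m = 0"
      by (rule coeffs_inf_ext) (simp add: coeffs_Y_Eo(1)[OF Eo_zero_in bE k(1)] pr2_linear sg_zero fun_app coeffs_inf_zero)
    show "Y_Eo sc b 0 $$ m = 0"
      by (rule coeffs_inf_ext) (simp add: coeffs_Y_Eo(1)[OF bE Eo_zero_in k(2)] pr2_linear bE sg_zero fun_app coeffs_inf_zero)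
  qed
  have base: "Y_Eo sc a b $$ m \<in> vhull U" if ab: "a \<in> ?A" "b \<in> ?A" for a b
  proof -
    obtain i j where ij: "a \<in> iter U i" "b \<in> iter U j" using ab by blast
    then have "a \<in> iter U (max i j)" "b \<in> iter U (max i j)"
      using iter_mono[OF U, of i "max i j"] iter_mono[OF U, of j "max i j"] by auto
    then have "Y_Eo sc a b $$ m \<in> iter U (Suc (max i j))" by (auto simp: prods_def)
    then show ?thesis using AH by blast
  qed
  have left: "Y_Eo sc a b $$ m \<in> vhull U" if "a \<in> spn ?A" "b \<in> ?A" for a b
    using that
  proof (induction rule: spn_induct)
    case (add x y)
    then have *: "x \<in> vhull U" "y \<in> vhull U" "b \<in> vhull U" using AH by (auto simp: vhull_def)
    then obtain k k' where k: "compat2 k x b" "compat2 k' y b" using c by blast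
    have "x \<in> Eo sc" "y \<in> Eo sc" "b \<in> Eo sc" using * HE by auto
    from Y_Eo_add_left[OF this k] show ?case using add sub by simp
  next
    case (scale x e)
    then have *: "x \<in> vhull U" "b \<in> vhull U" using AH by (auto simp: vhull_def)
    then obtain k where k: "compat2 k x b" using c by blast
    have "x \<in> Eo sc" "b \<in> Eo sc" using * HE by auto
    from Y_Eo_scale_left[OF this k] show ?case using scale sub by (simp add: fls_scale_Eo_nth)
  next
    case zero
    then have "b \<in> vhull U" using AH by blast
    then show ?case using 0 sub by simp
  qed (use base in auto)
  have "Y_Eo sc a b $$ m \<in> vhull U" if "b \<in> spn ?A" "a \<in> vhull U" for a b
    using that
  proof (induction rule: spn_induct)
    case (base x)
    then show ?case using left by (auto simp: vhull_def)
  next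
    case (add x y)
    then have *: "x \<in> vhull U" "y \<in> vhull U" by (auto simp: vhull_def)
    then obtain k k' where k: "compat2 k a x" "compat2 k' a y" using c add by blast
    have "a \<in> Eo sc" "x \<in> Eo sc" "y \<in> Eo sc" using * HE add by auto
    from Y_Eo_add_right[OF this k] show ?case using add sub by simp
  next
    case (scale x e)
    then have *: "x \<in> vhull U" by (auto simp: vhull_def)
    then obtain k where k: "compat2 k a x" using c scale by blast
    have "a \<in> Eo sc" "x \<in> Eo sc" using * HE scale by auto
    from Y_Eo_scale_right[OF this k] show ?case using scale sub by (simp add: fls_scale_Eo_nth)
  next
    case zero
    then show ?case using 0 sub by auto
  qed
  with ab show ?thesis by (simp add: vhull_def)
qed

lemma hull_subspace: "module.subspace (Eo_scale sc) (vhull U)"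
  unfolding subspace_Eo_iff by (auto simp: vhull_def intro: nmod_0 nmod_add nmod_scale)

lemma compatible_quasi_compatible:
  assumes "compatible sc A"
  shows "quasi_compatible sc A"
proof -
  have "(X1 - X2) ^ k \<noteq> (0 :: complex poly poly)" for k by (simp add: X1_def X2_def)
  then show ?thesis using assms unfolding compatible_def quasi_compatible_def by blast
qed

lemma hull_base: "U \<subseteq> vhull U" "Eo_one \<in> vhull U"
proof -
  have "iter U 0 \<subseteq> vhull U" unfolding vhull_def by (auto intro!: nmod_base exI[of _ 0])
  then show "U \<subseteq> vhull U" "Eo_one \<in> vhull U" by auto
qed

lemma generated_eq_hull:
  assumes U: "good_rel sc U U"
  shows "generated sc U = vhull U"
  unfolding generated_def
proof (rule Least_equality)
  show "closed_subspace sc (vhull U) \<and> U \<subseteq> vhull U \<and> Eo_one \<in> vhull U"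
    unfolding closed_subspace_def
    using hull_subspace hull_Y[OF U] hull_base compatible_quasi_compatible[OF good_compatible[OF hull_good[OF U]]] by auto
next
  fix K assume K: "closed_subspace sc K \<and> U \<subseteq> K \<and> Eo_one \<in> K"
  have Y: "Y_Eo sc a b $$ m \<in> K" if "a \<in> K" "b \<in> K" for a b m
  proof -
    \<comment> \<open>Closure is indexed by n with x0^(-n-1); n = -m - 1 reaches the coefficient
      \<open>m\<close>.\<close>
    have "Y_Eo sc a b $$ (- (- m - 1) - 1) \<in> K" using K that unfolding closed_subspace_def by blast
    then show ?thesis by simp
  qed
  have it: "iter U n \<subseteq> K" for n
  proof (induction n)
    case (Suc n)
    then show ?case using Y by (auto simp: prods_def subset_iff)
  qed (use K in simp)
  have "x \<in> K" if "x \<in> spn (\<Union>n. iter U n)" for x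
    using that
    by (induction rule: spn_induct) (use K it in \<open>auto simp: closed_subspace_def subspace_Eo_iff\<close>)
  then show "vhull U \<subseteq> K" by (auto simp: vhull_def)
qed

end

section \<open>Products of three operators\<close>

text \<open>Two ways to find the coefficient of x0^m x2^n in (x + x2 + x0)^i (x + x2)^q. On the
  right the first power is expanded in x0 and what remains, a power of x + x2, in x2. On the left (x
  + x1)^i (x + x2)^q is expanded first and then x1 = x0 + x2.\<close>

lemma cb_vandermonde:
  "(\<Sum>l\<in>{0..n}. cb (m + l) l * (cb i (m + l) * cb q (n - l))) = cb i m * cb (i + q - m) n"
proof (cases "m < 0 \<or> n < 0")
  case True
  \<comment> \<open>Negative \<open>n\<close> leaves no summands. For negative \<open>m\<close> the
    factor \<open>cb i (m + l)\<close> vanishes if \<open>m + l\<close> is negative, and otherwise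
    \<open>cb (m + l) l\<close> does, because then 0 <= m + l < l.\<close>
  have "cb (m + l) l * (cb i (m + l) * cb q (n - l)) = 0" if "l \<in> {0..n}" for l
  proof (cases "m + l < 0")
    case False
    with True that have "cb (m + l) l = of_nat (nat (m + l) choose nat l)" "nat (m + l) < nat l"
      by (auto simp: cb_def binomial_gbinomial)
    then show ?thesis by simp
  qed simp
  then have "(\<Sum>l\<in>{0..n}. cb (m + l) l * (cb i (m + l) * cb q (n - l))) = 0" by (intro sum.neutral) auto
  with True show ?thesis by auto
next
  case False
  then obtain m' n' where m: "m = int m'" "n = int n'" by (metis nonneg_int_cases linorder_not_less)
  \<comment> \<open>Trinomial revision takes \<open>cb i m\<close> out of the sum; Vandermonde's
    convolution remains.\<close>
  have rev: "cb (m + int l) (int l) * cb i (m + int l) = cb i m * (of_int (i - m) gchoose l)" for l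
  proof -
    have "(of_int i gchoose (m' + l)) * (of_nat (m' + l) gchoose m') = (of_int i gchoose m') * ((of_int i - of_nat m' :: complex) gchoose l)"
      using gbinomial_trinomial_revision[of m' "m' + l" "of_int i :: complex"] by simp
    moreover have "(of_nat (m' + l) gchoose m' :: complex) = of_nat (m' + l) gchoose l"
      unfolding binomial_gbinomial[symmetric] using binomial_symmetric[of m' "m' + l"] by simp
    ultimately show ?thesis by (simp add: cb_def m nat_add_distrib mult.commute)
  qed
  have "(\<Sum>l\<in>{0..n}. cb (m + l) l * (cb i (m + l) * cb q (n - l))) =
      (\<Sum>l\<in>{0..n'}. cb (m + int l) (int l) * (cb i (m + int l) * cb q (n - int l)))"
    by (rule sum.reindex_bij_witness[of _ int nat]) (auto simp: m)
  also have "\<dots> = (\<Sum>l\<in>{0..n'}. cb i m * ((of_int (i - m) gchoose l) * (of_int q gchoose (n' - l))))"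
  proof (rule sum.cong[OF refl])
    fix l assume "l \<in> {0..n'}"
    then have "cb q (n - int l) = of_int q gchoose (n' - l)" by (simp add: cb_def m nat_diff_distrib)
    then show "cb (m + int l) (int l) * (cb i (m + int l) * cb q (n - int l)) = cb i m * ((of_int (i - m) gchoose l) * (of_int q gchoose (n' - l)))"
      using rev[of l] by (simp add: mult.assoc[symmetric])
  qed
  also have "\<dots> = cb i m * ((of_int (i - m) + of_int q) gchoose n')"
    by (simp only: sum_distrib_left[symmetric] gbinomial_Vandermonde)
  also have "\<dots> = cb i m * cb (i + q - m) n"
    by (simp add: cb_def m algebra_simps)
  finally show ?thesis .
qed

definition swap12 :: "(int \<Rightarrow> int \<Rightarrow> int \<Rightarrow> 'v) \<Rightarrow> int \<Rightarrow> int \<Rightarrow> int \<Rightarrow> 'v" where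
  "swap12 F = (\<lambda>m n r. F n m r)"

context complex_space
begin

text \<open>For \<open>F = a(z\<^sub>1)b(z\<^sub>2)c(z\<^sub>3)w\<close>, \<open>sgV F m n\<close> and \<open>sgB F w m n\<close> are the coefficients of \<open>x\<^sub>1\<^sup>m x\<^sub>2\<^sup>n\<close> in
  \<open>Y(a,x\<^sub>1)Y(b,x\<^sub>2)c\<close> and of \<open>x\<^sub>0\<^sup>m x\<^sub>2\<^sup>n\<close> in \<open>Y(Y(a,x\<^sub>0)b,x\<^sub>2)c\<close>, applied to \<open>w\<close>.\<close>

definition sgV :: "(int \<Rightarrow> int \<Rightarrow> int \<Rightarrow> 'w) \<Rightarrow> int \<Rightarrow> int \<Rightarrow> int \<Rightarrow> 'w" where
  "sgV F m n = sg m (\<lambda>z1. sg n (F z1))"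

definition domV :: "(int \<Rightarrow> int \<Rightarrow> int \<Rightarrow> 'w) \<Rightarrow> bool" where
  "domV F \<longleftrightarrow> (\<forall>z1. sing (F z1)) \<and> (\<forall>n. sing (\<lambda>z1. sg n (F z1)))"

definition sgB :: "('w \<Rightarrow> int \<Rightarrow> int \<Rightarrow> int \<Rightarrow> 'w) \<Rightarrow> 'w \<Rightarrow> int \<Rightarrow> int \<Rightarrow> int \<Rightarrow> 'w" where
  "sgB F w m n = sg n (sgA m F w)"

definition domB :: "('w \<Rightarrow> int \<Rightarrow> int \<Rightarrow> int \<Rightarrow> 'w) \<Rightarrow> bool" where
  "domB F \<longleftrightarrow> singA F \<and> (\<forall>m w. sing (sgA m F w))"

lemma sg_add_slice: "domV F \<Longrightarrow> domV G \<Longrightarrow> (\<lambda>z1. sg n ((F + G) z1)) = (\<lambda>z1. sg n (F z1)) + (\<lambda>z1. sg n (G z1))"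
  by (simp add: domV_def fun_eq_iff plus_fun_apply[of F G] sg_add) (simp add: fun_app)

lemma domV_add: "domV F \<Longrightarrow> domV G \<Longrightarrow> domV (F + G)"
proof -
  assume *: "domV F" "domV G"
  have "sing ((F + G) z1)" for z1 using * by (simp add: domV_def fun_app sing_add)
  moreover have "sing (\<lambda>z1. sg n ((F + G) z1))" for n
    unfolding sg_add_slice[OF *] using * by (intro sing_add) (auto simp: domV_def)
  ultimately show ?thesis by (simp add: domV_def)
qed

lemma sgV_add: "domV F \<Longrightarrow> domV G \<Longrightarrow> sgV (F + G) m n = sgV F m n + sgV G m n"
  unfolding sgV_def by (subst sg_add_slice) (auto simp: domV_def intro: sg_add)

lemma sg_scale_slice: "domV F \<Longrightarrow> (\<lambda>z1. sg n (fscale s2 c F z1)) = s2 c (\<lambda>z1. sg n (F z1))"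
  by (simp add: domV_def fun_eq_iff fscale_apply[of s2] sg_scale) (simp add: fscale_apply)

lemma domV_scale: "domV F \<Longrightarrow> domV (fscale s2 c F)"
  unfolding domV_def[of "fscale s2 c F"] sg_scale_slice
  by (auto simp: domV_def fscale_apply[of s2] intro!: sing_scale)

lemma sgV_scale: "domV F \<Longrightarrow> sgV (fscale s2 c F) m n = fscale sc c (sgV F m n)"
  unfolding sgV_def by (subst sg_scale_slice) (auto simp: domV_def intro: sg_scale)

lemma e13_slice: "domV F \<Longrightarrow> (\<lambda>z1. sg n (e13 F z1)) = dl (\<lambda>z1. sg n (F z1))"
proof -
  assume F: "domV F"
  have "e13 F z1 = F (z1 - 1) - sh2 (F z1)" for z1 by (simp add: e13_def sh2_def fun_eq_iff fun_app)
  then have "sg n (e13 F z1) = sg n (F (z1 - 1)) - sg n (sh2 (F z1))" for z1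
    using F by (simp add: domV_def sg_diff sing_sh2)
  then show ?thesis using F
    by (intro ext) (simp add: domV_def dl_def fun_app sg_sh2)
qed

lemma e23_slice: "domV F \<Longrightarrow> (\<lambda>z1. sg n (e23 F z1)) = (\<lambda>z1. sg (n - 1) (F z1))"
proof -
  assume F: "domV F"
  have "e23 F z1 = dl (F z1)" for z1 by (simp add: e23_def dl_def)
  then show ?thesis using F by (simp add: domV_def sg_dl)
qed

lemma domV_e13: "domV F \<Longrightarrow> domV (e13 F)"
proof -
  assume F: "domV F"
  have "e13 F z1 = F (z1 - 1) - sh2 (F z1)" for z1 by (simp add: e13_def sh2_def fun_eq_iff fun_app)
  then show ?thesis using F e13_slice[OF F]
    by (simp add: domV_def sing_diff sing_sh2 sing_dl)
qed

lemma domV_e23: "domV F \<Longrightarrow> domV (e23 F)"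
proof -
  assume F: "domV F"
  have "e23 F z1 = dl (F z1)" for z1 by (simp add: e23_def dl_def)
  then show ?thesis using F e23_slice[OF F] by (simp add: domV_def sing_dl)
qed

lemma sgV_e13: "domV F \<Longrightarrow> sgV (e13 F) m n = sgV F (m - 1) n"
  unfolding sgV_def by (subst e13_slice) (auto simp: domV_def sg_dl)

lemma sgV_e23: "domV F \<Longrightarrow> sgV (e23 F) m n = sgV F m (n - 1)"
  unfolding sgV_def by (subst e23_slice) auto

lemma e12_eq: "e12 F = e13 F + fscale s2 (-1) (e23 F)"
  by (simp add: e_defs fun_eq_iff fun_app fscale_apply)

lemma domV_e12: "domV F \<Longrightarrow> domV (e12 F)"
  unfolding e12_eq by (intro domV_add domV_scale domV_e13 domV_e23)

lemma sgV_e12: "domV F \<Longrightarrow> sgV (e12 F) m n = sgV F (m - 1) n - sgV F m (n - 1)"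
  unfolding e12_eq
  by (simp add: sgV_add sgV_scale domV_scale domV_e13 domV_e23 sgV_e13 sgV_e23 fun_eq_iff fun_app fscale_apply)

definition vx :: "int \<Rightarrow> (int \<Rightarrow> int \<Rightarrow> int \<Rightarrow> 'w) \<Rightarrow> int \<Rightarrow> int \<Rightarrow> 'w" where
  "vx x F = (\<lambda>m n. sgV F m n x)"

text \<open>Under z1 = x + x1, z2 = x + x2, z3 = x the differences z1 - z3, z2 - z3, z1 - z2 become
  x1, x2, x1 - x2.\<close>

lemma vx_e: "domV F \<Longrightarrow> vx x (e13 F) = sh1 (vx x F)" "domV F \<Longrightarrow> vx x (e23 F) = sh2 (vx x F)"
  "domV F \<Longrightarrow> vx x (e12 F) = dl (vx x F)"
  by (simp_all add: vx_def sgV_e12 sgV_e13 sgV_e23 sh1_def sh2_def dl_def fun_eq_iff fun_app)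

lemma vx_add: "domV F \<Longrightarrow> domV G \<Longrightarrow> vx x (F + G) = vx x F + vx x G"
  by (simp add: vx_def sgV_add fun_eq_iff fun_app)

lemma vx_scale: "domV F \<Longrightarrow> vx x (fscale s2 c F) = s2 c (vx x F)"
  by (simp add: vx_def sgV_scale fun_eq_iff fscale_apply)

lemma e_pow_domV: "domV F \<Longrightarrow> domV ((e12 ^^ i) F) \<and> vx x ((e12 ^^ i) F) = (dl ^^ i) (vx x F)"
  "domV F \<Longrightarrow> domV ((e13 ^^ i) F) \<and> vx x ((e13 ^^ i) F) = (sh1 ^^ i) (vx x F)"
  "domV F \<Longrightarrow> domV ((e23 ^^ i) F) \<and> vx x ((e23 ^^ i) F) = (sh2 ^^ i) (vx x F)"
  by (induction i) (simp_all add: o_apply domV_e12 domV_e13 domV_e23 vx_e)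

text \<open>The exponents \<open>k\<close> and \<open>l\<close> are kept apart: z1 - z3 and z2 - z3
  become the monomials x1 and x2, whose powers can be undone, while powers of x1 - x2
  cannot.\<close>

definition EE :: "nat \<Rightarrow> nat \<Rightarrow> (int \<Rightarrow> int \<Rightarrow> int \<Rightarrow> 'w) \<Rightarrow> int \<Rightarrow> int \<Rightarrow> int \<Rightarrow> 'w" where
  "EE k l F = (e12 ^^ k) ((e13 ^^ l) ((e23 ^^ l) F))"

definition TT :: "nat \<Rightarrow> nat \<Rightarrow> (int \<Rightarrow> int \<Rightarrow> 'w) \<Rightarrow> int \<Rightarrow> int \<Rightarrow> 'w" where
  "TT k l H = (dl ^^ k) ((sh1 ^^ l) ((sh2 ^^ l) H))"

lemma vx_EE: "domV F \<Longrightarrow> vx x (EE k l F) = TT k l (vx x F)"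
  by (simp add: EE_def TT_def e_pow_domV)

lemma EE_e12: "EE k l (e12 F) = e12 (EE k l F)"
proof -
  have "e12 ((e13 ^^ k) F) = (e13 ^^ k) (e12 F)" "e12 ((e23 ^^ k) F) = (e23 ^^ k) (e12 F)" "e12 ((e12 ^^ k) F) = (e12 ^^ k) (e12 F)"
    for k and F :: "int \<Rightarrow> int \<Rightarrow> int \<Rightarrow> 'w"
    by (rule funpow_intertwine[where L = e12], simp add: e_commute)+
  then show ?thesis by (simp add: EE_def)
qed

lemma e_linear:
  "e12 (F + G) = e12 F + e12 G" "e12 (fscale s2 c F) = fscale s2 c (e12 F)"
  "e13 (F + G) = e13 F + e13 G" "e13 (fscale s2 c F) = fscale s2 c (e13 F)"
  "e23 (F + G) = e23 F + e23 G" "e23 (fscale s2 c F) = fscale s2 c (e23 F)"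
  by (simp_all add: e_defs fun_eq_iff fun_app fscale_apply scale_right_diff_distrib)

lemma EE_linear: "EE k l (F + G) = EE k l F + EE k l G" "EE k l (fscale s2 c F) = fscale s2 c (EE k l F)"
proof -
  have a: "(e12 ^^ k) (F + G) = (e12 ^^ k) F + (e12 ^^ k) G" "(e13 ^^ k) (F + G) = (e13 ^^ k) F + (e13 ^^ k) G"
    "(e23 ^^ k) (F + G) = (e23 ^^ k) F + (e23 ^^ k) G" for k and F G :: "int \<Rightarrow> int \<Rightarrow> int \<Rightarrow> 'w"
    by (induction k) (simp_all add: e_linear o_apply)
  have s: "(e12 ^^ k) (fscale s2 c F) = fscale s2 c ((e12 ^^ k) F)" "(e13 ^^ k) (fscale s2 c F) = fscale s2 c ((e13 ^^ k) F)"
    "(e23 ^^ k) (fscale s2 c F) = fscale s2 c ((e23 ^^ k) F)" for k F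
    by (induction k) (simp_all add: e_linear o_apply)
  show "EE k l (F + G) = EE k l F + EE k l G" "EE k l (fscale s2 c F) = fscale s2 c (EE k l F)"
    by (simp_all add: EE_def a s)
qed

lemma TT_linear: "TT k l (F + G) = TT k l F + TT k l G" "TT k l (s2 c F) = s2 c (TT k l F)" "TT k l (dl F) = dl (TT k l F)"
proof -
  have a: "(sh1 ^^ k) (F + G) = (sh1 ^^ k) F + (sh1 ^^ k) G" "(sh2 ^^ k) (F + G) = (sh2 ^^ k) F + (sh2 ^^ k) G" for k and F G :: "int \<Rightarrow> int \<Rightarrow> 'w"
    using linear_endo.T_add[OF dl.E1.pow_endo[of k], of F G] linear_endo.T_add[OF dl.E2.pow_endo[of k], of F G] by auto
  have s: "(sh1 ^^ k) (s2 c F) = s2 c ((sh1 ^^ k) F)" "(sh2 ^^ k) (s2 c F) = s2 c ((sh2 ^^ k) F)" "(dl ^^ k) (s2 c F) = s2 c ((dl ^^ k) F)" for k F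
    using linear_endo.T_scale[OF dl.E1.pow_endo[of k], of c F] linear_endo.T_scale[OF dl.E2.pow_endo[of k], of c F]
      linear_endo.T_scale[OF dlE.pow_endo[of k], of c F] by auto
  show "TT k l (F + G) = TT k l F + TT k l G" "TT k l (s2 c F) = s2 c (TT k l F)"
    by (simp_all add: TT_def a s dl_pow_add)
  have "dl ((sh1 ^^ k) F) = (sh1 ^^ k) (dl F)" "dl ((sh2 ^^ k) F) = (sh2 ^^ k) (dl F)" "dl ((dl ^^ k) F) = (dl ^^ k) (dl F)" for k and F :: "int \<Rightarrow> int \<Rightarrow> 'w"
    by (rule funpow_intertwine[where L = dl], simp add: dl_def sh1_def sh2_def fun_eq_iff)+
  then show "TT k l (dl F) = dl (TT k l F)" by (simp add: TT_def)
qed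

lemma TT_apply: "TT k l H m n = (dl ^^ k) H (m - int l) (n - int l)"
proof -
  have 1: "(sh1 ^^ l) ((sh2 ^^ l) H) = (\<lambda>m n. H (m - int l) (n - int l))"
  proof -
    have "(sh1 ^^ k) H = (\<lambda>m n. H (m - int k) n)" "(sh2 ^^ k) H = (\<lambda>m n. H m (n - int k))" for k and H :: "int \<Rightarrow> int \<Rightarrow> 'w"
      by (induction k) (simp_all add: o_apply sh1_def sh2_def fun_eq_iff algebra_simps)
    then show ?thesis by simp
  qed
  have "(\<lambda>m n. (dl ^^ k) H (m - int l) (n - int l)) = (dl ^^ k) (\<lambda>m n. H (m - int l) (n - int l))"
    by (rule funpow_intertwine[where L = "\<lambda>H m n. H (m - int l) (n - int l)"])
      (simp add: dl_def fun_eq_iff algebra_simps)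
  from fun_cong[OF fun_cong[OF this]] show ?thesis unfolding TT_def 1 by simp
qed

lemma TT_inj: "TT k l H = TT k l H' \<longleftrightarrow> (dl ^^ k) H = (dl ^^ k) H'"
proof
  assume *: "TT k l H = TT k l H'"
  have "(dl ^^ k) H m n = (dl ^^ k) H' m n" for m n
    using fun_cong[OF fun_cong[OF *], of "m + int l" "n + int l"] by (simp add: TT_apply)
  then show "(dl ^^ k) H = (dl ^^ k) H'" by (simp add: fun_eq_iff)
qed (simp add: TT_apply fun_eq_iff)

lemma bnd3_EE_mono: "bnd3 (EE k l F) \<Longrightarrow> k \<le> k' \<Longrightarrow> l \<le> l' \<Longrightarrow> bnd3 (EE k' l' F)"
proof -
  assume *: "bnd3 (EE k l F)" "k \<le> k'" "l \<le> l'"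
  define d d' where "d = k' - k" and "d' = l' - l"
  have kl: "k' = d + k" "l' = d' + l" using * by (auto simp: d_def d'_def)
  have "EE k' l' F = (e12 ^^ d) ((e13 ^^ d') ((e23 ^^ d') (EE k l F)))"
    unfolding EE_def kl funpow_add o_apply by (simp only: e_pow_pow_commute)
  then show ?thesis using bnd3_pow[OF *(1)] by simp
qed

lemma bnd3_add: "bnd3 F \<Longrightarrow> bnd3 G \<Longrightarrow> bnd3 (F + G :: int \<Rightarrow> int \<Rightarrow> int \<Rightarrow> 'w)"
proof -
  assume "bnd3 F" "bnd3 G"
  then obtain N M where N: "\<And>m n r. F m n r \<noteq> 0 \<Longrightarrow> m \<le> N \<and> n \<le> N \<and> r \<le> N"
    and M: "\<And>m n r. G m n r \<noteq> 0 \<Longrightarrow> m \<le> M \<and> n \<le> M \<and> r \<le> M" unfolding bnd3_def by blast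
  have "m \<le> max N M \<and> n \<le> max N M \<and> r \<le> max N M" if "(F + G) m n r \<noteq> 0" for m n r
    using N[of m n r] M[of m n r] that by (cases "F m n r = 0") (auto simp: fun_app)
  then show ?thesis unfolding bnd3_def by blast
qed

lemma bnd3_scale: "bnd3 F \<Longrightarrow> bnd3 (fscale s2 c F)"
  unfolding bnd3_def fscale_apply by (metis scale_zero_right)

lemma S_sum':
  assumes "finite I" "\<And>i. i \<notin> I \<Longrightarrow> F i (n + j - i) = 0"
  shows "S j F n = (\<Sum>i\<in>I. sc (cb i j) (F i (n + j - i)))"
  unfolding S_def by (rule Sum_any.expand_superset) (use assms in auto)

lemma bounded3_bnd2:
  assumes G: "\<And>m n r. G m n r \<noteq> 0 \<Longrightarrow> m \<le> N \<and> n \<le> N \<and> r \<le> N"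
  shows "bnd2 (G z1)" "bnd2 (\<lambda>z1. sg n (G z1))" "bnd2 (\<lambda>m n. G m n r)" "bnd2 (\<lambda>z2 z3. sg m (\<lambda>m n. G m n z3) z2)"
proof -
  show b: "bnd2 (G z1)" for z1 by (rule bnd2I[of _ N]) (use G in blast)
  have "z1 \<le> max N (2 * N - n) \<and> z3 \<le> max N (2 * N - n)" if nz: "sg n (G z1) z3 \<noteq> 0" for z1 z3
  proof -
    have nz': "S n (G z1) z3 \<noteq> 0" using nz by (simp add: sg_bnd2[OF b])
    have "z3 \<le> 2 * N - n" by (rule S_bounded[OF _ nz']) (use G in blast)
    moreover have "z1 \<le> N"
    proof (rule ccontr)
      assume "\<not> z1 \<le> N"
      then have "G z1 z2 z3 = 0" for z2 z3 using G[of z1 z2 z3] by blast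
      then show False using nz' by (simp add: S_def)
    qed
    ultimately show ?thesis by auto
  qed
  then show "bnd2 (\<lambda>z1. sg n (G z1))" by (rule bnd2I)
  show b': "bnd2 (\<lambda>m n. G m n r)" for r by (rule bnd2I[of _ N]) (use G in blast)
  have "z2 \<le> max N (2 * N - m) \<and> z3 \<le> max N (2 * N - m)" if nz: "sg m (\<lambda>m n. G m n z3) z2 \<noteq> 0" for z2 z3
  proof -
    have nz': "S m (\<lambda>m n. G m n z3) z2 \<noteq> 0" using nz by (simp add: sg_bnd2[OF b'])
    have "z2 \<le> 2 * N - m" by (rule S_bounded[OF _ nz']) (use G in blast)
    moreover have "z3 \<le> N"
    proof (rule ccontr)
      assume "\<not> z3 \<le> N"
      then have "G z1 z2 z3 = 0" for z1 z2 using G[of z1 z2 z3] by blast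
      then show False using nz' by (simp add: S_def)
    qed
    ultimately show ?thesis by auto
  qed
  then show "bnd2 (\<lambda>z2 z3. sg m (\<lambda>m n. G m n z3) z2)" by (rule bnd2I)
qed

text \<open>The exponents of z1, z2, z3 add up to \<open>x + m + n\<close>, so for a bounded series
  the iterated substitution is one finite double sum.\<close>

lemma sgV_bounded:
  assumes G: "\<And>m n r. G m n r \<noteq> 0 \<Longrightarrow> m \<le> N \<and> n \<le> N \<and> r \<le> N"
  defines "J \<equiv> \<lambda>s. {s - 2 * N..N}"
  shows "sgV G m n x = (\<Sum>i\<in>J (x + m + n). \<Sum>j\<in>J (x + m + n). sc (cb i m * cb j n) (G i j (x + m + n - i - j)))"
proof -
  have z: "G i j r = 0" if "i > N \<or> j > N \<or> r > N" for i j r using G[of i j r] that by force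
  note b = bounded3_bnd2[OF G]
  let ?J = "J (x + m + n)"
  have in1: "S n (G i) (x + m - i) = (\<Sum>j\<in>?J. sc (cb j n) (G i j (x + m - i + n - j)))" for i
  proof (rule S_sum')
    fix j assume "j \<notin> ?J"
    then show "G i j (x + m - i + n - j) = 0"
      by (intro z) (auto simp: J_def)
  qed (simp add: J_def)
  have "sgV G m n x = S m (\<lambda>z1. S n (G z1)) x"
    unfolding sgV_def using b by (simp add: sg_bnd2)
  also have "\<dots> = (\<Sum>i\<in>?J. sc (cb i m) (S n (G i) (x + m - i)))"
  proof (rule S_sum')
    fix i assume i: "i \<notin> ?J"
    have "G i j (x + m - i + n - j) = 0" for j
      using i by (intro z) (auto simp: J_def)
    then show "S n (G i) (x + m - i) = 0" unfolding in1 by simp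
  qed (simp add: J_def)
  also have "\<dots> = (\<Sum>i\<in>?J. \<Sum>j\<in>?J. sc (cb i m * cb j n) (G i j (x + m + n - i - j)))"
    unfolding in1 by (simp add: scale_sum_right algebra_simps)
  finally show ?thesis .
qed

lemma domV_bnd3: "bnd3 G \<Longrightarrow> domV G"
  unfolding bnd3_def domV_def using bounded3_bnd2(1,2) sing_bnd2 by blast

text \<open>For a bounded series the order of the two substitutions does not matter, as the double
  sum of \<open>sgV_bounded\<close> is symmetric in z1 and z2.\<close>

lemma sgV_swap12:
  assumes "bnd3 G"
  shows "vx x (swap12 G) = flip2 (vx x G)"
proof (intro ext)
  fix m n
  obtain N where G: "\<And>m n r. G m n r \<noteq> 0 \<Longrightarrow> m \<le> N \<and> n \<le> N \<and> r \<le> N"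
    using assms unfolding bnd3_def by blast
  have G': "swap12 G m n r \<noteq> 0 \<Longrightarrow> m \<le> N \<and> n \<le> N \<and> r \<le> N" for m n r
    using G[of n m r] by (auto simp: swap12_def)
  have 1: "sgV (swap12 G) m n x = (\<Sum>i\<in>{x + m + n - 2 * N..N}. \<Sum>j\<in>{x + m + n - 2 * N..N}.
      sc (cb i m * cb j n) (swap12 G i j (x + m + n - i - j)))"
    by (rule sgV_bounded) (rule G')
  have 2: "sgV G n m x = (\<Sum>i\<in>{x + n + m - 2 * N..N}. \<Sum>j\<in>{x + n + m - 2 * N..N}.
      sc (cb i n * cb j m) (G i j (x + n + m - i - j)))"
    by (rule sgV_bounded) (rule G)
  show "vx x (swap12 G) m n = flip2 (vx x G) m n"
    unfolding vx_def flip2_def 1 2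
    by (subst sum.swap) (simp add: swap12_def algebra_simps)
qed

lemma sgV_bnd3_neg: "bnd3 G \<Longrightarrow> m < 0 \<or> n < 0 \<Longrightarrow> vx x G m n = 0"
proof -
  assume "bnd3 G" and mn: "m < 0 \<or> n < 0"
  then obtain N where G: "\<And>m n r. G m n r \<noteq> 0 \<Longrightarrow> m \<le> N \<and> n \<le> N \<and> r \<le> N"
    unfolding bnd3_def by blast
  have 1: "sgV G m n x = (\<Sum>i\<in>{x + m + n - 2 * N..N}. \<Sum>j\<in>{x + m + n - 2 * N..N}.
      sc (cb i m * cb j n) (G i j (x + m + n - i - j)))"
    by (rule sgV_bounded) (rule G)
  show ?thesis unfolding vx_def 1 using mn by (intro sum.neutral ballI) auto
qed

definition Sub :: "(int \<Rightarrow> int \<Rightarrow> 'w) \<Rightarrow> int \<Rightarrow> int \<Rightarrow> 'w" where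
  "Sub H = (\<lambda>m n. Sum_any (\<lambda>j. sc (binom_coeff 1 1 m j) (H (m + j) (n - j))))"
  \<comment> \<open>\<open>H(x\<^sub>0 + x\<^sub>2, x\<^sub>2)\<close>\<close>

lemma Sub_sum:
  assumes "\<And>m n. n < B \<Longrightarrow> H m n = 0" "finite I" "{0..n - B} \<subseteq> I"
  shows "Sub H m n = (\<Sum>j\<in>I. sc (cb (m + j) j) (H (m + j) (n - j)))"
  unfolding Sub_def binom_coeff_cb
proof (subst Sum_any.expand_superset[of I])
  show "{j. sc (cb (m + j) j * 1 powi m * 1 powi j) (H (m + j) (n - j)) \<noteq> 0} \<subseteq> I"
  proof clarify
    fix j assume "sc (cb (m + j) j * 1 powi m * 1 powi j) (H (m + j) (n - j)) \<noteq> 0"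
    then have "\<not> j < 0" "\<not> n - j < B" using assms(1)[of "n - j" "m + j"] by auto
    then show "j \<in> I" using assms(3) by auto
  qed
qed (use assms in simp_all)

text \<open>Substituting z1 = z2 + x0 and then z2 = x + x2 amounts to z1 = x + x1, z2 = x + x2
  followed by x1 = x0 + x2. On finite sums this is \<open>cb_vandermonde\<close>.\<close>

lemma sgB_bounded:
  assumes G: "\<And>m n r. F w m n r \<noteq> 0 \<Longrightarrow> m \<le> N \<and> n \<le> N \<and> r \<le> N"
  shows "sgB F w m n x = Sub (vx x (F w)) m n"
proof -
  define G' where "G' = F w"
  have G: "\<And>m n r. G' m n r \<noteq> 0 \<Longrightarrow> m \<le> N \<and> n \<le> N \<and> r \<le> N" using assms by (simp add: G'_def)
  have z: "G' i j r = 0" if "i > N \<or> j > N \<or> r > N" for i j r using G[of i j r] that by force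
  have b3: "bnd3 G'" unfolding bnd3_def using G by blast
  note b = bounded3_bnd2[OF G]
  define J where "J = {x + m + n - 2 * N..N}"
  define J2 where "J2 = {x + n - N..2 * N - m}"
  have in1: "S m (\<lambda>z1 z2. G' z1 z2 (x + n - j)) j = (\<Sum>i\<in>J. sc (cb i m) (G' i (j + m - i) (x + n - j)))" for j
  proof (rule S_sum')
    fix i assume "i \<notin> J"
    then show "G' i (j + m - i) (x + n - j) = 0" by (intro z) (auto simp: J_def)
  qed (simp add: J_def)
  have "sgB F w m n x = S n (\<lambda>z2 z3. S m (\<lambda>z1 z2. G' z1 z2 z3) z2) x"
    unfolding sgB_def sgA_def G'_def[symmetric] using b by (simp add: sg_bnd2)
  also have "\<dots> = (\<Sum>j\<in>J2. sc (cb j n) (S m (\<lambda>z1 z2. G' z1 z2 (x + n - j)) j))"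
  proof (rule S_sum')
    fix j assume j: "j \<notin> J2"
    have "G' i (j + m - i) (x + n - j) = 0" for i
      using j by (intro z) (auto simp: J2_def)
    then show "S m (\<lambda>z1 z2. G' z1 z2 (x + n - j)) j = 0" unfolding in1 by simp
  qed (simp add: J2_def)
  also have "\<dots> = (\<Sum>i\<in>J. \<Sum>j\<in>J2. sc (cb i m * cb j n) (G' i (j + m - i) (x + n - j)))"
    unfolding in1 by (subst sum.swap) (simp add: scale_sum_right algebra_simps)
  \<comment> \<open>\<open>q\<close> is the exponent of z2 in the given series and
    \<open>j = i + q - m\<close> the one after z1^i has contributed z2^(i-m).\<close>
  also have "\<dots> = (\<Sum>i\<in>J. \<Sum>q\<in>J. sc (cb i m * cb (i + q - m) n) (G' i q (x + m + n - i - q)))"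
  proof (rule sum.cong[OF refl])
    fix i
    let ?g = "\<lambda>q. sc (cb i m * cb (i + q - m) n) (G' i q (x + m + n - i - q))"
    have "(\<Sum>j\<in>J2. sc (cb i m * cb j n) (G' i (j + m - i) (x + n - j))) = (\<Sum>q\<in>(\<lambda>j. j + m - i) ` J2. ?g q)"
      by (subst sum.reindex) (auto simp: inj_on_def o_apply algebra_simps)
    also have "\<dots> = (\<Sum>q\<in>J. ?g q)"
    proof (rule sum.mono_neutral_cong)
      show "?g q = 0" if "q \<in> J - (\<lambda>j. j + m - i) ` J2" for q
      proof -
        have "q - m + i \<notin> J2"
        proof
          assume "q - m + i \<in> J2"
          then have "q \<in> (\<lambda>j. j + m - i) ` J2" by (intro image_eqI[of _ _ "q - m + i"]) auto
          with that show False by blast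
        qed
        then have "G' i q (x + m + n - i - q) = 0" by (intro z) (auto simp: J2_def)
        then show ?thesis by simp
      qed
      show "?g q = 0" if "q \<in> (\<lambda>j. j + m - i) ` J2 - J" for q
      proof -
        have "G' i q (x + m + n - i - q) = 0" using that by (intro z) (auto simp: J_def)
        then show ?thesis by simp
      qed
    qed (auto simp: J_def J2_def)
    finally show "(\<Sum>j\<in>J2. sc (cb i m * cb j n) (G' i (j + m - i) (x + n - j))) = (\<Sum>q\<in>J. ?g q)" .
  qed
  also have "\<dots> = (\<Sum>i\<in>J. \<Sum>q\<in>J. \<Sum>l\<in>{0..n}. sc (cb (m + l) l * (cb i (m + l) * cb q (n - l))) (G' i q (x + m + n - i - q)))"
    by (simp only: cb_vandermonde[symmetric] scale_sum_left)
  also have "\<dots> = (\<Sum>l\<in>{0..n}. \<Sum>i\<in>J. \<Sum>q\<in>J. sc (cb (m + l) l * (cb i (m + l) * cb q (n - l))) (G' i q (x + m + n - i - q)))"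
    by (simp only: sum.swap[of _ "{0..n}" J])
  also have "\<dots> = (\<Sum>l\<in>{0..n}. sc (cb (m + l) l) (vx x G' (m + l) (n - l)))"
  proof (rule sum.cong[OF refl])
    fix l
    have "vx x G' (m + l) (n - l) = (\<Sum>i\<in>J. \<Sum>q\<in>J. sc (cb i (m + l) * cb q (n - l)) (G' i q (x + m + n - i - q)))"
    proof -
      have "sgV G' (m + l) (n - l) x = (\<Sum>i\<in>{x + (m + l) + (n - l) - 2 * N..N}. \<Sum>j\<in>{x + (m + l) + (n - l) - 2 * N..N}.
          sc (cb i (m + l) * cb j (n - l)) (G' i j (x + (m + l) + (n - l) - i - j)))"
        by (rule sgV_bounded) (rule G)
      then show ?thesis by (simp add: vx_def J_def algebra_simps)
    qed
    then show "(\<Sum>i\<in>J. \<Sum>q\<in>J. sc (cb (m + l) l * (cb i (m + l) * cb q (n - l))) (G' i q (x + m + n - i - q)))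
       = sc (cb (m + l) l) (vx x G' (m + l) (n - l))"
      by (simp add: scale_sum_right)
  qed
  also have "\<dots> = Sub (vx x G') m n"
    by (rule Sub_sum[of 0, symmetric]) (auto simp: sgV_bnd3_neg[OF b3])
  finally show ?thesis by (simp add: G'_def)
qed

lemma Sub_sh2: "Sub (sh2 H) = sh2 (Sub H)"
  by (simp add: Sub_def sh2_def fun_eq_iff algebra_simps)

lemma Sub_sh1:
  assumes B: "\<And>m n. n < B \<Longrightarrow> H m n = 0"
  shows "Sub (sh1 H) = sh1 (Sub H) + sh2 (Sub H)"
proof (intro ext)
  fix m n
  define M where "M = \<bar>n - B\<bar> + 1"
  have z: "n' - j < B \<Longrightarrow> H (m' + j) (n' - j) = 0" for n' j m' using B by simp
  have "Sub (sh1 H) m n = (\<Sum>j\<in>{0..M}. sc (cb (m + j) j) (H (m - 1 + j) (n - j)))"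
    by (subst Sub_sum[of B _ "{0..M}"]) (auto simp: sh1_def B M_def algebra_simps)
  also have "\<dots> = (\<Sum>j\<in>{0..M}. sc (cb (m - 1 + j) j) (H (m - 1 + j) (n - j))) + (\<Sum>j\<in>{0..M}. sc (cb (m - 1 + j) (j - 1)) (H (m - 1 + j) (n - j)))"
  proof -
    have "cb (m + j) j = cb (m - 1 + j) j + cb (m - 1 + j) (j - 1)" for j
      using cb_Suc[of "m - 1 + j" j] by (simp add: algebra_simps)
    then show ?thesis by (simp add: scale_left_distrib sum.distrib)
  qed
  also have "(\<Sum>j\<in>{0..M}. sc (cb (m - 1 + j) j) (H (m - 1 + j) (n - j))) = sh1 (Sub H) m n"
    by (subst Sub_sum[of B _ "{0..M}", symmetric]) (auto simp: B M_def sh1_def)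
  also have "(\<Sum>j\<in>{0..M}. sc (cb (m - 1 + j) (j - 1)) (H (m - 1 + j) (n - j))) =
      (\<Sum>j\<in>{-1..M - 1}. sc (cb (m + j) j) (H (m + j) (n - 1 - j)))"
    by (rule sum.reindex_bij_witness[of _ "\<lambda>j. j + 1" "\<lambda>j. j - 1"]) (auto simp: algebra_simps)
  also have "\<dots> = sh2 (Sub H) m n"
    by (subst Sub_sum[of B _ "{-1..M - 1}", symmetric]) (auto simp: B M_def sh2_def)
  finally show "Sub (sh1 H) m n = (sh1 (Sub H) + sh2 (Sub H)) m n" by (simp add: fun_app)
qed

lemma Sub_diff:
  assumes B: "\<And>m n. n < B \<Longrightarrow> H m n = 0" "\<And>m n. n < B \<Longrightarrow> H' m n = 0"
  shows "Sub (H - H') = Sub H - Sub H'"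
proof (intro ext)
  fix m n
  have "Sub (H - H') m n = (\<Sum>j\<in>{0..n - B}. sc (cb (m + j) j) ((H - H') (m + j) (n - j)))"
    by (rule Sub_sum[of B]) (auto simp: B fun_app)
  then show "Sub (H - H') m n = (Sub H - Sub H') m n"
    by (simp add: Sub_sum[of B H, OF B(1) _ order.refl] Sub_sum[of B H', OF B(2) _ order.refl] fun_app
        scale_right_diff_distrib sum_subtractf)
qed

text \<open>Under x1 = x0 + x2 the factors x1 - x2, x1, x2 become x0, x0 + x2, x2. The lower bound
  in x2 makes the substitution a finite sum and survives all three multiplications.\<close>

lemma Sub_TT:
  assumes B: "\<And>m n. n < B \<Longrightarrow> H m n = 0"
  shows "Sub (TT k l H) = (sh1 ^^ k) (((\<lambda>x. sh1 x + sh2 x) ^^ l) ((sh2 ^^ l) (Sub H)))"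
proof -
  define P where "P G \<longleftrightarrow> (\<exists>B. \<forall>m n. n < B \<longrightarrow> G m n = 0)" for G :: "int \<Rightarrow> int \<Rightarrow> 'w"
  have P2: "P (sh2 G)" if G: "P G" for G
  proof -
    obtain B where "\<And>m n. n < B \<Longrightarrow> G m n = 0" using G unfolding P_def by blast
    then show ?thesis unfolding P_def sh2_def by (intro exI[of _ B]) auto
  qed
  have P1: "P (sh1 G)" if "P G" for G
    using that unfolding P_def sh1_def by blast
  have s1: "Sub (sh1 G) = sh1 (Sub G) + sh2 (Sub G)" if "P G" for G
    using that Sub_sh1 unfolding P_def by blast
  have Pd: "P (dl G) \<and> Sub (dl G) = sh1 (Sub G)" if G: "P G" for G
  proof -
    obtain B C where B: "\<And>m n. n < B \<Longrightarrow> sh1 G m n = 0" and C: "\<And>m n. n < C \<Longrightarrow> sh2 G m n = 0"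
      using P1[OF G] P2[OF G] unfolding P_def by blast
    have "Sub (sh1 G - sh2 G) = Sub (sh1 G) - Sub (sh2 G)"
      by (rule Sub_diff[of "min B C"]) (auto simp: B C)
    moreover have "P (sh1 G - sh2 G)" unfolding P_def by (rule exI[of _ "min B C"]) (auto simp: B C fun_app)
    ultimately show ?thesis using s1[OF G] by (simp add: dl_alt Sub_sh2)
  qed
  have 2: "P G \<Longrightarrow> P ((sh2 ^^ k) G) \<and> Sub ((sh2 ^^ k) G) = (sh2 ^^ k) (Sub G)" for k G
    by (induction k) (simp_all add: o_apply P2 Sub_sh2)
  have 1: "P G \<Longrightarrow> P ((sh1 ^^ k) G) \<and> Sub ((sh1 ^^ k) G) = ((\<lambda>x. sh1 x + sh2 x) ^^ k) (Sub G)" for k G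
    by (induction k) (simp_all add: o_apply P1 s1)
  have 3: "P G \<Longrightarrow> P ((dl ^^ k) G) \<and> Sub ((dl ^^ k) G) = (sh1 ^^ k) (Sub G)" for k G
    by (induction k) (simp_all add: o_apply Pd)
  have "P H" using B unfolding P_def by blast
  then show ?thesis unfolding TT_def using 1 2 3 by simp
qed

text \<open>Here z1 = x + x2 + x0, z2 = x + x2 and z3 = x, which explains the images of the three
  differences.\<close>

lemma sgB_E:
  assumes "domB F"
  shows "domB (E12 F) \<and> (\<lambda>m n. sgB (E12 F) w m n x) = sh1 (\<lambda>m n. sgB F w m n x)"
    "domB (E23 F) \<and> (\<lambda>m n. sgB (E23 F) w m n x) = sh2 (\<lambda>m n. sgB F w m n x)"
    "domB (E13 F) \<and> (\<lambda>m n. sgB (E13 F) w m n x) = sh1 (\<lambda>m n. sgB F w m n x) + sh2 (\<lambda>m n. sgB F w m n x)"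
proof -
  have s: "singA F" and d: "\<And>m w. sing (sgA m F w)" using assms by (auto simp: domB_def)
  show "domB (E12 F) \<and> (\<lambda>m n. sgB (E12 F) w m n x) = sh1 (\<lambda>m n. sgB F w m n x)"
    using s d by (simp add: domB_def sgB_def singA_E12 sgA_E12 sh1_def fun_eq_iff)
  show "domB (E23 F) \<and> (\<lambda>m n. sgB (E23 F) w m n x) = sh2 (\<lambda>m n. sgB F w m n x)"
    using s d by (simp add: domB_def sgB_def singA_E23 sgA_E23 sh2_def fun_eq_iff o_apply sing_dl sg_dl)
  show "domB (E13 F) \<and> (\<lambda>m n. sgB (E13 F) w m n x) = sh1 (\<lambda>m n. sgB F w m n x) + sh2 (\<lambda>m n. sgB F w m n x)"
    using s d by (simp add: domB_def sgB_def singA_E13 sgA_E13 sh1_def sh2_def fun_eq_iff fun_app o_apply sing_dl sing_add sg_add sg_dl add.commute)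
qed

lemma sgB_EE:
  assumes "domB F"
  shows "(\<lambda>m n. sgB (\<lambda>w. EE k k (F w)) w m n x) =
    (sh1 ^^ k) (((\<lambda>x. sh1 x + sh2 x) ^^ k) ((sh2 ^^ k) (\<lambda>m n. sgB F w m n x)))"
proof -
  have 2: "domB F \<Longrightarrow> domB ((E23 ^^ k) F) \<and> (\<lambda>m n. sgB ((E23 ^^ k) F) w m n x) = (sh2 ^^ k) (\<lambda>m n. sgB F w m n x)" for F
    by (induction k) (simp_all add: o_apply[of E23] o_apply[of sh2] sgB_E)
  have 1: "domB F \<Longrightarrow> domB ((E13 ^^ k) F) \<and> (\<lambda>m n. sgB ((E13 ^^ k) F) w m n x) = ((\<lambda>x. sh1 x + sh2 x) ^^ k) (\<lambda>m n. sgB F w m n x)" for F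
    by (induction k) (simp_all add: o_apply[of E13] o_apply[of "\<lambda>x. sh1 x + sh2 x"] sgB_E)
  have 3: "domB F \<Longrightarrow> domB ((E12 ^^ k) F) \<and> (\<lambda>m n. sgB ((E12 ^^ k) F) w m n x) = (sh1 ^^ k) (\<lambda>m n. sgB F w m n x)" for F
    by (induction k) (simp_all add: o_apply[of E12] o_apply[of sh1] sgB_E)
  have ptw: "(E12 ^^ k) H w = (e12 ^^ k) (H w)" "(E13 ^^ k) H w = (e13 ^^ k) (H w)" "(E23 ^^ k) H w = (e23 ^^ k) (H w)" for H w
    by (rule funpow_intertwine[where L = "\<lambda>F. F w"], simp add: o_apply)+
  have "(\<lambda>w. EE k k (F w)) = (E12 ^^ k) ((E13 ^^ k) ((E23 ^^ k) F))"
    by (simp add: fun_eq_iff EE_def ptw)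
  then show ?thesis using 1 2 3 assms by simp
qed

end

section \<open>The generated nonlocal vertex algebra\<close>

context complex_space
begin

text \<open>Opposite to infinity: f(x2 - x1) has nonnegative powers of x1, and \<open>F\<close> is
  bounded below, in x1 uniformly and in x2 for each power of x1. For a given coefficient only
  finitely many \<open>i\<close> occur, and for each of them finitely many \<open>j\<close>.\<close>

lemma Czero_fin:
  assumes "\<And>m n. m < M \<Longrightarrow> F m n = 0" and "\<And>m. \<exists>N. \<forall>n<N. F m n = 0"
  shows "sact_fin (Czero f) F"
    and "(\<forall>m<M. \<forall>n. sact (Czero f) F m n = 0) \<and> (\<forall>m. \<exists>N. \<forall>n<N. sact (Czero f) F m n = 0)"
proof -
  obtain A where A: "\<And>l. l < A \<Longrightarrow> f $$ l = 0" using fls_nth_vanishes_belowE[of f] by metis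
  obtain N where N: "\<And>m n. n < N m \<Longrightarrow> F m n = 0" using choice[of "\<lambda>m N. \<forall>n<N. F m n = 0"] assms(2) by blast
  have supp: "0 \<le> i \<and> i \<le> m - M \<and> A - i \<le> j \<and> j \<le> n - N (m - i)"
    if *: "Czero f i j \<noteq> 0" "F (m - i) (n - j) \<noteq> 0" for i j m n
  proof -
    have "\<not> i < 0" "f $$ (i + j) \<noteq> 0" using * by (auto simp: Czero_def binom_coeff_def)
    then have "0 \<le> i" "A \<le> i + j" using A[of "i + j"] by force+
    moreover have "M \<le> m - i" "N (m - i) \<le> n - j" using * assms(1) N by (meson linorder_not_less)+
    ultimately show ?thesis by simp
  qed
  show "sact_fin (Czero f) F"
    unfolding sact_fin_def
  proof (intro allI)
    fix m n
    have "{(i, j). Czero f i j \<noteq> 0 \<and> F (m - i) (n - j) \<noteq> 0} \<subseteq> (SIGMA i:{0..m - M}. {A - i..n - N (m - i)})"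
      using supp by fastforce
    then show "finite {(i, j). Czero f i j \<noteq> 0 \<and> F (m - i) (n - j) \<noteq> 0}"
      by (rule finite_subset) auto
  qed
  have nz: "\<exists>i j. Czero f i j \<noteq> 0 \<and> F (m - i) (n - j) \<noteq> 0" if n0: "sact (Czero f) F m n \<noteq> 0" for m n
  proof -
    obtain p where "(case p of (i, j) \<Rightarrow> sc (Czero f i j) (F (m - i) (n - j))) \<noteq> 0"
      using n0 unfolding sact_def by (elim Sum_any.not_neutral_obtains_not_neutral)
    then show ?thesis by (cases p) auto
  qed
  show "(\<forall>m<M. \<forall>n. sact (Czero f) F m n = 0) \<and> (\<forall>m. \<exists>N. \<forall>n<N. sact (Czero f) F m n = 0)"
  proof (intro conjI allI impI)
    fix m n assume "m < M"
    then show "sact (Czero f) F m n = 0" using nz[of m n] supp[of _ _ m n] by force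
  next
    fix m
    define L where "L = Min (insert 0 ((\<lambda>i. A - i + N (m - i)) ` {0..m - M}))"
    have "L \<le> n" if n: "sact (Czero f) F m n \<noteq> 0" for n
    proof -
      obtain i j where "Czero f i j \<noteq> 0" "F (m - i) (n - j) \<noteq> 0" using nz[OF n] by blast
      from supp[OF this] have i: "i \<in> {0..m - M}" "A - i + N (m - i) \<le> n" by auto
      have "L \<le> A - i + N (m - i)" unfolding L_def using i(1) by (intro Min_le) auto
      with i show ?thesis by simp
    qed
    then have "\<forall>n<L. sact (Czero f) F m n = 0" by (meson linorder_not_less)
    then show "\<exists>N. \<forall>n<N. sact (Czero f) F m n = 0" by blast
  qed
qed

lemma Czero_poly:
  assumes "\<And>m n. m < M \<Longrightarrow> F m n = 0" and "\<And>m. \<exists>N. \<forall>n<N. F m n = 0"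
  shows "pact s2 (\<lambda>F. - dl F) q (sact (Czero h) F) = sact (Czero (poly (map_poly fls_const q) fls_X * h)) F"
proof (rule sact_poly)
  show "sact_fin (Czero h) F" for h by (rule Czero_fin(1)[OF assms])
  show "Czero (fls_X * h) i j = Czero h i (j - 1) - Czero h (i - 1) j" for h i j
  proof -
    have bc: "binom_coeff 1 (- 1) j i = binom_coeff 1 (- 1) (j - 1) i - binom_coeff 1 (- 1) j (i - 1)"
      by (simp add: binom_coeff_rec[of 1 "-1" j i])
    have idx: "i + (j - 1) = i + j - 1" "i - 1 + j = i + j - 1" by simp_all
    show ?thesis unfolding Czero_def idx
      by (simp add: bc right_diff_distrib fls_X_times_conv_shift)
  qed
qed (simp_all add: Czero_def algebra_simps)

lemma Czero_1: "sact (Czero 1) F = F"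
proof (rule sact_one)
  fix i j
  show "Czero 1 i j = (if i = 0 \<and> j = 0 then 1 else 0)"
    by (auto simp: Czero_def binom_coeff_cb cb_zero_left add.commute)
qed

lemma pact_dl_alt: "pact s2 dl q F = pact s2 (\<lambda>F. - dl F) (pcompose q [:0, -1:]) F"
  using linear_endo.pact_uminus[OF minus_dl_endo, of q F] by simp

text \<open>The shape of Y(u,x2)Y(v,x1)c: bounded below in x1 because of Y(v,x1)c, but in x2 only
  after the power of x1 is fixed.\<close>

definition rowbd :: "(int \<Rightarrow> int \<Rightarrow> 'w) \<Rightarrow> bool" where
  "rowbd F \<longleftrightarrow> (\<exists>M. \<forall>m<M. \<forall>n. F m n = 0) \<and> (\<forall>m. \<exists>N. \<forall>n<N. F m n = 0)"

lemma rowbd_add: "rowbd F \<Longrightarrow> rowbd G \<Longrightarrow> rowbd (F + G)"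
proof -
  assume *: "rowbd F" "rowbd G"
  obtain M M' where "\<forall>m<M. \<forall>n. F m n = 0" "\<forall>m<M'. \<forall>n. G m n = 0" using * unfolding rowbd_def by blast
  then have "\<forall>m<min M M'. \<forall>n. (F + G) m n = 0" by (simp add: fun_app)
  moreover have "\<exists>N. \<forall>n<N. (F + G) m n = 0" for m
  proof -
    obtain N N' where "\<forall>n<N. F m n = 0" "\<forall>n<N'. G m n = 0" using * unfolding rowbd_def by meson
    then show ?thesis by (intro exI[of _ "min N N'"]) (simp add: fun_app)
  qed
  ultimately show ?thesis unfolding rowbd_def by blast
qed

lemma rowbd_scale: "rowbd F \<Longrightarrow> rowbd (s2 c F)"
  unfolding rowbd_def fscale_apply by (metis scale_zero_right)

lemma rowbd_dl: "rowbd F \<Longrightarrow> rowbd (dl F)"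
proof -
  assume F: "rowbd F"
  obtain M where "\<forall>m<M. \<forall>n. F m n = 0" using F unfolding rowbd_def by blast
  then have "\<forall>m<M. \<forall>n. dl F m n = 0" by (simp add: dl_def)
  moreover have "\<exists>N. \<forall>n<N. dl F m n = 0" for m
  proof -
    obtain N N' where "\<forall>n<N. F (m - 1) n = 0" "\<forall>n<N'. F m n = 0" using F unfolding rowbd_def by meson
    then show ?thesis by (intro exI[of _ "min N N'"]) (simp add: dl_def)
  qed
  ultimately show ?thesis unfolding rowbd_def by blast
qed

lemma rowbd_dl_pow: "rowbd F \<Longrightarrow> rowbd ((dl ^^ k) F)"
  by (induction k) (simp_all add: o_apply rowbd_dl)

lemma rowbd_zero: "rowbd 0"
  by (simp add: rowbd_def fun_app)

lemma rowbd_diff: "rowbd F \<Longrightarrow> rowbd G \<Longrightarrow> rowbd (F - G)"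
  using rowbd_add[of F "s2 (-1) G"] rowbd_scale[of G "-1"] by (simp add: dl.E1.scale_minus_left)

lemma rowbd_sum: "(\<And>i. i \<in> I \<Longrightarrow> rowbd (f i)) \<Longrightarrow> rowbd (sum f I)"
  by (induction I rule: infinite_finite_induct) (auto simp: rowbd_zero rowbd_add)

lemma rowbd_sact:
  assumes "rowbd F"
  shows "rowbd (sact (Czero f) F)"
proof -
  obtain M where M: "\<And>m n. m < M \<Longrightarrow> F m n = 0" and N: "\<And>m. \<exists>N. \<forall>n<N. F m n = 0"
    using assms unfolding rowbd_def by blast
  have "(\<forall>m<M. \<forall>n. sact (Czero f) F m n = 0) \<and> (\<forall>m. \<exists>N. \<forall>n<N. sact (Czero f) F m n = 0)"
    by (rule Czero_fin(2)[OF M N])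
  then show ?thesis unfolding rowbd_def by blast
qed

lemma dl_bottom:
  assumes "\<And>m' n. m' < m \<Longrightarrow> H m' n = 0"
  shows "(\<forall>m'<m. (dl ^^ i) H m' n = 0) \<and> (dl ^^ i) H m n = sc ((-1) ^ i) (H m (n - int i))"
proof (induction i arbitrary: n)
  case (Suc i)
  have dl: "dl G m n = G (m - 1) n - G m (n - 1)" for G :: "int \<Rightarrow> int \<Rightarrow> 'w" and m n by (simp add: dl_def)
  show ?case unfolding funpow.simps o_apply
    using Suc[of "n - 1"] Suc[of n] assms
    by (auto simp: dl[of "(dl ^^ i) H"] Suc[THEN conjunct1, rule_format] algebra_simps)
qed (use assms in simp)

text \<open>Counterpart of \<open>cancel_top\<close> for expansions at 0. On the lowest row in x1
  the difference x1 - x2 acts as -x2, so the lowest entry of that row meets the lowest nonzero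
  coefficient of \<open>q\<close>.\<close>

lemma cancel_bottom:
  assumes q: "q \<noteq> 0" and H0: "pact s2 dl q H = 0" and H: "rowbd H"
  shows "H = 0"
proof -
  obtain M where M: "\<And>m n. m < M \<Longrightarrow> H m n = 0" using H unfolding rowbd_def by blast
  define d where "d = (LEAST d. coeff q d \<noteq> 0)"
  have "\<exists>d. coeff q d \<noteq> 0" using q by (metis leading_coeff_neq_0)
  then have d: "coeff q d \<noteq> 0" "\<And>i. i < d \<Longrightarrow> coeff q i = 0"
    unfolding d_def by (rule LeastI_ex, metis not_less_Least)
  have dq: "d \<le> degree q" using d(1) by (rule le_degree)
  have all: "\<forall>m < M + int k. \<forall>n. H m n = 0" for k
  proof (induction k)
    case (Suc k)
    define m where "m = M + int k"
    have low: "\<And>m' n. m' < m \<Longrightarrow> H m' n = 0" using Suc by (simp add: m_def)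
    obtain N where N: "\<And>n. n < N \<Longrightarrow> H m n = 0" using H unfolding rowbd_def by meson
    have rows: "\<forall>n < N + int j. H m n = 0" for j
    proof (induction j)
      case (Suc j)
      define n where "n = N + int j"
      \<comment> \<open>At \<open>n + int d\<close> the terms with i > d refer to entries of the row
        before \<open>n\<close>, which are already known to vanish.\<close>
      have "0 = pact s2 dl q H m (n + int d)" by (simp add: H0 fun_app)
      also have "\<dots> = (\<Sum>i\<le>degree q. sc (coeff q i) ((dl ^^ i) H m (n + int d)))"
        by (simp add: pact_def sum_fun_apply fscale_apply)
      also have "\<dots> = (\<Sum>i\<in>{d}. sc (coeff q i) ((dl ^^ i) H m (n + int d)))"
      proof (rule sum.mono_neutral_right)
        show "\<forall>i\<in>{..degree q} - {d}. sc (coeff q i) ((dl ^^ i) H m (n + int d)) = 0"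
        proof
          fix i assume "i \<in> {..degree q} - {d}"
          then consider "i < d" | "i > d" by force
          then show "sc (coeff q i) ((dl ^^ i) H m (n + int d)) = 0"
          proof cases
            case 2
            then have "H m (n + int d - int i) = 0" using Suc by (simp add: n_def)
            then show ?thesis using dl_bottom[of m H, OF low] by simp
          qed (simp add: d(2))
        qed
      qed (use dq in auto)
      also have "\<dots> = sc (coeff q d * (-1) ^ d) (H m n)"
        using dl_bottom[of m H, OF low] by simp
      finally have "H m n = 0" using d(1) by simp
      moreover have "n' < N + int (Suc j) \<Longrightarrow> n' = n \<or> n' < N + int j" for n' by (auto simp: n_def)
      ultimately show ?case using Suc by blast
    qed (use N in simp)
    have "H m n = 0" for n using rows[of "nat (n - N + 1)"] by auto
    moreover have "m' < M + int (Suc k) \<Longrightarrow> m' = m \<or> m' < m" for m' by (auto simp: m_def)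
    ultimately show ?case using low by blast
  qed (use M in simp)
  have "H m n = 0" for m n using all[of "nat (m - M + 1)"] by auto
  then show ?thesis by (simp add: fun_eq_iff fun_app)
qed

sublocale e12: linear_endo "fscale s2" e12
proof -
  interpret V: vector_space "fscale s2" by (intro vector_space_fscale) unfold_locales
  show "linear_endo (fscale s2) (e12 :: (int \<Rightarrow> int \<Rightarrow> int \<Rightarrow> 'w) \<Rightarrow> _)"
    by unfold_locales (rule e_linear)+
qed

lemma swap12_sign: "EE k l (swap12 F) = fscale s2 ((-1) ^ k) (swap12 (EE k l F))"
proof -
  have "swap12 ((e13 ^^ l) F) = (e23 ^^ l) (swap12 F)" "swap12 ((e23 ^^ l) F) = (e13 ^^ l) (swap12 F)"
    for l and F :: "int \<Rightarrow> int \<Rightarrow> int \<Rightarrow> 'w"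
    by (rule funpow_intertwine[where L = swap12], simp add: swap12_def e_defs)+
  then have 1: "(e13 ^^ l) ((e23 ^^ l) (swap12 F)) = swap12 ((e13 ^^ l) ((e23 ^^ l) F))"
    by (simp add: e_pow_pow_commute)
  have 2: "(e12 ^^ k) (swap12 G) = fscale s2 ((-1) ^ k) (swap12 ((e12 ^^ k) G))" for G
  proof (induction k)
    case (Suc k)
    have "e12 (swap12 H) = fscale s2 (-1) (swap12 (e12 H))" for H
      by (simp add: swap12_def e_defs fun_eq_iff fscale_apply uminus_apply)
    then show ?case by (simp add: Suc o_apply e_linear)
  qed (simp add: fun_eq_iff fscale_apply)
  show ?thesis unfolding EE_def 1 2 ..
qed

lemma TT_flip2: "TT k l (flip2 H) = s2 ((-1) ^ k) (flip2 (TT k l H))"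
proof -
  have "(dl ^^ k) (flip2 H) = s2 ((-1) ^ k) (flip2 ((dl ^^ k) H))"
  proof (induction k)
    case (Suc k)
    have "dl (flip2 H) = s2 (-1) (flip2 (dl H))" for H :: "int \<Rightarrow> int \<Rightarrow> 'w"
      by (simp add: flip2_def dl_def fun_eq_iff fscale_apply uminus_apply)
    then show ?case by (simp add: Suc o_apply dlE.T_scale)
  qed (simp add: fun_eq_iff fscale_apply)
  then show ?thesis
    by (intro ext) (simp add: TT_apply fscale_apply flip2_def)
qed

lemma vx_pact: "domV G \<Longrightarrow> domV (pact (fscale s2) e12 q G) \<and> vx x (pact (fscale s2) e12 q G) = pact s2 dl q (vx x G)"
proof (induction q)
  case 0
  have "domV 0" by (rule domV_bnd3) (simp add: bnd3_def fun_app)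
  moreover have "vx x 0 = 0"
  proof -
    have "vx x (fscale s2 0 0) = s2 0 (vx x 0)" by (rule vx_scale) fact
    then show ?thesis by simp
  qed
  ultimately show ?case by simp
next
  case (pCons a q)
  then show ?case
    by (simp add: e12.pact_pCons dlE.pact_pCons domV_add domV_scale domV_e12 vx_add vx_scale vx_e)
qed

lemma bnd3_pact: "bnd3 G \<Longrightarrow> bnd3 (pact (fscale s2) e12 q G)"
proof -
  assume G: "bnd3 G"
  have "bnd3 (e12 H)" if "bnd3 H" for H :: "int \<Rightarrow> int \<Rightarrow> int \<Rightarrow> 'w" using bnd3_pow[OF that, of 1 0 0] by simp
  moreover have "bnd3 (0 :: int \<Rightarrow> int \<Rightarrow> int \<Rightarrow> 'w)" by (simp add: bnd3_def fun_app)
  ultimately show ?thesis using e12.pact_in[of "{G. bnd3 G}" G q] G bnd3_add bnd3_scale by auto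
qed

end

section \<open>Vertex algebra structure on a good set closed under products\<close>

locale closed_good = complex_space sc for sc :: "complex \<Rightarrow> 'w \<Rightarrow> 'w::ab_group_add" +
  fixes K :: "('w \<Rightarrow> 'w fls) set"
  assumes good: "good_rel sc K K"
    and Y_closed: "a \<in> K \<Longrightarrow> b \<in> K \<Longrightarrow> Y_Eo sc a b $$ m \<in> K"
begin

sublocale KS: complex_space "Eo_scale sc" by (rule vs_Eo)

lemma K_Eo: "a \<in> K \<Longrightarrow> a \<in> Eo sc"
  using good by (auto simp: good_rel_def)

lemma K_compat: "a \<in> K \<Longrightarrow> b \<in> K \<Longrightarrow> \<exists>k. compat2 k a b"
  using good_relD(3)[OF good] .

definition VV :: "('w \<Rightarrow> 'w fls) \<Rightarrow> ('w \<Rightarrow> 'w fls) \<Rightarrow> ('w \<Rightarrow> 'w fls) \<Rightarrow> int \<Rightarrow> int \<Rightarrow> 'w \<Rightarrow> 'w fls" where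
  "VV a b c = (\<lambda>m n. Y_Eo sc a (Y_Eo sc b c $$ n) $$ m)"

text \<open>Identities between operator-valued series are tested on a vector \<open>w\<close> and a
  power of x, where they become identities between substituted triple products.\<close>

definition ev :: "'w \<Rightarrow> int \<Rightarrow> (int \<Rightarrow> int \<Rightarrow> 'w \<Rightarrow> 'w fls) \<Rightarrow> int \<Rightarrow> int \<Rightarrow> 'w" where
  "ev w x G = (\<lambda>m n. coeffs_inf (G m n) w x)"

lemma coeffs_inf_minus: "coeffs_inf (a - b) w n = coeffs_inf a w n - coeffs_inf b w n"
  by (simp add: coeffs_inf_def fun_app)

lemma ev_linear: "ev w x (F + G) = ev w x F + ev w x G" "ev w x (KS.s2 c F) = s2 c (ev w x F)"
  "ev w x (dl F) = dl (ev w x F)" "ev w x (flip2 F) = flip2 (ev w x F)"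
  "ev w x (sh1 F) = sh1 (ev w x F)" "ev w x (sh2 F) = sh2 (ev w x F)" "ev w x 0 = 0"
  by (simp_all add: ev_def fun_eq_iff fun_app fscale_apply coeffs_inf_plus coeffs_inf_Eo_scale dl_def flip2_def
      sh1_def sh2_def coeffs_inf_minus coeffs_inf_zero)

lemma ev_dl_pow: "ev w x ((dl ^^ k) F) = (dl ^^ k) (ev w x F)"
  by (rule funpow_intertwine[where L = "ev w x"]) (rule ev_linear)

lemma ev_pact: "ev w x (pact KS.s2 dl q F) = pact s2 dl q (ev w x F)"
  by (rule KS.dlE.pact_commute[where L = "ev w x"]) (simp_all add: ev_linear dlE.linear_endo_axioms)

lemma ev_ext: "(\<And>w x. ev w x F = ev w x G) \<Longrightarrow> F = G"
proof (rule ext, rule ext, rule coeffs_inf_ext)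
  fix m n w x assume "\<And>w x. ev w x F = ev w x G"
  from fun_cong[OF fun_cong[OF this]] show "coeffs_inf (F m n) w x = coeffs_inf (G m n) w x"
    by (simp add: ev_def)
qed

lemma ev_VV:
  assumes "a \<in> K" "b \<in> K" "c \<in> K"
  shows "domV (pr3 a b c w)" "ev w x (VV a b c) = vx x (pr3 a b c w)"
proof -
  have E: "a \<in> Eo sc" "b \<in> Eo sc" "c \<in> Eo sc" using assms K_Eo by auto
  obtain k where k: "compat2 k b c" using K_compat assms by blast
  have p: "pr2 a (Y_Eo sc b c $$ n) w = (\<lambda>z1. sg n (pr3 a b c w z1))" for n
  proof (intro ext)
    fix z1 z3
    have "sg n (\<lambda>z2 z3. coeffs_inf a (pr2 b c w z2 z3) z1) z3 = coeffs_inf a (sg n (pr2 b c w) z3) z1"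
      by (rule sg_map[where \<phi> = "\<lambda>v. coeffs_inf a v z1", OF sing_compat2[OF k]])
        (simp_all add: coeffs_inf_add coeffs_inf_scale E)
    then show "pr2 a (Y_Eo sc b c $$ n) w z1 z3 = sg n (pr3 a b c w z1) z3"
      by (simp add: pr2_def[of a] coeffs_Y_Eo(1)[OF E(2,3) k] pr3_def pr2_def[of b])
  qed
  have kn: "\<exists>k. compat2 k a (Y_Eo sc b c $$ n)" for n using K_compat Y_closed assms by blast
  have "sing (pr3 a b c w z1)" for z1
    using sing_map[where \<phi> = "\<lambda>v. coeffs_inf a v z1", OF sing_compat2[OF k], of w]
    by (simp add: coeffs_inf_diff E pr2_def pr3_def)
  moreover have "sing (\<lambda>z1. sg n (pr3 a b c w z1))" for n
    using kn[of n] sing_compat2 unfolding p[symmetric] by blast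
  ultimately show "domV (pr3 a b c w)" by (simp add: domV_def)
  show "ev w x (VV a b c) = vx x (pr3 a b c w)"
  proof (intro ext)
    fix m n
    obtain k' where k': "compat2 k' a (Y_Eo sc b c $$ n)" using kn by blast
    show "ev w x (VV a b c) m n = vx x (pr3 a b c w) m n"
      by (simp add: ev_def VV_def vx_def sgV_def coeffs_Y_Eo(1)[OF E(1) K_Eo[OF Y_closed[OF assms(2,3)]] k'] p)
  qed
qed

lemma ev_AA:
  assumes "a \<in> K" "b \<in> K" "c \<in> K"
  shows "domB (pr3 a b c)" "ev w x (\<lambda>m n. Y_Eo sc (Y_Eo sc a b $$ m) c $$ n) = (\<lambda>m n. sgB (pr3 a b c) w m n x)"
proof -
  have E: "a \<in> Eo sc" "b \<in> Eo sc" "c \<in> Eo sc" using assms K_Eo by auto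
  obtain k where k: "compat2 k a b" using K_compat assms by blast
  note F = sgA_pr3_left[OF E(1,2) k, where c = c]
  have km: "\<exists>k. compat2 k (Y_Eo sc a b $$ m) c" for m using K_compat Y_closed assms by blast
  then show "domB (pr3 a b c)" unfolding domB_def F(2) using F(1) sing_compat2 by blast
  show "ev w x (\<lambda>m n. Y_Eo sc (Y_Eo sc a b $$ m) c $$ n) = (\<lambda>m n. sgB (pr3 a b c) w m n x)"
  proof (intro ext)
    fix m n
    obtain k' where k': "compat2 k' (Y_Eo sc a b $$ m) c" using km by blast
    show "ev w x (\<lambda>m n. Y_Eo sc (Y_Eo sc a b $$ m) c $$ n) m n = sgB (pr3 a b c) w m n x"
      by (simp add: ev_def sgB_def F(2) coeffs_Y_Eo(1)[OF K_Eo[OF Y_closed[OF assms(1,2)]] E(3) k'])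
  qed
qed

lemma Y_zero_right:
  assumes a: "a \<in> K"
  shows "Y_Eo sc a 0 $$ m = 0"
proof (rule coeffs_inf_ext)
  fix w n
  have E: "a \<in> Eo sc" using a K_Eo by auto
  have "bnd2 (0 :: int \<Rightarrow> int \<Rightarrow> 'w)" using bnd2_0 by (simp add: zero_fun_def)
  then have "compat2 0 a 0" by (simp add: compat2_def pr2_linear E fun_app)
  from coeffs_Y_Eo(1)[OF E Eo_zero_in this]
  show "coeffs_inf (Y_Eo sc a 0 $$ m) w n = coeffs_inf 0 w n"
    by (simp add: pr2_linear E sg_zero fun_app coeffs_inf_zero)
qed

lemma VV_below: "a \<in> K \<Longrightarrow> \<exists>B. \<forall>m. \<forall>n<B. VV a b c m n = 0"
proof -
  assume a: "a \<in> K"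
  obtain B where "\<forall>n<B. Y_Eo sc b c $$ n = 0" using fls_nth_vanishes_belowE by blast
  then have "VV a b c m n = 0" if "n < B" for m n
    using that Y_zero_right[OF a] by (simp add: VV_def)
  then show ?thesis by blast
qed

lemma VV_row: "\<exists>N. \<forall>m<N. VV a b c m n = 0"
  unfolding VV_def using fls_nth_vanishes_belowE by blast

text \<open>After multiplication by the k-th powers of all three differences the triple product is
  bounded and \<open>sgB_bounded\<close> applies. On both sides these factors become x0^k (x0 +
  x2)^k x2^k; the monomials cancel, and (x0 + x2)^k is the factor that weak associativity
  permits.\<close>

lemma weak_associativity:
  assumes abc: "a \<in> K" "b \<in> K" "c \<in> K"
  shows "\<exists>l. \<forall>m n.
      poly_act (Eo_scale sc) 0 1 ((X1 + X2) ^ l)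
        (\<lambda>ns. Sum_any (\<lambda>j. Eo_scale sc (binom_coeff 1 1 (ns ! 0) j)
           (Y_Eo sc a (Y_Eo sc b c $$ (ns ! 1 - j)) $$ (ns ! 0 + j)))) [m, n] =
      poly_act (Eo_scale sc) 0 1 ((X1 + X2) ^ l) (\<lambda>ns. Y_Eo sc (Y_Eo sc a b $$ (ns ! 0)) c $$ (ns ! 1)) [m, n]"
proof -
  let ?P = "\<lambda>H. sh1 H + sh2 H"
  define AA where "AA = (\<lambda>m n. Y_Eo sc (Y_Eo sc a b $$ m) c $$ n)"
  obtain k where k: "\<And>w. bnd3 (EE k k (pr3 a b c w))"
    using triple_compat[OF good good abc] unfolding EE_def by blast
  obtain B where B: "\<And>m n. n < B \<Longrightarrow> VV a b c m n = 0" using VV_below[OF abc(1)] by blast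
  have evSub: "ev w x (KS.Sub (VV a b c)) = Sub (vx x (pr3 a b c w))" for w x
  proof (intro ext)
    fix m n
    have vB: "vx x (pr3 a b c w) m n = 0" if "n < B" for m n
      using B[OF that] fun_cong[OF fun_cong[OF ev_VV(2)[OF abc, of w x]], of m n] by (simp add: ev_def coeffs_inf_zero)
    have sum: "coeffs_inf (sum f A) w x = (\<Sum>j\<in>A. coeffs_inf (f j) w x)" for f and A :: "int set"
      by (induction A rule: infinite_finite_induct) (simp_all add: coeffs_inf_zero coeffs_inf_plus)
    have "KS.Sub (VV a b c) m n = (\<Sum>j\<in>{0..n - B}. Eo_scale sc (cb (m + j) j) (VV a b c (m + j) (n - j)))"
      by (rule KS.Sub_sum[OF B]) auto
    moreover have "Sub (vx x (pr3 a b c w)) m n = (\<Sum>j\<in>{0..n - B}. sc (cb (m + j) j) (vx x (pr3 a b c w) (m + j) (n - j)))"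
      by (rule Sub_sum[OF vB]) auto
    ultimately show "ev w x (KS.Sub (VV a b c)) m n = Sub (vx x (pr3 a b c w)) m n"
      by (simp add: ev_def sum coeffs_inf_Eo_scale flip: ev_VV(2)[OF abc])
  qed
  have key: "(?P ^^ k) (Sub (vx x (pr3 a b c w))) = (?P ^^ k) (\<lambda>m n. sgB (pr3 a b c) w m n x)" for w x
  proof -
    have vB: "vx x (pr3 a b c w) m n = 0" if "n < B" for m n
      using B[OF that] fun_cong[OF fun_cong[OF ev_VV(2)[OF abc, of w x]], of m n] by (simp add: ev_def coeffs_inf_zero)
    obtain N where N: "\<And>m n r. EE k k (pr3 a b c w) m n r \<noteq> 0 \<Longrightarrow> m \<le> N \<and> n \<le> N \<and> r \<le> N"
      using k[of w] unfolding bnd3_def by blast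
    have "(\<lambda>m n. sgB (\<lambda>w. EE k k (pr3 a b c w)) w m n x) = Sub (vx x (EE k k (pr3 a b c w)))"
      by (intro ext sgB_bounded) (rule N)
    then have eq: "(sh1 ^^ k) ((?P ^^ k) ((sh2 ^^ k) (\<lambda>m n. sgB (pr3 a b c) w m n x))) =
        (sh1 ^^ k) ((?P ^^ k) ((sh2 ^^ k) (Sub (vx x (pr3 a b c w)))))"
      by (simp add: sgB_EE ev_AA(1)[OF abc] vx_EE ev_VV(1)[OF abc] Sub_TT[OF vB])
    have comm: "(?P ^^ k) ((sh2 ^^ k) H) = (sh2 ^^ k) ((?P ^^ k) H)" for H :: "int \<Rightarrow> int \<Rightarrow> 'w"
    proof -
      have "?P ((sh2 ^^ k) H) = (sh2 ^^ k) (?P H)" for H :: "int \<Rightarrow> int \<Rightarrow> 'w"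
        by (rule funpow_intertwine[where L = ?P]) (simp add: sh1_def sh2_def fun_eq_iff fun_app)
      then show ?thesis by (intro funpow_intertwine[where L = "(sh2 ^^ k)", symmetric]) simp
    qed
    have inj: "F = G" if "(sh1 ^^ k) ((sh2 ^^ k) F) = (sh1 ^^ k) ((sh2 ^^ k) G)" for F G :: "int \<Rightarrow> int \<Rightarrow> 'w"
    proof -
      have "TT 0 k F = TT 0 k G" using that by (simp add: TT_def)
      then show ?thesis by (simp add: TT_inj)
    qed
    show ?thesis by (rule inj) (rule eq[unfolded comm, symmetric])
  qed
  have evP: "ev w x ((?P ^^ k) G) = (?P ^^ k) (ev w x G)" for w x G
    by (rule funpow_intertwine[where L = "ev w x"]) (simp add: ev_linear)
  have "(?P ^^ k) (KS.Sub (VV a b c)) = (?P ^^ k) AA"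
    by (rule ev_ext) (simp add: evP evSub AA_def ev_AA(2)[OF abc] key)
  then have "poly_act (Eo_scale sc) 0 1 ((X1 + X2) ^ k)
        (\<lambda>ns. Sum_any (\<lambda>j. Eo_scale sc (binom_coeff 1 1 (ns ! 0) j)
           (Y_Eo sc a (Y_Eo sc b c $$ (ns ! 1 - j)) $$ (ns ! 0 + j)))) [m, n] =
      poly_act (Eo_scale sc) 0 1 ((X1 + X2) ^ k) (\<lambda>ns. Y_Eo sc (Y_Eo sc a b $$ (ns ! 0)) c $$ (ns ! 1)) [m, n]" for m n
    unfolding KS.poly_act_2 KS.dl.pact2_sum_power by (simp add: KS.Sub_def VV_def AA_def)
  then show ?thesis by blast
qed

text \<open>The power of z1 - z2 comes from the pair \<open>a\<close>, \<open>b\<close>, and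
  \<open>c\<close> influences \<open>l\<close> alone. Starting from \<open>triple_compat\<close>,
  the surplus power of z1 - z2 is removed by \<open>cancel_top\<close> for each fixed exponent of
  z3.\<close>

lemma triple_compat_left:
  assumes abc: "a \<in> K" "b \<in> K" "c \<in> K" and k0: "compat2 k0 a b"
  shows "\<exists>l0. \<forall>l\<ge>l0. \<forall>w. bnd3 (EE k0 l (pr3 a b c w))"
proof -
  have aE: "a \<in> Eo sc" using abc K_Eo by auto
  obtain k where k: "\<And>w. bnd3 (EE k k (pr3 a b c w))"
    using triple_compat[OF good good abc] unfolding EE_def by blast
  obtain k1 where k1: "compat2 k1 b c" using K_compat abc by blast
  define l0 where "l0 = k + k0 + k1"
  have "bnd3 (EE k0 l (pr3 a b c w))" if l: "l \<ge> l0" for l w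
  proof -
    define X where "X = EE k0 l (pr3 a b c w)"
    have top: "bnd3 ((e12 ^^ (l - k0)) X)"
    proof -
      have "bnd3 (EE l l (pr3 a b c w))" by (rule bnd3_EE_mono[OF k]) (use l in \<open>auto simp: l0_def\<close>)
      moreover have "EE l l (pr3 a b c w) = (e12 ^^ (l - k0)) X"
        unfolding X_def EE_def by (rule funpow_split) (use l in \<open>simp add: l0_def\<close>)
      ultimately show ?thesis by simp
    qed
    have ebd23: "ebd (\<lambda>m n r. n) X" "ebd (\<lambda>m n r. r) X"
    proof -
      obtain N where N: "\<And>n r. (dl ^^ k1) (pr2 b c w) n r \<noteq> 0 \<Longrightarrow> n \<le> N \<and> r \<le> N"
        using k1 unfolding compat2_def bnd2_def by blast
      have "(e23 ^^ k1) (pr3 a b c w) = (\<lambda>m n r. coeffs_inf a ((dl ^^ k1) (pr2 b c w) n r) m)"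
        using coeffs_pow_map[OF aE, of k1 "pr2 b c w"] by (simp add: pr3_def pr2_def)
      then have "n \<le> N \<and> r \<le> N" if "(e23 ^^ k1) (pr3 a b c w) m n r \<noteq> 0" for m n r
        using N[of n r] that aE by (cases "(dl ^^ k1) (pr2 b c w) n r = 0") auto
      then have 1: "ebd (\<lambda>m n r. n) ((e23 ^^ k1) (pr3 a b c w))" "ebd (\<lambda>m n r. r) ((e23 ^^ k1) (pr3 a b c w))"
        unfolding ebd_def by blast+
      have "X = (e12 ^^ k0) ((e13 ^^ l) ((e23 ^^ (l - k1)) ((e23 ^^ k1) (pr3 a b c w))))"
        unfolding X_def EE_def using l funpow_split[of k1 l e23 "pr3 a b c w"] by (simp add: l0_def)
      then show "ebd (\<lambda>m n r. n) X" "ebd (\<lambda>m n r. r) X"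
        using ebd_pow[OF 1(1), of k0 l "l - k1"] ebd_pow[OF 1(2), of k0 l "l - k1"] by simp_all
    qed
    obtain N where N: "\<And>m n r. (e12 ^^ (l - k0)) X m n r \<noteq> 0 \<Longrightarrow> m \<le> N \<and> n \<le> N \<and> r \<le> N"
      using top unfolding bnd3_def by blast
    define Q where "Q G \<longleftrightarrow> (\<forall>r. \<exists>M. \<forall>m n. m > M \<longrightarrow> G m n r = 0)" for G :: "int \<Rightarrow> int \<Rightarrow> int \<Rightarrow> 'w"
    \<comment> \<open>For each exponent of z3 the first exponent is bounded, because the power
      \<open>k0\<close> makes \<open>a\<close> and \<open>b\<close> compatible. This is what
      \<open>cancel_top\<close> needs.\<close>
    have QX: "Q X"
    proof -
      have e13: "Q (e13 G)" if G: "Q G" for G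
        unfolding Q_def
      proof
        fix r
        obtain M M' where "\<forall>m n. m > M \<longrightarrow> G m n r = 0" "\<forall>m n. m > M' \<longrightarrow> G m n (r - 1) = 0"
          using G unfolding Q_def by meson
        then show "\<exists>M. \<forall>m n. m > M \<longrightarrow> e13 G m n r = 0"
          by (intro exI[of _ "max (M + 1) M'"]) (simp add: e13_def)
      qed
      have e23: "Q (e23 G)" if G: "Q G" for G
        unfolding Q_def
      proof
        fix r
        obtain M M' where "\<forall>m n. m > M \<longrightarrow> G m n r = 0" "\<forall>m n. m > M' \<longrightarrow> G m n (r - 1) = 0"
          using G unfolding Q_def by meson
        then show "\<exists>M. \<forall>m n. m > M \<longrightarrow> e23 G m n r = 0"
          by (intro exI[of _ "max M M'"]) (simp add: e23_def)
      qed
      have pw: "Q G \<Longrightarrow> Q ((e13 ^^ i) G)" "Q G \<Longrightarrow> Q ((e23 ^^ i) G)" for G i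
        by (induction i) (simp_all add: o_apply e13 e23)
      have "Q ((e12 ^^ k0) (pr3 a b c w))"
        unfolding Q_def
      proof
        fix r
        have "(\<lambda>m n. (e12 ^^ k0) G m n r) = (dl ^^ k0) (\<lambda>m n. G m n r)" for G :: "int \<Rightarrow> int \<Rightarrow> int \<Rightarrow> 'w"
          by (rule funpow_intertwine[where L = "\<lambda>G m n. G m n r"]) (simp add: e12_def dl_def)
        from this[of "pr3 a b c w"]
        have "(\<lambda>m n. (e12 ^^ k0) (pr3 a b c w) m n r) = (dl ^^ k0) (pr2 a b (coeffs_inf c w r))"
          by (simp add: pr3_def pr2_def)
        moreover obtain M where "\<And>m n. (dl ^^ k0) (pr2 a b (coeffs_inf c w r)) m n \<noteq> 0 \<Longrightarrow> m \<le> M \<and> n \<le> M"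
          using k0 unfolding compat2_def bnd2_def by blast
        ultimately show "\<exists>M. \<forall>m n. m > M \<longrightarrow> (e12 ^^ k0) (pr3 a b c w) m n r = 0"
          by (intro exI[of _ M]) (metis linorder_not_less)
      qed
      from pw(1)[OF pw(2)[OF this], of l l] show ?thesis
        by (simp add: X_def EE_def e_pow_pow_commute)
    qed
    have "m \<le> N" if "X m n r \<noteq> 0" for m n r
    proof (rule ccontr)
      assume mN: "\<not> m \<le> N"
      obtain M where M: "\<And>m n. m > M \<Longrightarrow> X m n r = 0" using QX unfolding Q_def by blast
      have "(\<lambda>m n. (e12 ^^ i) G m n r) = (dl ^^ i) (\<lambda>m n. G m n r)" for i and G :: "int \<Rightarrow> int \<Rightarrow> int \<Rightarrow> 'w"
        by (rule funpow_intertwine[where L = "\<lambda>G m n. G m n r"]) (simp add: e12_def dl_def)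
      from this[of "l - k0" X] have "pact s2 dl ([:0, 1:] ^ (l - k0)) (\<lambda>m n. X m n r) m n = 0" if "m > N" for m n
        using N[of m n r] that unfolding dlE.pact_X_power
        by (metis linorder_not_less)
      then have "X m n r = 0"
        using mN by (intro cancel_top[of "[:0, 1:] ^ (l - k0)" N "\<lambda>m n. X m n r" M m n] M) auto
      with that show False by simp
    qed
    then have "ebd (\<lambda>m n r. m) X" unfolding ebd_def by blast
    with ebd23 show ?thesis unfolding bnd3_iff X_def by simp
  qed
  then show ?thesis by blast
qed

lemma nmod_gens_list:
  assumes "X \<in> nmod s3 {D} {flipw (pr2 u v) |u v. u \<in> K \<and> v \<in> K}"
  shows "\<exists>gs. (\<forall>(g, u, v)\<in>set gs. u \<in> K \<and> v \<in> K) \<and> X = (\<Sum>(g, u, v)\<leftarrow>gs. pact s3 D g (flipw (pr2 u v)))"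
proof -
  obtain gs where gs: "snd ` set gs \<subseteq> {flipw (pr2 u v) |u v. u \<in> K \<and> v \<in> K}" "X = (\<Sum>(g, y)\<leftarrow>gs. pact s3 D g y)"
    using D.nmod_sum_list[OF assms] by blast
  have "\<exists>hs. (\<forall>(g, u, v)\<in>set hs. u \<in> K \<and> v \<in> K) \<and> (\<Sum>(g, y)\<leftarrow>gs. pact s3 D g y) = (\<Sum>(g, u, v)\<leftarrow>hs. pact s3 D g (flipw (pr2 u v)))"
    using gs(1)
  proof (induction gs)
    case Nil
    show ?case by (rule exI[of _ "[]"]) simp
  next
    case (Cons p gs)
    obtain g y where p: "p = (g, y)" by force
    from Cons obtain hs where hs: "\<forall>(g, u, v)\<in>set hs. u \<in> K \<and> v \<in> K"
      "(\<Sum>(g, y)\<leftarrow>gs. pact s3 D g y) = (\<Sum>(g, u, v)\<leftarrow>hs. pact s3 D g (flipw (pr2 u v)))" by auto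
    from Cons.prems obtain u v where "y = flipw (pr2 u v)" "u \<in> K" "v \<in> K" by (auto simp: p)
    with hs show ?case by (intro exI[of _ "(g, u, v) # hs"]) (simp add: p)
  qed
  with gs(2) show ?thesis by blast
qed

text \<open>The order of the quantifiers is the point: the list fixes \<open>k\<close> before
  \<open>c\<close> is given, and \<open>l\<close> may depend on \<open>c\<close>. Each term
  u(z2)v(z1) arises by exchanging z1 and z2 in a product covered by
  \<open>triple_compat_left\<close>, and \<open>sgV_swap12\<close> carries this to the exchange of
  x1 and x2.\<close>

lemma transfer_list:
  assumes "\<forall>(g, u, v)\<in>set gs. u \<in> K \<and> v \<in> K"
  shows "\<exists>k0. \<forall>k\<ge>k0. \<forall>c\<in>K. \<exists>l0. \<forall>l\<ge>l0. \<forall>w x.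
     bnd3 (EE k l (\<lambda>z1 z2 z3. (\<Sum>(g, u, v)\<leftarrow>gs. pact s3 D g (flipw (pr2 u v))) (coeffs_inf c w z3) z1 z2)) \<and>
     vx x (EE k l (\<lambda>z1 z2 z3. (\<Sum>(g, u, v)\<leftarrow>gs. pact s3 D g (flipw (pr2 u v))) (coeffs_inf c w z3) z1 z2)) =
       TT k l (ev w x (\<Sum>(g, u, v)\<leftarrow>gs. pact KS.s2 dl g (flip2 (VV u v c))))"
  using assms
proof (induction gs)
  case Nil
  have z: "(\<lambda>z1 z2 z3. (0 :: 'w \<Rightarrow> int \<Rightarrow> int \<Rightarrow> 'w) (coeffs_inf c w z3) z1 z2) = fscale s2 0 0" for c w
    by (simp add: fun_eq_iff fun_app fscale_apply)
  have z0: "bnd3 (0 :: int \<Rightarrow> int \<Rightarrow> int \<Rightarrow> 'w)" by (simp add: bnd3_def fun_app)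
  have "vx x (fscale s2 0 G) = s2 0 (vx x G)" if "bnd3 G" for G x by (rule vx_scale) (rule domV_bnd3[OF that])
  then have v0: "vx x 0 = 0" for x using z0 by simp
  have E0: "EE k l 0 = 0" for k l
    using EE_linear(2)[of k l 0 0] by simp
  have T0: "TT k l 0 = 0" for k l using TT_linear(2)[of k l 0 0] by simp
  show ?case using z0 v0 T0 by (intro exI[of _ 0]) (simp add: z E0 ev_linear)
next
  case (Cons p gs)
  obtain g u v where p: "p = (g, u, v)" by (cases p) auto
  then have uv: "u \<in> K" "v \<in> K" using Cons.prems by auto
  obtain k1 where k1: "\<forall>k\<ge>k1. \<forall>c\<in>K. \<exists>l0. \<forall>l\<ge>l0. \<forall>w x.
     bnd3 (EE k l (\<lambda>z1 z2 z3. (\<Sum>(g, u, v)\<leftarrow>gs. pact s3 D g (flipw (pr2 u v))) (coeffs_inf c w z3) z1 z2)) \<and>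
     vx x (EE k l (\<lambda>z1 z2 z3. (\<Sum>(g, u, v)\<leftarrow>gs. pact s3 D g (flipw (pr2 u v))) (coeffs_inf c w z3) z1 z2)) =
       TT k l (ev w x (\<Sum>(g, u, v)\<leftarrow>gs. pact KS.s2 dl g (flip2 (VV u v c))))"
    using Cons by auto
  obtain k2 where k2: "compat2 k2 u v" using K_compat uv by blast
  show ?case
  proof (rule exI[of _ "max k1 k2"], intro allI impI ballI)
    fix k c assume k: "max k1 k2 \<le> k" and c: "c \<in> K"
    obtain l1 where l1: "\<And>l w x. l \<ge> l1 \<Longrightarrow>
      bnd3 (EE k l (\<lambda>z1 z2 z3. (\<Sum>(g, u, v)\<leftarrow>gs. pact s3 D g (flipw (pr2 u v))) (coeffs_inf c w z3) z1 z2)) \<and>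
      vx x (EE k l (\<lambda>z1 z2 z3. (\<Sum>(g, u, v)\<leftarrow>gs. pact s3 D g (flipw (pr2 u v))) (coeffs_inf c w z3) z1 z2)) =
       TT k l (ev w x (\<Sum>(g, u, v)\<leftarrow>gs. pact KS.s2 dl g (flip2 (VV u v c))))"
      using k1[rule_format, OF max.boundedE(1)[OF k] c] by blast
    obtain l2 where l2: "\<And>l w. l \<ge> l2 \<Longrightarrow> bnd3 (EE k2 l (pr3 u v c w))"
      using triple_compat_left[OF uv c k2] by blast
    show "\<exists>l0. \<forall>l\<ge>l0. \<forall>w x.
       bnd3 (EE k l (\<lambda>z1 z2 z3. (\<Sum>(g, u, v)\<leftarrow>p # gs. pact s3 D g (flipw (pr2 u v))) (coeffs_inf c w z3) z1 z2)) \<and>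
       vx x (EE k l (\<lambda>z1 z2 z3. (\<Sum>(g, u, v)\<leftarrow>p # gs. pact s3 D g (flipw (pr2 u v))) (coeffs_inf c w z3) z1 z2)) =
         TT k l (ev w x (\<Sum>(g, u, v)\<leftarrow>p # gs. pact KS.s2 dl g (flip2 (VV u v c))))"
    proof (intro exI[of _ "max l1 l2"] allI impI)
      fix l w x assume l: "max l1 l2 \<le> l"
      define L where "L X = (\<lambda>z1 z2 z3. X (coeffs_inf c w z3) z1 z2)" for X :: "'w \<Rightarrow> int \<Rightarrow> int \<Rightarrow> 'w"
      define R where "R = (\<Sum>(g, u, v)\<leftarrow>gs. pact s3 D g (flipw (pr2 u v)))"
      define Z where "Z = (\<Sum>(g, u, v)\<leftarrow>gs. pact KS.s2 dl g (flip2 (VV u v c)))"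
      have R: "bnd3 (EE k l (L R))" "vx x (EE k l (L R)) = TT k l (ev w x Z)"
        using l1[of l w x] l by (auto simp: L_def R_def Z_def)
      have L: "L (X + Y) = L X + L Y" "L (s3 e X) = fscale s2 e (L X)" "L (D X) = e12 (L X)" for X Y e
        by (simp_all add: L_def fun_eq_iff fun_app fscale_apply e12_def dl_def o_apply)
      have Lp: "L (pact s3 D g X) = pact (fscale s2) e12 g (L X)" for X
        by (rule D.pact_commute[where L = L]) (simp_all add: L e12.linear_endo_axioms)
      have Ep: "EE k l (pact (fscale s2) e12 g X) = pact (fscale s2) e12 g (EE k l X)" for X
        by (rule e12.pact_commute[where L = "EE k l"]) (simp_all add: EE_linear EE_e12 e12.linear_endo_axioms)
      have Tp: "TT k l (pact s2 dl g X) = pact s2 dl g (TT k l X)" for X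
        by (rule dlE.pact_commute[where L = "TT k l"]) (simp_all add: TT_linear dlE.linear_endo_axioms)
      have sw: "L (flipw (pr2 u v)) = swap12 (pr3 u v c w)"
        by (simp add: L_def flipw_def flip2_def swap12_def pr2_def pr3_def)
      have b: "bnd3 (EE k l (pr3 u v c w))"
        by (rule bnd3_EE_mono[OF l2[of l w]]) (use k l in auto)
      have bs: "bnd3 (swap12 (EE k l (pr3 u v c w)))"
        using b unfolding bnd3_def swap12_def by blast
      define H where "H = EE k l (swap12 (pr3 u v c w))"
      have H: "bnd3 H" "vx x H = TT k l (ev w x (flip2 (VV u v c)))"
      proof -
        show "bnd3 H" unfolding H_def swap12_sign by (rule bnd3_scale[OF bs])
        have "vx x H = s2 ((-1) ^ k) (flip2 (vx x (EE k l (pr3 u v c w))))"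
          unfolding H_def swap12_sign by (simp only: vx_scale[OF domV_bnd3[OF bs]] sgV_swap12[OF b])
        also have "\<dots> = TT k l (flip2 (vx x (pr3 u v c w)))"
          by (simp only: TT_flip2 vx_EE[OF ev_VV(1)[OF uv c]])
        finally show "vx x H = TT k l (ev w x (flip2 (VV u v c)))"
          by (simp only: ev_linear ev_VV(2)[OF uv c])
      qed
      have "EE k l (L (pact s3 D g (flipw (pr2 u v)) + R)) = pact (fscale s2) e12 g H + EE k l (L R)"
        by (simp only: L Lp EE_linear Ep sw H_def)
      moreover have "bnd3 (pact (fscale s2) e12 g H)" by (rule bnd3_pact[OF H(1)])
      moreover have "vx x (pact (fscale s2) e12 g H) = TT k l (ev w x (pact KS.s2 dl g (flip2 (VV u v c))))"
        using vx_pact[OF domV_bnd3[OF H(1)], of g x] by (simp only: H(2) Tp ev_pact)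
      ultimately have "bnd3 (EE k l (L (pact s3 D g (flipw (pr2 u v)) + R))) \<and>
          vx x (EE k l (L (pact s3 D g (flipw (pr2 u v)) + R))) = TT k l (ev w x (pact KS.s2 dl g (flip2 (VV u v c)) + Z))"
        using R by (simp add: bnd3_add vx_add domV_bnd3 ev_linear TT_linear)
      then show "bnd3 (EE k l (\<lambda>z1 z2 z3. (\<Sum>(g, u, v)\<leftarrow>p # gs. pact s3 D g (flipw (pr2 u v))) (coeffs_inf c w z3) z1 z2)) \<and>
       vx x (EE k l (\<lambda>z1 z2 z3. (\<Sum>(g, u, v)\<leftarrow>p # gs. pact s3 D g (flipw (pr2 u v))) (coeffs_inf c w z3) z1 z2)) =
         TT k l (ev w x (\<Sum>(g, u, v)\<leftarrow>p # gs. pact KS.s2 dl g (flip2 (VV u v c))))"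
        by (simp add: p L_def R_def Z_def)
    qed
  qed
qed

text \<open>The relation for a(z1)b(z2) is applied to the coefficients of c(z3), cleared and
  substituted. The powers of x1 and x2, which depend on \<open>c\<close>, are removed by
  \<open>TT_inj\<close>, so \<open>k\<close> is the same for all \<open>c\<close>.\<close>

lemma S_locality_poly:
  assumes ab: "a \<in> K" "b \<in> K"
  shows "\<exists>q gs k. q \<noteq> 0 \<and> (\<forall>(g, u, v)\<in>set gs. u \<in> K \<and> v \<in> K) \<and> (\<forall>c\<in>K. KS.rowbd ((dl ^^ k) (VV a b c)) \<and>
     (dl ^^ k) (pact KS.s2 dl q (VV a b c)) = (dl ^^ k) (\<Sum>(g, u, v)\<leftarrow>gs. pact KS.s2 dl g (flip2 (VV u v c))))"
proof -
  obtain q where q: "q \<noteq> 0" "pact s3 D q (pr2 a b) \<in> nmod s3 {D} {flipw (pr2 u v) |u v. u \<in> K \<and> v \<in> K}"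
    using good_relD(4)[OF good ab] by blast
  from nmod_gens_list[OF q(2)] obtain gs where gs: "\<forall>(g, u, v)\<in>set gs. u \<in> K \<and> v \<in> K"
    "pact s3 D q (pr2 a b) = (\<Sum>(g, u, v)\<leftarrow>gs. pact s3 D g (flipw (pr2 u v)))" by blast
  obtain k0 where k0: "\<forall>k\<ge>k0. \<forall>c\<in>K. \<exists>l0. \<forall>l\<ge>l0. \<forall>w x.
     bnd3 (EE k l (\<lambda>z1 z2 z3. (\<Sum>(g, u, v)\<leftarrow>gs. pact s3 D g (flipw (pr2 u v))) (coeffs_inf c w z3) z1 z2)) \<and>
     vx x (EE k l (\<lambda>z1 z2 z3. (\<Sum>(g, u, v)\<leftarrow>gs. pact s3 D g (flipw (pr2 u v))) (coeffs_inf c w z3) z1 z2)) =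
       TT k l (ev w x (\<Sum>(g, u, v)\<leftarrow>gs. pact KS.s2 dl g (flip2 (VV u v c))))"
    using transfer_list[OF gs(1)] by blast
  obtain kab where kab: "compat2 kab a b" using K_compat ab by blast
  define k where "k = max k0 kab"
  have "KS.rowbd ((dl ^^ k) (VV a b c)) \<and>
     (dl ^^ k) (pact KS.s2 dl q (VV a b c)) = (dl ^^ k) (\<Sum>(g, u, v)\<leftarrow>gs. pact KS.s2 dl g (flip2 (VV u v c)))"
    if c: "c \<in> K" for c
  proof -
    have "k0 \<le> k" "kab \<le> k" by (auto simp: k_def)
    obtain l1 where l1: "\<And>l w x. l \<ge> l1 \<Longrightarrow>
       vx x (EE k l (\<lambda>z1 z2 z3. pact s3 D q (pr2 a b) (coeffs_inf c w z3) z1 z2)) =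
       TT k l (ev w x (\<Sum>(g, u, v)\<leftarrow>gs. pact KS.s2 dl g (flip2 (VV u v c))))"
      using k0[rule_format, OF \<open>k0 \<le> k\<close> c] unfolding gs(2) by blast
    obtain l2 where l2: "\<And>l w. l \<ge> l2 \<Longrightarrow> bnd3 (EE kab l (pr3 a b c w))"
      using triple_compat_left[OF ab c kab] by blast
    define l where "l = max l1 l2"
    have b: "bnd3 (EE k l (pr3 a b c w))" for w
      by (rule bnd3_EE_mono[OF l2[of l w]]) (use \<open>kab \<le> k\<close> in \<open>auto simp: l_def\<close>)
    have vxT: "vx x (EE k l (pr3 a b c w)) = TT k l (ev w x (VV a b c))" for w x
      by (simp only: vx_EE[OF ev_VV(1)[OF ab c]] ev_VV(2)[OF ab c])
    have eq: "(dl ^^ k) (pact KS.s2 dl q (VV a b c)) = (dl ^^ k) (\<Sum>(g, u, v)\<leftarrow>gs. pact KS.s2 dl g (flip2 (VV u v c)))"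
    proof (rule ev_ext)
      fix w x
      define L where "L X = (\<lambda>z1 z2 z3. X (coeffs_inf c w z3) z1 z2)" for X :: "'w \<Rightarrow> int \<Rightarrow> int \<Rightarrow> 'w"
      have L: "L (X + Y) = L X + L Y" "L (s3 e X) = fscale s2 e (L X)" "L (D X) = e12 (L X)" for X Y e
        by (simp_all add: L_def fun_eq_iff fun_app fscale_apply e12_def dl_def o_apply)
      have Lp: "L (pact s3 D q X) = pact (fscale s2) e12 q (L X)" for X
        by (rule D.pact_commute[where L = L]) (simp_all add: L e12.linear_endo_axioms)
      have Ep: "EE k l (pact (fscale s2) e12 q X) = pact (fscale s2) e12 q (EE k l X)" for X
        by (rule e12.pact_commute[where L = "EE k l"]) (simp_all add: EE_linear EE_e12 e12.linear_endo_axioms)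
      have Tp: "TT k l (pact s2 dl q X) = pact s2 dl q (TT k l X)" for X
        by (rule dlE.pact_commute[where L = "TT k l"]) (simp_all add: TT_linear dlE.linear_endo_axioms)
      have La: "L (pr2 a b) = pr3 a b c w" by (simp add: L_def pr2_def pr3_def)
      have "TT k l (ev w x (\<Sum>(g, u, v)\<leftarrow>gs. pact KS.s2 dl g (flip2 (VV u v c)))) = vx x (EE k l (L (pact s3 D q (pr2 a b))))"
        using l1[where l = l and w = w and x = x] by (simp add: L_def l_def)
      also have "\<dots> = pact s2 dl q (vx x (EE k l (pr3 a b c w)))"
        using vx_pact[OF domV_bnd3[OF b[of w]], of q x] by (simp only: Lp Ep La)
      also have "\<dots> = TT k l (ev w x (pact KS.s2 dl q (VV a b c)))"
        by (simp only: vxT Tp ev_pact)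
      finally show "ev w x ((dl ^^ k) (pact KS.s2 dl q (VV a b c))) =
          ev w x ((dl ^^ k) (\<Sum>(g, u, v)\<leftarrow>gs. pact KS.s2 dl g (flip2 (VV u v c))))"
        unfolding TT_inj ev_dl_pow by simp
    qed
    \<comment> \<open>A bounded triple product yields nonnegative powers of x1 and x2 only; undoing
      x1^l x2^l gives the lower bound \<open>- int l\<close>.\<close>
    have zero: "(dl ^^ k) (VV a b c) m n = 0" if "m < - int l \<or> n < - int l" for m n
    proof (rule coeffs_inf_ext)
      fix w x
      have "coeffs_inf ((dl ^^ k) (VV a b c) m n) w x = ev w x ((dl ^^ k) (VV a b c)) m n"
        by (simp add: ev_def)
      also have "\<dots> = vx x (EE k l (pr3 a b c w)) (m + int l) (n + int l)"
        by (simp add: ev_dl_pow vxT TT_apply)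
      also have "\<dots> = 0" by (rule sgV_bnd3_neg[OF b]) (use that in auto)
      finally show "coeffs_inf ((dl ^^ k) (VV a b c) m n) w x = coeffs_inf 0 w x" by (simp add: coeffs_inf_zero)
    qed
    have "KS.rowbd ((dl ^^ k) (VV a b c))"
      unfolding KS.rowbd_def using zero by blast
    with eq show ?thesis by blast
  qed
  then show ?thesis using q(1) gs(1) by blast
qed

lemma poly_fls_X_nonzero:
  fixes q :: "complex poly"
  assumes "q \<noteq> 0"
  shows "poly (map_poly fls_const q) fls_X \<noteq> 0"
proof -
  have neg: "poly (map_poly fls_const q) fls_X $$ n = 0" if "n < 0" for n and q :: "complex poly"
    using that by (induction q arbitrary: n) (simp_all add: map_poly_pCons fls_X_times_conv_shift)
  have "poly (map_poly fls_const q) fls_X $$ int k = coeff q k" for k and q :: "complex poly"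
  proof (induction q arbitrary: k)
    case (pCons a q)
    show ?case
    proof (cases k)
      case 0
      with neg[of "-1" q] show ?thesis by (simp add: map_poly_pCons fls_X_times_conv_shift)
    next
      case (Suc l)
      with pCons.IH[of l] show ?thesis by (simp add: map_poly_pCons fls_X_times_conv_shift)
    qed
  qed simp
  from this[of q "degree q"] assms show ?thesis by auto
qed

text \<open>The two sides agree after multiplication by q(x1 - x2), and their difference is bounded
  below, so \<open>cancel_bottom\<close> applies.\<close>

lemma S_locality_series:
  assumes ab: "a \<in> K" "b \<in> K"
  shows "\<exists>(r::nat) u v (f :: nat \<Rightarrow> complex fls) k.
      (\<forall>i<r. u i \<in> K \<and> v i \<in> K) \<and>
      (\<forall>w\<in>K. \<forall>m n.
        poly_act (Eo_scale sc) 0 1 ((X1 - X2) ^ k) (op_prod [\<lambda>w n. Y_Eo sc a w $$ n, \<lambda>w n. Y_Eo sc b w $$ n] w) [m, n] =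
        poly_act (Eo_scale sc) 0 1 ((X1 - X2) ^ k)
          (\<lambda>ns. \<Sum>i<r. series_act (Eo_scale sc)
             (\<lambda>s t. f i $$ (s + t) * binom_coeff 1 (- 1) t s)
             (\<lambda>ns. op_prod [\<lambda>w n. Y_Eo sc (v i) w $$ n, \<lambda>w n. Y_Eo sc (u i) w $$ n] w (rev ns)) ns) [m, n])"
proof -
  obtain q gs k where q: "q \<noteq> 0" and gs: "\<forall>(g, u, v)\<in>set gs. u \<in> K \<and> v \<in> K"
    and k: "\<And>c. c \<in> K \<Longrightarrow> KS.rowbd ((dl ^^ k) (VV a b c))"
      "\<And>c. c \<in> K \<Longrightarrow> (dl ^^ k) (pact KS.s2 dl q (VV a b c)) = (dl ^^ k) (\<Sum>(g, u, v)\<leftarrow>gs. pact KS.s2 dl g (flip2 (VV u v c)))"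
    using S_locality_poly[OF ab] by metis
  define r where "r = length gs"
  define g u v where "g i = fst (gs ! i)" and "u i = fst (snd (gs ! i))" and "v i = snd (snd (gs ! i))" for i
  have uv: "u i \<in> K" "v i \<in> K" if "i < r" for i
    using bspec[OF gs nth_mem[of i gs]] that by (simp_all add: r_def u_def v_def case_prod_unfold)
  let ?c = "\<lambda>q. pcompose q [:0, - 1 :: complex:]"
  let ?e = "\<lambda>p. poly (map_poly fls_const p) (fls_X :: complex fls)"
  \<comment> \<open>The quotient is to be evaluated at x2 - x1, whence the sign change in numerator
    and denominator.\<close>
  define f where "f i = ?e (?c (g i)) / ?e (?c q)" for i
  have eq: "(dl ^^ k) (VV a b c) = (dl ^^ k) (\<Sum>i<r. KS.sact (Czero (f i)) (flip2 (VV (u i) (v i) c)))" if c: "c \<in> K" for c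
  proof -
    define y where "y i = flip2 (VV (u i) (v i) c)" for i
    have yb: "KS.rowbd (y i)" if i: "i < r" for i
    proof -
      obtain B where "\<forall>m. \<forall>n<B. VV (u i) (v i) c m n = 0" using VV_below uv[OF i] by blast
      then have "\<forall>m<B. \<forall>n. y i m n = 0" by (simp add: y_def flip2_def)
      moreover have "\<exists>N. \<forall>n<N. y i m n = 0" for m using VV_row[of "u i" "v i" c m] by (simp add: y_def flip2_def)
      ultimately show ?thesis unfolding KS.rowbd_def by blast
    qed
    have act: "pact KS.s2 dl q (KS.sact (Czero (f i)) (y i)) = pact KS.s2 dl (g i) (y i)" if i: "i < r" for i
    proof -
      obtain M where M: "\<And>m n. m < M \<Longrightarrow> y i m n = 0" and N: "\<And>m. \<exists>N. \<forall>n<N. y i m n = 0"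
        using yb[OF i] unfolding KS.rowbd_def by blast
      have CP: "pact KS.s2 (\<lambda>F. - dl F) p (KS.sact (Czero h) (y i)) = KS.sact (Czero (?e p * h)) (y i)" for p h
        by (rule KS.Czero_poly[OF M N])
      have "?e (?c q) * f i = ?e (?c (g i))"
        using poly_fls_X_nonzero[OF pcompose_uminus_nonzero[OF q]] by (simp add: f_def)
      then have "pact KS.s2 dl q (KS.sact (Czero (f i)) (y i)) = KS.sact (Czero (?e (?c (g i)) * 1)) (y i)"
        unfolding KS.pact_dl_alt[of q] using CP[of "?c q" "f i"] by simp
      also have "\<dots> = pact KS.s2 dl (g i) (y i)"
        unfolding KS.pact_dl_alt[of "g i"] using CP[of "?c (g i)" 1] by (simp add: KS.Czero_1)
      finally show ?thesis .
    qed
    define Z where "Z = (\<Sum>i<r. KS.sact (Czero (f i)) (y i))"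
    have dq: "pact KS.s2 dl q ((dl ^^ k) H) = (dl ^^ k) (pact KS.s2 dl q H)" for H
      by (rule funpow_intertwine[where L = "pact KS.s2 dl q"]) (rule KS.dlE.pact_T)
    have "(\<Sum>(g, u, v)\<leftarrow>gs. pact KS.s2 dl g (flip2 (VV u v c))) = (\<Sum>i<r. pact KS.s2 dl (g i) (y i))"
      by (simp add: sum_list_sum_nth r_def atLeast0LessThan y_def g_def u_def v_def case_prod_unfold)
    also have "\<dots> = pact KS.s2 dl q Z"
      unfolding Z_def KS.dlE.pact_sum_right by (rule sum.cong) (auto simp: act)
    finally have "pact KS.s2 dl q ((dl ^^ k) (VV a b c)) = pact KS.s2 dl q ((dl ^^ k) Z)"
      unfolding dq using k(2)[OF c] by simp
    then have "pact KS.s2 dl q ((dl ^^ k) (VV a b c) - (dl ^^ k) Z) = 0"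
      by (simp add: KS.dlE.pact_diff_right)
    moreover have "KS.rowbd ((dl ^^ k) (VV a b c) - (dl ^^ k) Z)"
      unfolding Z_def by (intro KS.rowbd_diff k(1) c KS.rowbd_dl_pow KS.rowbd_sum KS.rowbd_sact yb) auto
    ultimately have "(dl ^^ k) (VV a b c) - (dl ^^ k) Z = 0" by (rule KS.cancel_bottom[OF q])
    then show ?thesis by (simp add: Z_def y_def)
  qed
  have "poly_act (Eo_scale sc) 0 1 ((X1 - X2) ^ k) (op_prod [\<lambda>w n. Y_Eo sc a w $$ n, \<lambda>w n. Y_Eo sc b w $$ n] c) [m, n] =
        poly_act (Eo_scale sc) 0 1 ((X1 - X2) ^ k)
          (\<lambda>ns. \<Sum>i<r. series_act (Eo_scale sc)
             (\<lambda>s t. f i $$ (s + t) * binom_coeff 1 (- 1) t s)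
             (\<lambda>ns. op_prod [\<lambda>w n. Y_Eo sc (u i) w $$ n, \<lambda>w n. Y_Eo sc (v i) w $$ n] c (rev ns)) ns) [m, n]"
    if c: "c \<in> K" for c m n
  proof -
    have 1: "(\<lambda>m n. op_prod [\<lambda>w n. Y_Eo sc a w $$ n, \<lambda>w n. Y_Eo sc b w $$ n] c [m, n]) = VV a b c"
      by (simp add: VV_def)
    have 2: "(\<lambda>m n. \<Sum>i<r. series_act (Eo_scale sc) (\<lambda>s t. f i $$ (s + t) * binom_coeff 1 (- 1) t s)
             (\<lambda>ns. op_prod [\<lambda>w n. Y_Eo sc (u i) w $$ n, \<lambda>w n. Y_Eo sc (v i) w $$ n] c (rev ns)) [m, n]) =
        (\<Sum>i<r. KS.sact (Czero (f i)) (flip2 (VV (u i) (v i) c)))"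
      unfolding KS.series_act_eq_sact by (intro ext) (simp add: sum_fun_apply flip2_def VV_def Czero_def)
    show ?thesis unfolding KS.poly_act_2 KS.pact2_dl 1 2 eq[OF c] ..
  qed
  \<comment> \<open>The witnesses change places, since in the target relation the left factor is
    \<open>v i\<close>.\<close>
  then show ?thesis using uv
    by (intro exI[of _ r] exI[of _ v] exI[of _ u] exI[of _ f] exI[of _ k]) blast
qed

lemma nonlocal_va:
  assumes sub: "module.subspace (Eo_scale sc) K" and one: "Eo_one \<in> K"
  shows "nonlocal_vertex_algebra (Eo_scale sc) K (Y_Eo sc) Eo_one"
proof (intro nonlocal_vertex_algebra.intro nonlocal_vertex_algebra_axioms.intro)
  show "vector_space (Eo_scale sc)" by (rule vector_space_Eo_scale)
  fix u u' v v' w and c :: complex and n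
  show "u \<in> K \<Longrightarrow> v \<in> K \<Longrightarrow> Y_Eo sc u v $$ n \<in> K" by (rule Y_closed)
  show "u \<in> K \<Longrightarrow> u' \<in> K \<Longrightarrow> v \<in> K \<Longrightarrow> Y_Eo sc (u + u') v = Y_Eo sc u v + Y_Eo sc u' v"
    using Y_Eo_add_left K_Eo K_compat by meson
  show "u \<in> K \<Longrightarrow> v \<in> K \<Longrightarrow> Y_Eo sc (Eo_scale sc c u) v = fls_scale (Eo_scale sc) c (Y_Eo sc u v)"
    using Y_Eo_scale_left K_Eo K_compat by meson
  show "u \<in> K \<Longrightarrow> v \<in> K \<Longrightarrow> v' \<in> K \<Longrightarrow> Y_Eo sc u (v + v') = Y_Eo sc u v + Y_Eo sc u v'"
    using Y_Eo_add_right K_Eo K_compat by meson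
  show "u \<in> K \<Longrightarrow> v \<in> K \<Longrightarrow> Y_Eo sc u (Eo_scale sc c v) = fls_scale (Eo_scale sc) c (Y_Eo sc u v)"
    using Y_Eo_scale_right K_Eo K_compat by meson
  show "v \<in> K \<Longrightarrow> Y_Eo sc Eo_one v = fls_const v" using Y_Eo_one_left K_Eo by blast
  show "v \<in> K \<Longrightarrow> n < 0 \<Longrightarrow> Y_Eo sc v Eo_one $$ n = 0" using Y_Eo_one_right(1) K_Eo by blast
  show "v \<in> K \<Longrightarrow> Y_Eo sc v Eo_one $$ 0 = v" using Y_Eo_one_right(2) K_Eo by blast
qed (use sub one weak_associativity in auto)

lemma weak_quantum_va:
  assumes sub: "module.subspace (Eo_scale sc) K" and one: "Eo_one \<in> K"
  shows "weak_quantum_vertex_algebra (Eo_scale sc) K (Y_Eo sc) Eo_one"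
  by (intro weak_quantum_vertex_algebra.intro weak_quantum_vertex_algebra_axioms.intro nonlocal_va sub one S_locality_series)

text \<open>With the identity as module map, associativity is the description of \<open>Y_Eo\<close>
  through (x1 - x2)^k given by \<open>coeffs_Y_Eo\<close>.\<close>

lemma module_inf:
  assumes sub: "module.subspace (Eo_scale sc) K" and one: "Eo_one \<in> K"
  shows "module_at_infinity (Eo_scale sc) K (Y_Eo sc) Eo_one sc (\<lambda>a. a)"
proof (intro module_at_infinity.intro module_at_infinity_axioms.intro nonlocal_va sub one)
  show "vector_space sc" ..
  fix u v assume uv: "u \<in> K" "v \<in> K"
  then have E: "u \<in> Eo sc" "v \<in> Eo sc" using K_Eo by auto
  obtain k where k: "compat2 k u v" using K_compat uv by blast
  have "sbs ((dl ^^ k) (pr2 u v w)) = subst_add sc (poly_act sc 0 1 ((X1 - X2) ^ k) (op_prod [coeffs_inf u, coeffs_inf v] w))" for w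
  proof -
    have *: "(\<lambda>m n. poly_act sc 0 1 ((X1 - X2) ^ k) (op_prod [coeffs_inf u, coeffs_inf v] w) [m, n]) = (dl ^^ k) (pr2 u v w)"
      unfolding poly_act_2 pact2_dl by (simp add: pr2_def)
    have "bnd2 ((dl ^^ k) (pr2 u v w))" using k by (simp add: compat2_def)
    then show ?thesis using sbs_nth'[of "poly_act sc 0 1 ((X1 - X2) ^ k) (op_prod [coeffs_inf u, coeffs_inf v] w)"]
      unfolding * by simp
  qed
  then have "Y_Eo sc u v $$ (m - int k) = (\<lambda>w. subst_add sc (poly_act sc 0 1 ((X1 - X2) ^ k) (op_prod [coeffs_inf u, coeffs_inf v] w)) $$ m)" for m
    using coeffs_Y_Eo(2)[OF E k, of "m - int k"] by simp
  moreover have "hom_inf sc 2 (\<lambda>w. poly_act sc 0 1 ((X1 - X2) ^ k) (op_prod [coeffs_inf u, coeffs_inf v] w))"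
    using k unfolding hom_inf_2[OF E] pact2_dl compat2_def .
  ultimately show "\<exists>k. hom_inf sc 2 (\<lambda>w. poly_act sc 0 1 ((X1 - X2) ^ k) (op_prod [coeffs_inf u, coeffs_inf v] w)) \<and>
      (\<forall>w m. (Y_Eo sc u v $$ (m - int k)) w = subst_add sc (poly_act sc 0 1 ((X1 - X2) ^ k) (op_prod [coeffs_inf u, coeffs_inf v] w)) $$ m)"
    by (intro exI[of _ k]) (simp del: op_prod.simps)
qed (use K_Eo in auto)

end

theorem theorem4p7:
  fixes scale :: "complex \<Rightarrow> 'w \<Rightarrow> 'w::ab_group_add"
    and U :: "('w \<Rightarrow> 'w fls) set"
  assumes "vector_space scale"
    and "S_local scale U"
  shows "compatible scale U \<and>
    weak_quantum_vertex_algebra (Eo_scale scale) (generated scale U) (Y_Eo scale) Eo_one \<and>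
    module_at_infinity (Eo_scale scale) (generated scale U) (Y_Eo scale) Eo_one scale (\<lambda>a. a)"
proof -
  interpret complex_space scale using assms(1) by (simp add: complex_space_def)
  have U: "good_rel scale U U" by (rule S_local_good_rel) fact
  interpret closed_good scale "vhull U"
    by unfold_locales (rule hull_good[OF U], rule hull_Y[OF U])
  show ?thesis
    unfolding generated_eq_hull[OF U]
    using good_compatible[OF U] weak_quantum_va module_inf hull_subspace hull_base(2) by blast
qed

end
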